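(* Let $G\subset U_n^+$ be a closed subgroup, and let $\{\Gamma_U\mid U\in U_n\}$ be the associated family of discrete groups. (1) The group dual subgroups of $G$ are exactly those coming from quotients of the groups $\Gamma_U$: for every $U\in U_n$ and every quotient group $\Gamma_U\to\Lambda$, the composition $C(G)\to C^*(\Gamma_U)\to C^*(\Lambda)$ gives an embedding $\widehat{\Lambda}\subset G$; and conversely, every group dual subgroup $\widehat{\Lambda}\subset G$, with $\Lambda$ a discrete group, arises in this way for some $U\in U_n$ and some quotient map $\Gamma_U\to\Lambda$. (2) $G$ is strange if and only if $G$ is not classical and all the groups $\Gamma_U$, $U\in U_n$, are abelian.
   Context: Compact quantum groups $G$ are described by Hopf $C^*$-algebras $C(G)$ in the sense of Woronowicz, are assumed to be of Kac type, and full and reduced versions are identified (equalities such as $A=C^*(\Gamma)$ refer to full versions). $G$ is classical if $C(G)$ is commutative. A closed subgroup $H\subset G$ is given by a surjective morphism of Hopf $C^*$-algebras $C(G)\to C(H)$. For a discrete group $\Lambda$, its dual $\widehat{\Lambda}$ is given by $C(\widehat{\Lambda})=C^*(\Lambda)$ with $\Delta(g)=g\otimes g$; it is classical iff $\Lambda$ is abelian. $G$ is called strange if it is non-classical and all its group dual subgroups $\widehat{\Lambda}\subset G$ are classical. $C(U_n^+)$ is the universal $C^*$-algebra generated by variables $u_{ij}$, $i,j=1,\ldots,n$, with the relations making $u=(u_{ij})$ and $u^t=(u_{ji})$ unitary matrices, with $\Delta(u_{ij})=\sum_ku_{ik}\otimes u_{kj}$, $\varepsilon(u_{ij})=\delta_{ij}$,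 $S(u_{ij})=u_{ji}^*$. For a closed subgroup $G\subset U_n^+$, we still denote by $u_{ij}$ the images of the generators in $C(G)$. $U_n$ is the group of $n\times n$ unitary scalar matrices. For $U\in U_n$, set $v=UuU^*$; the quotient $C(G)/\langle v_{ij}=0,\ \forall\, i\neq j\rangle$ is a cocommutative Hopf $C^*$-algebra, generated by the group-like elements $g_i=v_{ii}$, and $\Gamma_U=\langle g_1,\ldots,g_n\rangle$ is the discrete group defined by $C^*(\Gamma_U)=C(G)/\langle v_{ij}=0,\ \forall\, i\neq j\rangle$. *)

theory Defs
  imports
    "HOL-Analysis.Cartesian_Space"
    "HOL-Algebra.QuotRing"
    "HOL-Algebra.Generated_Groups"
    "HOL-Library.Infinite_Typeclass"
begin

section \<open>C*-algebras\<close>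

record 'a star_alg = "'a ring" +
  scale :: "complex \<Rightarrow> 'a \<Rightarrow> 'a"
  star :: "'a \<Rightarrow> 'a"

record 'a cstar_alg = "'a star_alg" +
  nrm :: "'a \<Rightarrow> real"

locale star_algebra = ring A for A :: "('a, 'm) star_alg_scheme" (structure) +
  assumes scale_closed: "x \<in> carrier A \<Longrightarrow> scale A c x \<in> carrier A"
    and scale_add: "\<lbrakk>x \<in> carrier A; y \<in> carrier A\<rbrakk> \<Longrightarrow>
          scale A c (x \<oplus> y) = scale A c x \<oplus> scale A c y"
    and add_scale: "x \<in> carrier A \<Longrightarrow> scale A (c + d) x = scale A c x \<oplus> scale A d x"
    and scale_scale: "x \<in> carrier A \<Longrightarrow> scale A c (scale A d x) = scale A (c * d) x"
    and scale_1: "x \<in> carrier A \<Longrightarrow> scale A 1 x = x"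
    and scale_mult_left: "\<lbrakk>x \<in> carrier A; y \<in> carrier A\<rbrakk> \<Longrightarrow>
          scale A c x \<otimes> y = scale A c (x \<otimes> y)"
    and scale_mult_right: "\<lbrakk>x \<in> carrier A; y \<in> carrier A\<rbrakk> \<Longrightarrow>
          x \<otimes> scale A c y = scale A c (x \<otimes> y)"
    and star_closed: "x \<in> carrier A \<Longrightarrow> star A x \<in> carrier A"
    and star_star: "x \<in> carrier A \<Longrightarrow> star A (star A x) = x"
    and star_add: "\<lbrakk>x \<in> carrier A; y \<in> carrier A\<rbrakk> \<Longrightarrow>
          star A (x \<oplus> y) = star A x \<oplus> star A y"
    and star_scale: "x \<in> carrier A \<Longrightarrow> star A (scale A c x) = scale A (cnj c) (star A x)"
    and star_mult: "\<lbrakk>x \<in> carrier A; y \<in> carrier A\<rbrakk> \<Longrightarrow>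
          star A (x \<otimes> y) = star A y \<otimes> star A x"

definition cstar_seminorm :: "('a, 'm) star_alg_scheme \<Rightarrow> ('a \<Rightarrow> real) \<Rightarrow> bool" where
  "cstar_seminorm A p \<longleftrightarrow>
     (\<forall>x\<in>carrier A. 0 \<le> p x) \<and>
     (\<forall>x\<in>carrier A. \<forall>y\<in>carrier A. p (x \<oplus>\<^bsub>A\<^esub> y) \<le> p x + p y) \<and>
     (\<forall>c. \<forall>x\<in>carrier A. p (scale A c x) = cmod c * p x) \<and>
     (\<forall>x\<in>carrier A. \<forall>y\<in>carrier A. p (x \<otimes>\<^bsub>A\<^esub> y) \<le> p x * p y) \<and>
     (\<forall>x\<in>carrier A. p (star A x \<otimes>\<^bsub>A\<^esub> x) = (p x)\<^sup>2)"

definition cauchy_seqs :: "('a, 'm) star_alg_scheme \<Rightarrow> ('a \<Rightarrow> real) \<Rightarrow> (nat \<Rightarrow> 'a) set" where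
  "cauchy_seqs A p = {x. (\<forall>k. x k \<in> carrier A) \<and>
     (\<forall>e>0. \<exists>N. \<forall>k\<ge>N. \<forall>m\<ge>N. p (x k \<ominus>\<^bsub>A\<^esub> x m) < e)}"

locale cstar_algebra = star_algebra A for A :: "('a, 'm) cstar_alg_scheme" (structure) +
  assumes nrm_cstar: "cstar_seminorm A (nrm A)"
    and nrm_definite: "x \<in> carrier A \<Longrightarrow> nrm A x = 0 \<Longrightarrow> x = \<zero>"
    and complete: "X \<in> cauchy_seqs A (nrm A) \<Longrightarrow>
          \<exists>l\<in>carrier A. (\<lambda>k. nrm A (X k \<ominus> l)) \<longlonglongrightarrow> 0"

text \<open>Unital *-homomorphisms; between C*-algebras these are automatically contractive.\<close>

definition cstar_hom ::
  "('a, 'm) star_alg_scheme \<Rightarrow> ('b, 'k) star_alg_scheme \<Rightarrow> ('a \<Rightarrow> 'b) set" where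
  "cstar_hom A B = {f \<in> ring_hom A B.
     (\<forall>c. \<forall>x\<in>carrier A. f (scale A c x) = scale B c (f x)) \<and>
     (\<forall>x\<in>carrier A. f (star A x) = star B (f x))}"

definition cstar_iso ::
  "('a, 'm) star_alg_scheme \<Rightarrow> ('b, 'k) star_alg_scheme \<Rightarrow> ('a \<Rightarrow> 'b) set" where
  "cstar_iso A B = {f \<in> cstar_hom A B. bij_betw f (carrier A) (carrier B)}"

definition complex_alg :: "complex cstar_alg" where
  "complex_alg = \<lparr>carrier = UNIV, monoid.mult = (*), one = 1, zero = 0, add = (+),
     scale = (*), star = cnj, nrm = cmod\<rparr>"

definition opp_alg :: "('a, 'm) star_alg_scheme \<Rightarrow> ('a, 'm) star_alg_scheme" where
  "opp_alg A = A\<lparr>monoid.mult := \<lambda>x y. y \<otimes>\<^bsub>A\<^esub> x\<rparr>"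

definition commutative_alg :: "('a, 'm) ring_scheme \<Rightarrow> bool" where
  "commutative_alg A \<longleftrightarrow>
     (\<forall>x\<in>carrier A. \<forall>y\<in>carrier A. x \<otimes>\<^bsub>A\<^esub> y = y \<otimes>\<^bsub>A\<^esub> x)"


section \<open>Universal C*-algebras\<close>

text \<open>The completion of a *-algebra for a C*-seminorm: Cauchy sequences modulo null sequences.\<close>

definition cls :: "('a, 'm) star_alg_scheme \<Rightarrow> ('a \<Rightarrow> real) \<Rightarrow> (nat \<Rightarrow> 'a) \<Rightarrow> (nat \<Rightarrow> 'a) set" where
  "cls X p x = {y \<in> cauchy_seqs X p. (\<lambda>k. p (x k \<ominus>\<^bsub>X\<^esub> y k)) \<longlonglongrightarrow> 0}"

definition completion ::
  "('a, 'm) star_alg_scheme \<Rightarrow> ('a \<Rightarrow> real) \<Rightarrow> (nat \<Rightarrow> 'a) set cstar_alg" where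
  "completion X p = \<lparr>carrier = cls X p ` cauchy_seqs X p,
     monoid.mult = \<lambda>C D. \<Union>x\<in>C. \<Union>y\<in>D. cls X p (\<lambda>k. x k \<otimes>\<^bsub>X\<^esub> y k),
     one = cls X p (\<lambda>k. \<one>\<^bsub>X\<^esub>),
     zero = cls X p (\<lambda>k. \<zero>\<^bsub>X\<^esub>),
     add = \<lambda>C D. \<Union>x\<in>C. \<Union>y\<in>D. cls X p (\<lambda>k. x k \<oplus>\<^bsub>X\<^esub> y k),
     scale = \<lambda>c C. \<Union>x\<in>C. cls X p (\<lambda>k. scale X c (x k)),
     star = \<lambda>C. \<Union>x\<in>C. cls X p (\<lambda>k. star X (x k)),
     nrm = \<lambda>C. THE r. \<forall>x\<in>C. (\<lambda>k. p (x k)) \<longlonglongrightarrow> r\<rparr>"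

text \<open>The largest C*-seminorm vanishing on \<open>R\<close>. Every *-representation in which \<open>R\<close> vanishes
  yields such a seminorm, and conversely. The supremum is a genuine one in all uses below, where
  the *-algebras are generated by elements of bounded C*-seminorm.\<close>

definition univ_seminorm :: "('a, 'm) star_alg_scheme \<Rightarrow> 'a set \<Rightarrow> 'a \<Rightarrow> real" where
  "univ_seminorm X R x = Sup {p x | p. cstar_seminorm X p \<and> (\<forall>r\<in>R. p r = 0)}"

definition univ_cstar :: "('a, 'm) star_alg_scheme \<Rightarrow> 'a set \<Rightarrow> (nat \<Rightarrow> 'a) set cstar_alg" where
  "univ_cstar X R = completion X (univ_seminorm X R)"

definition univ_elem :: "('a, 'm) star_alg_scheme \<Rightarrow> 'a set \<Rightarrow> 'a \<Rightarrow> (nat \<Rightarrow> 'a) set" where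
  "univ_elem X R x = cls X (univ_seminorm X R) (\<lambda>k. x)"

text \<open>Extension to enveloping C*-algebras of a *-homomorphism between *-algebras.\<close>

definition univ_map ::
  "('b, 'm) star_alg_scheme \<Rightarrow> ('a \<Rightarrow> 'b) \<Rightarrow> (nat \<Rightarrow> 'a) set \<Rightarrow> (nat \<Rightarrow> 'b) set" where
  "univ_map Y f C = (\<Union>x\<in>C. cls Y (univ_seminorm Y {}) (\<lambda>k. f (x k)))"


section \<open>Tensor products\<close>

text \<open>The algebraic tensor product is realised inside the dual of the space of bilinear forms:
  \<open>a \<otimes> b\<close> is evaluation at \<open>(a, b)\<close>, extended by 0 to functions that are not bilinear
  on the carriers.\<close>

type_synonym ('a, 'b) tensor = "('a \<Rightarrow> 'b \<Rightarrow> complex) \<Rightarrow> complex"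

definition bilinear_on ::
  "('a, 'm) star_alg_scheme \<Rightarrow> ('b, 'k) star_alg_scheme \<Rightarrow> ('a \<Rightarrow> 'b \<Rightarrow> complex) \<Rightarrow> bool" where
  "bilinear_on A B \<phi> \<longleftrightarrow>
     (\<forall>a\<in>carrier A. \<forall>a'\<in>carrier A. \<forall>b\<in>carrier B. \<phi> (a \<oplus>\<^bsub>A\<^esub> a') b = \<phi> a b + \<phi> a' b) \<and>
     (\<forall>a\<in>carrier A. \<forall>b\<in>carrier B. \<forall>b'\<in>carrier B. \<phi> a (b \<oplus>\<^bsub>B\<^esub> b') = \<phi> a b + \<phi> a b') \<and>
     (\<forall>c. \<forall>a\<in>carrier A. \<forall>b\<in>carrier B. \<phi> (scale A c a) b = c * \<phi> a b) \<and>
     (\<forall>c. \<forall>a\<in>carrier A. \<forall>b\<in>carrier B. \<phi> a (scale B c b) = c * \<phi> a b)"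

definition simple_tensor ::
  "('a, 'm) star_alg_scheme \<Rightarrow> ('b, 'k) star_alg_scheme \<Rightarrow> 'a \<Rightarrow> 'b \<Rightarrow> ('a, 'b) tensor" where
  "simple_tensor A B a b = (\<lambda>\<phi>. if bilinear_on A B \<phi> then \<phi> a b else 0)"

text \<open>Multiplication and involution are the extensions of
  \<open>(a \<otimes> b)(c \<otimes> d) = ac \<otimes> bd\<close> and \<open>(a \<otimes> b)* = a* \<otimes> b*\<close>.\<close>

definition alg_tensor ::
  "('a, 'm) star_alg_scheme \<Rightarrow> ('b, 'k) star_alg_scheme \<Rightarrow> ('a, 'b) tensor star_alg" where
  "alg_tensor A B = \<lparr>
     carrier = {t. \<exists>(m::nat) a b. (\<forall>k<m. a k \<in> carrier A \<and> b k \<in> carrier B) \<and>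
                    t = (\<lambda>\<phi>. \<Sum>k<m. simple_tensor A B (a k) (b k) \<phi>)},
     monoid.mult = \<lambda>s t \<phi>. if bilinear_on A B \<phi>
       then s (\<lambda>a b. t (\<lambda>c d. \<phi> (a \<otimes>\<^bsub>A\<^esub> c) (b \<otimes>\<^bsub>B\<^esub> d))) else 0,
     one = simple_tensor A B \<one>\<^bsub>A\<^esub> \<one>\<^bsub>B\<^esub>,
     zero = \<lambda>\<phi>. 0,
     add = \<lambda>s t \<phi>. s \<phi> + t \<phi>,
     scale = \<lambda>c t \<phi>. c * t \<phi>,
     star = \<lambda>t \<phi>. if bilinear_on A B \<phi>
       then cnj (t (\<lambda>a b. cnj (\<phi> (star A a) (star B b)))) else 0\<rparr>"

text \<open>The C*-algebraic tensor product is the maximal one, in accordance with the use of full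
  versions throughout.\<close>

definition tensor_cstar ::
  "('a, 'm) star_alg_scheme \<Rightarrow> ('b, 'k) star_alg_scheme \<Rightarrow> (nat \<Rightarrow> ('a, 'b) tensor) set cstar_alg"
  where "tensor_cstar A B = univ_cstar (alg_tensor A B) {}"

definition tensor_elem ::
  "('a, 'm) star_alg_scheme \<Rightarrow> ('b, 'k) star_alg_scheme \<Rightarrow> 'a \<Rightarrow> 'b \<Rightarrow>
     (nat \<Rightarrow> ('a, 'b) tensor) set" where
  "tensor_elem A B a b = univ_elem (alg_tensor A B) {} (simple_tensor A B a b)"

definition tensor_map ::
  "('c, 'm) star_alg_scheme \<Rightarrow> ('d, 'k) star_alg_scheme \<Rightarrow> ('a \<Rightarrow> 'c) \<Rightarrow> ('b \<Rightarrow> 'd) \<Rightarrow>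
     (nat \<Rightarrow> ('a, 'b) tensor) set \<Rightarrow> (nat \<Rightarrow> ('c, 'd) tensor) set" where
  "tensor_map C D f g = univ_map (alg_tensor C D)
     (\<lambda>t \<phi>. if bilinear_on C D \<phi> then t (\<lambda>a b. \<phi> (f a) (g b)) else 0)"


section \<open>Group duals\<close>

text \<open>The *-algebra of a monoid \<open>M\<close> with involution \<open>i\<close>: finitely supported functions with
  convolution.\<close>

definition monoid_alg :: "('g, 'm) monoid_scheme \<Rightarrow> ('g \<Rightarrow> 'g) \<Rightarrow> ('g \<Rightarrow> complex) star_alg" where
  "monoid_alg M i = \<lparr>
     carrier = {f. finite {g. f g \<noteq> 0} \<and> {g. f g \<noteq> 0} \<subseteq> carrier M},
     monoid.mult = \<lambda>f h z. \<Sum>a\<in>{a. f a \<noteq> 0}. \<Sum>b\<in>{b. h b \<noteq> 0}.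
                      if a \<otimes>\<^bsub>M\<^esub> b = z then f a * h b else 0,
     one = \<lambda>z. if z = \<one>\<^bsub>M\<^esub> then 1 else 0,
     zero = \<lambda>z. 0,
     add = \<lambda>f h z. f z + h z,
     scale = \<lambda>c f z. c * f z,
     star = \<lambda>f z. if z \<in> carrier M then cnj (f (i z)) else 0\<rparr>"

definition single :: "'g \<Rightarrow> 'g \<Rightarrow> complex" where
  "single g = (\<lambda>z. if z = g then 1 else 0)"

definition group_alg :: "('g, 'm) monoid_scheme \<Rightarrow> ('g \<Rightarrow> complex) star_alg" where
  "group_alg \<Lambda> = monoid_alg \<Lambda> (m_inv \<Lambda>)"

definition group_cstar :: "('g, 'm) monoid_scheme \<Rightarrow> (nat \<Rightarrow> 'g \<Rightarrow> complex) set cstar_alg" where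
  "group_cstar \<Lambda> = univ_cstar (group_alg \<Lambda>) {}"

definition group_elem :: "('g, 'm) monoid_scheme \<Rightarrow> 'g \<Rightarrow> (nat \<Rightarrow> 'g \<Rightarrow> complex) set" where
  "group_elem \<Lambda> g = univ_elem (group_alg \<Lambda>) {} (single g)"

text \<open>The morphism \<open>C*(\<Gamma>) \<rightarrow> C*(\<Lambda>)\<close> induced by \<open>p : \<Gamma> \<rightarrow> \<Lambda>\<close>.\<close>

definition group_cstar_map ::
  "('h, 'm) monoid_scheme \<Rightarrow> ('g \<Rightarrow> 'h) \<Rightarrow>
     (nat \<Rightarrow> 'g \<Rightarrow> complex) set \<Rightarrow> (nat \<Rightarrow> 'h \<Rightarrow> complex) set" where
  "group_cstar_map \<Lambda> p = univ_map (group_alg \<Lambda>)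
     (\<lambda>f z. \<Sum>g\<in>{g. f g \<noteq> 0}. if p g = z then f g else 0)"

definition group_comult ::
  "('g, 'm) monoid_scheme \<Rightarrow> ((nat \<Rightarrow> 'g \<Rightarrow> complex) set \<Rightarrow>
     (nat \<Rightarrow> ((nat \<Rightarrow> 'g \<Rightarrow> complex) set, (nat \<Rightarrow> 'g \<Rightarrow> complex) set) tensor) set) \<Rightarrow> bool" where
  "group_comult \<Lambda> \<Delta> \<longleftrightarrow>
     \<Delta> \<in> cstar_hom (group_cstar \<Lambda>) (tensor_cstar (group_cstar \<Lambda>) (group_cstar \<Lambda>)) \<and>
     (\<forall>g\<in>carrier \<Lambda>. \<Delta> (group_elem \<Lambda> g) =
        tensor_elem (group_cstar \<Lambda>) (group_cstar \<Lambda>) (group_elem \<Lambda> g) (group_elem \<Lambda> g))"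


section \<open>Closed subgroups\<close>

definition closed_subgroup ::
  "('a, 'm) star_alg_scheme \<Rightarrow> ('a \<Rightarrow> (nat \<Rightarrow> ('a, 'a) tensor) set) \<Rightarrow>
   ('b, 'k) star_alg_scheme \<Rightarrow> ('b \<Rightarrow> (nat \<Rightarrow> ('b, 'b) tensor) set) \<Rightarrow> ('a \<Rightarrow> 'b) \<Rightarrow> bool" where
  "closed_subgroup A \<Delta>\<^sub>A B \<Delta>\<^sub>B \<theta> \<longleftrightarrow>
     \<theta> \<in> cstar_hom A B \<and> \<theta> ` carrier A = carrier B \<and>
     (\<forall>x\<in>carrier A. \<Delta>\<^sub>B (\<theta> x) = tensor_map B B \<theta> \<theta> (\<Delta>\<^sub>A x))"

definition group_dual_subgroup ::
  "('a, 'm) star_alg_scheme \<Rightarrow> ('a \<Rightarrow> (nat \<Rightarrow> ('a, 'a) tensor) set) \<Rightarrow>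
   ('g, 'k) monoid_scheme \<Rightarrow> ('a \<Rightarrow> (nat \<Rightarrow> 'g \<Rightarrow> complex) set) \<Rightarrow> bool" where
  "group_dual_subgroup A \<Delta> \<Lambda> \<theta> \<longleftrightarrow>
     (\<exists>\<Delta>\<^sub>\<Lambda>. group_comult \<Lambda> \<Delta>\<^sub>\<Lambda> \<and> closed_subgroup A \<Delta> (group_cstar \<Lambda>) \<Delta>\<^sub>\<Lambda> \<theta>)"

text \<open>The type argument is the type from which the elements of the groups \<open>\<Lambda>\<close> are taken.
  For closed subgroups \<open>G\<close> of some \<open>U\<^sub>n\<^sup>+\<close>, all groups \<open>\<Lambda>\<close> that occur are finitely
  generated, hence countable, so any infinite type accommodates all of them up to isomorphism.\<close>

definition strange ::
  "'h::infinite itself \<Rightarrow> ('a, 'm) star_alg_scheme \<Rightarrow>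
     ('a \<Rightarrow> (nat \<Rightarrow> ('a, 'a) tensor) set) \<Rightarrow> bool" where
  "strange _ A \<Delta> \<longleftrightarrow> \<not> commutative_alg A \<and>
     (\<forall>(\<Lambda> :: 'h monoid) \<theta>. group \<Lambda> \<longrightarrow> group_dual_subgroup A \<Delta> \<Lambda> \<theta> \<longrightarrow>
        commutative_alg (group_cstar \<Lambda>))"


section \<open>The free unitary quantum group and its subgroups\<close>

definition mat_mult ::
  "('a, 'm) star_alg_scheme \<Rightarrow> ('n::finite \<Rightarrow> 'n \<Rightarrow> 'a) \<Rightarrow> ('n \<Rightarrow> 'n \<Rightarrow> 'a) \<Rightarrow> 'n \<Rightarrow> 'n \<Rightarrow> 'a" where
  "mat_mult A v w i j = (\<Oplus>\<^bsub>A\<^esub>k\<in>UNIV. v i k \<otimes>\<^bsub>A\<^esub> w k j)"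

definition mat_adj ::
  "('a, 'm) star_alg_scheme \<Rightarrow> ('n::finite \<Rightarrow> 'n \<Rightarrow> 'a) \<Rightarrow> 'n \<Rightarrow> 'n \<Rightarrow> 'a" where
  "mat_adj A v i j = star A (v j i)"

definition mat_one :: "('a, 'm) star_alg_scheme \<Rightarrow> 'n::finite \<Rightarrow> 'n \<Rightarrow> 'a" where
  "mat_one A i j = (if i = j then \<one>\<^bsub>A\<^esub> else \<zero>\<^bsub>A\<^esub>)"

text \<open>The free *-algebra on generators \<open>u\<^sub>i\<^sub>j\<close>: words in letters \<open>(i, j, s)\<close>, with
  \<open>s = False\<close> for \<open>u\<^sub>i\<^sub>j\<close> and \<open>s = True\<close> for its adjoint.\<close>

definition free_star_alg :: "(('n \<times> 'n \<times> bool) list \<Rightarrow> complex) star_alg" where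
  "free_star_alg = monoid_alg \<lparr>carrier = UNIV, monoid.mult = (@), one = []\<rparr>
     (\<lambda>w. rev (map (\<lambda>(i, j, s). (i, j, \<not> s)) w))"

definition free_gen :: "'n \<Rightarrow> 'n \<Rightarrow> ('n \<times> 'n \<times> bool) list \<Rightarrow> complex" where
  "free_gen i j = single [(i, j, False)]"

definition unitary_relations ::
  "('a, 'm) star_alg_scheme \<Rightarrow> ('n::finite \<Rightarrow> 'n \<Rightarrow> 'a) \<Rightarrow> 'a set" where
  "unitary_relations A w =
     {mat_mult A w (mat_adj A w) i j \<ominus>\<^bsub>A\<^esub> mat_one A i j | i j. True} \<union>
     {mat_mult A (mat_adj A w) w i j \<ominus>\<^bsub>A\<^esub> mat_one A i j | i j. True}"

definition Un_plus_relations :: "(('n::finite \<times> 'n \<times> bool) list \<Rightarrow> complex) set" where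
  "Un_plus_relations = unitary_relations free_star_alg free_gen \<union>
     unitary_relations free_star_alg (\<lambda>i j. free_gen j i)"

type_synonym 'n Un_plus_elem = "(nat \<Rightarrow> ('n \<times> 'n \<times> bool) list \<Rightarrow> complex) set"

definition C_Un_plus :: "'n::finite Un_plus_elem cstar_alg" where
  "C_Un_plus = univ_cstar free_star_alg Un_plus_relations"

definition Un_plus_gen :: "'n::finite \<Rightarrow> 'n \<Rightarrow> 'n Un_plus_elem" where
  "Un_plus_gen i j = univ_elem free_star_alg Un_plus_relations (free_gen i j)"

definition Un_plus_comult ::
  "('n::finite Un_plus_elem \<Rightarrow> (nat \<Rightarrow> ('n Un_plus_elem, 'n Un_plus_elem) tensor) set) \<Rightarrow> bool" where
  "Un_plus_comult \<Delta> \<longleftrightarrow>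
     \<Delta> \<in> cstar_hom C_Un_plus (tensor_cstar C_Un_plus C_Un_plus) \<and>
     (\<forall>i j. \<Delta> (Un_plus_gen i j) =
        (\<Oplus>\<^bsub>tensor_cstar C_Un_plus C_Un_plus\<^esub>k\<in>UNIV.
           tensor_elem C_Un_plus C_Un_plus (Un_plus_gen i k) (Un_plus_gen k j)))"

definition gen_star_subalg :: "('a, 'm) star_alg_scheme \<Rightarrow> 'a set \<Rightarrow> 'a set" where
  "gen_star_subalg A X = \<Inter>{S. X \<subseteq> S \<and> S \<subseteq> carrier A \<and> \<one>\<^bsub>A\<^esub> \<in> S \<and>
     (\<forall>x\<in>S. \<forall>y\<in>S. x \<oplus>\<^bsub>A\<^esub> y \<in> S \<and> x \<otimes>\<^bsub>A\<^esub> y \<in> S) \<and>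
     (\<forall>x\<in>S. star A x \<in> S \<and> (\<forall>c. scale A c x \<in> S))}"

text \<open>A closed subgroup \<open>G \<subset> U\<^sub>n\<^sup>+\<close>, given by its (full) Hopf C*-algebra \<open>A = C(G)\<close>, of Kac type,
  and by the surjection \<open>\<theta> : C(U\<^sub>n\<^sup>+) \<rightarrow> C(G)\<close>. Fullness says that the norm is the largest
  C*-seminorm on the dense *-subalgebra generated by the coordinates \<open>u\<^sub>i\<^sub>j = \<theta>(u\<^sub>i\<^sub>j)\<close>.\<close>

locale closed_subgroup_Un_plus = cstar_algebra A for A :: "'a cstar_alg" +
  fixes \<Delta> :: "'a \<Rightarrow> (nat \<Rightarrow> ('a, 'a) tensor) set"
    and \<theta> :: "'n::finite Un_plus_elem \<Rightarrow> 'a"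
  assumes comult: "\<Delta> \<in> cstar_hom A (tensor_cstar A A)"
    and counit: "\<exists>\<epsilon>\<in>cstar_hom A complex_alg.
          \<forall>i j. \<epsilon> (\<theta> (Un_plus_gen i j)) = (if i = j then 1 else 0)"
    and antipode: "\<exists>S\<in>cstar_hom A (opp_alg A).
          \<forall>i j. S (\<theta> (Un_plus_gen i j)) = star A (\<theta> (Un_plus_gen j i))"
    and subgroup: "\<exists>\<Delta>\<^sub>U. Un_plus_comult \<Delta>\<^sub>U \<and> closed_subgroup C_Un_plus \<Delta>\<^sub>U A \<Delta> \<theta>"
    and full: "cstar_seminorm
            (A\<lparr>carrier := gen_star_subalg A {\<theta> (Un_plus_gen i j) | i j. True}\<rparr>) p \<Longrightarrow>
          x \<in> gen_star_subalg A {\<theta> (Un_plus_gen i j) | i j. True} \<Longrightarrow> p x \<le> nrm A x"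


section \<open>The groups \<open>\<Gamma>\<^sub>U\<close>\<close>

definition unitary_group :: "(complex ^ 'n ^ 'n::finite) set" where
  "unitary_group = {U. U ** (\<chi> i j. cnj (U $ j $ i)) = mat 1 \<and>
                       (\<chi> i j. cnj (U $ j $ i)) ** U = mat 1}"

definition rotated ::
  "('a, 'm) star_alg_scheme \<Rightarrow> ('n::finite \<Rightarrow> 'n \<Rightarrow> 'a) \<Rightarrow> complex ^ 'n ^ 'n \<Rightarrow> 'n \<Rightarrow> 'n \<Rightarrow> 'a" where
  "rotated A u U i j =
     (\<Oplus>\<^bsub>A\<^esub>k\<in>UNIV. \<Oplus>\<^bsub>A\<^esub>l\<in>UNIV. scale A (U $ i $ k * cnj (U $ j $ l)) (u k l))"

definition closed_star_ideal :: "('a, 'm) cstar_alg_scheme \<Rightarrow> 'a set \<Rightarrow> 'a set" where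
  "closed_star_ideal A R = \<Inter>{J. ideal J A \<and> R \<subseteq> J \<and> (\<forall>x\<in>J. star A x \<in> J) \<and>
     (\<forall>x l. (\<forall>k. x k \<in> J) \<and> l \<in> carrier A \<and> (\<lambda>k::nat. nrm A (x k \<ominus>\<^bsub>A\<^esub> l)) \<longlonglongrightarrow> 0 \<longrightarrow> l \<in> J)}"

definition quotient_cstar :: "('a, 'm) cstar_alg_scheme \<Rightarrow> 'a set \<Rightarrow> 'a set cstar_alg" where
  "quotient_cstar A I = \<lparr>
     carrier = carrier (A Quot I),
     monoid.mult = monoid.mult (A Quot I),
     one = one (A Quot I),
     zero = zero (A Quot I),
     add = add (A Quot I),
     scale = \<lambda>c X. \<Union>x\<in>X. I +>\<^bsub>A\<^esub> scale A c x,
     star = \<lambda>X. \<Union>x\<in>X. I +>\<^bsub>A\<^esub> star A x,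
     nrm = \<lambda>X. Inf (nrm A ` X)\<rparr>"

context
  fixes A :: "'a cstar_alg" and \<theta> :: "'n::finite Un_plus_elem \<Rightarrow> 'a" and U :: "complex ^ 'n ^ 'n"
begin

definition v_gen :: "'n \<Rightarrow> 'n \<Rightarrow> 'a" where
  "v_gen = rotated A (\<lambda>i j. \<theta> (Un_plus_gen i j)) U"

definition diag_ideal :: "'a set" where
  "diag_ideal = closed_star_ideal A {v_gen i j | i j. i \<noteq> j}"

definition diag_quotient :: "'a set cstar_alg" where
  "diag_quotient = quotient_cstar A diag_ideal"

definition diag_proj :: "'a \<Rightarrow> 'a set" where
  "diag_proj x = diag_ideal +>\<^bsub>A\<^esub> x"

definition Gamma :: "'a set monoid" where
  "Gamma = (units_of diag_quotient)
     \<lparr>carrier := generate (units_of diag_quotient) (range (\<lambda>i. diag_proj (v_gen i i)))\<rparr>"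

text \<open>The identification \<open>C(G)/\<langle>v\<^sub>i\<^sub>j = 0, i \<noteq> j\<rangle> = C*(\<Gamma>\<^sub>U)\<close>.\<close>

definition Gamma_identification :: "('a set \<Rightarrow> (nat \<Rightarrow> 'a set \<Rightarrow> complex) set) \<Rightarrow> bool" where
  "Gamma_identification \<kappa> \<longleftrightarrow> \<kappa> \<in> cstar_iso diag_quotient (group_cstar Gamma) \<and>
     (\<forall>\<gamma>\<in>carrier Gamma. \<kappa> \<gamma> = group_elem Gamma \<gamma>)"

end

end

theory Submission
 imports Defs
begin

text \<open>The diagonal quotient \<open>D\<close> of \<open>C(G)\<close> is generated by the group-like unitaries \<open>g\<^sub>i = v\<^sub>i\<^sub>i\<close>. By
 comultiplication, states of \<open>D\<close> may be multiplied pointwise on \<open>\<Gamma>\<^sub>U\<close>; high powers of a state that is strictly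
 contractive on finitely many nontrivial elements isolate coefficients, so \<open>\<Gamma>\<^sub>U\<close> is linearly independent in
 \<open>D\<close>. Fullness of \<open>C(G)\<close> then gives \<open>D = C*(\<Gamma>\<^sub>U)\<close>.

 Conversely, let \<open>w\<^sub>i\<^sub>j \<in> C*(\<Lambda>)\<close> be the images of \<open>u\<^sub>i\<^sub>j\<close>, and \<open>E\<^sub>h\<close> the coefficient functionals given by the trace.
 Comparing coefficients in \<open>\<Delta>(w\<^sub>i\<^sub>j) = \<Sum>\<^sub>k w\<^sub>i\<^sub>k \<otimes> w\<^sub>k\<^sub>j\<close> shows that each row \<open>r = (E\<^sub>h(w\<^sub>i\<^sub>k))\<^sub>k\<close> satisfies
 \<open>r w = h r\<close>. Such rows are orthogonal for distinct \<open>h\<close> and span, since \<open>w\<close> is unitary; an orthonormal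
 basis of them is the required \<open>U\<close>. Finally \<open>\<Gamma>\<^sub>U\<close> is countable, so strangeness can be
 tested on groups with elements in any infinite type.\<close>

section \<open>Star algebras and C*-seminorms\<close>

text \<open>The tensor products are maximal, that is, normed by a supremum over all C*-seminorms, so
  little can be computed inside them: they are reached through homomorphisms into them and states on
  them. Hence product states carry both directions. A state is extended to a universal C*-algebra by
  exhibiting its GNS operator seminorm as one of the competing seminorms; for a product state,
  positivity on the algebraic tensor product is the Schur product theorem for two Gram matrices.
  States must also separate elements, which rests on Hahn-Banach and on the positivity of x* x.
  Positivity is expressed by norm inequalities such as nrm (T - a) <= T, without spectra, and
  everything is traced back to one convergent iteration for the square root of 1 - z. The same
  square root yields the contractivity of homomorphisms, and the approximate units in ideals from
  which the C*-identity of the quotient norm is derived.\<close>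

context star_algebra
begin

lemmas star_closed_simps [simp] = scale_closed star_closed star_star scale_1
lemmas star_alg = star_algebra_axioms
lemmas star_ops = scale_add scale_scale scale_mult_left scale_mult_right star_add star_scale star_mult

lemma scale_zero_right [simp]: "scale A c \<zero> = \<zero>"
proof -
 have "scale A c \<zero> \<oplus> scale A c \<zero> = scale A c \<zero>"
  using scale_add[of \<zero> \<zero> c] by simp
 then show ?thesis by simp
qed

lemma scale_zero_left [simp]: "x \<in> carrier A ==> scale A 0 x = \<zero>"
proof -
 assume x: "x \<in> carrier A"
 have "scale A 0 x \<oplus> scale A 0 x = scale A 0 x"
  using add_scale[of x 0 0] x by simp
 then show ?thesis using x by simp
qed

lemma scale_minus_one: "x \<in> carrier A ==> \<ominus> x = scale A (- 1) x"
proof -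
 assume x: "x \<in> carrier A"
 have "scale A (- 1) x \<oplus> x = \<zero>"
  using add_scale[of x "- 1" 1] x by simp
 then show ?thesis using x by (simp add: minus_equality)
qed

lemma minus_conv: "x \<in> carrier A ==> y \<in> carrier A ==> x \<ominus> y = x \<oplus> scale A (- 1) y"
 by (simp add: minus_eq scale_minus_one)

lemma star_zero [simp]: "star A \<zero> = \<zero>"
proof -
 have "star A \<zero> \<oplus> star A \<zero> = star A \<zero>"
  using star_add[of \<zero> \<zero>] by simp
 then show ?thesis by simp
qed

lemma star_one [simp]: "star A \<one> = \<one>"
proof -
 have "star A (star A \<one> \<otimes> \<one>) = star A \<one> \<otimes> \<one>"
  by (subst star_mult) auto
 then show ?thesis by simp
qed

lemma star_uminus: "x \<in> carrier A ==> star A (\<ominus> x) = \<ominus> star A x"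
 by (simp add: scale_minus_one star_scale)

lemma star_minus: "x \<in> carrier A ==> y \<in> carrier A ==> star A (x \<ominus> y) = star A x \<ominus> star A y"
 by (simp add: minus_eq star_add star_uminus)

lemma scale_minus: "x \<in> carrier A ==> y \<in> carrier A ==> scale A c (x \<ominus> y) = scale A c x \<ominus> scale A c y"
 by (simp add: minus_conv scale_add scale_scale mult.commute)

lemma r_distr_minus: "x \<in> carrier A ==> y \<in> carrier A ==> z \<in> carrier A ==> z \<otimes> (x \<ominus> y) = z \<otimes> x \<ominus> z \<otimes> y"
 by (simp add: minus_eq r_distr r_minus)

lemma l_distr_minus: "x \<in> carrier A ==> y \<in> carrier A ==> z \<in> carrier A ==> (x \<ominus> y) \<otimes> z = x \<otimes> z \<ominus> y \<otimes> z"
 by (simp add: minus_eq l_distr l_minus)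

lemma minus_self [simp]: "x \<in> carrier A ==> x \<ominus> x = \<zero>"
 by (simp add: minus_eq r_neg)

lemma minus_eq_zero_iff: "x \<in> carrier A ==> y \<in> carrier A ==> x \<ominus> y = \<zero> \<longleftrightarrow> x = y"
 by (metis add.inv_closed minus_eq minus_equality minus_minus minus_self)

lemma minus_swap4: "a \<in> carrier A ==> b \<in> carrier A ==> c \<in> carrier A ==> d \<in> carrier A ==>
  (a \<oplus> b) \<ominus> (c \<oplus> d) = (a \<ominus> c) \<oplus> (b \<ominus> d)"
 by (simp add: minus_eq minus_add a_ac)

lemma minus_split: "a \<in> carrier A ==> b \<in> carrier A ==> c \<in> carrier A ==> a \<ominus> c = (a \<ominus> b) \<oplus> (b \<ominus> c)"
 by (simp add: minus_eq a_assoc[symmetric]) (simp add: a_assoc l_neg)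

text \<open>Linear combinations of four fixed elements, named by their coefficients.
  \<open>B\<close> is obtained opaquely from \<open>coords4_ex\<close>; rewriting with
  \<open>coords4D\<close> then turns an identity between linear combinations into identities of
  complex numbers.\<close>

definition coords4 :: "'a => 'a => 'a => 'a => (complex => complex => complex => complex => 'a) => bool" where
 "coords4 x y z w B \<longleftrightarrow> (\<forall>a b c d. B a b c d = scale A a x \<oplus> (scale A b y \<oplus> (scale A c z \<oplus> scale A d w))) &
   x \<in> carrier A & y \<in> carrier A & z \<in> carrier A & w \<in> carrier A"

lemma coords4_ex:
 assumes "x \<in> carrier A" "y \<in> carrier A" "z \<in> carrier A" "w \<in> carrier A"
 shows "\<exists>B. coords4 x y z w B"
 using assms unfolding coords4_def
 by (intro exI[of _ "%a b c d. scale A a x \<oplus> (scale A b y \<oplus> (scale A c z \<oplus> scale A d w))"]) simp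

lemma coords4D:
 assumes "coords4 x y z w B"
 shows "x = B 1 0 0 0" "y = B 0 1 0 0" "z = B 0 0 1 0" "w = B 0 0 0 1" "\<zero> = B 0 0 0 0"
  "B a b c d \<oplus> B a' b' c' d' = B (a+a') (b+b') (c+c') (d+d')"
  "B a b c d \<ominus> B a' b' c' d' = B (a-a') (b-b') (c-c') (d-d')"
  "scale A e (B a b c d) = B (e*a) (e*b) (e*c) (e*d)"
  "B a b c d \<in> carrier A"
proof -
 have B_def: "B a b c d = scale A a x \<oplus> (scale A b y \<oplus> (scale A c z \<oplus> scale A d w))" for a b c d
  using assms unfolding coords4_def by auto
 have mem: "x \<in> carrier A" "y \<in> carrier A" "z \<in> carrier A" "w \<in> carrier A"
  using assms unfolding coords4_def by auto
 have 1: "B a b c d \<oplus> B a' b' c' d' = B (a+a') (b+b') (c+c') (d+d')" for a b c d a' b' c' d'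
  using mem by (simp add: B_def add_scale a_ac)
 have 2: "scale A e (B a b c d) = B (e*a) (e*b) (e*c) (e*d)" for a b c d e
  using mem by (simp add: B_def scale_add scale_scale)
 have cl: "B a b c d \<in> carrier A" for a b c d
  using mem by (simp add: B_def)
 have 3: "B a b c d \<ominus> B a' b' c' d' = B (a-a') (b-b') (c-c') (d-d')" for a b c d a' b' c' d'
  by (simp add: minus_conv cl 1 2)
 show "B a b c d \<oplus> B a' b' c' d' = B (a+a') (b+b') (c+c') (d+d')"
  "B a b c d \<ominus> B a' b' c' d' = B (a-a') (b-b') (c-c') (d-d')"
  "scale A e (B a b c d) = B (e*a) (e*b) (e*c) (e*d)" "B a b c d \<in> carrier A"
  by (rule 1 2 3 cl)+
 show "x = B 1 0 0 0" "y = B 0 1 0 0" "z = B 0 0 1 0" "w = B 0 0 0 1" "\<zero> = B 0 0 0 0"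
  using mem by (simp_all add: B_def)
qed

end

section \<open>C*-seminorms and convergence with respect to them\<close>

locale star_seminorm = star_algebra A for A :: "('a, 'm) star_alg_scheme" (structure) +
 fixes p :: "'a => real"
 assumes seminorm: "cstar_seminorm A p"
begin

lemma p_nonneg [simp]: "x \<in> carrier A ==> 0 <= p x"
 and p_add: "x \<in> carrier A ==> y \<in> carrier A ==> p (x \<oplus> y) <= p x + p y"
 and p_scale: "x \<in> carrier A ==> p (scale A c x) = cmod c * p x"
 and p_mult: "x \<in> carrier A ==> y \<in> carrier A ==> p (x \<otimes> y) <= p x * p y"
 and p_cstar: "x \<in> carrier A ==> p (star A x \<otimes> x) = (p x)^2"
 using seminorm by (auto simp: cstar_seminorm_def)

lemma p_zero [simp]: "p \<zero> = 0"
 using p_scale[of \<zero> 0] by simp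

lemma p_uminus: "x \<in> carrier A ==> p (\<ominus> x) = p x"
 by (simp add: scale_minus_one p_scale)

lemma p_minus_commute: "x \<in> carrier A ==> y \<in> carrier A ==> p (x \<ominus> y) = p (y \<ominus> x)"
 using p_uminus[of "x \<ominus> y"] by (simp add: minus_eq minus_add a_comm)

lemma p_minus_le: "x \<in> carrier A ==> y \<in> carrier A ==> p (x \<ominus> y) <= p x + p y"
 using p_add[of x "\<ominus> y"] by (simp add: minus_eq p_uminus)

lemma p_triangle: "x \<in> carrier A ==> y \<in> carrier A ==> z \<in> carrier A ==> p (x \<ominus> z) <= p (x \<ominus> y) + p (y \<ominus> z)"
 using p_add[of "x \<ominus> y" "y \<ominus> z"] by (simp add: minus_split[of x y z])

lemma p_diff_le: "x \<in> carrier A ==> y \<in> carrier A ==> \<bar>p x - p y\<bar> <= p (x \<ominus> y)"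
proof -
 assume x: "x \<in> carrier A" and y: "y \<in> carrier A"
 have "p x <= p (x \<ominus> y) + p y" using p_triangle[of x y \<zero>] x y by (simp add: minus_eq)
 moreover have "p y <= p (y \<ominus> x) + p x" using p_triangle[of y x \<zero>] x y by (simp add: minus_eq)
 ultimately show ?thesis using p_minus_commute[OF x y] by linarith
qed

text \<open>The C*-identity and submultiplicativity bound the square of \<open>p y\<close> by
  \<open>p (star A y) * p y\<close>; cancel \<open>p y\<close>, then exchange the roles of an
  element and its adjoint.\<close>

lemma p_star [simp]: assumes x: "x \<in> carrier A" shows "p (star A x) = p x"
proof -
 have *: "p y <= p (star A y)" if y: "y \<in> carrier A" for y
 proof (cases "p y = 0")
  case False
  have "p y * p y <= p (star A y) * p y"
   using p_cstar[OF y] p_mult[of "star A y" y] y by (simp add: power2_eq_square)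
  moreover have "p y > 0" using False p_nonneg[OF y] by linarith
  ultimately show ?thesis by simp
 qed (use y in simp)
 show ?thesis using *[of x] *[of "star A x"] x by auto
qed

lemma p_selfadjoint_square: "x \<in> carrier A ==> star A x = x ==> p (x \<otimes> x) = (p x)^2"
 using p_cstar[of x] by simp

text \<open>The unit is a self-adjoint idempotent. The value 0 is possible, since neither a seminorm
  nor a C*-algebra is required to be nonzero; later proofs split on it.\<close>

lemma p_one_cases: "p \<one> = 0 \<or> p \<one> = 1"
 using p_cstar[of \<one>] by (simp add: power2_eq_square)

lemma p_one_le: "p \<one> <= 1"
 using p_one_cases by auto

lemma p_isometry_le: "w \<in> carrier A ==> star A w \<otimes> w = \<one> ==> p w <= 1"
 using p_cstar[of w] p_one_le by (simp add: power_le_one_iff)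

definition lims :: "(nat => 'a) => 'a => bool" where
 "lims X l \<longleftrightarrow> (\<forall>k. X k \<in> carrier A) & l \<in> carrier A & (%k. p (X k \<ominus> l)) \<longlonglongrightarrow> 0"

lemma limsD: "lims X l ==> X k \<in> carrier A" "lims X l ==> l \<in> carrier A"
  "lims X l ==> (%k. p (X k \<ominus> l)) \<longlonglongrightarrow> 0"
 by (auto simp: lims_def)

lemma lims_bound:
 assumes "!!k. X k \<in> carrier A" "l \<in> carrier A" "!!k. p (X k \<ominus> l) <= b k" "b \<longlonglongrightarrow> 0"
 shows "lims X l"
 unfolding lims_def
proof (intro conjI allI)
 show "(%k. p (X k \<ominus> l)) \<longlonglongrightarrow> 0"
  by (rule tendsto_sandwich[of "%_. 0" _ _ b]) (use assms in \<open>auto intro!: always_eventually\<close>)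
qed (use assms in auto)

lemma lims_const: "l \<in> carrier A ==> lims (%_. l) l"
 by (simp add: lims_def)

lemma lims_add: assumes X: "lims X l" and Y: "lims Y m" shows "lims (%k. X k \<oplus> Y k) (l \<oplus> m)"
proof (rule lims_bound)
 show "p ((X k \<oplus> Y k) \<ominus> (l \<oplus> m)) <= p (X k \<ominus> l) + p (Y k \<ominus> m)" for k
  using X Y by (simp add: minus_swap4 limsD p_add)
 show "(%k. p (X k \<ominus> l) + p (Y k \<ominus> m)) \<longlonglongrightarrow> 0"
  using tendsto_add[OF limsD(3)[OF X] limsD(3)[OF Y]] by simp
qed (use X Y in \<open>auto simp: limsD\<close>)

lemma lims_scale: assumes X: "lims X l" shows "lims (%k. scale A c (X k)) (scale A c l)"
proof (rule lims_bound)
 show "p (scale A c (X k) \<ominus> scale A c l) <= cmod c * p (X k \<ominus> l)" for k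
  using X by (simp add: scale_minus[symmetric] limsD p_scale)
 show "(%k. cmod c * p (X k \<ominus> l)) \<longlonglongrightarrow> 0"
  using tendsto_mult_left[OF limsD(3)[OF X], of "cmod c"] by simp
qed (use X in \<open>auto simp: limsD\<close>)

lemma lims_minus: assumes X: "lims X l" and Y: "lims Y m" shows "lims (%k. X k \<ominus> Y k) (l \<ominus> m)"
 using lims_add[OF X lims_scale[OF Y, of "-1"]] X Y
 by (simp add: minus_conv limsD)

lemma lims_star: assumes X: "lims X l" shows "lims (%k. star A (X k)) (star A l)"
proof (rule lims_bound)
 show "p (star A (X k) \<ominus> star A l) <= p (X k \<ominus> l)" for k
  using X by (simp add: star_minus[symmetric] limsD)
 show "(%k. p (X k \<ominus> l)) \<longlonglongrightarrow> 0"
  using limsD(3)[OF X] .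
qed (use X in \<open>auto simp: limsD\<close>)

lemma lims_p: assumes X: "lims X l" shows "(%k. p (X k)) \<longlonglongrightarrow> p l"
proof -
 have "(%k. p (X k) - p l) \<longlonglongrightarrow> 0"
 proof (rule tendsto_0_le[where K = 1])
  show "\<forall>\<^sub>F k in sequentially. norm (p (X k) - p l) <= norm (p (X k \<ominus> l)) * 1"
   using X by (auto intro!: always_eventually p_diff_le simp: limsD)
 qed (rule limsD(3)[OF X])
 then show ?thesis by (simp add: LIM_zero_iff)
qed

lemma lims_mult: assumes X: "lims X l" and Y: "lims Y m" shows "lims (%k. X k \<otimes> Y k) (l \<otimes> m)"
proof (rule lims_bound)
 fix k
 have c: "X k \<in> carrier A" "Y k \<in> carrier A" "l \<in> carrier A" "m \<in> carrier A"
  using X Y by (auto simp: limsD)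
 have "p (X k \<otimes> Y k \<ominus> l \<otimes> m) <= p (X k \<otimes> Y k \<ominus> X k \<otimes> m) + p (X k \<otimes> m \<ominus> l \<otimes> m)"
  using c by (intro p_triangle) auto
 also have "... = p (X k \<otimes> (Y k \<ominus> m)) + p ((X k \<ominus> l) \<otimes> m)"
  using c by (simp add: r_distr_minus l_distr_minus)
 also have "... <= p (X k) * p (Y k \<ominus> m) + p (X k \<ominus> l) * p m"
  using c by (intro add_mono p_mult) auto
 finally show "p (X k \<otimes> Y k \<ominus> l \<otimes> m) <= p (X k) * p (Y k \<ominus> m) + p (X k \<ominus> l) * p m" .
next
 show "(%k. p (X k) * p (Y k \<ominus> m) + p (X k \<ominus> l) * p m) \<longlonglongrightarrow> 0"
  using tendsto_add[OF tendsto_mult[OF lims_p[OF X] limsD(3)[OF Y]]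
    tendsto_mult_right[OF limsD(3)[OF X], of "p m"]] by simp
qed (use X Y in \<open>auto simp: limsD\<close>)

lemma lims_Suc: "lims X l ==> lims (%k. X (Suc k)) l"
 unfolding lims_def using LIMSEQ_Suc by fastforce

lemma lims_null_unique: assumes "lims X l" "lims X m" shows "p (l \<ominus> m) = 0"
proof -
 have "lims (%k. X k \<ominus> X k) (l \<ominus> m)" using lims_minus assms by blast
 then have "(%k. p (X k \<ominus> X k)) \<longlonglongrightarrow> p (l \<ominus> m)" by (rule lims_p)
 then show ?thesis using assms(1) by (simp add: limsD minus_eq r_neg LIMSEQ_const_iff)
qed

lemma lims_p_le: assumes "lims X l" "!!k. p (X k) <= c" shows "p l <= c"
 by (rule LIMSEQ_le_const2[OF lims_p[OF assms(1)]]) (use assms(2) in auto)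

end

lemma star_seminormI: "star_algebra A ==> cstar_seminorm A p ==> star_seminorm A p"
 by (simp add: star_seminorm_def star_seminorm_axioms_def)

sublocale cstar_algebra \<subseteq> nm: star_seminorm A "nrm A"
 by unfold_locales (rule nrm_cstar)

section \<open>Elementary C*-algebra theory\<close>

context cstar_algebra
begin

lemma lims_unique: "nm.lims X l ==> nm.lims X m ==> l = m"
 using nm.lims_null_unique[of X l m] nrm_definite[of "l \<ominus> m"]
 by (auto simp: nm.limsD minus_eq_zero_iff)

text \<open>Telescoping bounds the distance of \<open>X (k + m)\<close> and \<open>X k\<close> by an
  increment of the real sequence, which is Cauchy. A general majorant is allowed because that of the
  square root iteration does not converge geometrically.\<close>

lemma lims_dominated:
 assumes X: "!!k. X k \<in> carrier A" and r: "convergent r"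
  and le: "!!k. nrm A (X (Suc k) \<ominus> X k) <= r (Suc k) - r k"
 obtains l where "nm.lims X l"
proof -
 have inc: "nrm A (X (k + m) \<ominus> X k) <= r (k + m) - r k" for k m
 proof (induction m)
  case (Suc m)
  show ?case
   using nm.p_triangle[of "X (k + Suc m)" "X (k + m)" "X k"] Suc le[of "k + m"] X by simp
 qed (use X in simp)
 have "Cauchy r" using r Cauchy_convergent_iff by blast
 have "X \<in> cauchy_seqs A (nrm A)"
  unfolding cauchy_seqs_def
 proof (intro CollectI conjI allI impI)
  fix e :: real assume "e > 0"
  then obtain M where M: "!!m n. m \<ge> M ==> n \<ge> M ==> \<bar>r m - r n\<bar> < e"
   using \<open>Cauchy r\<close> unfolding Cauchy_def dist_real_def by blast
  have *: "nrm A (X m \<ominus> X k) < e" if "k \<ge> M" "m \<ge> k" for m k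
   using inc[of k "m - k"] M[of m k] that by simp
  show "\<exists>N. \<forall>k\<ge>N. \<forall>m\<ge>N. nrm A (X k \<ominus> X m) < e"
   using * nm.p_minus_commute X by (metis nle_le)
 qed (rule X)
 then show ?thesis
  using complete that X unfolding nm.lims_def by blast
qed

section \<open>Closed ideals, square roots and unitaries\<close>

definition closed_ideal :: "'a set => bool" where
 "closed_ideal I \<longleftrightarrow> ideal I A & (\<forall>x\<in>I. star A x \<in> I) & (\<forall>X l. (\<forall>k. X k \<in> I) --> nm.lims X l --> l \<in> I)"

lemma closed_idealD:
 assumes "closed_ideal I"
 shows "ideal I A" "x \<in> I ==> x \<in> carrier A" "x \<in> I ==> y \<in> I ==> x \<oplus> y \<in> I" "\<zero> \<in> I"
  "x \<in> I ==> y \<in> carrier A ==> x \<otimes> y \<in> I" "x \<in> I ==> y \<in> carrier A ==> y \<otimes> x \<in> I"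
  "x \<in> I ==> star A x \<in> I" "(!!k. X k \<in> I) ==> nm.lims X l ==> l \<in> I"
  "x \<in> I ==> scale A c x \<in> I" "x \<in> I ==> y \<in> I ==> x \<ominus> y \<in> I"
proof -
 show id: "ideal I A" using assms by (simp add: closed_ideal_def)
 interpret ideal I A by (rule id)
 show cl: "x \<in> I ==> x \<in> carrier A" for x using Icarr by blast
 show add: "x \<in> I ==> y \<in> I ==> x \<oplus> y \<in> I" for x y by simp
 show "\<zero> \<in> I" by simp
 show mr: "x \<in> I ==> y \<in> carrier A ==> x \<otimes> y \<in> I" for x y by (simp add: I_r_closed)
 show "x \<in> I ==> y \<in> carrier A ==> y \<otimes> x \<in> I" by (simp add: I_l_closed)
 show "x \<in> I ==> star A x \<in> I" using assms by (simp add: closed_ideal_def)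
 show "(!!k. X k \<in> I) ==> nm.lims X l ==> l \<in> I" using assms unfolding closed_ideal_def by blast
 \<comment> \<open>Ring ideals know no scalars; multiply by \<open>scale A c \<one>\<close>
   instead.\<close>
 show sc: "scale A c x \<in> I" if "x \<in> I" for c x
  using mr[OF that, of "scale A c \<one>"] cl[OF that] by (simp add: scale_mult_right)
 show "x \<in> I ==> y \<in> I ==> x \<ominus> y \<in> I"
  using add[OF _ sc[of y "-1"]] by (simp add: minus_conv cl)
qed

text \<open>The square root of \<open>1 - z\<close> is \<open>1 - y\<close>, where \<open>y\<close> is the limit of the iteration
 \<open>y := (z + y^2) / 2\<close>; the same scalar iteration with \<open>z = 1\<close> dominates the increments.\<close>

lemma sqrt_ex:
 assumes z: "z \<in> carrier A" "star A z = z" "nrm A z <= 1"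
 shows "\<exists>s. s \<in> carrier A & star A s = s & nrm A (\<one> \<ominus> s) <= 1 & s \<otimes> s = \<one> \<ominus> z &
  (\<forall>x\<in>carrier A. x \<otimes> z = z \<otimes> x --> x \<otimes> s = s \<otimes> x) &
  (\<forall>I. closed_ideal I --> z \<in> I --> \<one> \<ominus> s \<in> I)"
proof -
 define y where "y = rec_nat \<zero> (%_ v. scale A (1/2) (z \<oplus> v \<otimes> v))"
 define r where "r = rec_nat (0::real) (%_ v. (1 + v^2) / 2)"
 have y0: "y 0 = \<zero>" and ySuc: "y (Suc n) = scale A (1/2) (z \<oplus> y n \<otimes> y n)" for n
  by (simp_all add: y_def)
 have r0: "r 0 = 0" and rSuc: "r (Suc n) = (1 + (r n)^2) / 2" for n
  by (simp_all add: r_def)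
 have yc [simp]: "y n \<in> carrier A" for n
  by (induction n) (simp_all add: y0 ySuc z)
 have ys: "star A (y n) = y n" for n
  by (induction n) (simp_all add: y0 ySuc z star_ops)
 have r01: "0 <= r n & r n <= 1" for n
  by (induction n) (simp_all add: r0 rSuc power_le_one)
 have yr: "nrm A (y n) <= r n" for n
 proof (induction n)
  case (Suc n)
  have "nrm A (z \<oplus> y n \<otimes> y n) <= 1 + nrm A (y n) * nrm A (y n)"
   using nm.p_add[of z "y n \<otimes> y n"] nm.p_mult[of "y n" "y n"] z by simp
  also have "... <= 1 + r n * r n"
   using Suc by (intro add_left_mono mult_mono) (auto simp: r01)
  finally show ?case
   using z by (simp add: ySuc rSuc nm.p_scale power2_eq_square)
 qed (simp add: y0 r0)
 \<comment> \<open>The right side exceeds the left by half the square of r n - 1.\<close>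
 have rmono: "r n <= r (Suc n)" for n
  using sum_power2_ge_zero[of "r n - 1" 0] by (simp add: rSuc power2_eq_square algebra_simps)
 have inc: "nrm A (y (Suc n) \<ominus> y n) <= r (Suc n) - r n" for n
 proof (induction n)
  case 0
  then show ?case using yr[of "Suc 0"] by (simp add: y0 r0 minus_eq)
 next
  case (Suc n)
  let ?a = "y (Suc n)" and ?b = "y n"
  \<comment> \<open>The terms with z cancel, and a^2 - b^2 is written as a (a - b) + (a - b) b,
    which needs no commutativity. As \<open>r\<close> obeys the scalar form of the same recursion,
    the bound reproduces itself.\<close>
  have "y (Suc (Suc n)) \<ominus> y (Suc n) = scale A (1/2) ((z \<oplus> ?a \<otimes> ?a) \<ominus> (z \<oplus> ?b \<otimes> ?b))"
   using z by (simp add: ySuc[of "Suc n"] ySuc[of n] scale_minus)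
  also have "(z \<oplus> ?a \<otimes> ?a) \<ominus> (z \<oplus> ?b \<otimes> ?b) = ?a \<otimes> ?a \<ominus> ?b \<otimes> ?b"
   using z by (subst minus_swap4) auto
  also have "... = (?a \<otimes> ?a \<ominus> ?a \<otimes> ?b) \<oplus> (?a \<otimes> ?b \<ominus> ?b \<otimes> ?b)"
   by (rule minus_split) auto
  also have "... = ?a \<otimes> (?a \<ominus> ?b) \<oplus> (?a \<ominus> ?b) \<otimes> ?b"
   by (simp add: r_distr_minus l_distr_minus)
  finally have "nrm A (y (Suc (Suc n)) \<ominus> y (Suc n)) = 1/2 * nrm A (?a \<otimes> (?a \<ominus> ?b) \<oplus> (?a \<ominus> ?b) \<otimes> ?b)"
   by (simp add: nm.p_scale)
  also have "... <= 1/2 * (nrm A ?a * nrm A (?a \<ominus> ?b) + nrm A (?a \<ominus> ?b) * nrm A ?b)"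
   by (intro mult_left_mono order.trans[OF nm.p_add] add_mono nm.p_mult) auto
  also have "... <= 1/2 * (r (Suc n) * (r (Suc n) - r n) + (r (Suc n) - r n) * r n)"
   using yr Suc rmono r01 by (intro mult_left_mono add_mono mult_mono) auto
  also have "... = r (Suc (Suc n)) - r (Suc n)"
   by (simp add: rSuc[of "Suc n"] rSuc[of n] power2_eq_square algebra_simps add_divide_distrib diff_divide_distrib)
  finally show ?case .
 qed
 have "convergent r"
  by (rule Bseq_monoseq_convergent) (use r01 rmono in \<open>auto intro!: BseqI'[where K=1] simp: monoseq_Suc\<close>)
 then obtain l where l: "nm.lims y l"
  using lims_dominated[of y r] inc by auto
 note lc [simp] = nm.limsD(2)[OF l]
 have eq: "l = scale A (1/2) (z \<oplus> l \<otimes> l)"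
 proof (rule lims_unique)
  show "nm.lims (%k. y (Suc k)) l" using l by (rule nm.lims_Suc)
  show "nm.lims (%k. y (Suc k)) (scale A (1/2) (z \<oplus> l \<otimes> l))"
   unfolding ySuc using z l by (intro nm.lims_scale nm.lims_add nm.lims_const nm.lims_mult)
 qed
 have ls: "star A l = l"
  using lims_unique[OF nm.lims_star[OF l]] l by (simp add: ys)
 have ln: "nrm A l <= 1"
  by (rule nm.lims_p_le[OF l]) (use yr r01 order.trans in blast)
 have lcomm: "x \<otimes> l = l \<otimes> x" if x: "x \<in> carrier A" "x \<otimes> z = z \<otimes> x" for x
 proof -
  have *: "x \<otimes> y n = y n \<otimes> x" for n
  proof (induction n)
   case (Suc n)
   have "x \<otimes> (y n \<otimes> y n) = (x \<otimes> y n) \<otimes> y n" using x by (simp add: m_assoc)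
   also have "... = (y n \<otimes> y n) \<otimes> x" using x by (simp add: Suc m_assoc)
   finally show ?case
    using x z by (simp add: ySuc scale_mult_left scale_mult_right l_distr r_distr)
  qed (use x in \<open>simp add: y0\<close>)
  have 1: "nm.lims (%n. x \<otimes> y n) (x \<otimes> l)" and 2: "nm.lims (%n. y n \<otimes> x) (l \<otimes> x)"
   using l x by (auto intro!: nm.lims_mult nm.lims_const)
  show ?thesis by (rule lims_unique[OF 1]) (use 2 * in simp)
 qed
 \<comment> \<open>The clause on ideals is carried along for the approximate units, which need
   \<open>w \<ominus> \<one>\<close> in the ideal.\<close>
 have lI: "l \<in> I" if I: "closed_ideal I" "z \<in> I" for I
 proof (rule closed_idealD(8)[OF I(1) _ l])
  show "y n \<in> I" for n
   by (induction n) (use I in \<open>simp_all add: y0 ySuc closed_idealD(3,4,5,9)[OF I(1)]\<close>)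
 qed
 obtain B' where "coords4 (\<one>) (l) (z) \<zero> B'"
  using coords4_ex[OF one_closed lc z(1) zero_closed] by blast
 note B = coords4D(1-3,5-9)[OF this]
 have ll: "l \<otimes> l = scale A 2 l \<ominus> z"
 proof -
  have "scale A 2 l = z \<oplus> l \<otimes> l"
   using arg_cong[OF eq, of "scale A 2"] z by (simp add: scale_scale)
  then show ?thesis using z by (simp add: minus_eq a_ac r_neg1 r_neg2)
 qed
 have sq: "(\<one> \<ominus> l) \<otimes> (\<one> \<ominus> l) = \<one> \<ominus> z"
 proof -
  have "(\<one> \<ominus> l) \<otimes> (\<one> \<ominus> l) = \<one> \<ominus> l \<ominus> (l \<ominus> (scale A 2 l \<ominus> z))"
   by (simp add: r_distr_minus l_distr_minus ll)
  also have "... = \<one> \<ominus> z" by (simp add: B)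
  finally show ?thesis .
 qed
 have ml: "\<one> \<ominus> (\<one> \<ominus> l) = l" by (simp add: B)
 have cm: "x \<otimes> (\<one> \<ominus> l) = (\<one> \<ominus> l) \<otimes> x" if "x \<in> carrier A" "x \<otimes> z = z \<otimes> x" for x
  using that by (simp add: r_distr_minus l_distr_minus lcomm)
 show ?thesis
  by (rule exI[of _ "\<one> \<ominus> l"]) (simp add: star_minus ls ml ln sq lI cm)
qed

text \<open>A self-adjoint contraction is the imaginary part of the unitary w = s + i h, where s is
  the square root of 1 - h^2 and commutes with h. The formula for 1 - 2 h^2 is the double-angle
  formula cos 2t = 1 - 2 (sin t)^2. If h lies in a closed ideal, so does w - 1 = i h - (1 -
  s).\<close>

lemma unitary_ex:
 assumes h: "h \<in> carrier A" "star A h = h" "nrm A h <= 1"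
 shows "\<exists>w. w \<in> carrier A & star A w \<otimes> w = \<one> & w \<otimes> star A w = \<one> &
  h = scale A (- \<i> / 2) (w \<ominus> star A w) &
  \<one> \<ominus> scale A 2 (h \<otimes> h) = scale A (1/2) (w \<otimes> w \<oplus> star A w \<otimes> star A w) &
  (\<forall>I. closed_ideal I --> h \<in> I --> w \<ominus> \<one> \<in> I)"
proof -
 have hn: "nrm A (h \<otimes> h) <= 1"
  using nm.p_selfadjoint_square[of h] h by (simp add: power_le_one)
 have hh: "h \<otimes> h \<in> carrier A" "star A (h \<otimes> h) = h \<otimes> h" "nrm A (h \<otimes> h) <= 1"
  using h hn by (auto simp: star_mult)
 obtain s where s: "s \<in> carrier A" "star A s = s" "nrm A (\<one> \<ominus> s) <= 1" "s \<otimes> s = \<one> \<ominus> h \<otimes> h"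
  "!!x. x \<in> carrier A ==> x \<otimes> (h \<otimes> h) = (h \<otimes> h) \<otimes> x ==> x \<otimes> s = s \<otimes> x"
  "!!I. closed_ideal I ==> h \<otimes> h \<in> I ==> \<one> \<ominus> s \<in> I"
  using sqrt_ex[OF hh] by blast
 have hs: "h \<otimes> s = s \<otimes> h" using s(5)[of h] h by (simp add: m_assoc)
 obtain B' where "coords4 (\<one>) (h \<otimes> h) (s \<otimes> h) \<zero> B'"
  using coords4_ex[OF one_closed m_closed[OF h(1) h(1)] m_closed[OF s(1) h(1)] zero_closed] by blast
 note B = coords4D(1-3,5-9)[OF this]
 obtain D' where "coords4 (\<one>) (h) (s) \<zero> D'"
  using coords4_ex[OF one_closed h(1) s(1) zero_closed] by blast
 note D = coords4D(1-3,5-9)[OF this]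
 define w where "w = s \<oplus> scale A \<i> h"
 have wc [simp]: "w \<in> carrier A" using s(1) h(1) by (simp add: w_def)
 have ws: "star A w = s \<oplus> scale A (- \<i>) h" using s(1,2) h by (simp add: w_def star_add star_scale)
 note ex = l_distr r_distr scale_mult_left scale_mult_right scale_scale scale_add hs s(1,4) h(1)
 have p1: "star A w \<otimes> w = \<one>"
  by (simp add: ws) (simp add: w_def ex, simp add: B)
 have p2: "w \<otimes> star A w = \<one>"
  by (simp add: ws) (simp add: w_def ex, simp add: B)
 have p3: "h = scale A (- \<i> / 2) (w \<ominus> star A w)"
  unfolding ws unfolding w_def by (simp add: D)
 have p4: "\<one> \<ominus> scale A 2 (h \<otimes> h) = scale A (1/2) (w \<otimes> w \<oplus> star A w \<otimes> star A w)"
  unfolding ws unfolding w_def by (simp add: ex, simp add: B)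
 have p5: "w \<ominus> \<one> \<in> I" if I: "closed_ideal I" "h \<in> I" for I
 proof -
  have "w \<ominus> \<one> = scale A \<i> h \<ominus> (\<one> \<ominus> s)"
   by (simp only: w_def) (simp add: D)
  moreover have "h \<otimes> h \<in> I" using closed_idealD(5)[OF I(1) I(2) h(1)] .
  ultimately show ?thesis
   using closed_idealD(10)[OF I(1) closed_idealD(9)[OF I] s(6)[OF I(1)]] by simp
 qed
 show ?thesis using wc p1 p2 p3 p4 p5 by blast
qed

text \<open>\<open>h\<close> is, up to a factor of modulus 1/2, the difference of a unitary and its
  adjoint, and every C*-seminorm is at most one on unitaries. No continuity of \<open>q\<close>
  enters.\<close>

lemma seminorm_le_of_selfadjoint:
 assumes q: "cstar_seminorm A q" and h: "h \<in> carrier A" "star A h = h" "nrm A h <= 1"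
 shows "q h <= 1"
proof -
 interpret q: star_seminorm A q using q by unfold_locales
 obtain w where w: "w \<in> carrier A" "star A w \<otimes> w = \<one>" "w \<otimes> star A w = \<one>"
  "h = scale A (- \<i> / 2) (w \<ominus> star A w)"
  using unitary_ex[OF h] by blast
 show ?thesis
  using q.p_minus_le[of w "star A w"] q.p_isometry_le[of w] w
  by (subst w(4)) (simp add: q.p_scale norm_divide)
qed

text \<open>By the C*-identity it is enough to compare both sides on
  \<open>star A x \<otimes> x\<close>, which becomes a self-adjoint contraction after scaling.
  Applied to pulled back norms, this makes homomorphisms contractive.\<close>

lemma seminorm_le_nrm:
 assumes q: "cstar_seminorm A q" and x: "x \<in> carrier A"
 shows "q x <= nrm A x"
proof -
 interpret q: star_seminorm A q using q by unfold_locales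
 let ?h = "star A x \<otimes> x"
 have hc: "?h \<in> carrier A" "star A ?h = ?h" using x by (auto simp: star_mult)
 have "q ?h <= nrm A ?h"
 proof (cases "nrm A ?h = 0")
  case True
  then have "?h = \<zero>" using hc nrm_definite by blast
  then show ?thesis by simp
 next
  case False
  define c where "c = inverse (nrm A ?h)"
  have c: "c > 0" using False nm.p_nonneg[OF hc(1)] by (simp add: c_def less_le)
  have "q (scale A c ?h) <= 1"
   by (rule seminorm_le_of_selfadjoint[OF q])
    (use hc c False in \<open>simp_all add: star_scale nm.p_scale norm_inverse c_def\<close>)
  then show ?thesis using hc c False by (simp add: q.p_scale c_def norm_inverse) (simp add: field_simps)
 qed
 then have "(q x)^2 <= (nrm A x)^2" using x by (simp add: q.p_cstar nm.p_cstar)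
 then show ?thesis using x by (simp add: power2_le_iff_abs_le)
qed

text \<open>The norm form of 0 <= h^2 <= 1: the first element is the average of the squares of a
  unitary and of its adjoint, and the second is the average of the first and the unit.\<close>

lemma nrm_one_minus:
 assumes h: "h \<in> carrier A" "star A h = h" "nrm A h <= 1"
 shows "nrm A (\<one> \<ominus> scale A 2 (h \<otimes> h)) <= 1" "nrm A (\<one> \<ominus> h \<otimes> h) <= 1"
proof -
 obtain w where w: "w \<in> carrier A" "star A w \<otimes> w = \<one>" "w \<otimes> star A w = \<one>"
  "\<one> \<ominus> scale A 2 (h \<otimes> h) = scale A (1/2) (w \<otimes> w \<oplus> star A w \<otimes> star A w)"
  using unitary_ex[OF h] by blast
 have nw: "nrm A w <= 1" using nm.p_isometry_le w by blast
 have "nrm A (w \<otimes> w) <= 1 * 1" "nrm A (star A w \<otimes> star A w) <= 1 * 1"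
  by (intro order.trans[OF nm.p_mult] mult_mono; use w nw in simp)+
 then show 1: "nrm A (\<one> \<ominus> scale A 2 (h \<otimes> h)) <= 1"
  using nm.p_add[of "w \<otimes> w" "star A w \<otimes> star A w"] w(1) by (simp add: w(4) nm.p_scale)
 have "\<one> \<ominus> h \<otimes> h = scale A (1/2) (\<one> \<oplus> (\<one> \<ominus> scale A 2 (h \<otimes> h)))"
 proof -
  obtain B' where "coords4 (\<one>) (h \<otimes> h) \<zero> \<zero> B'"
   using coords4_ex[OF one_closed m_closed[OF h(1) h(1)] zero_closed zero_closed] by blast
  note B = coords4D(1,2,5-9)[OF this]
  show ?thesis by (simp add: B)
 qed
 then show "nrm A (\<one> \<ominus> h \<otimes> h) <= 1"
  using nm.p_add[of \<one> "\<one> \<ominus> scale A 2 (h \<otimes> h)"] 1 h nm.p_one_le by (simp add: nm.p_scale)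
qed

text \<open>After normalising \<open>k\<close>, the triangle inequality is saturated by \<open>e = 2k^2 - 1\<close>:
 \<open>e\<close> has norm at most one while \<open>1 + e\<close> has norm two.\<close>

lemma nrm_add_square:
 assumes k: "k \<in> carrier A" "star A k = k" and T: "0 <= T" and nt: "nrm A \<one> = 1"
 shows "T + (nrm A k)^2 <= nrm A (scale A (of_real T) \<one> \<oplus> k \<otimes> k)"
proof (cases "nrm A k = 0")
 case True
 then have "k = \<zero>" using k nrm_definite by blast
 then show ?thesis using T nt by (simp add: nm.p_scale)
next
 case False
 define n where "n = nrm A k"
 have n: "n > 0" using False nm.p_nonneg[OF k(1)] by (simp add: n_def less_le)
 define g where "g = scale A (inverse (of_real n)) k"
 have g: "g \<in> carrier A" "star A g = g" "nrm A g = 1"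
  using k n by (simp_all add: g_def star_scale nm.p_scale n_def[symmetric] norm_inverse)
 have nn: "n * n * (inverse n * inverse n) = 1" using n by (simp add: field_simps)
 have kk: "k \<otimes> k = scale A (of_real (n^2)) (g \<otimes> g)"
  using k n by (simp add: g_def scale_mult_left scale_mult_right scale_scale power2_eq_square
    nn flip: of_real_mult of_real_inverse)
 define t where "t = T / n^2"
 have t: "t \<ge> 0" using T by (simp add: t_def)
 define G where "G = g \<otimes> g"
 have G: "G \<in> carrier A" "nrm A G = 1"
  using nm.p_selfadjoint_square[of g] g by (auto simp: G_def)
 define e where "e = scale A 2 G \<ominus> \<one>"
 have ec: "e \<in> carrier A" using G by (simp add: e_def)
 have e1: "nrm A e <= 1"
  using nrm_one_minus(1)[OF g(1,2)] g G nm.p_minus_commute[of \<one> "scale A 2 G"] by (simp add: e_def G_def)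
 obtain B' where "coords4 (\<one>) (G) \<zero> \<zero> B'"
  using coords4_ex[OF one_closed G(1) zero_closed zero_closed] by blast
 note B = coords4D(1,2,5-9)[OF this]
 have lower: "1 + t <= nrm A (scale A (of_real t) \<one> \<oplus> G)"
 proof -
  let ?v = "scale A (of_real t) \<one> \<oplus> G"
  have vc: "?v \<in> carrier A" using G by simp
  \<comment> \<open>As \<open>G\<close> has norm one, the left side has norm 2 t + 1, of which the
    summand with \<open>e\<close> accounts for at most t.\<close>
  have "scale A (of_real (2 * t + 1)) G = ?v \<oplus> scale A (of_real t) e"
   by (simp only: e_def) (simp add: B algebra_simps)
  then have "(2 * t + 1) = nrm A (?v \<oplus> scale A (of_real t) e)"
   using G t nm.p_scale[of G "of_real (2 * t + 1)"] norm_of_real[of "2 * t + 1", where 'a = complex]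
   by (simp del: of_real_add of_real_mult norm_of_real)
  also have "... <= nrm A ?v + t * nrm A e"
   using nm.p_add[of ?v "scale A (of_real t) e"] ec vc t by (simp add: nm.p_scale)
  also have "... <= nrm A ?v + t" using e1 t by (simp add: mult_left_le)
  finally show ?thesis by simp
 qed
 have "scale A (of_real T) \<one> \<oplus> k \<otimes> k = scale A (of_real (n^2)) (scale A (of_real t) \<one> \<oplus> G)"
  using G n by (simp add: kk G_def[symmetric] scale_add scale_scale t_def power2_eq_square)
 then have "nrm A (scale A (of_real T) \<one> \<oplus> k \<otimes> k) = n^2 * nrm A (scale A (of_real t) \<one> \<oplus> G)"
  using G n by (simp add: nm.p_scale norm_power)
 also have "... \<ge> n^2 * (1 + t)" using lower by (simp add: mult_left_mono)
 also have "n^2 * (1 + t) = T + n^2" using n by (simp add: t_def field_simps)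
 finally show ?thesis by (simp add: n_def)
qed

end

section \<open>Positivity of the elements x* x\<close>

context cstar_algebra
begin

lemma nrm_pow_le: "x \<in> carrier A ==> nrm A x <= 1 ==> nrm A (x [^] (n::nat)) <= 1"
proof (induction n)
 case (Suc n)
 have "nrm A (x [^] Suc n) <= nrm A (x [^] n) * nrm A x" using Suc by (simp add: nm.p_mult)
 also have "... <= 1 * 1" using Suc by (intro mult_mono) auto
 finally show ?case by simp
qed (simp add: nm.p_one_le)

text \<open>A spectral radius argument: for self-adjoint \<open>e\<close> the C*-identity makes the
  norm of the power 2^m equal to the norm of \<open>e\<close> to the power 2^m, which outgrows any
  linear bound once that norm exceeds 1.\<close>

lemma nrm_le_one_of_powers:
 fixes K :: real
 assumes e: "e \<in> carrier A" "star A e = e" and K: "K \<ge> 0"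
  and le: "!!n. nrm A (e [^] (n::nat)) <= 1 + real n * K"
 shows "nrm A e <= 1"
proof (rule ccontr)
 assume "\<not> nrm A e <= 1"
 define d where "d = nrm A e - 1"
 have d: "d > 0" and ed: "nrm A e = 1 + d" using \<open>\<not> nrm A e <= 1\<close> by (auto simp: d_def)
 have st: "star A (e [^] n) = e [^] n" for n :: nat
  by (induction n) (use e in \<open>simp_all add: star_mult, simp add: nat_pow_comm[of e _ 1, simplified]\<close>)
 have pw: "nrm A (e [^] ((2::nat) ^ m)) = (1 + d) ^ (2 ^ m)" for m
 proof (induction m)
  case (Suc m)
  have "e [^] ((2::nat) ^ Suc m) = e [^] ((2::nat) ^ m) \<otimes> e [^] ((2::nat) ^ m)"
   using e by (simp add: nat_pow_mult mult_2)
  then have "nrm A (e [^] ((2::nat) ^ Suc m)) = (nrm A (e [^] ((2::nat) ^ m)))^2"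
   using e nm.p_selfadjoint_square[of "e [^] ((2::nat) ^ m)"] st by simp
  then show ?case using Suc by (simp add: power_mult[symmetric] mult.commute)
 qed (use e in \<open>simp add: ed\<close>)
 \<comment> \<open>With k = 2^m, Bernoulli gives only the linear bound 1 + k d, so its square is
   compared with the exponent 2 k: (1 + k d)^2 <= 1 + 2 k K. This forces k d^2 <= 1 + 2 K, which the
   choice of \<open>m\<close> violates.\<close>
 obtain m where m: "(1 + 2 * K) / d^2 < 2 ^ m"
  using real_arch_pow[of 2 "(1 + 2 * K) / d^2"] by auto
 define k where "k = (2::real) ^ m"
 have k1: "k \<ge> 1" by (simp add: k_def)
 have "1 + k * d <= (1 + d) ^ (2 ^ m)"
  using Bernoulli_inequality[of d "2 ^ m"] d by (simp add: k_def)
 then have "(1 + k * d)^2 <= ((1 + d) ^ (2 ^ m))^2"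
  using k1 d by (intro power_mono) auto
 also have "... = (1 + d) ^ (2 ^ Suc m)"
  by (simp add: power_mult[symmetric] mult.commute)
 also have "... <= 1 + 2 * k * K" using le[of "2 ^ Suc m"] pw[of "Suc m"] by (simp add: k_def)
 finally have "(1 + k * d)^2 <= 1 + 2 * k * K" .
 moreover have "(1 + k * d)^2 \<ge> (k * d)^2" using k1 d by (intro power_mono) auto
 ultimately have "k * (k * d^2) <= 1 + 2 * k * K" by (simp add: power2_eq_square algebra_simps)
 also have "... <= k * (1 + 2 * K)" using k1 K by (simp add: algebra_simps)
 finally have "k * d^2 <= 1 + 2 * K" using k1 by simp
 moreover have "1 + 2 * K < k * d^2" using m d by (simp add: k_def field_simps)
 ultimately show False by simp
qed

text \<open>Stands in for the fact that the two products of \<open>y\<close> and its adjoint have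
  the same nonzero spectrum. With \<open>d\<close> and \<open>e\<close> the two sums, y d^n = e^n y,
  so e^(n+1) is e^n plus y d^n times the adjoint of y. The powers of \<open>e\<close> thus grow at
  most linearly.\<close>

lemma nrm_one_plus_swap:
 assumes y: "y \<in> carrier A" and le: "nrm A (\<one> \<oplus> star A y \<otimes> y) <= 1"
 shows "nrm A (\<one> \<oplus> y \<otimes> star A y) <= 1"
proof -
 define e where "e = \<one> \<oplus> y \<otimes> star A y"
 define d where "d = \<one> \<oplus> star A y \<otimes> y"
 have c [simp]: "e \<in> carrier A" "d \<in> carrier A" "star A e = e"
  using y by (auto simp: e_def d_def star_ops)
 have yd: "y \<otimes> d = e \<otimes> y" using y by (simp add: e_def d_def r_distr l_distr m_assoc)
 have ydn: "y \<otimes> d [^] n = e [^] n \<otimes> y" for n :: nat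
 proof (induction n)
  case (Suc n)
  have "y \<otimes> d [^] Suc n = (y \<otimes> d [^] n) \<otimes> d" using y by (simp add: m_assoc)
  also have "... = e [^] n \<otimes> (y \<otimes> d)" using y by (simp add: Suc m_assoc)
  also have "... = e [^] Suc n \<otimes> y" using y by (simp add: yd m_assoc)
  finally show ?case .
 qed (use y in simp)
 show ?thesis
  unfolding e_def[symmetric]
 proof (rule nrm_le_one_of_powers[where K = "(nrm A y)^2"])
  show "nrm A (e [^] n) <= 1 + real n * (nrm A y)^2" for n :: nat
  proof (induction n)
   case (Suc n)
   have "e [^] Suc n = e [^] n \<oplus> (e [^] n \<otimes> y) \<otimes> star A y"
    using y c by (simp add: r_distr m_assoc) (simp add: e_def r_distr m_assoc)
   also have "... = e [^] n \<oplus> (y \<otimes> d [^] n) \<otimes> star A y" by (simp add: ydn)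
   finally have "nrm A (e [^] Suc n) <= nrm A (e [^] n) + nrm A ((y \<otimes> d [^] n) \<otimes> star A y)"
    using nm.p_add[of "e [^] n" "(y \<otimes> d [^] n) \<otimes> star A y"] y by simp
   also have "nrm A ((y \<otimes> d [^] n) \<otimes> star A y) <= nrm A (y \<otimes> d [^] n) * nrm A y"
    using nm.p_mult[of "y \<otimes> d [^] n" "star A y"] y by simp
   also have "... <= (nrm A y * 1) * nrm A y"
    using nm.p_mult[of y "d [^] n"] nrm_pow_le[of d n] le y
    by (intro mult_right_mono order.trans[OF nm.p_mult] mult_left_mono) (auto simp: d_def)
   finally show ?case using Suc by (simp add: power2_eq_square algebra_simps)
  qed (simp add: nm.p_one_le)
 qed simp_all
qed

lemma eq_zero_of_nrm: "x \<in> carrier A ==> nrm A x <= 0 ==> x = \<zero>"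
 using nrm_definite nm.p_nonneg by fastforce

lemma nrm_trivial: "nrm A \<one> = 0 ==> x \<in> carrier A ==> nrm A x = 0"
 using nm.p_mult[of \<one> x] nm.p_nonneg[of x] by (auto intro: antisym)

lemma selfadjoint_sq_zero: "f \<in> carrier A ==> star A f = f ==> f \<otimes> f = \<zero> ==> f = \<zero>"
 using nm.p_selfadjoint_square[of f] eq_zero_of_nrm[of f] by simp

text \<open>An element of the form \<open>y* y\<close> that is minus a square vanishes: its swapped version
 \<open>y y*\<close> is also negative, but the sum of the two is twice a sum of two squares.\<close>

lemma star_mult_neg_square:
 assumes y: "y \<in> carrier A" and c: "c \<in> carrier A" "star A c = c"
  and eq: "star A y \<otimes> y = \<ominus> (c \<otimes> c)" and ny: "nrm A y <= 1" and nc: "nrm A c <= 1"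
 shows "c = \<zero>"
proof -
 \<comment> \<open>\<open>a\<close> and \<open>b\<close> are the real and imaginary parts of
   \<open>y\<close>; twice the sum of their squares is
   \<open>star A y \<otimes> y \<oplus> y \<otimes> star A y\<close>.\<close>
 define a where "a = scale A (1/2) (y \<oplus> star A y)"
 define b where "b = scale A (- \<i> / 2) (y \<ominus> star A y)"
 have ab [simp]: "a \<in> carrier A" "b \<in> carrier A" using y by (auto simp: a_def b_def)
 have sa: "star A a = a" using y by (simp add: a_def star_ops a_comm)
 have swap: "scale A (\<i> / 2) (v \<ominus> u) = scale A (- \<i> / 2) (u \<ominus> v)" if "u \<in> carrier A" "v \<in> carrier A" for u v
 proof -
  obtain D' where "coords4 u v \<zero> \<zero> D'" using coords4_ex[of "u" "v" "\<zero>" "\<zero>"] \<open>u \<in> carrier A\<close> \<open>v \<in> carrier A\<close> by auto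
  note D = coords4D(1,2,5-9)[OF this]
  show ?thesis by (simp add: D)
 qed
 have sb: "star A b = b"
 proof -
  have "star A b = scale A (\<i> / 2) (star A y \<ominus> y)" using y by (simp add: b_def star_minus star_scale)
  also have "... = b" unfolding b_def using y by (intro swap) auto
  finally show ?thesis .
 qed
 have na: "nrm A a <= 1" "nrm A b <= 1"
  using nm.p_add[of y "star A y"] nm.p_minus_le[of y "star A y"] y ny
  by (simp_all add: a_def b_def nm.p_scale norm_divide)
 obtain E' where "coords4 (y \<otimes> y) (star A y \<otimes> y) (y \<otimes> star A y) (star A y \<otimes> star A y) E'"
  using coords4_ex[of "(y \<otimes> y)" "(star A y \<otimes> y)" "(y \<otimes> star A y)" "(star A y \<otimes> star A y)"] y by auto
 note E = coords4D[OF this]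
 have "scale A 2 (a \<otimes> a \<oplus> b \<otimes> b) = star A y \<otimes> y \<oplus> y \<otimes> star A y"
  unfolding a_def b_def using y
  by (simp add: l_distr r_distr scale_mult_left scale_mult_right scale_scale scale_add
    l_distr_minus r_distr_minus scale_minus) (simp add: E)
 then have ab2: "scale A 2 (a \<otimes> a) \<oplus> scale A 2 (b \<otimes> b) = y \<otimes> star A y \<ominus> c \<otimes> c"
  using y c by (simp add: scale_add eq minus_eq a_comm)
 \<comment> \<open>By hypothesis \<open>\<one> \<oplus> star A y \<otimes> y\<close> is 1 - c^2,
   hence a contraction, and the swap lemma passes to the other product.\<close>
 have nyy: "nrm A (\<one> \<oplus> y \<otimes> star A y) <= 1"
  by (rule nrm_one_plus_swap) (use y c eq nrm_one_minus(2)[OF c nc] in \<open>auto simp: minus_eq\<close>)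
 obtain B' where "coords4 \<one> (a \<otimes> a) (b \<otimes> b) (c \<otimes> c) B'" using coords4_ex[of "\<one>" "(a \<otimes> a)" "(b \<otimes> b)" "(c \<otimes> c)"] c by auto
 note B = coords4D[OF this]
 have yy: "y \<otimes> star A y = scale A 2 (a \<otimes> a) \<oplus> scale A 2 (b \<otimes> b) \<oplus> c \<otimes> c"
  unfolding ab2 using y c by (simp add: minus_eq a_assoc l_neg)
 \<comment> \<open>The constant is 1 + 2 + 2, the total of the bounds for the three groups on the
   right. By \<open>nrm_add_square\<close> the left side has norm at least 5 plus the square of the
   norm of \<open>c\<close>, so \<open>c\<close> is 0.\<close>
 have "scale A (of_real 5) \<one> \<oplus> c \<otimes> c =
   (\<one> \<oplus> y \<otimes> star A y) \<oplus> (scale A 2 (\<one> \<ominus> a \<otimes> a) \<oplus> scale A 2 (\<one> \<ominus> b \<otimes> b))"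
  unfolding yy by (simp add: B)
 also have "nrm A ... <= 1 + (2 * 1 + 2 * 1)"
  using y nyy nrm_one_minus(2)[OF ab(1) sa na(1)] nrm_one_minus(2)[OF ab(2) sb na(2)]
   nm.p_add[of "\<one> \<oplus> y \<otimes> star A y" "scale A 2 (\<one> \<ominus> a \<otimes> a) \<oplus> scale A 2 (\<one> \<ominus> b \<otimes> b)"]
   nm.p_add[of "scale A 2 (\<one> \<ominus> a \<otimes> a)" "scale A 2 (\<one> \<ominus> b \<otimes> b)"]
  by (simp add: nm.p_scale)
 finally have *: "nrm A (scale A (of_real 5) \<one> \<oplus> c \<otimes> c) <= 5" by simp
 have "nrm A c = 0"
 proof (cases "nrm A \<one> = 1")
  case True
  have "5 + (nrm A c)^2 <= 5"
   by (rule order.trans[OF nrm_add_square[OF c _ True] *]) simp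
  then show ?thesis by simp
 next
  case False
  then show ?thesis using nm.p_one_cases nrm_trivial c by blast
 qed
 then show ?thesis using c eq_zero_of_nrm by simp
qed

text \<open>With \<open>h = x* x\<close>, \<open>s = |h|\<close> and \<open>f = s - h\<close> (twice the negative part of \<open>h\<close>), the
 element \<open>y = x f\<close> satisfies \<open>y* y = f h f = - s f^2\<close>.\<close>

lemma star_mult_square_normalized:
 assumes x: "x \<in> carrier A" and nx: "nrm A x <= 1"
 shows "\<exists>r\<in>carrier A. star A r = r & star A x \<otimes> x = r \<otimes> r"
proof -
 define h where "h = star A x \<otimes> x"
 have h [simp]: "h \<in> carrier A" "star A h = h" using x by (auto simp: h_def star_mult)
 have nh: "nrm A h <= 1" using nm.p_cstar[OF x] nx x by (simp add: h_def power_le_one)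
 define z where "z = \<one> \<ominus> h \<otimes> h"
 have z: "z \<in> carrier A" "star A z = z" "nrm A z <= 1"
  using nrm_one_minus(2)[OF h nh] by (auto simp: z_def star_minus star_mult)
 \<comment> \<open>\<open>s\<close> plays the role of the absolute value of \<open>h\<close>: its
   square is h^2, and the bound on 1 - s lets \<open>sqrt_ex\<close> produce a root \<open>r\<close>
   of \<open>s\<close> as well.\<close>
 obtain s where s: "s \<in> carrier A" "star A s = s" "nrm A (\<one> \<ominus> s) <= 1" "s \<otimes> s = \<one> \<ominus> z"
  and scomm: "!!x. x \<in> carrier A ==> x \<otimes> z = z \<otimes> x ==> x \<otimes> s = s \<otimes> x"
  using sqrt_ex[OF z] by blast
 have s1: "\<one> \<ominus> s \<in> carrier A" "star A (\<one> \<ominus> s) = \<one> \<ominus> s" using s(1,2) by (auto simp: star_minus)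
 obtain r where r: "r \<in> carrier A" "star A r = r" "r \<otimes> r = \<one> \<ominus> (\<one> \<ominus> s)"
  and rcomm: "!!x. x \<in> carrier A ==> x \<otimes> (\<one> \<ominus> s) = (\<one> \<ominus> s) \<otimes> x ==> x \<otimes> r = r \<otimes> x"
  using sqrt_ex[OF s1 s(3)] by blast
 have mm: "\<one> \<ominus> (\<one> \<ominus> v) = v" if "v \<in> carrier A" for v
 proof -
  obtain B' where "coords4 \<one> v \<zero> \<zero> B'" using coords4_ex[of "\<one>" "v" "\<zero>" "\<zero>"] \<open>v \<in> carrier A\<close> by auto
  note B = coords4D(1,2,5-9)[OF this]
  show ?thesis by (simp add: B)
 qed
 have ss: "s \<otimes> s = h \<otimes> h" using s(4) by (simp add: z_def mm)
 have rr: "r \<otimes> r = s" using r(3) s(1) by (simp add: mm)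
 have hs: "h \<otimes> s = s \<otimes> h"
  by (rule scomm) (simp_all add: z_def r_distr_minus l_distr_minus m_assoc)
 have hr: "h \<otimes> r = r \<otimes> h"
  by (rule rcomm) (use s(1) in \<open>simp_all add: r_distr_minus l_distr_minus hs\<close>)
 have sr: "s \<otimes> r = r \<otimes> s"
  by (rule rcomm) (use s(1) in \<open>simp_all add: r_distr_minus l_distr_minus\<close>)
 define f where "f = s \<ominus> h"
 have f [simp]: "f \<in> carrier A" "star A f = f" using s(1,2) by (auto simp: f_def star_minus)
 have fs: "f \<otimes> s = s \<otimes> f" "f \<otimes> r = r \<otimes> f"
  using s(1) r(1) by (simp_all add: f_def r_distr_minus l_distr_minus hs hr sr)
 have hf: "h \<otimes> f = \<ominus> (s \<otimes> f)"
 proof -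
  have "h \<otimes> f = h \<otimes> s \<ominus> h \<otimes> h" using s(1) by (simp add: f_def r_distr_minus)
  also have "... = \<ominus> (h \<otimes> h \<ominus> h \<otimes> s)" using s(1) by (simp add: minus_eq minus_add a_comm)
  also have "h \<otimes> h \<ominus> h \<otimes> s = s \<otimes> f" using s(1) by (simp add: f_def r_distr_minus ss hs)
  finally show ?thesis .
 qed
 define c where "c = r \<otimes> f"
 have c [simp]: "c \<in> carrier A" "star A c = c"
  using r(1,2) by (auto simp: c_def star_mult fs)
 have cc: "c \<otimes> c = s \<otimes> (f \<otimes> f)"
 proof -
  have "c \<otimes> c = r \<otimes> (f \<otimes> r) \<otimes> f" using r(1) by (simp add: c_def m_assoc)
  also have "... = (r \<otimes> r) \<otimes> (f \<otimes> f)" unfolding fs using r(1) by (simp add: m_assoc)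
  finally show ?thesis by (simp add: rr)
 qed
 define y where "y = x \<otimes> f"
 have y [simp]: "y \<in> carrier A" using x by (simp add: y_def)
 have yy: "star A y \<otimes> y = \<ominus> (c \<otimes> c)"
 proof -
  have "star A y \<otimes> y = f \<otimes> (h \<otimes> f)" using x by (simp add: y_def star_mult h_def m_assoc)
  also have "... = \<ominus> (f \<otimes> s \<otimes> f)" using s(1) by (simp add: hf r_minus m_assoc)
  also have "... = \<ominus> (c \<otimes> c)" using s(1) by (simp add: fs cc m_assoc)
  finally show ?thesis .
 qed
 \<comment> \<open>\<open>star_mult_neg_square\<close> is stated for contractions, so
   \<open>y\<close> and \<open>c\<close> are scaled by a common positive factor.\<close>
 define m where "m = inverse (1 + nrm A y + nrm A c)"
 have pos: "1 + nrm A y + nrm A c > 0" using nm.p_nonneg[OF y] nm.p_nonneg[OF c(1)] by linarith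
 have m: "m > 0" "m * nrm A y <= 1" "m * nrm A c <= 1"
  using pos nm.p_nonneg[OF y] nm.p_nonneg[OF c(1)]
  by (simp_all add: m_def inverse_eq_divide pos_divide_le_eq del: nm.p_nonneg)
 have "scale A (of_real m) c = \<zero>"
 proof (rule star_mult_neg_square[of "scale A (of_real m) y"])
  show "star A (scale A (of_real m) y) \<otimes> scale A (of_real m) y = \<ominus> (scale A (of_real m) c \<otimes> scale A (of_real m) c)"
   using yy by (simp add: star_scale scale_mult_left scale_mult_right scale_scale)
    (simp add: scale_minus_one scale_scale)
 qed (use m in \<open>auto simp: star_scale nm.p_scale\<close>)
 then have "c = \<zero>" using m(1) nm.p_scale[of c "of_real m"] eq_zero_of_nrm[of c] by simp
 then have sff: "s \<otimes> (f \<otimes> f) = \<zero>" using cc by simp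
 \<comment> \<open>Since s^2 = h^2, both sides are 2 (h^2 - s h). Hence f^4 = 2 (s f^2) f = 0, and a
   self-adjoint element with square 0 vanishes; applied twice this gives f = 0, that is s =
   h.\<close>
 have ff: "f \<otimes> f = scale A 2 (s \<otimes> f)"
 proof -
  obtain B' where "coords4 (s \<otimes> h) (h \<otimes> h) \<zero> \<zero> B'" using coords4_ex[of "(s \<otimes> h)" "(h \<otimes> h)" "\<zero>" "\<zero>"] s(1) by auto
  note B = coords4D(1,2,5-9)[OF this]
  show ?thesis using s(1) by (simp add: f_def r_distr_minus l_distr_minus hs ss) (simp add: B)
 qed
 have "(f \<otimes> f) \<otimes> (f \<otimes> f) = scale A 2 ((s \<otimes> (f \<otimes> f)) \<otimes> f)"
  using s(1) by (subst (1) ff) (simp add: scale_mult_left m_assoc)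
 then have "(f \<otimes> f) \<otimes> (f \<otimes> f) = \<zero>" by (simp add: sff)
 then have "f \<otimes> f = \<zero>" by (rule selfadjoint_sq_zero[rotated 2]) (auto simp: star_mult)
 then have "f = \<zero>" by (rule selfadjoint_sq_zero[rotated 2]) auto
 then have "s = h" using s(1) by (simp add: f_def minus_eq_zero_iff)
 then show ?thesis using r(1,2) rr unfolding h_def by (intro bexI[of _ r] conjI) simp_all
qed

text \<open>Removes the normalisation. The divisor exceeds the norm by one, so that x = 0 is no
  special case.\<close>

lemma star_mult_square:
 assumes x: "x \<in> carrier A"
 shows "\<exists>r\<in>carrier A. star A r = r & star A x \<otimes> x = r \<otimes> r"
proof -
 define m where "m = 1 + nrm A x"
 have m: "m > 0" "nrm A x <= m" using nm.p_nonneg[OF x] by (auto simp: m_def)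
 define y where "y = scale A (of_real (inverse m)) x"
 have y: "y \<in> carrier A" "nrm A y <= 1" and xy: "x = scale A (of_real m) y"
  using x m by (auto simp: y_def nm.p_scale scale_scale norm_divide inverse_eq_divide pos_divide_le_eq)
 obtain r where r: "r \<in> carrier A" "star A r = r" "star A y \<otimes> y = r \<otimes> r"
  using star_mult_square_normalized[OF y] by blast
 have "star A x \<otimes> x = scale A (of_real m) r \<otimes> scale A (of_real m) r"
  using y r by (simp add: xy star_scale scale_mult_left scale_mult_right scale_scale)
 then show ?thesis using r by (intro bexI[of _ "scale A (of_real m) r"]) (auto simp: star_scale)
qed

text \<open>The inequality nrm (T - a) <= T for some T is the norm form of a >= 0. Unlike being a
  square, it is visibly stable under sums.\<close>

lemma positive_bound:
 assumes x: "x \<in> carrier A"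
 shows "\<exists>T\<ge>0. nrm A (scale A (of_real T) \<one> \<ominus> star A x \<otimes> x) <= T"
proof -
 obtain r where r: "r \<in> carrier A" "star A r = r" "star A x \<otimes> x = r \<otimes> r"
  using star_mult_square[OF x] by blast
 define m where "m = 1 + nrm A r"
 have m: "m > 0" "nrm A r <= m" using nm.p_nonneg[OF r(1)] by (auto simp: m_def)
 define y where "y = scale A (of_real (inverse m)) r"
 have y: "y \<in> carrier A" "star A y = y" "nrm A y <= 1" and ry: "r = scale A (of_real m) y"
  using r m by (auto simp: y_def nm.p_scale star_scale scale_scale norm_divide inverse_eq_divide pos_divide_le_eq)
 have "scale A (of_real (m^2)) \<one> \<ominus> star A x \<otimes> x = scale A (of_real (m^2)) (\<one> \<ominus> y \<otimes> y)"
  using y by (simp add: r(3) ry scale_mult_left scale_mult_right scale_scale scale_minus power2_eq_square)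
 then have "nrm A (scale A (of_real (m^2)) \<one> \<ominus> star A x \<otimes> x) <= m^2"
  using nrm_one_minus(2)[OF y] y m by (simp add: nm.p_scale norm_power mult_left_le)
 then show ?thesis by (intro exI[of _ "m^2"]) auto
qed

lemma positive_sum_bound:
 assumes "finite K" and x: "!!k. k \<in> K ==> x k \<in> carrier A"
 shows "\<exists>T\<ge>0. nrm A (scale A (of_real T) \<one> \<ominus> (\<Oplus>k\<in>K. star A (x k) \<otimes> x k)) <= T"
 using assms
proof (induction K rule: finite_induct)
 case (insert k K)
 obtain T where T: "T \<ge> 0" "nrm A (scale A (of_real T) \<one> \<ominus> (\<Oplus>k\<in>K. star A (x k) \<otimes> x k)) <= T"
  using insert by auto
 obtain S where S: "S \<ge> 0" "nrm A (scale A (of_real S) \<one> \<ominus> star A (x k) \<otimes> x k) <= S"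
  using positive_bound[of "x k"] insert by auto
 let ?a = "star A (x k) \<otimes> x k" and ?b = "\<Oplus>k\<in>K. star A (x k) \<otimes> x k"
 have c: "?a \<in> carrier A" "?b \<in> carrier A" using insert by (auto intro!: finsum_closed)
 have "(\<Oplus>j\<in>insert k K. star A (x j) \<otimes> x j) = ?a \<oplus> ?b"
  using insert by (intro finsum_insert) auto
 moreover have "scale A (of_real (S + T)) \<one> \<ominus> (?a \<oplus> ?b) = (scale A (of_real S) \<one> \<ominus> ?a) \<oplus> (scale A (of_real T) \<one> \<ominus> ?b)"
  using c by (simp add: add_scale minus_swap4)
 ultimately have "nrm A (scale A (of_real (S + T)) \<one> \<ominus> (\<Oplus>j\<in>insert k K. star A (x j) \<otimes> x j)) <= S + T"
  using nm.p_add[of "scale A (of_real S) \<one> \<ominus> ?a" "scale A (of_real T) \<one> \<ominus> ?b"] c S T by simp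
 then show ?case using S T by (intro exI[of _ "S + T"]) simp
qed (auto intro!: exI[of _ 0])

text \<open>Let a be the summand of \<open>j\<close> and b the sum of the others, so a + b = 1.
  Positivity of b bounds T + a = (T - b) + 1 by T + 1 in norm, while \<open>nrm_add_square\<close>
  bounds it below by T plus the norm of a. This is what bounds the coordinates of a unitary
  matrix.\<close>

lemma nrm_le_one_of_sum:
 assumes K: "finite K" "j \<in> K" and x: "!!k. k \<in> K ==> x k \<in> carrier A"
  and sum: "(\<Oplus>k\<in>K. star A (x k) \<otimes> x k) = \<one>"
 shows "nrm A (x j) <= 1"
proof (cases "nrm A \<one> = 1")
 case False
 then show ?thesis using nm.p_one_cases nrm_trivial x K by fastforce
next
 case True
 let ?a = "star A (x j) \<otimes> x j" and ?b = "\<Oplus>k\<in>K - {j}. star A (x k) \<otimes> x k"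
 have c: "?a \<in> carrier A" "?b \<in> carrier A" using K x by (auto intro!: finsum_closed)
 have "(\<Oplus>k\<in>insert j (K - {j}). star A (x k) \<otimes> x k) = ?a \<oplus> ?b"
  using K x by (intro finsum_insert) auto
 then have ab: "?a \<oplus> ?b = \<one>" using K sum by (simp add: insert_absorb)
 obtain T where T: "T \<ge> 0" "nrm A (scale A (of_real T) \<one> \<ominus> ?b) <= T"
  using positive_sum_bound[of "K - {j}" x] K x by auto
 obtain r where r: "r \<in> carrier A" "star A r = r" "?a = r \<otimes> r"
  using star_mult_square[of "x j"] x K by blast
 obtain B' where "coords4 ?a ?b \<zero> \<zero> B'" using coords4_ex[of "?a" "?b" "\<zero>" "\<zero>"] c by auto
 note B = coords4D(1,2,5-9)[OF this]
 have "scale A (of_real T) \<one> \<oplus> ?a = (scale A (of_real T) \<one> \<ominus> ?b) \<oplus> \<one>"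
  unfolding ab[symmetric] by (simp add: B)
 then have "nrm A (scale A (of_real T) \<one> \<oplus> r \<otimes> r) <= T + 1"
  using nm.p_add[of "scale A (of_real T) \<one> \<ominus> ?b" \<one>] c T True by (simp add: r(3))
 then have "(nrm A r)^2 <= 1" using nrm_add_square[OF r(1,2) T(1) True] by simp
 moreover have "(nrm A (x j))^2 = (nrm A r)^2"
  using nm.p_cstar[of "x j"] nm.p_selfadjoint_square[OF r(1,2)] x K r(3) by simp
 ultimately have "(nrm A (x j))^2 <= 1^2" by simp
 then show ?thesis by (rule power2_le_imp_le) simp
qed

end

section \<open>Quotients and completions\<close>

text \<open>Applied to the coset map and to the class map on Cauchy sequences, so that the axioms
  for quotients and completions are inherited.\<close>

lemma star_algebra_image:
 fixes X :: "('a, 'm) star_alg_scheme" and Y :: "('b, 'k) star_alg_scheme" (structure)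
 assumes X: "star_algebra X" and im: "f ` carrier X = carrier Y"
  and add: "!!x y. x \<in> carrier X ==> y \<in> carrier X ==> f (x \<oplus>\<^bsub>X\<^esub> y) = f x \<oplus> f y"
  and mult: "!!x y. x \<in> carrier X ==> y \<in> carrier X ==> f (x \<otimes>\<^bsub>X\<^esub> y) = f x \<otimes> f y"
  and one: "f \<one>\<^bsub>X\<^esub> = \<one>" and zero: "f \<zero>\<^bsub>X\<^esub> = \<zero>"
  and scale: "!!c x. x \<in> carrier X ==> f (scale X c x) = scale Y c (f x)"
  and star: "!!x. x \<in> carrier X ==> f (star X x) = star Y (f x)"
 shows "star_algebra Y"
proof -
 interpret X: star_algebra X by fact
 note rew = add[symmetric] mult[symmetric] one[symmetric] zero[symmetric] scale[symmetric] star[symmetric]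
 have neg: "f (\<ominus>\<^bsub>X\<^esub> v) \<oplus> f v = \<zero>" if "v \<in> carrier X" for v
  using add[of "\<ominus>\<^bsub>X\<^esub> v" v] that by (simp add: X.l_neg zero)
 have ab: "abelian_group Y"
 proof (rule abelian_groupI; (unfold im[symmetric])?)
  show "\<exists>y\<in>f ` carrier X. y \<oplus> x = \<zero>" if "x \<in> f ` carrier X" for x
   using that neg by (metis X.add.inv_closed imageE imageI)
 qed ((elim imageE)?; simp add: rew X.a_ac)+
 have mo: "monoid Y"
  by (rule monoidI; unfold im[symmetric]; (elim imageE)?) (simp_all add: rew X.m_assoc)
 have ri: "ring Y"
  by (rule ringI[OF ab mo]; unfold im[symmetric]; elim imageE)
   (simp_all add: rew X.l_distr X.r_distr)
 show ?thesis
  by (intro star_algebra.intro ri star_algebra_axioms.intro; unfold im[symmetric]; elim imageE)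
   (simp_all add: rew X.star_ops X.add_scale)
qed

section \<open>Completeness tested on geometrically convergent sequences\<close>

context star_seminorm
begin

lemma cauchy_dominated:
 assumes X: "!!k. X k \<in> carrier A" and r: "convergent r"
  and le: "!!k. p (X (Suc k) \<ominus> X k) <= r (Suc k) - r k"
 shows "X \<in> cauchy_seqs A p" "k <= m ==> p (X m \<ominus> X k) <= r m - r k"
proof -
 have inc: "p (X (k + m) \<ominus> X k) <= r (k + m) - r k" for k m
 proof (induction m)
  case (Suc m)
  show ?case
   using p_triangle[of "X (k + Suc m)" "X (k + m)" "X k"] Suc le[of "k + m"] X by simp
 qed (use X in simp)
 show "p (X m \<ominus> X k) <= r m - r k" if "k <= m" for k m
  using inc[of k "m - k"] that by simp
 have "Cauchy r" using r Cauchy_convergent_iff by blast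
 show "X \<in> cauchy_seqs A p"
  unfolding cauchy_seqs_def
 proof (intro CollectI conjI allI impI)
  fix e :: real assume "e > 0"
  then obtain M where M: "!!m n. m \<ge> M ==> n \<ge> M ==> \<bar>r m - r n\<bar> < e"
   using \<open>Cauchy r\<close> unfolding Cauchy_def dist_real_def by blast
  have *: "p (X m \<ominus> X k) < e" if "k \<ge> M" "m \<ge> k" for m k
   using inc[of k "m - k"] M[of m k] that by simp
  show "\<exists>N. \<forall>k\<ge>N. \<forall>m\<ge>N. p (X k \<ominus> X m) < e"
   using * p_minus_commute X by (metis nle_le)
 qed (rule X)
qed

lemma convergent_geometric: "convergent (%k. c - 2 * c * (1/2)^k :: real)"
proof -
 have "(%k. c - 2 * c * (1/2)^k) \<longlonglongrightarrow> c - 2 * c * 0"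
  by (intro tendsto_intros LIMSEQ_power_zero) auto
 then show ?thesis unfolding convergent_def by blast
qed

lemma cauchy_geometric:
 assumes X: "!!k. X k \<in> carrier A" and le: "!!k. p (X (Suc k) \<ominus> X k) <= c * (1/2)^k"
 shows "X \<in> cauchy_seqs A p" "k <= m ==> p (X m \<ominus> X k) <= 2 * c * (1/2)^k"
proof -
 have le': "p (X (Suc k) \<ominus> X k) <= (c - 2 * c * (1/2)^(Suc k)) - (c - 2 * c * (1/2)^k)" for k
  using le[of k] by simp
 show "X \<in> cauchy_seqs A p"
  by (rule cauchy_dominated(1)[OF X convergent_geometric le'])
 have "0 <= p (X (Suc 0) \<ominus> X 0)" using X by simp
 then have c: "c \<ge> 0" using le[of 0] by simp
 then have "0 <= 2 * c * (1/2)^m" by simp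
 then show "p (X m \<ominus> X k) <= 2 * c * (1/2)^k" if "k <= m"
  using cauchy_dominated(2)[OF X convergent_geometric le' that] by simp
qed

text \<open>Every Cauchy sequence has a subsequence with geometrically small increments, and its
  limit is the limit of the whole sequence.\<close>

lemma complete_of_geometric:
 assumes rapid: "!!X. (!!k. X k \<in> carrier A) ==> (!!k. p (X (Suc k) \<ominus> X k) <= (1/2)^k) ==> \<exists>l. lims X l"
  and X: "X \<in> cauchy_seqs A p"
 shows "\<exists>l. lims X l"
proof -
 have Xc: "X k \<in> carrier A" for k using X by (simp add: cauchy_seqs_def)
 have "\<forall>j. \<exists>N. \<forall>k\<ge>N. \<forall>m\<ge>N. p (X k \<ominus> X m) < (1/2)^j"
  using X by (simp add: cauchy_seqs_def)
 then obtain N where N: "!!j k m. k \<ge> N j ==> m \<ge> N j ==> p (X k \<ominus> X m) < (1/2)^j" by metis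
 \<comment> \<open>The maximum up to Suc j puts both \<open>f j\<close> and \<open>f (Suc j)\<close>
   beyond \<open>N j\<close>, so the increment from one to the other is below (1/2)^j.\<close>
 define f where "f j = Max (N ` {..Suc j})" for j
 have f: "N i <= f j" if "i <= Suc j" for i j using that by (auto simp: f_def)
 have "\<exists>l. lims (%j. X (f j)) l"
  by (rule rapid) (use N[of _ "f (Suc _)" "f _"] f Xc in \<open>auto intro!: less_imp_le\<close>)
 then obtain l where l: "lims (%j. X (f j)) l" by blast
 have "(%k. p (X k \<ominus> l)) \<longlonglongrightarrow> 0"
 proof (rule LIMSEQ_I)
  fix e :: real assume e: "e > 0"
  obtain J where J: "!!j. j \<ge> J ==> norm (p (X (f j) \<ominus> l) - 0) < e / 2"
   using LIMSEQ_D[OF limsD(3)[OF l] half_gt_zero[OF e]] by blast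
  obtain i where i: "(1/2)^i < e / 2" using real_arch_pow_inv[of "e/2" "1/2"] e by auto
  define j where "j = max i J"
  have "norm (p (X k \<ominus> l) - 0) < e" if k: "k \<ge> N i" for k
  proof -
   have "p (X k \<ominus> l) <= p (X k \<ominus> X (f j)) + p (X (f j) \<ominus> l)"
    using Xc limsD(2)[OF l] by (intro p_triangle) auto
   moreover have "p (X k \<ominus> X (f j)) < e / 2"
    using N[of i k "f j"] k f[of i j] i by (simp add: j_def)
   moreover have "p (X (f j) \<ominus> l) < e / 2" using J[of j] unfolding j_def by simp
   ultimately show ?thesis using Xc limsD(2)[OF l] by simp
  qed
  then show "\<exists>no. \<forall>n\<ge>no. norm (p (X n \<ominus> l) - 0) < e" by blast
 qed
 then show ?thesis using Xc limsD(2)[OF l] unfolding lims_def by blast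
qed

end

lemma cstar_algebraI:
 fixes A :: "('a, 'm) cstar_alg_scheme" (structure)
 assumes sa: "star_algebra A" and sn: "cstar_seminorm A (nrm A)"
  and df: "!!x. x \<in> carrier A ==> nrm A x = 0 ==> x = \<zero>"
  and rapid: "!!X. (!!k. X k \<in> carrier A) ==> (!!k. nrm A (X (Suc k) \<ominus> X k) <= (1/2)^k) ==>
    \<exists>l. star_seminorm.lims A (nrm A) X l"
 shows "cstar_algebra A"
proof -
 interpret star_seminorm A "nrm A" using sa sn by (rule star_seminormI)
 show ?thesis
  by (intro cstar_algebra.intro sa cstar_algebra_axioms.intro sn df)
   (use complete_of_geometric[OF rapid] in \<open>auto simp: lims_def\<close>)
qed

context cstar_algebra
begin

text \<open>The averages of the powers of the unitary \<open>w\<close> of \<open>unitary_ex\<close> form approximate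
 units of the ideal, because \<open>w - 1\<close> lies in the ideal and divides \<open>j\<close>.\<close>

lemma approximate_unit:
 assumes I: "closed_ideal I" and j: "j \<in> I" "star A j = j" and e: "e > 0"
 shows "\<exists>b\<in>carrier A. \<one> \<ominus> b \<in> I & nrm A b <= 1 & nrm A (j \<otimes> b) <= e"
proof -
 note ID = closed_idealD[OF I]
 have jc [simp]: "j \<in> carrier A" by (rule ID(2)[OF j(1)])
 define m where "m = 1 + nrm A j"
 have m: "m > 0" "nrm A j <= m" using nm.p_nonneg[OF jc] by (auto simp: m_def simp del: nm.p_nonneg)
 define h where "h = scale A (of_real (inverse m)) j"
 have h: "h \<in> carrier A" "star A h = h" "nrm A h <= 1" and jh: "j = scale A (of_real m) h"
  using j m by (auto simp: h_def nm.p_scale star_scale scale_scale norm_divide inverse_eq_divide pos_divide_le_eq)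
 have hI: "h \<in> I" unfolding h_def by (rule ID(9)[OF j(1)])
 obtain w where w: "w \<in> carrier A" "star A w \<otimes> w = \<one>"
  "h = scale A (- \<i> / 2) (w \<ominus> star A w)" and wI: "w \<ominus> \<one> \<in> I"
  using unitary_ex[OF h] I hI by blast
 have nw: "nrm A w <= 1" using nm.p_isometry_le w(1,2) by blast
 define S where "S = rec_nat \<zero> (%n s. s \<oplus> w [^] (n::nat))"
 have S0: "S 0 = \<zero>" and SSuc: "S (Suc n) = S n \<oplus> w [^] n" for n
  by (simp_all add: S_def)
 have Sc [simp]: "S n \<in> carrier A" for n
  by (induction n) (simp_all add: S0 SSuc w(1))
 have Sn: "nrm A (S n) <= n" for n
 proof (induction n)
  case (Suc n)
  then show ?case
   using nm.p_add[of "S n" "w [^] n"] nrm_pow_le[OF w(1) nw, of n] w(1) by (simp add: SSuc)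
 qed (simp add: S0)
 have tel: "(w \<ominus> \<one>) \<otimes> S n = w [^] n \<ominus> \<one>" for n
 proof (induction n)
  case (Suc n)
  have "(w \<ominus> \<one>) \<otimes> S (Suc n) = (w [^] n \<ominus> \<one>) \<oplus> (w \<otimes> w [^] n \<ominus> w [^] n)"
   using w(1) by (simp add: SSuc r_distr Suc l_distr_minus)
  also have "w \<otimes> w [^] n = w [^] Suc n" using w(1) by (metis nat_pow_Suc2)
  also have "(w [^] n \<ominus> \<one>) \<oplus> (w [^] Suc n \<ominus> w [^] n) = (w [^] Suc n \<ominus> w [^] n) \<oplus> (w [^] n \<ominus> \<one>)"
   using w(1) by (simp add: a_comm)
  also have "... = w [^] Suc n \<ominus> \<one>" using w(1) by (intro minus_split[symmetric]) auto
  finally show ?case .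
 qed (use w(1) in \<open>simp add: S0\<close>)
 \<comment> \<open>The increment 1 - w^n is minus (w - 1) times \<open>S n\<close> by the geometric
   sum, hence in the ideal.\<close>
 have SI: "scale A (of_nat n) \<one> \<ominus> S n \<in> I" for n
 proof (induction n)
  case (Suc n)
  have "\<one> \<ominus> w [^] n = scale A (- 1) ((w \<ominus> \<one>) \<otimes> S n)"
   unfolding tel using w(1) by (simp add: minus_conv scale_add scale_scale a_comm)
  also have "... \<in> I" using w(1) by (intro ID(9) ID(5) wI) auto
  finally have "(scale A (of_nat n) \<one> \<ominus> S n) \<oplus> (\<one> \<ominus> w [^] n) \<in> I" using Suc ID(3) by blast
  moreover have "(scale A (of_nat n) \<one> \<ominus> S n) \<oplus> (\<one> \<ominus> w [^] n) = scale A (of_nat (Suc n)) \<one> \<ominus> S (Suc n)"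
   using w(1) minus_swap4[of "scale A (of_nat n) \<one>" \<one> "S n" "w [^] n"]
   by (simp add: SSuc add_scale a_comm[of \<one>])
  ultimately show ?case by simp
 qed (simp add: S0 ID(4))
 \<comment> \<open>The bound is uniform in n: as w - w* = (1 + w* ) (w - 1), the sum telescopes to a
   product of two factors of norm at most 2, with prefactor 1/2.\<close>
 have hS: "nrm A (h \<otimes> S n) <= 2" for n
 proof -
  have "w \<ominus> star A w = (\<one> \<oplus> star A w) \<otimes> (w \<ominus> \<one>)"
  proof -
   have "(\<one> \<oplus> star A w) \<otimes> (w \<ominus> \<one>) = (w \<ominus> \<one>) \<oplus> (\<one> \<ominus> star A w)"
    using w(1,2) by (subst l_distr) (simp_all add: r_distr_minus)
   moreover have "w \<ominus> star A w = (w \<ominus> \<one>) \<oplus> (\<one> \<ominus> star A w)"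
    using w(1) by (intro minus_split) auto
   ultimately show ?thesis by simp
  qed
  then have "h \<otimes> S n = scale A (- \<i> / 2) ((\<one> \<oplus> star A w) \<otimes> (w [^] n \<ominus> \<one>))"
   using w(1,2) by (subst w(3)) (simp add: scale_mult_left m_assoc tel)
  then have "nrm A (h \<otimes> S n) = 1/2 * nrm A ((\<one> \<oplus> star A w) \<otimes> (w [^] n \<ominus> \<one>))"
   using w(1) by (simp add: nm.p_scale norm_divide)
  also have "... <= 1/2 * (nrm A (\<one> \<oplus> star A w) * nrm A (w [^] n \<ominus> \<one>))"
   using w(1) by (intro mult_left_mono nm.p_mult) auto
  also have "... <= 1/2 * (2 * 2)"
  proof (intro mult_left_mono mult_mono)
   show "nrm A (\<one> \<oplus> star A w) <= 2"
    using nm.p_add[of \<one> "star A w"] w(1) nw nm.p_one_le by simp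
   show "nrm A (w [^] n \<ominus> \<one>) <= 2"
    using nm.p_minus_le[of "w [^] n" \<one>] w(1) nrm_pow_le[OF w(1) nw, of n] nm.p_one_le by simp
  qed (use w(1) in auto)
  finally show ?thesis by simp
 qed
 \<comment> \<open>\<open>j \<otimes> b\<close> is m / M times \<open>h \<otimes> S M\<close>, so
   its norm is at most 2 m / M.\<close>
 obtain M :: nat where M: "2 * m / e < M" using reals_Archimedean2 by blast
 then have M0: "M > 0" using m e by (metis divide_pos_pos mult_pos_pos of_nat_0_less_iff order.strict_trans zero_less_numeral)
 define b where "b = scale A (of_real (inverse M)) (S M)"
 have bc: "b \<in> carrier A" by (simp add: b_def)
 have "\<one> \<ominus> b = scale A (of_real (inverse M)) (scale A (of_nat M) \<one> \<ominus> S M)"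
  using M0 by (simp add: b_def scale_minus scale_scale)
 then have "\<one> \<ominus> b \<in> I" using ID(9)[OF SI] by simp
 moreover have "nrm A b <= 1"
  using Sn[of M] M0 by (simp add: b_def nm.p_scale norm_divide inverse_eq_divide pos_divide_le_eq)
 moreover have "nrm A (j \<otimes> b) <= e"
 proof -
  have "j \<otimes> b = scale A (of_real (m / M)) (h \<otimes> S M)"
   using h(1) by (subst jh) (simp add: b_def scale_mult_left scale_mult_right scale_scale divide_inverse mult.commute)
  then have "nrm A (j \<otimes> b) = m / M * nrm A (h \<otimes> S M)"
   using h(1) m M0 nm.p_scale[of "h \<otimes> S M" "of_real (m / M)"] norm_of_real[of "m / M", where 'a = complex]
   by (simp del: of_real_divide norm_of_real)
  also have "... <= m / M * 2" using hS m M0 by (intro mult_left_mono) auto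
  also have "... <= e" using M M0 e by (simp add: field_simps)
  finally show ?thesis .
 qed
 ultimately show ?thesis using bc by blast
qed

text \<open>The nontrivial half of the C*-identity for the quotient norm. Replacing \<open>v\<close>
  by its self-adjoint part, the error j against a* a lies in the ideal. Multiplying \<open>a\<close>
  by an approximate unit b with j b small stays in the coset of \<open>a\<close>, and y* y = b* v' b
  - b* j b is controlled by \<open>v\<close> alone.\<close>

lemma quotient_cstar_estimate:
 assumes I: "closed_ideal I" and a: "a \<in> carrier A" and v: "v \<in> carrier A" "v \<ominus> star A a \<otimes> a \<in> I"
  and e: "e > 0"
 shows "\<exists>y\<in>carrier A. y \<ominus> a \<in> I & (nrm A y)^2 <= nrm A v + e"
proof -
 note ID = closed_idealD[OF I]
 define h where "h = star A a \<otimes> a"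
 have h: "h \<in> carrier A" "star A h = h" using a by (auto simp: h_def star_mult)
 define v' where "v' = scale A (1/2) (v \<oplus> star A v)"
 have v': "v' \<in> carrier A" "star A v' = v'" using v by (auto simp: v'_def star_ops a_comm)
 have nv': "nrm A v' <= nrm A v"
  using nm.p_add[of v "star A v"] v(1) by (simp add: v'_def nm.p_scale)
 define j where "j = v' \<ominus> h"
 have j: "j \<in> carrier A" "star A j = j" using v' h by (auto simp: j_def star_minus)
 have "j = scale A (1/2) ((v \<ominus> h) \<oplus> star A (v \<ominus> h))"
 proof -
  have "scale A (1/2) ((v \<ominus> h) \<oplus> (u \<ominus> h)) = scale A (1/2) (v \<oplus> u) \<ominus> h" if u: "u \<in> carrier A" for u
  proof -
   obtain B' where "coords4 v u h \<zero> B'" using coords4_ex[of v u h \<zero>] v(1) h u by auto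
   note B = coords4D(1-3,5-9)[OF this]
   show ?thesis by (simp add: B)
  qed
  from this[of "star A v"]
  show ?thesis using v(1) h by (simp add: j_def v'_def star_minus)
 qed
 also have "... \<in> I" using v(2) by (intro ID(9) ID(3) ID(7)) (auto simp: h_def)
 finally have jI: "j \<in> I" .
 obtain b where b: "b \<in> carrier A" "\<one> \<ominus> b \<in> I" "nrm A b <= 1" "nrm A (j \<otimes> b) <= e"
  using approximate_unit[OF I jI j(2) e] by blast
 define y where "y = a \<otimes> b"
 have y: "y \<in> carrier A" using a b by (simp add: y_def)
 have "y \<ominus> a = scale A (- 1) (a \<otimes> (\<one> \<ominus> b))"
  using a b by (simp add: y_def minus_conv r_distr scale_add scale_scale scale_mult_right a_comm)
 then have yI: "y \<ominus> a \<in> I" using ID(9) ID(6) a b by simp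
 have "h = v' \<ominus> j"
  using v' h by (simp add: j_def minus_conv scale_add scale_scale a_assoc[symmetric])
   (metis a_inv_closed minus_eq minus_self l_zero scale_minus_one)
 then have "star A y \<otimes> y = star A b \<otimes> (v' \<otimes> b) \<ominus> star A b \<otimes> (j \<otimes> b)"
  using a b v' j by (simp add: y_def star_mult h_def m_assoc l_distr_minus r_distr_minus
    flip: m_assoc[of "star A a" a b])
 then have "(nrm A y)^2 <= nrm A (star A b \<otimes> (v' \<otimes> b)) + nrm A (star A b \<otimes> (j \<otimes> b))"
  using nm.p_minus_le[of "star A b \<otimes> (v' \<otimes> b)" "star A b \<otimes> (j \<otimes> b)"] y b v' j
  by (simp flip: nm.p_cstar)
 also have "nrm A (star A b \<otimes> (v' \<otimes> b)) <= 1 * (nrm A v * 1)"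
  using b v(1) v' nv' by (intro order.trans[OF nm.p_mult] mult_mono order.trans[OF nm.p_mult]) auto
 also have "nrm A (star A b \<otimes> (j \<otimes> b)) <= 1 * e"
  by (rule order.trans[OF nm.p_mult mult_mono]) (use b j in auto)
 finally show ?thesis using y yI by auto
qed

end

text \<open>Operations on quotients and completions are defined as unions over representatives; such
  a union collapses once all its members agree.\<close>

lemma UN_eq_const: "x \<in> S ==> (!!y. y \<in> S ==> F y = c) ==> (\<Union>y\<in>S. F y) = c"
 by blast

section \<open>The quotient of a C*-algebra by a closed ideal\<close>

locale cstar_quotient = cstar_algebra A for A :: "('a, 'm) cstar_alg_scheme" (structure) +
 fixes I :: "'a set"
 assumes I: "closed_ideal I"
begin

sublocale ideal I A using I by (rule closed_idealD)

lemmas ID = closed_idealD[OF I]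

abbreviation Q :: "'a set cstar_alg" where "Q == quotient_cstar A I"

lemma coset_mem_iff: "x \<in> carrier A ==> y \<in> I +> x \<longleftrightarrow> y \<in> carrier A & y \<ominus> x \<in> I"
proof
 assume x: "x \<in> carrier A" and y: "y \<in> I +> x"
 then obtain h where h: "h \<in> I" "y = h \<oplus> x" by (auto simp: a_r_coset_def')
 then have "y \<ominus> x = h" using x ID(2)[OF h(1)] by (simp add: minus_eq a_assoc r_neg)
 then show "y \<in> carrier A & y \<ominus> x \<in> I" using h x ID(2) by auto
next
 assume x: "x \<in> carrier A" and y: "y \<in> carrier A & y \<ominus> x \<in> I"
 have "y = (y \<ominus> x) \<oplus> x" using x y by (simp add: minus_eq a_assoc l_neg)
 then show "y \<in> I +> x" using y by (auto simp: a_r_coset_def')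
qed

lemma coset_eq_iff: assumes x: "x \<in> carrier A" and y: "y \<in> carrier A"
 shows "I +> x = I +> y \<longleftrightarrow> x \<ominus> y \<in> I"
proof
 assume "I +> x = I +> y"
 moreover have "x \<in> I +> x" using x ID(4) by (simp add: coset_mem_iff)
 ultimately show "x \<ominus> y \<in> I" using y by (simp add: coset_mem_iff)
next
 assume "x \<ominus> y \<in> I"
 moreover have "y \<ominus> x = scale A (- 1) (x \<ominus> y)"
  using x y by (simp add: minus_conv scale_add scale_scale a_comm)
 ultimately have "x \<ominus> y \<in> I" "y \<ominus> x \<in> I" using ID(9) by auto
 then have "z \<ominus> x \<in> I \<longleftrightarrow> z \<ominus> y \<in> I" if "z \<in> carrier A" for z
  using minus_split[of z x y] minus_split[of z y x] ID(3) that x y by metis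
 then show "I +> x = I +> y" using coset_mem_iff[OF x] coset_mem_iff[OF y] by blast
qed

lemma carrier_Q: "carrier Q = (%x. I +> x) ` carrier A"
 by (auto simp: quotient_cstar_def FactRing_def A_RCOSETS_def')

lemma scale_Q: "x \<in> carrier A ==> scale Q c (I +> x) = I +> scale A c x"
proof -
 assume x: "x \<in> carrier A"
 have "I +> scale A c y = I +> scale A c x" if "y \<in> I +> x" for y
  using that x by (simp add: coset_mem_iff coset_eq_iff scale_minus[symmetric] ID(9))
 moreover have "x \<in> I +> x" using x ID(4) by (simp add: coset_mem_iff)
 ultimately have "(\<Union>y\<in>I +> x. I +> scale A c y) = I +> scale A c x" by (rule UN_eq_const[rotated])
 then show ?thesis by (simp add: quotient_cstar_def)
qed

lemma star_Q: "x \<in> carrier A ==> star Q (I +> x) = I +> star A x"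
proof -
 assume x: "x \<in> carrier A"
 have "I +> star A y = I +> star A x" if "y \<in> I +> x" for y
  using that x by (simp add: coset_mem_iff coset_eq_iff star_minus[symmetric] ID(7))
 moreover have "x \<in> I +> x" using x ID(4) by (simp add: coset_mem_iff)
 ultimately have "(\<Union>y\<in>I +> x. I +> star A y) = I +> star A x" by (rule UN_eq_const[rotated])
 then show ?thesis by (simp add: quotient_cstar_def)
qed

lemma zero_Q: "\<zero>\<^bsub>Q\<^esub> = I +> \<zero>"
proof -
 have "I +> \<zero> = I" by (rule a_coset_add_zero[OF a_subset])
 then show ?thesis by (simp add: quotient_cstar_def FactRing_def)
qed

lemma one_Q: "\<one>\<^bsub>Q\<^esub> = I +> \<one>"
 by (simp add: quotient_cstar_def FactRing_def)

lemma add_Q: "x \<in> carrier A ==> y \<in> carrier A ==> (I +> x) \<oplus>\<^bsub>Q\<^esub> (I +> y) = I +> (x \<oplus> y)"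
 by (simp add: quotient_cstar_def FactRing_def a_rcos_sum)

lemma mult_Q: "x \<in> carrier A ==> y \<in> carrier A ==> (I +> x) \<otimes>\<^bsub>Q\<^esub> (I +> y) = I +> (x \<otimes> y)"
 by (simp add: quotient_cstar_def FactRing_def rcoset_mult_add)

lemma star_algebra_Q: "star_algebra Q"
 by (rule star_algebra_image[of A "%x. I +> x"])
  (simp_all add: star_alg carrier_Q add_Q mult_Q one_Q zero_Q scale_Q star_Q)

sublocale Q: star_algebra Q by (rule star_algebra_Q)

lemma minus_Q: "x \<in> carrier A ==> y \<in> carrier A ==> (I +> x) \<ominus>\<^bsub>Q\<^esub> (I +> y) = I +> (x \<ominus> y)"
 by (simp add: Q.minus_conv carrier_Q minus_conv scale_Q add_Q)

lemma nrm_Q_le: "x \<in> carrier A ==> y \<in> carrier A ==> y \<ominus> x \<in> I ==> nrm Q (I +> x) <= nrm A y"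
 unfolding quotient_cstar_def
 by (simp, rule cInf_lower) (auto simp: coset_mem_iff bdd_below_def intro!: exI[of _ 0])

lemma nrm_Q_self: "x \<in> carrier A ==> nrm Q (I +> x) <= nrm A x"
 by (rule nrm_Q_le) (auto simp: ID(4))

lemma nrm_Q_ex:
 assumes x: "x \<in> carrier A" and e: "nrm Q (I +> x) < e"
 shows "\<exists>y\<in>carrier A. y \<ominus> x \<in> I & nrm A y < e"
proof -
 have "Inf (nrm A ` (I +> x)) < e" using e by (simp add: quotient_cstar_def)
 moreover have "x \<in> I +> x" using x ID(4) by (simp add: coset_mem_iff)
 ultimately obtain y where "y \<in> I +> x" "nrm A y < e" using cInf_lessD[of "nrm A ` (I +> x)" e] by blast
 then show ?thesis using coset_mem_iff[OF x] by blast
qed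

lemma nrm_Q_nonneg: "x \<in> carrier A ==> 0 <= nrm Q (I +> x)"
 using nrm_Q_ex[of x 0] nm.p_nonneg by (meson not_less)

lemma nrm_Q_ex_coset:
 assumes x: "x \<in> carrier A" and e: "nrm Q (I +> x) < e"
 obtains y where "y \<in> carrier A" "I +> y = I +> x" "nrm A y < e"
 using nrm_Q_ex[OF assms] x by (auto simp: coset_eq_iff)

text \<open>Each inequality is proved up to a small error by representatives that nearly attain the
  infimum. Only the lower bound in the C*-identity needs more, namely
  \<open>quotient_cstar_estimate\<close>.\<close>

lemma seminorm_Q: "cstar_seminorm Q (nrm Q)"
proof -
 have nn: "0 <= nrm Q X" if "X \<in> carrier Q" for X using that nrm_Q_nonneg by (auto simp: carrier_Q)
 have add: "nrm Q (X \<oplus>\<^bsub>Q\<^esub> Y) <= nrm Q X + nrm Q Y" if XY: "X \<in> carrier Q" "Y \<in> carrier Q" for X Y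
 proof (rule field_le_epsilon)
  fix e :: real assume e: "e > 0"
  obtain x y where xy: "x \<in> carrier A" "y \<in> carrier A" "X = I +> x" "Y = I +> y"
   using XY by (auto simp: carrier_Q)
  obtain x' where x': "x' \<in> carrier A" "I +> x' = X" "nrm A x' < nrm Q X + e/2"
   using nrm_Q_ex_coset[OF xy(1), of "nrm Q X + e/2"] e xy by auto
  obtain y' where y': "y' \<in> carrier A" "I +> y' = Y" "nrm A y' < nrm Q Y + e/2"
   using nrm_Q_ex_coset[OF xy(2), of "nrm Q Y + e/2"] e xy by auto
  have "nrm Q (X \<oplus>\<^bsub>Q\<^esub> Y) <= nrm A (x' \<oplus> y')"
   using nrm_Q_self[of "x' \<oplus> y'"] x' y' by (simp flip: add_Q)
  also have "... <= nrm A x' + nrm A y'" using x' y' by (simp add: nm.p_add)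
  finally show "nrm Q (X \<oplus>\<^bsub>Q\<^esub> Y) <= nrm Q X + nrm Q Y + e" using x' y' by simp
 qed
 have scale1: "nrm Q (scale Q c X) <= cmod c * nrm Q X" if X: "X \<in> carrier Q" for c X
 proof (rule field_le_epsilon)
  fix e :: real assume e: "e > 0"
  obtain x where x: "x \<in> carrier A" "X = I +> x" using X by (auto simp: carrier_Q)
  define d where "d = e / (cmod c + 1)"
  have "cmod c + 1 > 0" by (simp add: add_nonneg_pos)
  then have d: "d > 0" "cmod c * d <= e" using e by (simp_all add: d_def pos_divide_le_eq field_simps)
  obtain x' where x': "x' \<in> carrier A" "I +> x' = X" "nrm A x' < nrm Q X + d"
   using nrm_Q_ex_coset[OF x(1), of "nrm Q X + d"] d x by auto
  have "nrm Q (scale Q c X) <= nrm A (scale A c x')"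
   using nrm_Q_self[of "scale A c x'"] x' by (simp flip: scale_Q)
  also have "... = cmod c * nrm A x'" using x' by (simp add: nm.p_scale)
  also have "... <= cmod c * (nrm Q X + d)" using x' by (intro mult_left_mono) auto
  finally show "nrm Q (scale Q c X) <= cmod c * nrm Q X + e" using d by (simp add: distrib_left)
 qed
 have scale: "nrm Q (scale Q c X) = cmod c * nrm Q X" if X: "X \<in> carrier Q" for c X
 proof (cases "c = 0")
  case True
  then show ?thesis using scale1[OF X, of 0] nn[of "scale Q 0 X"] X by auto
 next
  case False
  have "nrm Q X <= cmod (inverse c) * nrm Q (scale Q c X)"
   using scale1[of "scale Q c X" "inverse c"] X False by (simp add: Q.scale_scale)
  then have "cmod c * nrm Q X <= nrm Q (scale Q c X)"
   using False by (simp add: norm_divide inverse_eq_divide pos_le_divide_eq mult.commute)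
  then show ?thesis using scale1[OF X, of c] by simp
 qed
 have mult: "nrm Q (X \<otimes>\<^bsub>Q\<^esub> Y) <= nrm Q X * nrm Q Y" if XY: "X \<in> carrier Q" "Y \<in> carrier Q" for X Y
 proof -
  obtain x y where xy: "x \<in> carrier A" "y \<in> carrier A" "X = I +> x" "Y = I +> y"
   using XY by (auto simp: carrier_Q)
  have *: "nrm Q (X \<otimes>\<^bsub>Q\<^esub> Y) <= (nrm Q X + e) * (nrm Q Y + e)" if e: "e > 0" for e
  proof -
   obtain x' where x': "x' \<in> carrier A" "I +> x' = X" "nrm A x' < nrm Q X + e"
    using nrm_Q_ex_coset[OF xy(1), of "nrm Q X + e"] e xy by auto
   obtain y' where y': "y' \<in> carrier A" "I +> y' = Y" "nrm A y' < nrm Q Y + e"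
    using nrm_Q_ex_coset[OF xy(2), of "nrm Q Y + e"] e xy by auto
   have "nrm Q (X \<otimes>\<^bsub>Q\<^esub> Y) <= nrm A (x' \<otimes> y')"
    using nrm_Q_self[of "x' \<otimes> y'"] x' y' by (simp flip: mult_Q)
   also have "... <= nrm A x' * nrm A y'" using x' y' by (simp add: nm.p_mult)
   also have "... <= (nrm Q X + e) * (nrm Q Y + e)" using x' y' e nn XY by (intro mult_mono) auto
   finally show ?thesis .
  qed
  \<comment> \<open>Here the error is not additive, so the bound is passed to the limit as e
    decreases to 0.\<close>
  have "((%e. (nrm Q X + e) * (nrm Q Y + e)) \<longlongrightarrow> (nrm Q X + 0) * (nrm Q Y + 0)) (at_right 0)"
   by (intro tendsto_intros)
  then show ?thesis
   by (intro tendsto_lowerbound[of _ "nrm Q X * nrm Q Y" "at_right 0"])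
    (auto intro!: eventually_at_rightI[of 0 1] *)
 qed
 have low: "(nrm Q X)^2 <= nrm Q (star Q X \<otimes>\<^bsub>Q\<^esub> X)" if X: "X \<in> carrier Q" for X
 proof (rule field_le_epsilon)
  fix e :: real assume e: "e > 0"
  obtain x where x: "x \<in> carrier A" "X = I +> x" using X by (auto simp: carrier_Q)
  have XX: "star Q X \<otimes>\<^bsub>Q\<^esub> X = I +> (star A x \<otimes> x)" using x by (simp add: star_Q mult_Q)
  obtain v where v: "v \<in> carrier A" "v \<ominus> star A x \<otimes> x \<in> I" "nrm A v < nrm Q (star Q X \<otimes>\<^bsub>Q\<^esub> X) + e/2"
   using nrm_Q_ex[of "star A x \<otimes> x" "nrm Q (star Q X \<otimes>\<^bsub>Q\<^esub> X) + e/2"] e x XX by auto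
  obtain y where y: "y \<in> carrier A" "y \<ominus> x \<in> I" "(nrm A y)^2 <= nrm A v + e/2"
   using quotient_cstar_estimate[OF I x(1) v(1,2), of "e/2"] e by auto
  have "nrm Q X <= nrm A y" using nrm_Q_le[OF x(1) y(1,2)] x by simp
  then have "(nrm Q X)^2 <= (nrm A y)^2" using nn[OF X] by (intro power_mono) auto
  then show "(nrm Q X)^2 <= nrm Q (star Q X \<otimes>\<^bsub>Q\<^esub> X) + e" using y v by simp
 qed
 have star: "nrm Q (star Q X) <= nrm Q X" if X: "X \<in> carrier Q" for X
 proof (rule field_le_epsilon)
  fix e :: real assume e: "e > 0"
  obtain x where x: "x \<in> carrier A" "X = I +> x" using X by (auto simp: carrier_Q)
  obtain x' where x': "x' \<in> carrier A" "I +> x' = X" "nrm A x' < nrm Q X + e"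
   using nrm_Q_ex_coset[OF x(1), of "nrm Q X + e"] e x by auto
  have "nrm Q (star Q X) <= nrm A (star A x')"
   using nrm_Q_self[of "star A x'"] x' by (simp flip: star_Q)
  then show "nrm Q (star Q X) <= nrm Q X + e" using x' by simp
 qed
 have up: "nrm Q (star Q X \<otimes>\<^bsub>Q\<^esub> X) <= (nrm Q X)^2" if X: "X \<in> carrier Q" for X
 proof -
  have "nrm Q (star Q X \<otimes>\<^bsub>Q\<^esub> X) <= nrm Q (star Q X) * nrm Q X" using X by (intro mult) auto
  also have "... <= nrm Q X * nrm Q X" using star[OF X] nn[OF X] by (intro mult_right_mono)
  finally show ?thesis by (simp add: power2_eq_square)
 qed
 show ?thesis
  unfolding cstar_seminorm_def using nn add scale mult low up by (auto intro: antisym)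
qed

text \<open>Norm zero gives representatives \<open>y k\<close> tending to 0; then \<open>x\<close>
  is the limit of the elements x - y k of the closed ideal.\<close>

lemma definite_Q: assumes X: "X \<in> carrier Q" "nrm Q X = 0" shows "X = \<zero>\<^bsub>Q\<^esub>"
proof -
 obtain x where x: "x \<in> carrier A" "X = I +> x" using X by (auto simp: carrier_Q)
 have "\<exists>y\<in>carrier A. y \<ominus> x \<in> I & nrm A y < inverse (Suc k)" for k
  using nrm_Q_ex[OF x(1), of "inverse (Suc k)"] X x by simp
 then obtain y where y: "!!k. y k \<in> carrier A" "!!k. y k \<ominus> x \<in> I" "!!k. nrm A (y k) < inverse (Suc k)"
  by metis
 have L: "nm.lims (%k. x \<ominus> y k) x"
 proof (rule nm.lims_bound)
  show "nrm A (x \<ominus> y k \<ominus> x) <= inverse (Suc k)" for k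
  proof -
   have "x \<ominus> y k \<ominus> x = \<ominus> y k" using x y by (simp add: minus_eq a_ac r_neg1 r_neg2)
   then show ?thesis using y(3)[of k] y(1) by (simp add: nm.p_uminus)
  qed
  show "(%k. inverse (real (Suc k))) \<longlonglongrightarrow> 0" by (rule LIMSEQ_inverse_real_of_nat)
 qed (use x y in auto)
 have M: "x \<ominus> y k \<in> I" for k
 proof -
  have "x \<ominus> y k = scale A (- 1) (y k \<ominus> x)"
   using x y by (simp add: minus_conv scale_add scale_scale a_comm)
  then show ?thesis using ID(9) y by simp
 qed
 have "x \<in> I" by (rule ID(8)[OF M L])
 then show ?thesis using x by (simp add: zero_Q coset_eq_iff minus_eq)
qed

text \<open>A geometrically convergent sequence of cosets is lifted to one in \<open>A\<close> by
  lifting its increments and summing them up.\<close>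

lemma cstar_algebra_Q: "cstar_algebra Q"
proof (rule cstar_algebraI[OF star_algebra_Q seminorm_Q definite_Q])
 interpret QN: star_seminorm Q "nrm Q" by (rule star_seminormI[OF star_algebra_Q seminorm_Q])
 fix X assume X: "!!k::nat. X k \<in> carrier Q" and le: "!!k. nrm Q (X (Suc k) \<ominus>\<^bsub>Q\<^esub> X k) <= (1/2)^k"
 obtain x where x: "!!k. x k \<in> carrier A" "!!k. X k = I +> x k"
  using X unfolding carrier_Q image_iff by metis
 \<comment> \<open>The infimum defining the quotient norm need not be attained; the factor 2 leaves
   room for a representative.\<close>
 have "\<exists>z\<in>carrier A. z \<ominus> (x (Suc k) \<ominus> x k) \<in> I & nrm A z < 2 * (1/2)^k" for k
 proof -
  have "nrm Q (I +> (x (Suc k) \<ominus> x k)) <= (1/2)^k" using le[of k] x by (simp add: minus_Q)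
  also have "(1/2)^k < 2 * (1/2::real)^k" by simp
  finally show ?thesis using x by (intro nrm_Q_ex) auto
 qed
 then obtain z where z: "!!k. z k \<in> carrier A" "!!k. z k \<ominus> (x (Suc k) \<ominus> x k) \<in> I" "!!k. nrm A (z k) < 2 * (1/2)^k"
  by metis
 define y where "y = rec_nat (x 0) (%k v. v \<oplus> z k)"
 have y0: "y 0 = x 0" and yS: "y (Suc k) = y k \<oplus> z k" for k by (simp_all add: y_def)
 have yc [simp]: "y k \<in> carrier A" for k by (induction k) (simp_all add: y0 yS x z)
 have yX: "I +> y k = X k" for k
 proof -
  have "y k \<ominus> x k \<in> I"
  proof (induction k)
   case (Suc k)
   have "y (Suc k) \<ominus> x (Suc k) = (y k \<ominus> x k) \<oplus> (z k \<ominus> (x (Suc k) \<ominus> x k))"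
   proof -
    have "x k \<oplus> (x (Suc k) \<ominus> x k) = (x (Suc k) \<ominus> x k) \<oplus> x k" using x by (intro a_comm) auto
    also have "... = x (Suc k)" using x by (simp add: minus_eq a_assoc l_neg)
    finally show ?thesis
     using minus_swap4[of "y k" "z k" "x k" "x (Suc k) \<ominus> x k"] x z by (simp add: yS)
   qed
   then show ?case using Suc z(2) ID(3) by simp
  qed (simp add: y0 x ID(4))
  then show ?thesis using x by (simp add: coset_eq_iff)
 qed
 have "nrm A (y (Suc k) \<ominus> y k) <= 2 * (1/2)^k" for k
 proof -
  have "y (Suc k) \<ominus> y k = z k"
   using z minus_swap4[of "y k" "z k" "y k" \<zero>] by (simp add: yS) (simp add: minus_eq)
  then show ?thesis using z(3)[of k] by simp
 qed
 then have "y \<in> cauchy_seqs A (nrm A)" by (intro nm.cauchy_geometric) auto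
 then obtain l where l: "nm.lims y l" using complete[of y] yc unfolding nm.lims_def by blast
 have "QN.lims X (I +> l)"
 proof (rule QN.lims_bound)
  show "nrm Q (X k \<ominus>\<^bsub>Q\<^esub> (I +> l)) <= nrm A (y k \<ominus> l)" for k
   using nm.limsD(2)[OF l] nrm_Q_self[of "y k \<ominus> l"] by (simp add: yX[symmetric] minus_Q)
 qed (use X nm.limsD[OF l] in \<open>auto simp: carrier_Q\<close>)
 then show "\<exists>l. QN.lims X l" by blast
qed

sublocale Q: cstar_algebra Q by (rule cstar_algebra_Q)

lemma proj_hom: "(%x. I +> x) \<in> cstar_hom A Q"
 unfolding cstar_hom_def
 by (auto intro!: ring_hom_memI simp: carrier_Q mult_Q add_Q one_Q scale_Q star_Q)

lemma factor_hom:
 assumes f: "f \<in> cstar_hom A B" and ker: "!!x. x \<in> I ==> f x = \<zero>\<^bsub>B\<^esub>" and B: "star_algebra B"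
 shows "\<exists>g\<in>cstar_hom Q B. \<forall>x\<in>carrier A. g (I +> x) = f x"
proof -
 interpret B: star_algebra B by fact
 have fr: "f \<in> ring_hom A B" using f by (simp add: cstar_hom_def)
 note fh = ring_hom_closed[OF fr] ring_hom_add[OF fr] ring_hom_mult[OF fr] ring_hom_one[OF fr]
 have fs: "f (scale A c x) = scale B c (f x)" "f (star A x) = star B (f x)" if "x \<in> carrier A" for c x
  using f that by (auto simp: cstar_hom_def)
 define g where "g X = f (SOME x. x \<in> X)" for X
 have g: "g (I +> x) = f x" if x: "x \<in> carrier A" for x
 proof -
  have "x \<in> I +> x" using x ID(4) by (simp add: coset_mem_iff)
  then have "(SOME y. y \<in> I +> x) \<in> I +> x" by (rule someI)
  then obtain y where y: "y = (SOME y. y \<in> I +> x)" "y \<in> carrier A" "y \<ominus> x \<in> I"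
   using x by (auto simp: coset_mem_iff)
  have "f y = f ((y \<ominus> x) \<oplus> x)" using x y by (simp add: minus_eq a_assoc l_neg)
  also have "... = f x" using x y fh by (subst fh(2)) (auto simp: ker)
  finally show ?thesis using y by (simp add: g_def)
 qed
 have "g \<in> cstar_hom Q B"
  unfolding cstar_hom_def
  by (auto intro!: ring_hom_memI simp: carrier_Q mult_Q add_Q one_Q scale_Q star_Q g fh fs)
 then show ?thesis using g by blast
qed

end

context cstar_algebra
begin

lemma closed_star_ideal_facts:
 assumes R: "R \<subseteq> carrier A"
 shows "closed_ideal (closed_star_ideal A R)" "R \<subseteq> closed_star_ideal A R"
  "!!J. closed_ideal J ==> R \<subseteq> J ==> closed_star_ideal A R \<subseteq> J"
proof -
 define F where "F = {J. closed_ideal J & R \<subseteq> J}"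
 have ci: "closed_ideal J \<longleftrightarrow> ideal J A & (\<forall>x\<in>J. star A x \<in> J) &
   (\<forall>x l. (\<forall>k. x k \<in> J) & l \<in> carrier A & (%k::nat. nrm A (x k \<ominus> l)) \<longlonglongrightarrow> 0 --> l \<in> J)" for J
 proof -
  have "nm.lims X l \<longleftrightarrow> l \<in> carrier A & (%k. nrm A (X k \<ominus> l)) \<longlonglongrightarrow> 0"
   if "ideal J A" "\<forall>k. X k \<in> J" for X l
   using that ideal.Icarr[OF that(1)] by (auto simp: nm.lims_def)
  then show ?thesis unfolding closed_ideal_def by (metis (no_types, lifting))
 qed
 have eq: "closed_star_ideal A R = \<Inter>F"
  unfolding closed_star_ideal_def F_def ci by (rule arg_cong[of _ _ Inter]) blast
 \<comment> \<open>The family of candidate ideals is nonempty, so that its intersection is again an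
   ideal.\<close>
 have "closed_ideal (carrier A)"
  unfolding closed_ideal_def using oneideal nm.limsD(2) by auto
 then have ne: "F ~= {}" using R by (auto simp: F_def)
 have "ideal (\<Inter>F) A" by (rule i_Intersect[OF _ ne]) (auto simp: F_def closed_ideal_def)
 then show "closed_ideal (closed_star_ideal A R)"
  unfolding eq closed_ideal_def by (auto simp: F_def closed_idealD(7) intro: closed_idealD(8))
 show "R \<subseteq> closed_star_ideal A R" unfolding eq by (auto simp: F_def)
 show "closed_star_ideal A R \<subseteq> J" if "closed_ideal J" "R \<subseteq> J" for J
  unfolding eq using that by (auto simp: F_def)
qed

end

section \<open>Homomorphisms\<close>

lemma cstar_homD:
 assumes "f \<in> cstar_hom A B"
 shows "x \<in> carrier A ==> f x \<in> carrier B"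
  "x \<in> carrier A ==> y \<in> carrier A ==> f (x \<oplus>\<^bsub>A\<^esub> y) = f x \<oplus>\<^bsub>B\<^esub> f y"
  "x \<in> carrier A ==> y \<in> carrier A ==> f (x \<otimes>\<^bsub>A\<^esub> y) = f x \<otimes>\<^bsub>B\<^esub> f y"
  "f \<one>\<^bsub>A\<^esub> = \<one>\<^bsub>B\<^esub>"
  "x \<in> carrier A ==> f (scale A c x) = scale B c (f x)"
  "x \<in> carrier A ==> f (star A x) = star B (f x)"
 using assms unfolding cstar_hom_def
 by (auto intro: ring_hom_closed ring_hom_add ring_hom_mult ring_hom_one)

lemma cstar_homI:
 assumes "!!x. x \<in> carrier A ==> f x \<in> carrier B"
  "!!x y. x \<in> carrier A ==> y \<in> carrier A ==> f (x \<oplus>\<^bsub>A\<^esub> y) = f x \<oplus>\<^bsub>B\<^esub> f y"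
  "!!x y. x \<in> carrier A ==> y \<in> carrier A ==> f (x \<otimes>\<^bsub>A\<^esub> y) = f x \<otimes>\<^bsub>B\<^esub> f y"
  "f \<one>\<^bsub>A\<^esub> = \<one>\<^bsub>B\<^esub>"
  "!!c x. x \<in> carrier A ==> f (scale A c x) = scale B c (f x)"
  "!!x. x \<in> carrier A ==> f (star A x) = star B (f x)"
 shows "f \<in> cstar_hom A B"
 unfolding cstar_hom_def using assms by (auto intro!: ring_hom_memI)

lemma cstar_hom_comp: "f \<in> cstar_hom A B ==> g \<in> cstar_hom B C ==> g \<circ> f \<in> cstar_hom A C"
 by (rule cstar_homI) (simp_all add: cstar_homD)

lemma cstar_hom_zero:
 assumes "star_algebra A" "star_algebra B" "f \<in> cstar_hom A B"
 shows "f \<zero>\<^bsub>A\<^esub> = \<zero>\<^bsub>B\<^esub>"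
proof -
 interpret A: star_algebra A by fact
 interpret B: star_algebra B by fact
 have "f (scale A 0 \<zero>\<^bsub>A\<^esub>) = \<zero>\<^bsub>B\<^esub>"
  using cstar_homD(5)[OF assms(3), of "\<zero>\<^bsub>A\<^esub>" 0] cstar_homD(1)[OF assms(3), of "\<zero>\<^bsub>A\<^esub>"] by simp
 then show ?thesis by simp
qed

lemma cstar_hom_minus:
 assumes "star_algebra A" "star_algebra B" "f \<in> cstar_hom A B" "x \<in> carrier A" "y \<in> carrier A"
 shows "f (x \<ominus>\<^bsub>A\<^esub> y) = f x \<ominus>\<^bsub>B\<^esub> f y"
proof -
 interpret A: star_algebra A by fact
 interpret B: star_algebra B by fact
 show ?thesis using assms(4,5) by (simp add: A.minus_conv B.minus_conv cstar_homD[OF assms(3)])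
qed

lemma seminorm_pullback:
 assumes A: "star_algebra A" and f: "f \<in> cstar_hom A B" and q: "cstar_seminorm B q"
 shows "cstar_seminorm A (%x. q (f x))"
proof -
 interpret A: star_algebra A by fact
 show ?thesis using q unfolding cstar_seminorm_def by (simp add: cstar_homD[OF f])
qed

text \<open>The pulled back norm is a C*-seminorm, hence below the norm of \<open>A\<close>;
  boundedness is thus automatic, as \<open>cstar_hom\<close> is purely algebraic.\<close>

lemma cstar_hom_contractive:
 assumes "cstar_algebra A" "cstar_algebra B" "f \<in> cstar_hom A B" "x \<in> carrier A"
 shows "nrm B (f x) <= nrm A x"
proof -
 interpret A: cstar_algebra A by fact
 interpret B: cstar_algebra B by fact
 show ?thesis
  using A.seminorm_le_nrm[OF seminorm_pullback[OF A.star_alg assms(3) B.nrm_cstar] assms(4)] .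
qed

lemma cstar_hom_lims:
 assumes "cstar_algebra A" "cstar_algebra B" "f \<in> cstar_hom A B"
  and X: "star_seminorm.lims A (nrm A) X l"
 shows "star_seminorm.lims B (nrm B) (%k. f (X k)) (f l)"
proof -
 interpret A: cstar_algebra A by fact
 interpret B: cstar_algebra B by fact
 show ?thesis
 proof (rule B.nm.lims_bound)
  show "nrm B (f (X k) \<ominus>\<^bsub>B\<^esub> f l) <= nrm A (X k \<ominus>\<^bsub>A\<^esub> l)" for k
   using cstar_hom_contractive[OF assms(1-3), of "X k \<ominus>\<^bsub>A\<^esub> l"] A.nm.limsD[OF X]
   by (simp add: cstar_hom_minus[OF A.star_alg B.star_alg assms(3)])
 qed (use A.nm.limsD[OF X] in \<open>auto simp: cstar_homD[OF assms(3)]\<close>)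
qed

lemma kernel_closed_ideal:
 assumes A: "cstar_algebra A" and B: "cstar_algebra B" and f: "f \<in> cstar_hom A B"
 shows "cstar_algebra.closed_ideal A {x \<in> carrier A. f x = \<zero>\<^bsub>B\<^esub>}"
proof -
 interpret A: cstar_algebra A by fact
 interpret B: cstar_algebra B by fact
 interpret ring_hom_ring A B f
  by (rule ring_hom_ringI2[OF A.ring_axioms B.ring_axioms]) (use f in \<open>simp add: cstar_hom_def\<close>)
 have k1: "ideal {x \<in> carrier A. f x = \<zero>\<^bsub>B\<^esub>} A"
  using kernel_is_ideal unfolding a_kernel_def' .
 have k2: "l \<in> carrier A & f l = \<zero>\<^bsub>B\<^esub>"
  if "\<forall>k. X k \<in> {x \<in> carrier A. f x = \<zero>\<^bsub>B\<^esub>}" "A.nm.lims X l" for X l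
 proof -
  have "B.nm.lims (%k. f (X k)) (f l)" using cstar_hom_lims[OF A B f that(2)] .
  then have "B.nm.lims (%k. \<zero>\<^bsub>B\<^esub>) (f l)" using that(1) by simp
  then have "f l = \<zero>\<^bsub>B\<^esub>" by (rule B.lims_unique[OF _ B.nm.lims_const[OF B.zero_closed]])
  then show ?thesis using A.nm.limsD(2)[OF that(2)] by simp
 qed
 have k3: "star A x \<in> carrier A & f (star A x) = \<zero>\<^bsub>B\<^esub>" if "x \<in> carrier A" "f x = \<zero>\<^bsub>B\<^esub>" for x
  using that by (simp add: cstar_homD(6)[OF f])
 show ?thesis
  unfolding A.closed_ideal_def
 proof (intro conjI ballI allI impI k1)
  fix X l assume "\<forall>k. X k \<in> {x \<in> carrier A. f x = \<zero>\<^bsub>B\<^esub>}" "A.nm.lims X l"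
  then show "l \<in> {x \<in> carrier A. f x = \<zero>\<^bsub>B\<^esub>}" using k2[of X l] by simp
 qed (use k3 in simp)
qed

lemma cstar_hom_eqI:
 assumes A: "cstar_algebra A" and B: "cstar_algebra B" and f: "f \<in> cstar_hom A B" and g: "g \<in> cstar_hom A B"
  and dense: "!!x e. x \<in> carrier A ==> e > 0 ==> \<exists>y\<in>D. nrm A (x \<ominus>\<^bsub>A\<^esub> y) < e"
  and D: "D \<subseteq> carrier A" and eq: "!!y. y \<in> D ==> f y = g y" and x: "x \<in> carrier A"
 shows "f x = g x"
proof -
 interpret A: cstar_algebra A by fact
 interpret B: cstar_algebra B by fact
 have "\<exists>y\<in>D. nrm A (x \<ominus>\<^bsub>A\<^esub> y) < inverse (Suc k)" for k using dense[OF x] by simp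
 then obtain y where y: "!!k. y k \<in> D" "!!k. nrm A (x \<ominus>\<^bsub>A\<^esub> y k) < inverse (Suc k)" by metis
 have l: "A.nm.lims y x"
 proof (rule A.nm.lims_bound)
  show "nrm A (y k \<ominus>\<^bsub>A\<^esub> x) <= inverse (Suc k)" for k
   using y D x A.nm.p_minus_commute[of x "y k"] by (metis less_imp_le subsetD)
  show "(%k. inverse (real (Suc k))) \<longlonglongrightarrow> 0" by (rule LIMSEQ_inverse_real_of_nat)
 qed (use x y D in auto)
 show ?thesis
  using B.lims_unique[OF cstar_hom_lims[OF A B f l]] cstar_hom_lims[OF A B g l] y(1) eq by simp
qed

lemma cstar_hom_cong:
 assumes A: "star_algebra A" and f: "f \<in> cstar_hom A B" and eq: "!!x. x \<in> carrier A ==> g x = f x"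
 shows "g \<in> cstar_hom A B"
proof -
 interpret A: star_algebra A by fact
 show ?thesis by (rule cstar_homI) (simp_all add: eq cstar_homD[OF f])
qed

text \<open>Stated for a Lipschitz map on a mere index set, without algebraic structure, so that it
  serves homomorphisms and states alike. The approximating sequences in the conclusion let algebraic
  identities be carried to the limit afterwards.\<close>

lemma dense_extension:
 fixes j :: "'x => 'a" and f :: "'x => 'b"
  and A :: "('a, 'm) cstar_alg_scheme" and B :: "('b, 'k) cstar_alg_scheme"
 assumes A: "cstar_algebra A" and B: "cstar_algebra B"
  and j: "!!x. x \<in> X ==> j x \<in> carrier A" and f: "!!x. x \<in> X ==> f x \<in> carrier B"
  and le: "!!x y. x \<in> X ==> y \<in> X ==> nrm B (f x \<ominus>\<^bsub>B\<^esub> f y) <= nrm A (j x \<ominus>\<^bsub>A\<^esub> j y)"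
  and dense: "!!a e. a \<in> carrier A ==> e > 0 ==> \<exists>x\<in>X. nrm A (a \<ominus>\<^bsub>A\<^esub> j x) < e"
 shows "\<exists>F. (\<forall>a\<in>carrier A. F a \<in> carrier B) &
  (\<forall>x a. (\<forall>k. x k \<in> X) --> star_seminorm.lims A (nrm A) (%k. j (x k)) a -->
    star_seminorm.lims B (nrm B) (%k. f (x k)) (F a)) &
  (\<forall>x\<in>X. F (j x) = f x) &
  (\<forall>a\<in>carrier A. \<exists>x. (\<forall>k. x k \<in> X) & star_seminorm.lims A (nrm A) (%k. j (x k)) a)"
proof -
 interpret A: cstar_algebra A by fact
 interpret B: cstar_algebra B by fact
 have ex: "\<exists>x. (\<forall>k. x k \<in> X) & A.nm.lims (%k. j (x k)) a" if a: "a \<in> carrier A" for a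
 proof -
  have "\<exists>x\<in>X. nrm A (a \<ominus>\<^bsub>A\<^esub> j x) < inverse (Suc k)" for k using dense[OF a] by simp
  then obtain x where x: "!!k. x k \<in> X" "!!k. nrm A (a \<ominus>\<^bsub>A\<^esub> j (x k)) < inverse (Suc k)" by metis
  have "A.nm.lims (%k. j (x k)) a"
  proof (rule A.nm.lims_bound)
   show "nrm A (j (x k) \<ominus>\<^bsub>A\<^esub> a) <= inverse (Suc k)" for k
    using x(2)[of k] A.nm.p_minus_commute[OF a j[OF x(1)[of k]]] by simp
   show "(%k. inverse (real (Suc k))) \<longlonglongrightarrow> 0" by (rule LIMSEQ_inverse_real_of_nat)
  qed (use a j x in auto)
  then show ?thesis using x by blast
 qed
 have conv: "\<exists>l. B.nm.lims (%k. f (x k)) l" if x: "!!k. x k \<in> X" and l: "A.nm.lims (%k. j (x k)) a" for x a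
 proof -
  have "(%k. f (x k)) \<in> cauchy_seqs B (nrm B)"
   unfolding cauchy_seqs_def
  proof (intro CollectI conjI allI impI)
   fix e :: real assume "e > 0"
   then obtain N where N: "!!k. k \<ge> N ==> norm (nrm A (j (x k) \<ominus>\<^bsub>A\<^esub> a) - 0) < e / 2"
    using LIMSEQ_D[OF A.nm.limsD(3)[OF l], of "e / 2"] half_gt_zero by blast
   have "nrm B (f (x k) \<ominus>\<^bsub>B\<^esub> f (x m)) < e" if km: "k \<ge> N" "m \<ge> N" for k m
   proof -
    have "nrm B (f (x k) \<ominus>\<^bsub>B\<^esub> f (x m)) <= nrm A (j (x k) \<ominus>\<^bsub>A\<^esub> j (x m))" using le x by blast
    also have "... <= nrm A (j (x k) \<ominus>\<^bsub>A\<^esub> a) + nrm A (a \<ominus>\<^bsub>A\<^esub> j (x m))"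
     using j x A.nm.limsD(2)[OF l] by (intro A.nm.p_triangle) auto
    also have "nrm A (a \<ominus>\<^bsub>A\<^esub> j (x m)) = nrm A (j (x m) \<ominus>\<^bsub>A\<^esub> a)"
     using j x A.nm.limsD(2)[OF l] by (intro A.nm.p_minus_commute) auto
    finally show ?thesis using N[OF km(1)] N[OF km(2)] by simp
   qed
   then show "\<exists>N. \<forall>k\<ge>N. \<forall>m\<ge>N. nrm B (f (x k) \<ominus>\<^bsub>B\<^esub> f (x m)) < e" by blast
  qed (use f x in auto)
  then show ?thesis using B.complete[of "%k. f (x k)"] f[OF x] unfolding B.nm.lims_def by blast
 qed
 have uniq: "l = l'" if x: "!!k. x k \<in> X" "A.nm.lims (%k. j (x k)) a" "B.nm.lims (%k. f (x k)) l"
  and y: "!!k. y k \<in> X" "A.nm.lims (%k. j (y k)) a" "B.nm.lims (%k. f (y k)) l'" for x y a l l'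
 proof -
  have "A.nm.lims (%k. j (x k) \<ominus>\<^bsub>A\<^esub> j (y k)) (a \<ominus>\<^bsub>A\<^esub> a)" using x y by (intro A.nm.lims_minus)
  then have 1: "(%k. nrm A (j (x k) \<ominus>\<^bsub>A\<^esub> j (y k))) \<longlonglongrightarrow> 0"
   using A.nm.lims_p A.nm.limsD(2)[OF x(2)] by fastforce
  have 2: "B.nm.lims (%k. f (x k) \<ominus>\<^bsub>B\<^esub> f (y k)) (l \<ominus>\<^bsub>B\<^esub> l')" using x y by (intro B.nm.lims_minus)
  have 3: "B.nm.lims (%k. f (x k) \<ominus>\<^bsub>B\<^esub> f (y k)) \<zero>\<^bsub>B\<^esub>"
   by (rule B.nm.lims_bound[OF _ _ _ 1]) (use f x y le in \<open>simp_all add: B.minus_eq\<close>)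
  show ?thesis
   using B.lims_unique[OF 2 3] B.minus_eq_zero_iff B.nm.limsD(2)[OF x(3)] B.nm.limsD(2)[OF y(3)] by blast
 qed
 define F where "F a = (SOME l. \<exists>x. (\<forall>k. x k \<in> X) & A.nm.lims (%k. j (x k)) a & B.nm.lims (%k. f (x k)) l)" for a
 have Fex: "\<exists>x. (\<forall>k. x k \<in> X) & A.nm.lims (%k. j (x k)) a & B.nm.lims (%k. f (x k)) (F a)"
  if a: "a \<in> carrier A" for a
  unfolding F_def by (rule someI_ex) (use ex[OF a] conv in blast)
 have F1: "F a \<in> carrier B" if "a \<in> carrier A" for a using Fex[OF that] B.nm.limsD(2) by blast
 have F2: "B.nm.lims (%k. f (x k)) (F a)" if x: "\<forall>k. x k \<in> X" "A.nm.lims (%k. j (x k)) a" for x a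
 proof -
  obtain y where y: "\<forall>k. y k \<in> X" "A.nm.lims (%k. j (y k)) a" "B.nm.lims (%k. f (y k)) (F a)"
   using Fex[OF A.nm.limsD(2)[OF x(2)]] by blast
  obtain l where l: "B.nm.lims (%k. f (x k)) l" using conv x by blast
  then show ?thesis using uniq[of x a l y "F a"] x y by blast
 qed
 have F3: "F (j x) = f x" if x: "x \<in> X" for x
  using F2[of "%_. x" "j x"] x A.nm.lims_const[OF j[OF x]] B.lims_unique B.nm.lims_const[OF f[OF x]] by blast
 show ?thesis using F1 F2 F3 ex by blast
qed

text \<open>\<open>j\<close> need not be injective: the norm comparison already makes the value
  depend only on the image point.\<close>

lemma hom_extension:
 fixes A :: "('a, 'm) cstar_alg_scheme" and B :: "('b, 'k) cstar_alg_scheme"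
 assumes X: "star_algebra X" and A: "cstar_algebra A" and B: "cstar_algebra B"
  and j: "j \<in> cstar_hom X A" and f: "f \<in> cstar_hom X B"
  and le: "!!x. x \<in> carrier X ==> nrm B (f x) <= nrm A (j x)"
  and dense: "!!a e. a \<in> carrier A ==> e > 0 ==> \<exists>x\<in>carrier X. nrm A (a \<ominus>\<^bsub>A\<^esub> j x) < e"
 shows "\<exists>F\<in>cstar_hom A B. \<forall>x\<in>carrier X. F (j x) = f x"
proof -
 interpret X: star_algebra X by fact
 interpret A: cstar_algebra A by fact
 interpret B: cstar_algebra B by fact
 note jD = cstar_homD[OF j] note fD = cstar_homD[OF f]
 have le': "nrm B (f x \<ominus>\<^bsub>B\<^esub> f y) <= nrm A (j x \<ominus>\<^bsub>A\<^esub> j y)" if "x \<in> carrier X" "y \<in> carrier X" for x y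
  using le[of "x \<ominus>\<^bsub>X\<^esub> y"] that
  by (simp add: cstar_hom_minus[OF X A.star_alg j] cstar_hom_minus[OF X B.star_alg f])
 obtain F where F: "(\<forall>a\<in>carrier A. F a \<in> carrier B) &
  (\<forall>x a. (\<forall>k. x k \<in> carrier X) --> A.nm.lims (%k. j (x k)) a --> B.nm.lims (%k. f (x k)) (F a)) &
  (\<forall>x\<in>carrier X. F (j x) = f x) &
  (\<forall>a\<in>carrier A. \<exists>x. (\<forall>k. x k \<in> carrier X) & A.nm.lims (%k. j (x k)) a)"
  using dense_extension[OF A B jD(1) fD(1) le' dense] ..
 have F1: "F a \<in> carrier B" if "a \<in> carrier A" for a
  using F that by simp
 have F2: "B.nm.lims (%k. f (x k)) (F a)" if "!!k. x k \<in> carrier X" "A.nm.lims (%k. j (x k)) a" for x a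
  using F that by simp
 have F3: "F (j x) = f x" if "x \<in> carrier X" for x
  using F that by simp
 have F4: "\<exists>x. (\<forall>k. x k \<in> carrier X) & A.nm.lims (%k. j (x k)) a" if "a \<in> carrier A" for a
  using F that by simp
 have "F \<in> cstar_hom A B"
 proof (rule cstar_homI)
  fix a b assume a: "a \<in> carrier A" and b: "b \<in> carrier A"
  obtain x where x: "!!k. x k \<in> carrier X" "A.nm.lims (%k. j (x k)) a" using F4[OF a] by blast
  obtain y where y: "!!k. y k \<in> carrier X" "A.nm.lims (%k. j (y k)) b" using F4[OF b] by blast
  note Fx = F2[OF x] note Fy = F2[OF y]
  have "A.nm.lims (%k. j (x k \<oplus>\<^bsub>X\<^esub> y k)) (a \<oplus>\<^bsub>A\<^esub> b)"
   using A.nm.lims_add[OF x(2) y(2)] x(1) y(1) by (simp add: jD)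
  from F2[OF _ this] have "B.nm.lims (%k. f (x k) \<oplus>\<^bsub>B\<^esub> f (y k)) (F (a \<oplus>\<^bsub>A\<^esub> b))"
   using x(1) y(1) by (simp add: fD)
  then show "F (a \<oplus>\<^bsub>A\<^esub> b) = F a \<oplus>\<^bsub>B\<^esub> F b"
   by (rule B.lims_unique) (rule B.nm.lims_add[OF Fx Fy])
  have "A.nm.lims (%k. j (x k \<otimes>\<^bsub>X\<^esub> y k)) (a \<otimes>\<^bsub>A\<^esub> b)"
   using A.nm.lims_mult[OF x(2) y(2)] x(1) y(1) by (simp add: jD)
  from F2[OF _ this] have "B.nm.lims (%k. f (x k) \<otimes>\<^bsub>B\<^esub> f (y k)) (F (a \<otimes>\<^bsub>A\<^esub> b))"
   using x(1) y(1) by (simp add: fD)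
  then show "F (a \<otimes>\<^bsub>A\<^esub> b) = F a \<otimes>\<^bsub>B\<^esub> F b"
   by (rule B.lims_unique) (rule B.nm.lims_mult[OF Fx Fy])
 next
  fix a c assume a: "a \<in> carrier A"
  obtain x where x: "!!k. x k \<in> carrier X" "A.nm.lims (%k. j (x k)) a" using F4[OF a] by blast
  note Fx = F2[OF x]
  have "A.nm.lims (%k. j (scale X c (x k))) (scale A c a)"
   using A.nm.lims_scale[OF x(2), of c] x(1) by (simp add: jD)
  from F2[OF _ this] have "B.nm.lims (%k. scale B c (f (x k))) (F (scale A c a))"
   using x(1) by (simp add: fD)
  then show "F (scale A c a) = scale B c (F a)"
   by (rule B.lims_unique) (rule B.nm.lims_scale[OF Fx])
 next
  fix a assume a: "a \<in> carrier A"
  obtain x where x: "!!k. x k \<in> carrier X" "A.nm.lims (%k. j (x k)) a" using F4[OF a] by blast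
  note Fx = F2[OF x]
  have "A.nm.lims (%k. j (star X (x k))) (star A a)"
   using A.nm.lims_star[OF x(2)] x(1) by (simp add: jD)
  from F2[OF _ this] have "B.nm.lims (%k. star B (f (x k))) (F (star A a))"
   using x(1) by (simp add: fD)
  then show "F (star A a) = star B (F a)"
   by (rule B.lims_unique) (rule B.nm.lims_star[OF Fx])
 next
  show "F \<one>\<^bsub>A\<^esub> = \<one>\<^bsub>B\<^esub>" using F3[of "\<one>\<^bsub>X\<^esub>"] jD(4) fD(4) by simp
 qed (rule F1)
 then show ?thesis using F3 by blast
qed

lemma complex_alg_simps [simp]:
 "carrier complex_alg = UNIV" "x \<otimes>\<^bsub>complex_alg\<^esub> y = x * y" "\<one>\<^bsub>complex_alg\<^esub> = 1" "\<zero>\<^bsub>complex_alg\<^esub> = 0"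
 "x \<oplus>\<^bsub>complex_alg\<^esub> y = x + y" "scale complex_alg c x = c * x" "star complex_alg x = cnj x"
 "nrm complex_alg x = cmod x"
 by (simp_all add: complex_alg_def)

lemma star_algebra_complex: "star_algebra complex_alg"
proof -
 have ab: "abelian_group complex_alg"
  by (rule abelian_groupI) (auto intro: exI[of _ "- _"] simp: add_eq_0_iff)
 have "ring complex_alg"
  by (rule ringI[OF ab]) (auto intro!: monoidI simp: algebra_simps)
 then show ?thesis
  by (intro star_algebra.intro star_algebra_axioms.intro) (auto simp: algebra_simps)
qed

lemma complex_alg_minus [simp]: "x \<ominus>\<^bsub>complex_alg\<^esub> y = x - y"
proof -
 interpret star_algebra complex_alg by (rule star_algebra_complex)
 show ?thesis by (simp add: minus_conv)
qed

lemma cstar_algebra_complex: "cstar_algebra complex_alg"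
proof (intro cstar_algebra.intro star_algebra_complex cstar_algebra_axioms.intro)
 show "cstar_seminorm complex_alg (nrm complex_alg)"
  by (auto simp: cstar_seminorm_def norm_triangle_ineq norm_mult power2_eq_square)
 show "\<exists>l\<in>carrier complex_alg. (%k. nrm complex_alg (X k \<ominus>\<^bsub>complex_alg\<^esub> l)) \<longlonglongrightarrow> 0"
  if "X \<in> cauchy_seqs complex_alg (nrm complex_alg)" for X
 proof -
  have "Cauchy X" using that by (simp add: cauchy_seqs_def Cauchy_def dist_norm)
  then obtain l where "X \<longlonglongrightarrow> l" using Cauchy_convergent convergent_def by blast
  then have "(%k. cmod (X k - l)) \<longlonglongrightarrow> 0" using LIM_zero tendsto_norm_zero by blast
  then show ?thesis by auto
 qed
qed auto

lemma lims_complex_iff: "star_seminorm.lims complex_alg (nrm complex_alg) X l \<longleftrightarrow> X \<longlonglongrightarrow> l"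
proof -
 interpret cstar_algebra complex_alg by (rule cstar_algebra_complex)
 show ?thesis by (simp add: nm.lims_def tendsto_norm_zero_iff LIM_zero_iff)
qed

section \<open>The completion of a *-algebra for a C*-seminorm\<close>

context star_seminorm
begin

text \<open>An intermediate algebra with pointwise operations, whose axioms are immediate and pass
  to the completion by \<open>star_algebra_image\<close>.\<close>

definition seq_alg :: "(nat => 'a) star_alg" where
 "seq_alg = \<lparr>carrier = cauchy_seqs A p, monoid.mult = %x y k. x k \<otimes> y k, one = %k. \<one>,
   zero = %k. \<zero>, add = %x y k. x k \<oplus> y k, scale = %c x k. scale A c (x k), star = %x k. star A (x k)\<rparr>"

abbreviation cs where "cs == cauchy_seqs A p"
abbreviation cl where "cl == cls A p"

lemma cauchyD: "x \<in> cs ==> x k \<in> carrier A"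
 "x \<in> cs ==> e > 0 ==> \<exists>N. \<forall>k\<ge>N. \<forall>m\<ge>N. p (x k \<ominus> x m) < e"
 by (auto simp: cauchy_seqs_def)

lemma cauchy_norm_convergent:
 assumes x: "x \<in> cs" shows "convergent (%k. p (x k))"
proof -
 have "Cauchy (%k. p (x k))"
  unfolding Cauchy_def dist_real_def
 proof (intro allI impI)
  fix e :: real assume "e > 0"
  then obtain N where N: "\<forall>k\<ge>N. \<forall>m\<ge>N. p (x k \<ominus> x m) < e" using cauchyD(2)[OF x] by blast
  then show "\<exists>M. \<forall>m\<ge>M. \<forall>n\<ge>M. \<bar>p (x m) - p (x n)\<bar> < e"
   using p_diff_le[OF cauchyD(1)[OF x] cauchyD(1)[OF x]] by (meson order.strict_trans1)
 qed
 then show ?thesis by (rule Cauchy_convergent)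
qed

lemma cauchy_bounded:
 assumes x: "x \<in> cs" obtains M where "M > 0" "!!k. p (x k) <= M"
proof -
 have "Bseq (%k. p (x k))" using cauchy_norm_convergent[OF x] by (rule convergent_imp_Bseq)
 then obtain M where "M > 0" "!!k. norm (p (x k)) <= M" by (auto simp: Bseq_def)
 then show ?thesis using that[of M] by (metis abs_le_D1 real_norm_def)
qed

lemma cauchy_combine:
 assumes x: "x \<in> cs" and y: "y \<in> cs" and z: "!!k. z k \<in> carrier A"
  and M: "M > 0" and le: "!!k m. p (z k \<ominus> z m) <= M * (p (x k \<ominus> x m) + p (y k \<ominus> y m))"
 shows "z \<in> cs"
 unfolding cauchy_seqs_def
proof (intro CollectI conjI allI impI)
 fix e :: real assume e: "e > 0"
 define d where "d = e / (2 * M)"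
 have d: "d > 0" "M * (d + d) = e" using e M by (auto simp: d_def)
 obtain N1 where N1: "\<forall>k\<ge>N1. \<forall>m\<ge>N1. p (x k \<ominus> x m) < d" using cauchyD(2)[OF x d(1)] by blast
 obtain N2 where N2: "\<forall>k\<ge>N2. \<forall>m\<ge>N2. p (y k \<ominus> y m) < d" using cauchyD(2)[OF y d(1)] by blast
 have "p (z k \<ominus> z m) < e" if "k \<ge> max N1 N2" "m \<ge> max N1 N2" for k m
 proof -
  have "p (x k \<ominus> x m) + p (y k \<ominus> y m) < d + d" using N1 N2 that by (intro add_strict_mono) auto
  then have "M * (p (x k \<ominus> x m) + p (y k \<ominus> y m)) < M * (d + d)" using M by simp
  then show ?thesis using le[of k m] d(2) by linarith
 qed
 then show "\<exists>N. \<forall>k\<ge>N. \<forall>m\<ge>N. p (z k \<ominus> z m) < e" by blast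
qed (rule z)

lemma cauchy_add: assumes x: "x \<in> cs" and y: "y \<in> cs"
 shows "(%k. x k \<oplus> y k) \<in> cs"
 by (rule cauchy_combine[OF x y, of _ 1])
  (use cauchyD(1)[OF x] cauchyD(1)[OF y] in \<open>auto simp: minus_swap4 p_add\<close>)

lemma cauchy_scale: assumes x: "x \<in> cs" shows "(%k. scale A c (x k)) \<in> cs"
proof (rule cauchy_combine[OF x x, of _ "cmod c + 1"])
 show "0 < cmod c + 1" by (simp add: add_nonneg_pos)
 fix k m
 have "cmod c * p (x k \<ominus> x m) <= (cmod c + 1) * (p (x k \<ominus> x m) + p (x k \<ominus> x m))"
  using cauchyD(1)[OF x] by (intro mult_mono) auto
 then show "p (scale A c (x k) \<ominus> scale A c (x m)) <= (cmod c + 1) * (p (x k \<ominus> x m) + p (x k \<ominus> x m))"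
  using cauchyD(1)[OF x] by (simp add: scale_minus[symmetric] p_scale)
qed (use cauchyD(1)[OF x] in auto)

lemma cauchy_star: assumes x: "x \<in> cs" shows "(%k. star A (x k)) \<in> cs"
 by (rule cauchy_combine[OF x x, of _ 1])
  (use cauchyD(1)[OF x] in \<open>auto simp: star_minus[symmetric]\<close>)

lemma cauchy_const: "x \<in> carrier A ==> (%k. x) \<in> cs"
 by (auto simp: cauchy_seqs_def)

lemma mult_diff_le:
 assumes "a \<in> carrier A" "b \<in> carrier A" "c \<in> carrier A" "d \<in> carrier A" "p a <= M" "p d <= M"
 shows "p (a \<otimes> b \<ominus> c \<otimes> d) <= M * (p (a \<ominus> c) + p (b \<ominus> d))"
proof -
 have "p (a \<otimes> b \<ominus> c \<otimes> d) <= p (a \<otimes> b \<ominus> a \<otimes> d) + p (a \<otimes> d \<ominus> c \<otimes> d)"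
  using assms by (intro p_triangle) auto
 also have "... = p (a \<otimes> (b \<ominus> d)) + p ((a \<ominus> c) \<otimes> d)"
  using assms by (simp add: r_distr_minus l_distr_minus)
 also have "... <= p a * p (b \<ominus> d) + p (a \<ominus> c) * p d"
  using assms by (intro add_mono p_mult) auto
 also have "... <= M * p (b \<ominus> d) + p (a \<ominus> c) * M"
  using assms by (intro add_mono mult_right_mono mult_left_mono) auto
 finally show ?thesis by (simp add: algebra_simps)
qed

lemma cauchy_mult: assumes x: "x \<in> cs" and y: "y \<in> cs"
 shows "(%k. x k \<otimes> y k) \<in> cs"
proof -
 obtain M where M: "M > 0" "!!k. p (x k) <= M" using cauchy_bounded[OF x] by blast
 obtain N where N: "N > 0" "!!k. p (y k) <= N" using cauchy_bounded[OF y] by blast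
 show ?thesis
 proof (rule cauchy_combine[OF x y, of _ "max M N"])
  show "p (x k \<otimes> y k \<ominus> x m \<otimes> y m) <= max M N * (p (x k \<ominus> x m) + p (y k \<ominus> y m))" for k m
   using cauchyD(1)[OF x] cauchyD(1)[OF y] M N by (intro mult_diff_le) (auto simp: le_max_iff_disj)
 qed (use cauchyD(1)[OF x] cauchyD(1)[OF y] M in auto)
qed

lemma star_algebra_seq: "star_algebra seq_alg"
proof -
 note cl = cauchy_add cauchy_mult cauchy_scale cauchy_star cauchyD(1)
 have neg: "scale A (- 1) v \<oplus> v = \<zero>" if "v \<in> carrier A" for v
  using that by (simp add: scale_minus_one[symmetric] l_neg)
 have ab: "abelian_group seq_alg"
 proof (rule abelian_groupI)
  show "\<exists>y\<in>carrier seq_alg. y \<oplus>\<^bsub>seq_alg\<^esub> x = \<zero>\<^bsub>seq_alg\<^esub>" if "x \<in> carrier seq_alg" for x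
   by (rule bexI[of _ "%k. scale A (-1) (x k)"])
    (use that neg in \<open>auto simp: seq_alg_def cl\<close>)
 qed (auto simp: seq_alg_def cl a_ac cauchy_const)
 have mo: "monoid seq_alg"
  by (rule monoidI) (auto simp: seq_alg_def cl m_assoc cauchy_const)
 have ri: "ring seq_alg"
  by (rule ringI[OF ab mo]) (auto simp: seq_alg_def cl l_distr r_distr)
 show ?thesis
  by (intro star_algebra.intro ri star_algebra_axioms.intro)
   (auto simp: seq_alg_def cl star_ops add_scale)
qed

lemma cls_mem_iff: "y \<in> cl x \<longleftrightarrow> y \<in> cs & (%k. p (x k \<ominus> y k)) \<longlonglongrightarrow> 0"
 by (simp add: cls_def)

lemma cls_self: "x \<in> cs ==> x \<in> cl x"
 by (simp add: cls_mem_iff cauchyD)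

lemma cls_eqI:
 assumes x: "x \<in> cs" and y: "y \<in> cs" and l: "(%k. p (x k \<ominus> y k)) \<longlonglongrightarrow> 0"
 shows "cl x = cl y"
proof -
 have *: "z \<in> cl v" if u: "u \<in> cs" and v: "v \<in> cs"
  and l: "(%k. p (u k \<ominus> v k)) \<longlonglongrightarrow> 0" and z: "z \<in> cl u" for u v z
 proof -
  have zc: "z \<in> cs" "(%k. p (u k \<ominus> z k)) \<longlonglongrightarrow> 0" using z by (auto simp: cls_mem_iff)
  have "(%k. p (v k \<ominus> z k)) \<longlonglongrightarrow> 0"
  proof (rule tendsto_sandwich[of "%_. 0" _ _ "%k. p (u k \<ominus> v k) + p (u k \<ominus> z k)"])
   show "\<forall>\<^sub>F k in sequentially. p (v k \<ominus> z k) <= p (u k \<ominus> v k) + p (u k \<ominus> z k)"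
    using p_triangle[of "v _" "u _" "z _"] p_minus_commute[of "v _" "u _"]
     cauchyD(1)[OF u] cauchyD(1)[OF v] cauchyD(1)[OF zc(1)] by (simp add: always_eventually)
   show "(%k. p (u k \<ominus> v k) + p (u k \<ominus> z k)) \<longlonglongrightarrow> 0" using tendsto_add[OF l zc(2)] by simp
  qed (use cauchyD(1)[OF v] cauchyD(1)[OF zc(1)] in \<open>auto intro: always_eventually\<close>)
  then show ?thesis using zc by (simp add: cls_mem_iff)
 qed
 have l': "(%k. p (y k \<ominus> x k)) \<longlonglongrightarrow> 0"
  using l p_minus_commute[OF cauchyD(1)[OF x] cauchyD(1)[OF y]] by simp
 show ?thesis using *[OF x y l] *[OF y x l'] by blast
qed

lemma cls_mem_eq: "x \<in> cs ==> y \<in> cl x ==> cl y = cl x"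
 using cls_eqI[of x y] by (simp add: cls_mem_iff)

abbreviation C :: "(nat => 'a) set cstar_alg" where "C == completion A p"

lemma null_le:
 assumes "(%k. b k) \<longlonglongrightarrow> 0" "!!k. 0 <= a k" "!!k. a k <= M * b k" shows "(%k. a k) \<longlonglongrightarrow> (0::real)"
 by (rule tendsto_sandwich[of "%_. 0" _ _ "%k. M * b k"])
  (use assms tendsto_mult_left[OF assms(1), of M] in \<open>auto intro: always_eventually\<close>)

lemma add_C: assumes x: "x \<in> cs" and y: "y \<in> cs"
 shows "cl x \<oplus>\<^bsub>C\<^esub> cl y = cl (%k. x k \<oplus> y k)"
proof -
 have "cl (%k. x' k \<oplus> y' k) = cl (%k. x k \<oplus> y k)" if "x' \<in> cl x" "y' \<in> cl y" for x' y'
 proof (rule cls_eqI[symmetric])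
  have c: "x' \<in> cs" "y' \<in> cs"
   and l: "(%k. p (x k \<ominus> x' k) + p (y k \<ominus> y' k)) \<longlonglongrightarrow> 0"
   using that tendsto_add[of "%k. p (x k \<ominus> x' k)" 0 _ "%k. p (y k \<ominus> y' k)" 0] by (auto simp: cls_mem_iff)
  show "(%k. x k \<oplus> y k) \<in> cs" "(%k. x' k \<oplus> y' k) \<in> cs"
   using x y c by (auto intro: cauchy_add)
  show "(%k. p ((x k \<oplus> y k) \<ominus> (x' k \<oplus> y' k))) \<longlonglongrightarrow> 0"
   by (rule null_le[OF l, of _ 1])
    (use cauchyD(1)[OF x] cauchyD(1)[OF y] cauchyD(1)[OF c(1)] cauchyD(1)[OF c(2)] in \<open>auto simp: minus_swap4 p_add\<close>)
 qed
 then have "(\<Union>x'\<in>cl x. \<Union>y'\<in>cl y. cl (%k. x' k \<oplus> y' k)) = cl (%k. x k \<oplus> y k)"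
  by (intro UN_eq_const[OF cls_self[OF x]] UN_eq_const[OF cls_self[OF y]])
 then show ?thesis by (simp add: completion_def)
qed

lemma mult_C: assumes x: "x \<in> cs" and y: "y \<in> cs"
 shows "cl x \<otimes>\<^bsub>C\<^esub> cl y = cl (%k. x k \<otimes> y k)"
proof -
 have "cl (%k. x' k \<otimes> y' k) = cl (%k. x k \<otimes> y k)" if "x' \<in> cl x" "y' \<in> cl y" for x' y'
 proof (rule cls_eqI[symmetric])
  have c: "x' \<in> cs" "y' \<in> cs"
   and l: "(%k. p (x k \<ominus> x' k) + p (y k \<ominus> y' k)) \<longlonglongrightarrow> 0"
   using that tendsto_add[of "%k. p (x k \<ominus> x' k)" 0 _ "%k. p (y k \<ominus> y' k)" 0] by (auto simp: cls_mem_iff)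
  show "(%k. x k \<otimes> y k) \<in> cs" "(%k. x' k \<otimes> y' k) \<in> cs"
   using x y c by (auto intro: cauchy_mult)
  obtain M where M: "M > 0" "!!k. p (x k) <= M" using cauchy_bounded[OF x] by blast
  obtain N where N: "N > 0" "!!k. p (y' k) <= N" using cauchy_bounded[OF c(2)] by blast
  show "(%k. p ((x k \<otimes> y k) \<ominus> (x' k \<otimes> y' k))) \<longlonglongrightarrow> 0"
  proof (rule null_le[OF l, of _ "max M N"])
   show "p ((x k \<otimes> y k) \<ominus> (x' k \<otimes> y' k)) <= max M N * (p (x k \<ominus> x' k) + p (y k \<ominus> y' k))" for k
    by (rule mult_diff_le) (use cauchyD(1)[OF x] cauchyD(1)[OF y] cauchyD(1)[OF c(1)] cauchyD(1)[OF c(2)] M N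
     in \<open>auto simp: le_max_iff_disj\<close>)
  qed (use cauchyD(1)[OF x] cauchyD(1)[OF y] cauchyD(1)[OF c(1)] cauchyD(1)[OF c(2)] in auto)
 qed
 then have "(\<Union>x'\<in>cl x. \<Union>y'\<in>cl y. cl (%k. x' k \<otimes> y' k)) = cl (%k. x k \<otimes> y k)"
  by (intro UN_eq_const[OF cls_self[OF x]] UN_eq_const[OF cls_self[OF y]])
 then show ?thesis by (simp add: completion_def)
qed

lemma scale_C: assumes x: "x \<in> cs"
 shows "scale C c (cl x) = cl (%k. scale A c (x k))"
proof -
 have "cl (%k. scale A c (x' k)) = cl (%k. scale A c (x k))" if "x' \<in> cl x" for x'
 proof (rule cls_eqI[symmetric])
  have c: "x' \<in> cs" and l: "(%k. p (x k \<ominus> x' k)) \<longlonglongrightarrow> 0"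
   using that by (auto simp: cls_mem_iff)
  show "(%k. scale A c (x k)) \<in> cs" "(%k. scale A c (x' k)) \<in> cs"
   using x c by (auto intro: cauchy_scale)
  show "(%k. p (scale A c (x k) \<ominus> scale A c (x' k))) \<longlonglongrightarrow> 0"
   by (rule null_le[OF l, of _ "cmod c"])
    (use cauchyD(1)[OF x] cauchyD(1)[OF c(1)] in \<open>auto simp: scale_minus[symmetric] p_scale\<close>)
 qed
 then have "(\<Union>x'\<in>cl x. cl (%k. scale A c (x' k))) = cl (%k. scale A c (x k))"
  by (intro UN_eq_const[OF cls_self[OF x]])
 then show ?thesis by (simp add: completion_def)
qed

lemma star_C: assumes x: "x \<in> cs"
 shows "star C (cl x) = cl (%k. star A (x k))"
proof -
 have "cl (%k. star A (x' k)) = cl (%k. star A (x k))" if "x' \<in> cl x" for x'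
 proof (rule cls_eqI[symmetric])
  have c: "x' \<in> cs" and l: "(%k. p (x k \<ominus> x' k)) \<longlonglongrightarrow> 0"
   using that by (auto simp: cls_mem_iff)
  show "(%k. star A (x k)) \<in> cs" "(%k. star A (x' k)) \<in> cs"
   using x c by (auto intro: cauchy_star)
  show "(%k. p (star A (x k) \<ominus> star A (x' k))) \<longlonglongrightarrow> 0"
   by (rule null_le[OF l, of _ 1])
    (use cauchyD(1)[OF x] cauchyD(1)[OF c(1)] in \<open>auto simp: star_minus[symmetric]\<close>)
 qed
 then have "(\<Union>x'\<in>cl x. cl (%k. star A (x' k))) = cl (%k. star A (x k))"
  by (intro UN_eq_const[OF cls_self[OF x]])
 then show ?thesis by (simp add: completion_def)
qed

lemma carrier_C: "carrier C = cl ` cs"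
 by (simp add: completion_def)

lemma one_C: "\<one>\<^bsub>C\<^esub> = cl (%k. \<one>)" and zero_C: "\<zero>\<^bsub>C\<^esub> = cl (%k. \<zero>)"
 by (simp_all add: completion_def)

text \<open>The norms along a representative converge, and to the same limit for equivalent ones, so
  the definite description in \<open>completion\<close> denotes.\<close>

lemma nrm_C: assumes x: "x \<in> cs" shows "(%k. p (x k)) \<longlonglongrightarrow> nrm C (cl x)"
proof -
 obtain r where r: "(%k. p (x k)) \<longlonglongrightarrow> r" using cauchy_norm_convergent[OF x] convergent_def by blast
 have y: "(%k. p (y k)) \<longlonglongrightarrow> r" if "y \<in> cl x" for y
 proof -
  have c: "y \<in> cs" and l: "(%k. p (x k \<ominus> y k)) \<longlonglongrightarrow> 0"
   using that by (auto simp: cls_mem_iff)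
  have "(%k. p (x k) - p (y k)) \<longlonglongrightarrow> 0"
   by (rule tendsto_0_le[OF l, where K = 1])
    (use p_diff_le[OF cauchyD(1)[OF x] cauchyD(1)[OF c]] cauchyD(1)[OF x] cauchyD(1)[OF c] in \<open>auto intro!: always_eventually\<close>)
  from tendsto_diff[OF r this] show ?thesis by simp
 qed
 have "nrm C (cl x) = (THE r. \<forall>y\<in>cl x. (%k. p (y k)) \<longlonglongrightarrow> r)"
  by (simp add: completion_def)
 also have "... = r"
 proof (rule the_equality)
  show "r' = r" if "\<forall>y\<in>cl x. (%k. p (y k)) \<longlonglongrightarrow> r'" for r'
   using that cls_self[OF x] r LIMSEQ_unique by blast
 qed (use y in blast)
 finally show ?thesis using r by simp
qed

lemma star_algebra_C: "star_algebra C"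
 by (rule star_algebra_image[OF star_algebra_seq, of "cl"])
  (simp_all add: seq_alg_def carrier_C add_C mult_C scale_C star_C one_C zero_C)

lemma minus_C: assumes x: "x \<in> cs" and y: "y \<in> cs"
 shows "cl x \<ominus>\<^bsub>C\<^esub> cl y = cl (%k. x k \<ominus> y k)"
proof -
 interpret C: star_algebra C by (rule star_algebra_C)
 have "cl x \<ominus>\<^bsub>C\<^esub> cl y = cl (%k. x k \<oplus> scale A (-1) (y k))"
  using x y by (simp add: C.minus_conv carrier_C scale_C add_C cauchy_scale)
 then show ?thesis using cauchyD(1)[OF x] cauchyD(1)[OF y] by (simp add: minus_conv)
qed

lemma cauchy_minus: assumes x: "x \<in> cs" and y: "y \<in> cs"
 shows "(%k. x k \<ominus> y k) \<in> cs"
 using cauchy_add[OF x cauchy_scale[OF y, of "-1"]] cauchyD(1)[OF x] cauchyD(1)[OF y]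
 by (simp add: minus_conv)

lemma nrm_C_le: "x \<in> cs ==> (!!k. k \<ge> N ==> p (x k) <= c) ==> nrm C (cl x) <= c"
 by (rule LIMSEQ_le_const2[OF nrm_C]) auto

lemma seminorm_C: "cstar_seminorm C (nrm C)"
proof -
 have "nrm C (cl x) \<ge> 0" if "x \<in> cs" for x
  by (rule LIMSEQ_le_const[OF nrm_C[OF that]]) (use cauchyD(1)[OF that] in auto)
 moreover have "nrm C (cl (%k. x k \<oplus> y k)) <= nrm C (cl x) + nrm C (cl y)"
  if "x \<in> cs" "y \<in> cs" for x y
  by (rule LIMSEQ_le[OF nrm_C[OF cauchy_add[OF that]] tendsto_add[OF nrm_C[OF that(1)] nrm_C[OF that(2)]]])
   (use cauchyD(1)[OF that(1)] cauchyD(1)[OF that(2)] p_add in auto)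
 moreover have "nrm C (cl (%k. scale A c (x k))) = cmod c * nrm C (cl x)"
  if "x \<in> cs" for x c
  using LIMSEQ_unique[OF nrm_C[OF cauchy_scale[OF that, of c]]] tendsto_mult_left[OF nrm_C[OF that], of "cmod c"]
   cauchyD(1)[OF that] by (simp add: p_scale)
 moreover have "nrm C (cl (%k. x k \<otimes> y k)) <= nrm C (cl x) * nrm C (cl y)"
  if "x \<in> cs" "y \<in> cs" for x y
  by (rule LIMSEQ_le[OF nrm_C[OF cauchy_mult[OF that]] tendsto_mult[OF nrm_C[OF that(1)] nrm_C[OF that(2)]]])
   (use cauchyD(1)[OF that(1)] cauchyD(1)[OF that(2)] p_mult in auto)
 moreover have "nrm C (cl (%k. star A (x k) \<otimes> x k)) = (nrm C (cl x))^2"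
  if "x \<in> cs" for x
  using LIMSEQ_unique[OF nrm_C[OF cauchy_mult[OF cauchy_star[OF that] that]]] tendsto_power[OF nrm_C[OF that], of 2]
   cauchyD(1)[OF that] by (simp add: p_cstar)
 ultimately show ?thesis
  unfolding cstar_seminorm_def carrier_C
  by (simp add: add_C mult_C scale_C star_C cauchy_star)
qed

lemma completion_dense:
 assumes a: "a \<in> carrier C" and e: "e > 0"
 shows "\<exists>x\<in>carrier A. nrm C (a \<ominus>\<^bsub>C\<^esub> cl (%k. x)) < e"
proof -
 obtain x where x: "x \<in> cs" "a = cl x" using a by (auto simp: carrier_C)
 obtain N where N: "\<forall>k\<ge>N. \<forall>m\<ge>N. p (x k \<ominus> x m) < e / 2" using cauchyD(2)[OF x(1), of "e/2"] e by auto
 have "nrm C (cl (%k. x k \<ominus> x N)) <= e / 2"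
  by (rule nrm_C_le[of _ N]) (use N x cauchy_minus[OF x(1) cauchy_const] cauchyD(1)[OF x(1)] in \<open>auto intro: less_imp_le\<close>)
 then have "nrm C (a \<ominus>\<^bsub>C\<^esub> cl (%k. x N)) < e"
  using e x cauchyD(1)[OF x(1)] by (simp add: minus_C cauchy_const)
 then show ?thesis using cauchyD(1)[OF x(1)] by blast
qed

lemma nrm_C_const: "x \<in> carrier A ==> nrm C (cl (%k. x)) = p x"
 using nrm_C[OF cauchy_const[of x]] by (simp add: LIMSEQ_const_iff)

lemma cauchy_lims_C:
 assumes x: "x \<in> cs"
 shows "star_seminorm.lims C (nrm C) (%k. cl (%_. x k)) (cl x)"
proof -
 interpret C: star_seminorm C "nrm C" by (rule star_seminormI[OF star_algebra_C seminorm_C])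
 have "(%k. nrm C (cl (%_. x k) \<ominus>\<^bsub>C\<^esub> cl x)) \<longlonglongrightarrow> 0"
 proof (rule LIMSEQ_I)
  fix e :: real assume e: "e > 0"
  obtain N where N: "\<forall>k\<ge>N. \<forall>m\<ge>N. p (x k \<ominus> x m) < e / 2" using cauchyD(2)[OF x(1), of "e/2"] e by auto
  have le: "nrm C (cl (%_. x k) \<ominus>\<^bsub>C\<^esub> cl x) <= e / 2" if k: "k \<ge> N" for k
  proof -
   have "nrm C (cl (%m. x k \<ominus> x m)) <= e / 2"
    by (rule nrm_C_le[of _ N, OF cauchy_minus[OF cauchy_const x]])
     (use N k cauchyD(1)[OF x] in \<open>auto intro: less_imp_le\<close>)
   then show ?thesis using cauchyD(1)[OF x] x by (simp add: minus_C cauchy_const)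
  qed
  have ge: "nrm C (cl (%_. x k) \<ominus>\<^bsub>C\<^esub> cl x) \<ge> 0" for k
   using x cauchyD(1)[OF x] by (intro C.p_nonneg C.minus_closed) (auto simp: carrier_C cauchy_const)
  have "norm (nrm C (cl (%_. x k) \<ominus>\<^bsub>C\<^esub> cl x) - 0) < e" if "k \<ge> N" for k
   using e le[OF that] ge[of k] by simp
  then show "\<exists>no. \<forall>n\<ge>no. norm (nrm C (cl (%_. x n) \<ominus>\<^bsub>C\<^esub> cl x) - 0) < e" by blast
 qed
 then show ?thesis
  unfolding C.lims_def using x cauchyD(1)[OF x] by (auto simp: carrier_C cauchy_const)
qed

lemma cstar_algebra_C: "cstar_algebra C"
proof (rule cstar_algebraI[OF star_algebra_C seminorm_C])
 interpret C: star_seminorm C "nrm C" by (rule star_seminormI[OF star_algebra_C seminorm_C])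
 fix a assume a: "a \<in> carrier C" "nrm C a = 0"
 then obtain x where x: "x \<in> cs" "a = cl x" by (auto simp: carrier_C)
 have "cl x = cl (%k. \<zero>)"
  by (rule cls_eqI) (use nrm_C[OF x(1)] x a cauchyD(1)[OF x(1)] cauchy_const in \<open>auto simp: minus_eq\<close>)
 then show "a = \<zero>\<^bsub>C\<^esub>" using x by (simp add: zero_C)
next
 interpret C: star_seminorm C "nrm C" by (rule star_seminormI[OF star_algebra_C seminorm_C])
 fix X assume X: "!!k::nat. X k \<in> carrier C" and le: "!!k. nrm C (X (Suc k) \<ominus>\<^bsub>C\<^esub> X k) <= (1/2)^k"
 have "\<exists>x\<in>carrier A. nrm C (X k \<ominus>\<^bsub>C\<^esub> cl (%_. x)) < (1/2)^k" for k
  by (rule completion_dense[OF X]) simp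
 then obtain y where y: "!!k. y k \<in> carrier A" "!!k. nrm C (X k \<ominus>\<^bsub>C\<^esub> cl (%_. y k)) < (1/2)^k"
  by metis
 define d where "d k = cl (%_. y k)" for k
 have d: "d k \<in> carrier C" for k using y(1) by (auto simp: d_def carrier_C cauchy_const)
 \<comment> \<open>The detour through \<open>X (Suc k)\<close> and \<open>X k\<close> costs
   (1/2)^(k+1) + (1/2)^k + (1/2)^k, which is below 3 (1/2)^k.\<close>
 have "p (y (Suc k) \<ominus> y k) <= 3 * (1/2)^k" for k
 proof -
  have "p (y (Suc k) \<ominus> y k) = nrm C (d (Suc k) \<ominus>\<^bsub>C\<^esub> d k)"
   using y(1) by (simp add: d_def minus_C cauchy_const nrm_C_const)
  also have "... <= nrm C (d (Suc k) \<ominus>\<^bsub>C\<^esub> X (Suc k)) + nrm C (X (Suc k) \<ominus>\<^bsub>C\<^esub> d k)"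
   using d X by (intro C.p_triangle)
  also have "nrm C (X (Suc k) \<ominus>\<^bsub>C\<^esub> d k) <= nrm C (X (Suc k) \<ominus>\<^bsub>C\<^esub> X k) + nrm C (X k \<ominus>\<^bsub>C\<^esub> d k)"
   using d X by (intro C.p_triangle)
  also have "nrm C (d (Suc k) \<ominus>\<^bsub>C\<^esub> X (Suc k)) = nrm C (X (Suc k) \<ominus>\<^bsub>C\<^esub> d (Suc k))"
   using d X by (intro C.p_minus_commute)
  finally have "p (y (Suc k) \<ominus> y k) <= (1/2) ^ Suc k + ((1/2) ^ k + (1/2) ^ k)"
   using y(2)[of k] y(2)[of "Suc k"] le[of k] unfolding d_def by linarith
  moreover have "(0::real) <= (1/2) ^ k" by simp
  ultimately show ?thesis unfolding power_Suc by linarith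
 qed
 then have yc: "y \<in> cs" by (rule cauchy_geometric(1)[OF y(1)])
 have l: "C.lims d (cl y)" using cauchy_lims_C[OF yc] by (simp add: d_def[abs_def])
 have "C.lims X (cl y)"
 proof (rule C.lims_bound)
  show "nrm C (X k \<ominus>\<^bsub>C\<^esub> cl y) <= (1/2)^k + nrm C (d k \<ominus>\<^bsub>C\<^esub> cl y)" for k
   using C.p_triangle[OF X d C.limsD(2)[OF l], of k k] y(2)[of k] by (simp add: d_def)
  have "(%k. (1/2)^k + nrm C (d k \<ominus>\<^bsub>C\<^esub> cl y)) \<longlonglongrightarrow> 0 + 0"
   by (intro tendsto_add LIMSEQ_power_zero C.limsD(3)[OF l]) auto
  then show "(%k. (1/2)^k + nrm C (d k \<ominus>\<^bsub>C\<^esub> cl y)) \<longlonglongrightarrow> 0" by simp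
 qed (use X C.limsD(2)[OF l] in auto)
 then show "\<exists>l. C.lims X l" by blast
qed

lemma completion_hom: "(%x. cl (%k. x)) \<in> cstar_hom A C"
 by (rule cstar_homI)
  (auto simp: carrier_C cauchy_const add_C mult_C scale_C star_C one_C)

end

text \<open>\<open>F\<close> is the union over representatives that appears in
  \<open>univ_map\<close>. It agrees with the extension \<open>G\<close> by density, since a class
  is the limit of the constant classes of its representative.\<close>

lemma completion_map:
 assumes X: "star_seminorm X p" and Y: "star_seminorm Y q" and f: "f \<in> cstar_hom X Y"
  and le: "!!x. x \<in> carrier X ==> q (f x) <= p x"
 defines "F == %C. \<Union>x\<in>C. cls Y q (%k. f (x k))"
 shows "F \<in> cstar_hom (completion X p) (completion Y q)"
  and "!!x. x \<in> carrier X ==> F (cls X p (%k. x)) = cls Y q (%k. f x)"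
proof -
 interpret X: star_seminorm X p by fact
 interpret Y: star_seminorm Y q by fact
 interpret CX: cstar_algebra X.C by (rule X.cstar_algebra_C)
 interpret CY: cstar_algebra Y.C by (rule Y.cstar_algebra_C)
 note fD = cstar_homD[OF f]
 have "\<exists>F\<in>cstar_hom X.C Y.C. \<forall>x\<in>carrier X. F (cls X p (%k. x)) = ((%x. cls Y q (%k. x)) \<circ> f) x"
  by (rule hom_extension[OF X.star_alg X.cstar_algebra_C Y.cstar_algebra_C
     X.completion_hom cstar_hom_comp[OF f Y.completion_hom]])
   (use le X.completion_dense in \<open>auto simp: X.nrm_C_const Y.nrm_C_const fD\<close>)
 then obtain G where G: "G \<in> cstar_hom X.C Y.C"
  and Gx: "!!x. x \<in> carrier X ==> G (cls X p (%k. x)) = cls Y q (%k. f x)" by auto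
 have fc: "(%k. f (x k)) \<in> cauchy_seqs Y q" if x: "x \<in> cauchy_seqs X p" for x
  unfolding cauchy_seqs_def
 proof (intro CollectI conjI allI impI)
  fix e :: real assume "e > 0"
  then obtain N where N: "\<forall>k\<ge>N. \<forall>m\<ge>N. p (x k \<ominus>\<^bsub>X\<^esub> x m) < e" using X.cauchyD(2)[OF x] by blast
  have "q (f (x k) \<ominus>\<^bsub>Y\<^esub> f (x m)) <= p (x k \<ominus>\<^bsub>X\<^esub> x m)" for k m
   using le[of "x k \<ominus>\<^bsub>X\<^esub> x m"] X.cauchyD(1)[OF x]
   by (simp add: cstar_hom_minus[OF X.star_alg Y.star_alg f])
  then show "\<exists>N. \<forall>k\<ge>N. \<forall>m\<ge>N. q (f (x k) \<ominus>\<^bsub>Y\<^esub> f (x m)) < e"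
   using N by (meson order.strict_trans1)
 qed (use X.cauchyD(1)[OF x] fD in auto)
 have FG: "F (cls X p x) = G (cls X p x)" if x: "x \<in> cauchy_seqs X p" for x
  unfolding F_def
 proof (rule UN_eq_const[OF X.cls_self[OF x]])
  fix y assume y: "y \<in> cls X p x"
  then have yc: "y \<in> cauchy_seqs X p" by (simp add: X.cls_mem_iff)
  have "CY.nm.lims (%k. G (cls X p (%_. y k))) (G (cls X p y))"
   by (rule cstar_hom_lims[OF X.cstar_algebra_C Y.cstar_algebra_C G X.cauchy_lims_C[OF yc]])
  then have "CY.nm.lims (%k. cls Y q (%_. f (y k))) (G (cls X p y))"
   using X.cauchyD(1)[OF yc] by (simp add: Gx)
  then show "cls Y q (%k. f (y k)) = G (cls X p x)"
   using CY.lims_unique[OF Y.cauchy_lims_C[OF fc[OF yc]]] X.cls_mem_eq[OF x y] by simp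
 qed
 show "F \<in> cstar_hom X.C Y.C"
  by (rule cstar_hom_cong[OF X.star_algebra_C G]) (auto simp: X.carrier_C FG)
 show "F (cls X p (%k. x)) = cls Y q (%k. f x)" if "x \<in> carrier X" for x
  using that by (simp add: FG Gx X.cauchy_const)
qed

section \<open>Universal C*-algebras and monoid algebras\<close>

text \<open>Makes the set in \<open>univ_seminorm\<close> bounded above at every element, so that
  its \<open>Sup\<close> is a genuine supremum.\<close>

definition bounded_rel :: "('a, 'm) star_alg_scheme => 'a set => bool" where
 "bounded_rel X R \<longleftrightarrow> (\<forall>x\<in>carrier X. \<exists>M. \<forall>p. cstar_seminorm X p --> (\<forall>r\<in>R. p r = 0) --> p x <= M)"

locale univ_alg = star_algebra A for A :: "('a, 'm) star_alg_scheme" (structure) +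
 fixes R :: "'a set"
 assumes bounded: "bounded_rel A R"
begin

abbreviation admissible :: "('a => real) => bool" where
 "admissible p == cstar_seminorm A p & (\<forall>r\<in>R. p r = 0)"

abbreviation un :: "'a => real" where "un == univ_seminorm A R"

lemma un_upper: "admissible p ==> x \<in> carrier A ==> p x <= un x"
 unfolding univ_seminorm_def
proof (rule cSup_upper)
 assume x: "x \<in> carrier A"
 then obtain M where "\<forall>p. cstar_seminorm A p --> (\<forall>r\<in>R. p r = 0) --> p x <= M"
  using bounded unfolding bounded_rel_def by blast
 then show "bdd_above {p x |p. admissible p}" by (auto simp: bdd_above_def)
qed blast

lemma admissible_zero: "admissible (%_. 0)"
 by (simp add: cstar_seminorm_def)

lemma un_least: "(!!p. admissible p ==> p x <= c) ==> un x <= c"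
 unfolding univ_seminorm_def
 by (rule cSup_least) (use admissible_zero in auto)

text \<open>Upper bounds pass through the supremum one seminorm at a time. For the lower half of the
  C*-identity the bound on squares is turned by a square root into a bound on each value
  \<open>p x\<close>.\<close>

lemma un_seminorm: "cstar_seminorm A un"
proof -
 have nn: "0 <= un x" if "x \<in> carrier A" for x
  using un_upper[OF admissible_zero that] .
 have pd: "0 <= p x" "p (x \<oplus> y) <= p x + p y" "p (scale A c x) = cmod c * p x" "p (x \<otimes> y) <= p x * p y"
  "p (star A x \<otimes> x) = (p x)^2"
  if "admissible p" "x \<in> carrier A" "y \<in> carrier A" for p x y c
  using that by (auto simp: cstar_seminorm_def)
 have sc: "un (scale A c x) <= cmod c * un x" if x: "x \<in> carrier A" for c x
 proof (rule un_least)
  fix p assume p: "admissible p"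
  show "p (scale A c x) <= cmod c * un x"
   unfolding pd(3)[OF p x x] by (rule mult_left_mono[OF un_upper[OF p x]]) simp
 qed
 have sc': "cmod c * un x <= un (scale A c x)" if x: "x \<in> carrier A" for c x
 proof (cases "c = 0")
  case False
  have "un x <= cmod (inverse c) * un (scale A c x)"
   using sc[of "scale A c x" "inverse c"] x False by (simp add: scale_scale)
  then show ?thesis using False by (simp add: norm_divide inverse_eq_divide pos_le_divide_eq mult.commute)
 qed (use nn x in simp)
 have sq: "(un x)^2 <= un (star A x \<otimes> x)" if x: "x \<in> carrier A" for x
 proof -
  have "un x <= sqrt (un (star A x \<otimes> x))"
  proof (rule un_least)
   fix p assume p: "admissible p"
   have "(p x)^2 <= un (star A x \<otimes> x)" using un_upper[OF p, of "star A x \<otimes> x"] pd(5)[OF p x x] x by simp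
   then show "p x <= sqrt (un (star A x \<otimes> x))" by (rule real_le_rsqrt)
  qed
  then have "(un x)^2 <= (sqrt (un (star A x \<otimes> x)))^2" using nn[OF x] by (rule power_mono)
  then show ?thesis using nn[of "star A x \<otimes> x"] x by simp
 qed
 have 1: "un (x \<oplus> y) <= un x + un y" if "x \<in> carrier A" "y \<in> carrier A" for x y
 proof (rule un_least)
  fix p assume p: "admissible p"
  show "p (x \<oplus> y) <= un x + un y"
   using pd(2)[OF p that] un_upper[OF p that(1)] un_upper[OF p that(2)] by linarith
 qed
 have 2: "un (x \<otimes> y) <= un x * un y" if "x \<in> carrier A" "y \<in> carrier A" for x y
 proof (rule un_least)
  fix p assume p: "admissible p"
  show "p (x \<otimes> y) <= un x * un y"
   using pd(1)[OF p that(2,1)] nn[OF that(1)] un_upper[OF p that(1)] un_upper[OF p that(2)]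
   by (intro order.trans[OF pd(4)[OF p that]] mult_mono)
 qed
 have 3: "un (star A x \<otimes> x) = (un x)^2" if x: "x \<in> carrier A" for x
 proof (rule antisym[OF un_least sq[OF x]])
  fix p assume p: "admissible p"
  show "p (star A x \<otimes> x) <= (un x)^2"
   using un_upper[OF p x] pd(1,5)[OF p x x] by (simp add: power_mono)
 qed
 have 4: "un (scale A c x) = cmod c * un x" if "x \<in> carrier A" for c x
  using sc[OF that] sc'[OF that] by (rule antisym)
 show ?thesis
  unfolding cstar_seminorm_def using nn 1 2 3 4 by simp
qed

sublocale star_seminorm A un by unfold_locales (rule un_seminorm)

lemma un_rel: "r \<in> R ==> r \<in> carrier A ==> un r = 0"
 by (rule antisym[OF un_least p_nonneg]) auto

lemma cstar_algebra_univ: "cstar_algebra (univ_cstar A R)"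
 unfolding univ_cstar_def by (rule cstar_algebra_C)

lemma univ_elem_hom: "univ_elem A R \<in> cstar_hom A (univ_cstar A R)"
 using completion_hom unfolding univ_cstar_def univ_elem_def .

lemma univ_elem_eq: "x \<in> carrier A ==> y \<in> carrier A ==> un (x \<ominus> y) = 0 ==> univ_elem A R x = univ_elem A R y"
 unfolding univ_elem_def by (rule cls_eqI) (auto simp: cauchy_const)

lemma univ_dense:
 "a \<in> carrier (univ_cstar A R) ==> e > 0 ==>
   \<exists>x\<in>carrier A. nrm (univ_cstar A R) (a \<ominus>\<^bsub>univ_cstar A R\<^esub> univ_elem A R x) < e"
 unfolding univ_cstar_def univ_elem_def by (rule completion_dense)

lemma nrm_univ_elem: "x \<in> carrier A ==> nrm (univ_cstar A R) (univ_elem A R x) = un x"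
 unfolding univ_cstar_def univ_elem_def by (rule nrm_C_const)

text \<open>The norm of \<open>B\<close> pulled back along \<open>f\<close> is admissible and
  therefore below \<open>un\<close>; this is the comparison that extension by density asks
  for.\<close>

lemma univ_hom:
 assumes B: "cstar_algebra B" and f: "f \<in> cstar_hom A B" and R: "!!r. r \<in> R ==> f r = \<zero>\<^bsub>B\<^esub>"
 shows "\<exists>F\<in>cstar_hom (univ_cstar A R) B. \<forall>x\<in>carrier A. F (univ_elem A R x) = f x"
proof -
 interpret B: cstar_algebra B by fact
 show ?thesis
 proof (rule hom_extension[OF star_alg cstar_algebra_univ B univ_elem_hom f _ univ_dense])
  show "nrm B (f x) <= nrm (univ_cstar A R) (univ_elem A R x)" if "x \<in> carrier A" for x
   using un_upper[of "%x. nrm B (f x)"] seminorm_pullback[OF star_alg f B.nrm_cstar] that R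
   by (simp add: nrm_univ_elem)
 qed
qed

end

lemma univ_map_hom:
 assumes X: "univ_alg X {}" and Y: "univ_alg Y {}" and f: "f \<in> cstar_hom X Y"
 shows "univ_map Y f \<in> cstar_hom (univ_cstar X {}) (univ_cstar Y {})"
  and "x \<in> carrier X ==> univ_map Y f (univ_elem X {} x) = univ_elem Y {} (f x)"
proof -
 interpret X: univ_alg X "{}" by fact
 interpret Y: univ_alg Y "{}" by fact
 have le: "univ_seminorm Y {} (f x) <= univ_seminorm X {} x" if "x \<in> carrier X" for x
  using X.un_upper[of "%x. univ_seminorm Y {} (f x)"] seminorm_pullback[OF X.star_alg f Y.un_seminorm] that
  by simp
 note m = completion_map[OF X.star_seminorm_axioms Y.star_seminorm_axioms f le]
 have eq: "univ_map Y f = (%C. \<Union>x\<in>C. cls Y (univ_seminorm Y {}) (%k. f (x k)))"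
  by (rule ext) (simp add: univ_map_def)
 show "univ_map Y f \<in> cstar_hom (univ_cstar X {}) (univ_cstar Y {})"
  unfolding eq univ_cstar_def by (rule m(1))
 show "univ_map Y f (univ_elem X {} x) = univ_elem Y {} (f x)" if "x \<in> carrier X"
  unfolding eq univ_elem_def by (rule m(2)) (use that in simp_all)
qed

text \<open>Monoids with an involution reversing products. Covers groups with inversion as well as
  words with reversal and adjoint letters, so that group algebras and the free *-algebra are treated
  at once.\<close>

locale inv_monoid = monoid M for M :: "('g, 'm) monoid_scheme" (structure) +
 fixes i :: "'g => 'g"
 assumes i_closed [simp]: "g \<in> carrier M ==> i g \<in> carrier M"
  and i_i [simp]: "g \<in> carrier M ==> i (i g) = g"
  and i_mult: "g \<in> carrier M ==> h \<in> carrier M ==> i (g \<otimes> h) = i h \<otimes> i g"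
begin

lemma i_one [simp]: "i \<one> = \<one>"
 using i_mult[of "i \<one>" \<one>] by simp

abbreviation X :: "('g => complex) star_alg" where "X == monoid_alg M i"

text \<open>The pairing of a finitely supported function with an arbitrary test function. Elements
  are determined by their pairings (\<open>X_eqI\<close>), and convolution becomes a nested pairing
  (\<open>lsum_mult\<close>), so the algebra laws reduce to laws of the monoid.\<close>

definition lsum :: "('g => complex) => ('g => complex) => complex" where
 "lsum f \<xi> = (\<Sum>a\<in>{a. f a ~= 0}. f a * \<xi> a)"

lemma carrier_X: "f \<in> carrier X \<longleftrightarrow> finite {g. f g ~= 0} & {g. f g ~= 0} \<subseteq> carrier M"
 by (simp add: monoid_alg_def)

lemma lsum_superset: "finite S ==> {a. f a ~= 0} \<subseteq> S ==> lsum f \<xi> = (\<Sum>a\<in>S. f a * \<xi> a)"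
 unfolding lsum_def by (rule sum.mono_neutral_left) auto

lemma lsum_cong: "f \<in> carrier X ==> (!!a. a \<in> carrier M ==> \<xi> a = \<psi> a) ==> lsum f \<xi> = lsum f \<psi>"
 unfolding lsum_def carrier_X by (rule sum.cong) auto

lemma lsum_swap: "lsum f (%a. lsum h (%b. \<xi> a b)) = lsum h (%b. lsum f (%a. \<xi> a b))"
 unfolding lsum_def sum_distrib_left by (subst sum.swap) (simp add: mult.left_commute)

lemma lsum_ind: "f \<in> carrier X ==> lsum f (%a. if a = z then c else 0) = f z * c"
proof -
 assume f: "f \<in> carrier X"
 have "lsum f (%a. if a = z then c else 0) = (\<Sum>a\<in>insert z {a. f a ~= 0}. f a * (if a = z then c else 0))"
  by (rule lsum_superset) (use f in \<open>auto simp: carrier_X\<close>)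
 also have "... = f z * c" using f by (simp add: carrier_X if_distrib cong: if_cong)
 finally show ?thesis .
qed

lemma X_eqI: "f \<in> carrier X ==> h \<in> carrier X ==> (!!\<xi>. lsum f \<xi> = lsum h \<xi>) ==> f = h"
proof
 fix z assume "f \<in> carrier X" "h \<in> carrier X" "!!\<xi>. lsum f \<xi> = lsum h \<xi>"
 then show "f z = h z" using lsum_ind[of f z 1] lsum_ind[of h z 1] by simp
qed

lemma mult_X: "(f \<otimes>\<^bsub>X\<^esub> h) z = lsum f (%a. lsum h (%b. if a \<otimes> b = z then 1 else 0))"
 unfolding monoid_alg_def lsum_def
 by (simp add: sum_distrib_left) (intro sum.cong refl, simp)

lemma add_closed: assumes "f \<in> carrier X" "h \<in> carrier X" shows "f \<oplus>\<^bsub>X\<^esub> h \<in> carrier X"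
proof -
 have "{g. f g + h g ~= 0} \<subseteq> {g. f g ~= 0} \<union> {g. h g ~= 0}" by auto
 moreover have "(f \<oplus>\<^bsub>X\<^esub> h) g = f g + h g" for g by (simp add: monoid_alg_def)
 ultimately have sub: "{g. (f \<oplus>\<^bsub>X\<^esub> h) g ~= 0} \<subseteq> {g. f g ~= 0} \<union> {g. h g ~= 0}" by simp
 show ?thesis
  using assms finite_subset[OF sub] order.trans[OF sub] by (simp add: carrier_X)
qed

lemma lsum_nonzero: "lsum f \<xi> ~= 0 ==> \<exists>a. f a ~= 0 & \<xi> a ~= 0"
proof (rule ccontr)
 assume "lsum f \<xi> ~= 0" "\<not> (\<exists>a. f a ~= 0 & \<xi> a ~= 0)"
 moreover from this(2) have "lsum f \<xi> = 0" unfolding lsum_def by (intro sum.neutral) auto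
 ultimately show False by simp
qed

lemma lsum_add: assumes "f \<in> carrier X" "h \<in> carrier X" shows "lsum (f \<oplus>\<^bsub>X\<^esub> h) \<xi> = lsum f \<xi> + lsum h \<xi>"
proof -
 let ?S = "{g. f g ~= 0} \<union> {g. h g ~= 0}"
 have S: "finite ?S" using assms by (auto simp: carrier_X)
 have "lsum (f \<oplus>\<^bsub>X\<^esub> h) \<xi> = (\<Sum>a\<in>?S. (f a + h a) * \<xi> a)"
  by (subst lsum_superset[OF S]) (auto simp: monoid_alg_def)
 also have "... = (\<Sum>a\<in>?S. f a * \<xi> a) + (\<Sum>a\<in>?S. h a * \<xi> a)"
  by (simp add: distrib_right sum.distrib)
 finally show ?thesis by (simp add: lsum_superset[OF S])
qed

lemma scale_closed: "f \<in> carrier X ==> scale X c f \<in> carrier X"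
 by (auto simp: monoid_alg_def elim: rev_finite_subset)

lemma lsum_scale: assumes "f \<in> carrier X" shows "lsum (scale X c f) \<xi> = c * lsum f \<xi>"
proof -
 have S: "finite {g. f g ~= 0}" using assms by (auto simp: carrier_X)
 have "lsum (scale X c f) \<xi> = (\<Sum>a\<in>{g. f g ~= 0}. (c * f a) * \<xi> a)"
  by (subst lsum_superset[OF S]) (auto simp: monoid_alg_def)
 then show ?thesis by (simp add: lsum_def sum_distrib_left mult.assoc)
qed

lemma mult_support: "{z. (f \<otimes>\<^bsub>X\<^esub> h) z ~= 0} \<subseteq> (%(a, b). a \<otimes> b) ` ({a. f a ~= 0} \<times> {b. h b ~= 0})"
proof
 fix z assume "z \<in> {z. (f \<otimes>\<^bsub>X\<^esub> h) z ~= 0}"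
 then have "lsum f (%a. lsum h (%b. if a \<otimes> b = z then 1 else 0)) ~= 0" by (simp add: mult_X)
 then obtain a where a: "f a ~= 0" "lsum h (%b. if a \<otimes> b = z then 1 else 0) ~= 0"
  using lsum_nonzero by blast
 then obtain b where b: "h b ~= 0" "a \<otimes> b = z"
  using lsum_nonzero[OF a(2)] by (auto split: if_splits)
 then show "z \<in> (%(a, b). a \<otimes> b) ` ({a. f a ~= 0} \<times> {b. h b ~= 0})" using a by force
qed

lemma mult_closed: assumes "f \<in> carrier X" "h \<in> carrier X" shows "f \<otimes>\<^bsub>X\<^esub> h \<in> carrier X"
 unfolding carrier_X
proof
 show "finite {z. (f \<otimes>\<^bsub>X\<^esub> h) z ~= 0}"
  by (rule finite_subset[OF mult_support]) (use assms in \<open>auto simp: carrier_X\<close>)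
 show "{z. (f \<otimes>\<^bsub>X\<^esub> h) z ~= 0} \<subseteq> carrier M"
  by (rule order.trans[OF mult_support]) (use assms in \<open>auto simp: carrier_X\<close>)
qed

lemma lsum_mult:
 assumes f: "f \<in> carrier X" and h: "h \<in> carrier X"
 shows "lsum (f \<otimes>\<^bsub>X\<^esub> h) \<xi> = lsum f (%a. lsum h (%b. \<xi> (a \<otimes> b)))"
proof -
 let ?S = "(%(a, b). a \<otimes> b) ` ({a. f a ~= 0} \<times> {b. h b ~= 0})"
 have S: "finite ?S" using f h by (auto simp: carrier_X)
 have "lsum (f \<otimes>\<^bsub>X\<^esub> h) \<xi> = (\<Sum>z\<in>?S. \<Sum>a\<in>{a. f a ~= 0}. \<Sum>b\<in>{b. h b ~= 0}. if a \<otimes> b = z then f a * (h b * \<xi> z) else 0)"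
  by (subst lsum_superset[OF S mult_support])
   (simp add: mult_X lsum_def sum_distrib_left sum_distrib_right,
    intro sum.cong refl, simp add: mult.assoc)
 also have "... = (\<Sum>a\<in>{a. f a ~= 0}. \<Sum>b\<in>{b. h b ~= 0}. \<Sum>z\<in>?S. if a \<otimes> b = z then f a * (h b * \<xi> z) else 0)"
  by (rule trans[OF sum.swap]) (intro sum.cong refl sum.swap)
 also have "... = (\<Sum>a\<in>{a. f a ~= 0}. \<Sum>b\<in>{b. h b ~= 0}. f a * (h b * \<xi> (a \<otimes> b)))"
 proof (intro sum.cong refl)
  fix a b assume "a \<in> {a. f a ~= 0}" "b \<in> {b. h b ~= 0}"
  then have "a \<otimes> b \<in> ?S" by force
  then show "(\<Sum>z\<in>?S. if a \<otimes> b = z then f a * (h b * \<xi> z) else 0) = f a * (h b * \<xi> (a \<otimes> b))"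
   using S by (simp add: sum.delta)
 qed
 finally show ?thesis by (simp add: lsum_def sum_distrib_left)
qed

lemma star_closed: assumes "f \<in> carrier X" shows "star X f \<in> carrier X"
proof -
 have sub: "{g. star X f g ~= 0} \<subseteq> i ` {g. f g ~= 0}"
 proof
  fix g assume "g \<in> {g. star X f g ~= 0}"
  then have "g \<in> carrier M" "f (i g) ~= 0" by (auto simp: monoid_alg_def split: if_splits)
  then show "g \<in> i ` {g. f g ~= 0}" by (intro image_eqI[of _ _ "i g"]) auto
 qed
 moreover have "{g. star X f g ~= 0} \<subseteq> carrier M" by (auto simp: monoid_alg_def split: if_splits)
 ultimately show ?thesis using assms finite_subset[OF sub] by (simp add: carrier_X)
qed

lemma lsum_star: assumes f: "f \<in> carrier X" shows "lsum (star X f) \<xi> = cnj (lsum f (%a. cnj (\<xi> (i a))))"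
proof -
 let ?S = "{g. f g ~= 0}"
 have S: "finite ?S" "?S \<subseteq> carrier M" using f by (auto simp: carrier_X)
 have sub: "{g. star X f g ~= 0} \<subseteq> i ` ?S"
 proof
  fix g assume "g \<in> {g. star X f g ~= 0}"
  then have "g \<in> carrier M" "f (i g) ~= 0" by (auto simp: monoid_alg_def split: if_splits)
  then show "g \<in> i ` ?S" by (intro image_eqI[of _ _ "i g"]) auto
 qed
 have inj: "inj_on i ?S" by (rule inj_on_inverseI[where g = i]) (use S(2) i_i in blast)
 have "lsum (star X f) \<xi> = (\<Sum>a\<in>i ` ?S. star X f a * \<xi> a)"
  by (rule lsum_superset[OF _ sub]) (use S in simp)
 also have "... = (\<Sum>a\<in>?S. star X f (i a) * \<xi> (i a))"
  by (simp add: sum.reindex[OF inj])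
 also have "... = (\<Sum>a\<in>?S. cnj (f a) * \<xi> (i a))"
  using S(2) by (intro sum.cong refl) (auto simp: monoid_alg_def)
 finally show ?thesis by (simp add: lsum_def)
qed

lemma single_closed: "g \<in> carrier M ==> single g \<in> carrier X"
 by (auto simp: carrier_X single_def)

lemma lsum_single: "lsum (single g) \<xi> = \<xi> g"
 by (simp add: lsum_def single_def)

lemma one_X: "\<one>\<^bsub>X\<^esub> = single \<one>"
 by (simp add: monoid_alg_def single_def)

lemma zero_X: "\<zero>\<^bsub>X\<^esub> = (%z. 0)"
 by (simp add: monoid_alg_def)

lemma zero_closed: "\<zero>\<^bsub>X\<^esub> \<in> carrier X" and lsum_zero: "lsum \<zero>\<^bsub>X\<^esub> \<xi> = 0"
 by (simp_all add: monoid_alg_def lsum_def)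

lemma star_algebra_X: "star_algebra X"
proof -
 note cl = add_closed mult_closed scale_closed star_closed zero_closed single_closed
 note ls = lsum_add lsum_mult lsum_scale lsum_star lsum_zero lsum_single
 have lsum_lin: "lsum f (%a. \<xi> a + \<psi> a) = lsum f \<xi> + lsum f \<psi>" "lsum f (%a. c * \<xi> a) = c * lsum f \<xi>" for f \<xi> \<psi> c
  by (simp_all add: lsum_def distrib_left sum.distrib sum_distrib_left mult.left_commute)
 have ab: "abelian_group X"
 proof (rule abelian_groupI)
  show "\<exists>y\<in>carrier X. y \<oplus>\<^bsub>X\<^esub> x = \<zero>\<^bsub>X\<^esub>" if "x \<in> carrier X" for x
   by (rule bexI[of _ "scale X (-1) x"], rule X_eqI) (use that in \<open>auto simp: cl ls\<close>)
 qed (auto intro!: X_eqI simp: cl ls)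
 have mo: "monoid X"
 proof (rule monoidI)
  show "(x \<otimes>\<^bsub>X\<^esub> y) \<otimes>\<^bsub>X\<^esub> z = x \<otimes>\<^bsub>X\<^esub> (y \<otimes>\<^bsub>X\<^esub> z)" if "x \<in> carrier X" "y \<in> carrier X" "z \<in> carrier X" for x y z
   by (rule X_eqI) (use that in \<open>auto simp: cl ls m_assoc intro!: lsum_cong\<close>)
  show "\<one>\<^bsub>X\<^esub> \<otimes>\<^bsub>X\<^esub> x = x" "x \<otimes>\<^bsub>X\<^esub> \<one>\<^bsub>X\<^esub> = x" if "x \<in> carrier X" for x
   by (rule X_eqI; use that in \<open>auto simp: cl ls one_X intro!: lsum_cong\<close>)+
 qed (auto simp: cl one_X)
 have ri: "ring X"
  by (rule ringI[OF ab mo]; rule X_eqI) (auto simp: cl ls lsum_lin)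
 show ?thesis
 proof (intro star_algebra.intro ri star_algebra_axioms.intro)
  show "star X (x \<otimes>\<^bsub>X\<^esub> y) = star X y \<otimes>\<^bsub>X\<^esub> star X x" if "x \<in> carrier X" "y \<in> carrier X" for x y
  proof (rule X_eqI)
   fix \<xi>
   have "lsum (star X (x \<otimes>\<^bsub>X\<^esub> y)) \<xi> = cnj (lsum x (%a. lsum y (%b. cnj (\<xi> (i (a \<otimes> b))))))"
    using that by (simp add: cl ls)
   also have "lsum x (%a. lsum y (%b. cnj (\<xi> (i (a \<otimes> b))))) = lsum x (%a. lsum y (%b. cnj (\<xi> (i b \<otimes> i a))))"
    using that by (intro lsum_cong) (auto simp: i_mult)
   finally show "lsum (star X (x \<otimes>\<^bsub>X\<^esub> y)) \<xi> = lsum (star X y \<otimes>\<^bsub>X\<^esub> star X x) \<xi>"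
    using that by (simp add: cl ls lsum_swap[of y])
  qed (use that in \<open>auto simp: cl\<close>)
 qed ((rule X_eqI)?; auto simp: cl ls lsum_lin algebra_simps intro!: lsum_cong)+
qed

sublocale X: star_algebra X by (rule star_algebra_X)

lemma single_mult: "g \<in> carrier M ==> h \<in> carrier M ==> single g \<otimes>\<^bsub>X\<^esub> single h = single (g \<otimes> h)"
 by (rule X_eqI) (auto simp: mult_closed single_closed lsum_mult lsum_single)

lemma single_star: "g \<in> carrier M ==> star X (single g) = single (i g)"
 by (rule X_eqI) (auto simp: star_closed single_closed lsum_star lsum_single)

lemma X_induct [consumes 1, case_names zero add]:
 assumes f: "f \<in> carrier X" and zero: "P \<zero>\<^bsub>X\<^esub>"
  and add: "!!f g c. f \<in> carrier X ==> g \<in> carrier M ==> P f ==> P (f \<oplus>\<^bsub>X\<^esub> scale X c (single g))"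
 shows "P f"
 using f
proof (induction "card {g. f g ~= 0}" arbitrary: f)
 case 0
 then have "f = \<zero>\<^bsub>X\<^esub>" by (auto simp: carrier_X monoid_alg_def fun_eq_iff)
 then show ?case using zero by simp
next
 case (Suc n)
 then have fin: "finite {g. f g ~= 0}" "{g. f g ~= 0} \<subseteq> carrier M" by (auto simp: carrier_X)
 obtain g where g: "f g ~= 0" using Suc.hyps(2) by (metis (mono_tags) card.empty empty_Collect_eq nat.distinct(1))
 define h where "h = f(g := 0)"
 have sh: "{x. h x ~= 0} = {x. f x ~= 0} - {g}" by (auto simp: h_def)
 have h: "h \<in> carrier X" using fin by (auto simp: carrier_X sh)
 have "card {x. h x ~= 0} = n" using Suc.hyps(2) fin g by (simp add: sh)
 then have "P h" using Suc.hyps(1) h by blast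
 then have "P (h \<oplus>\<^bsub>X\<^esub> scale X (f g) (single g))" using add h fin g by blast
 moreover have "h \<oplus>\<^bsub>X\<^esub> scale X (f g) (single g) = f"
  by (auto simp: monoid_alg_def h_def single_def)
 ultimately show ?case by simp
qed

definition lift :: "('b, 'k) star_alg_scheme => ('g => 'b) => ('g => complex) => 'b" where
 "lift B \<pi> f = (\<Oplus>\<^bsub>B\<^esub>a\<in>{a. f a ~= 0}. scale B (f a) (\<pi> a))"

lemma lift_superset:
 assumes B: "star_algebra B" and \<pi>: "!!g. g \<in> carrier M ==> \<pi> g \<in> carrier B"
  and S: "finite S" "{a. f a ~= 0} \<subseteq> S" "S \<subseteq> carrier M"
 shows "lift B \<pi> f = (\<Oplus>\<^bsub>B\<^esub>a\<in>S. scale B (f a) (\<pi> a))"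
proof -
 interpret B: star_algebra B by fact
 show ?thesis
  unfolding lift_def by (rule B.add.finprod_mono_neutral_cong_left[OF S(1,2)]) (use S \<pi> in auto)
qed

lemma lift_hom:
 assumes B: "star_algebra B" and \<pi>: "!!g. g \<in> carrier M ==> \<pi> g \<in> carrier B"
  and one: "\<pi> \<one> = \<one>\<^bsub>B\<^esub>"
  and mult: "!!g h. g \<in> carrier M ==> h \<in> carrier M ==> \<pi> (g \<otimes> h) = \<pi> g \<otimes>\<^bsub>B\<^esub> \<pi> h"
  and st: "!!g. g \<in> carrier M ==> \<pi> (i g) = star B (\<pi> g)"
 shows "lift B \<pi> \<in> cstar_hom X B" "!!g. g \<in> carrier M ==> lift B \<pi> (single g) = \<pi> g"
proof -
 interpret B: star_algebra B by fact
 have sup: "lift B \<pi> f = (\<Oplus>\<^bsub>B\<^esub>a\<in>S. scale B (f a) (\<pi> a))"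
  if "finite S" "{a. f a ~= 0} \<subseteq> S" "S \<subseteq> carrier M" for f S
  by (rule lift_superset[OF B _ that]) (rule \<pi>)
 have cl: "lift B \<pi> f \<in> carrier B" if "f \<in> carrier X" for f
  unfolding lift_def using that \<pi> by (intro B.finsum_closed) (auto simp: carrier_X)
 have add: "lift B \<pi> (f \<oplus>\<^bsub>X\<^esub> h) = lift B \<pi> f \<oplus>\<^bsub>B\<^esub> lift B \<pi> h" if "f \<in> carrier X" "h \<in> carrier X" for f h
 proof -
  let ?S = "{g. f g ~= 0} \<union> {g. h g ~= 0}"
  have S: "finite ?S" "?S \<subseteq> carrier M" using that by (auto simp: carrier_X)
  have "lift B \<pi> (f \<oplus>\<^bsub>X\<^esub> h) = (\<Oplus>\<^bsub>B\<^esub>a\<in>?S. scale B (f a + h a) (\<pi> a))"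
   by (subst sup[OF S(1) _ S(2)]) (auto simp: monoid_alg_def)
  also have "... = (\<Oplus>\<^bsub>B\<^esub>a\<in>?S. scale B (f a) (\<pi> a) \<oplus>\<^bsub>B\<^esub> scale B (h a) (\<pi> a))"
   using S \<pi> by (intro B.finsum_cong') (auto simp: B.add_scale)
  also have "... = (\<Oplus>\<^bsub>B\<^esub>a\<in>?S. scale B (f a) (\<pi> a)) \<oplus>\<^bsub>B\<^esub> (\<Oplus>\<^bsub>B\<^esub>a\<in>?S. scale B (h a) (\<pi> a))"
   using S \<pi> by (intro B.finsum_addf) auto
  finally show ?thesis by (simp add: sup[OF S(1) _ S(2)])
 qed
 have sing: "lift B \<pi> (scale X c (single g)) = scale B c (\<pi> g)" if "g \<in> carrier M" for c g
  using that \<pi> by (subst sup[of "{g}"]) (auto simp: monoid_alg_def single_def)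
 have sing1: "lift B \<pi> (single g) = \<pi> g" if "g \<in> carrier M" for g
  using sing[OF that, of 1] \<pi> that X.scale_1 single_closed by simp
 have zero: "lift B \<pi> \<zero>\<^bsub>X\<^esub> = \<zero>\<^bsub>B\<^esub>" by (simp add: lift_def monoid_alg_def)
 note sc = single_closed \<pi> cl
 have scale: "lift B \<pi> (scale X c f) = scale B c (lift B \<pi> f)" if "f \<in> carrier X" for c f
  using that
  by (induction f rule: X_induct) (auto simp: zero add sing sc X.scale_add X.scale_scale B.scale_add B.scale_scale)
 have m1: "lift B \<pi> (single g \<otimes>\<^bsub>X\<^esub> h) = \<pi> g \<otimes>\<^bsub>B\<^esub> lift B \<pi> h" if "g \<in> carrier M" "h \<in> carrier X" for g h
  using that(2,1)
  by (induction h rule: X_induct)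
   (auto simp: zero add sing sing1 sc X.r_distr B.r_distr X.scale_mult_right B.scale_mult_right single_mult mult scale)
 have m: "lift B \<pi> (f \<otimes>\<^bsub>X\<^esub> h) = lift B \<pi> f \<otimes>\<^bsub>B\<^esub> lift B \<pi> h" if "f \<in> carrier X" "h \<in> carrier X" for f h
  using that
  by (induction f rule: X_induct)
   (auto simp: zero add sing sing1 sc X.l_distr B.l_distr X.scale_mult_left B.scale_mult_left m1 scale)
 have star: "lift B \<pi> (star X f) = star B (lift B \<pi> f)" if "f \<in> carrier X" for f
  using that
  by (induction f rule: X_induct)
   (auto simp: zero add sing sing1 sc X.star_add B.star_add X.star_scale B.star_scale single_star st scale)
 show "lift B \<pi> \<in> cstar_hom X B"
  by (rule cstar_homI) (auto simp: cl add m star scale one_X sing1 one)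
 show "lift B \<pi> (single g) = \<pi> g" if "g \<in> carrier M" for g by (rule sing1[OF that])
qed

lemma hom_eq_of_single:
 assumes B: "star_algebra B" and f: "f \<in> cstar_hom X B" and g: "g \<in> cstar_hom X B"
  and eq: "!!a. a \<in> carrier M ==> f (single a) = g (single a)" and x: "x \<in> carrier X"
 shows "f x = g x"
 using x
 by (induction x rule: X_induct)
  (auto simp: cstar_hom_zero[OF star_algebra_X B f] cstar_hom_zero[OF star_algebra_X B g]
   cstar_homD[OF f] cstar_homD[OF g] single_closed eq)

lemma bounded_relI:
 assumes "!!g. g \<in> carrier M ==> \<exists>K. \<forall>p. cstar_seminorm X p --> (\<forall>r\<in>R. p r = 0) --> p (single g) <= K"
 shows "bounded_rel X R"
 unfolding bounded_rel_def
proof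
 fix f assume "f \<in> carrier X"
 then show "\<exists>K. \<forall>p. cstar_seminorm X p --> (\<forall>r\<in>R. p r = 0) --> p f <= K"
 proof (induction f rule: X_induct)
  case zero
  have "p \<zero>\<^bsub>X\<^esub> <= 0" if "cstar_seminorm X p" for p
  proof -
   interpret p: star_seminorm X p using star_algebra_X that by (rule star_seminormI)
   show ?thesis by simp
  qed
  then show ?case by blast
 next
  case (add f g c)
  obtain K where K: "\<forall>p. cstar_seminorm X p --> (\<forall>r\<in>R. p r = 0) --> p f <= K" using add by blast
  obtain L where L: "\<forall>p. cstar_seminorm X p --> (\<forall>r\<in>R. p r = 0) --> p (single g) <= L"
   using assms add by blast
  have "p (f \<oplus>\<^bsub>X\<^esub> scale X c (single g)) <= K + cmod c * L" if p: "cstar_seminorm X p" "\<forall>r\<in>R. p r = 0" for p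
  proof -
   interpret p: star_seminorm X p using star_algebra_X p(1) by (rule star_seminormI)
   have "p (f \<oplus>\<^bsub>X\<^esub> scale X c (single g)) <= p f + cmod c * p (single g)"
    using p.p_add[of f "scale X c (single g)"] add single_closed by (simp add: p.p_scale)
   also have "... <= K + cmod c * L" using K L p by (intro add_mono mult_left_mono) auto
   finally show ?thesis .
  qed
  then show ?case by blast
 qed
qed

end

section \<open>Full group C*-algebras\<close>

lemma inv_monoid_group: "group G ==> inv_monoid G (m_inv G)"
 by (intro inv_monoid.intro inv_monoid_axioms.intro group.is_monoid)
  (auto simp: group.inv_mult_group)

locale group_dual = group \<Lambda> for \<Lambda> :: "('g, 'm) monoid_scheme" (structure)
begin

sublocale ga: inv_monoid \<Lambda> "m_inv \<Lambda>" by (rule inv_monoid_group) (rule group_axioms)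

lemma group_alg_eq: "group_alg \<Lambda> = ga.X" by (simp add: group_alg_def)

lemma single_unitary: "g \<in> carrier \<Lambda> ==> star ga.X (single g) \<otimes>\<^bsub>ga.X\<^esub> single g = \<one>\<^bsub>ga.X\<^esub>"
 by (simp add: ga.single_star ga.single_mult ga.one_X)

text \<open>Group elements are isometries, hence at most 1 in every C*-seminorm.\<close>

lemma univ_alg_group: "univ_alg (group_alg \<Lambda>) {}"
proof -
 have "bounded_rel ga.X {}"
 proof (rule ga.bounded_relI)
  have "p (single g) <= 1" if "g \<in> carrier \<Lambda>" "cstar_seminorm ga.X p" for g p
  proof -
   interpret p: star_seminorm ga.X p using ga.star_algebra_X that(2) by (rule star_seminormI)
   show ?thesis using p.p_isometry_le[of "single g"] single_unitary that ga.single_closed by blast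
  qed
  then show "\<exists>K. \<forall>p. cstar_seminorm ga.X p --> (\<forall>r\<in>{}. p r = 0) --> p (single g) <= K" if "g \<in> carrier \<Lambda>" for g
   using that by blast
 qed
 then show ?thesis by (simp add: group_alg_eq univ_alg_def univ_alg_axioms_def ga.star_algebra_X)
qed

sublocale U: univ_alg "group_alg \<Lambda>" "{}" by (rule univ_alg_group)

lemma cstar_algebra_group: "cstar_algebra (group_cstar \<Lambda>)"
 unfolding group_cstar_def by (rule U.cstar_algebra_univ)

lemma group_elem_closed: "g \<in> carrier \<Lambda> ==> group_elem \<Lambda> g \<in> carrier (group_cstar \<Lambda>)"
 and group_elem_mult: "g \<in> carrier \<Lambda> ==> h \<in> carrier \<Lambda> ==>
  group_elem \<Lambda> (g \<otimes> h) = group_elem \<Lambda> g \<otimes>\<^bsub>group_cstar \<Lambda>\<^esub> group_elem \<Lambda> h"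
 and group_elem_one: "group_elem \<Lambda> \<one> = \<one>\<^bsub>group_cstar \<Lambda>\<^esub>"
 and group_elem_inv: "g \<in> carrier \<Lambda> ==> group_elem \<Lambda> (inv g) = star (group_cstar \<Lambda>) (group_elem \<Lambda> g)"
 using cstar_homD[OF U.univ_elem_hom] ga.single_closed ga.single_mult ga.single_star ga.one_X
 unfolding group_cstar_def group_elem_def group_alg_eq by metis+

lemma group_cstar_hom:
 assumes B: "cstar_algebra B" and \<pi>: "!!g. g \<in> carrier \<Lambda> ==> \<pi> g \<in> carrier B"
  and one: "\<pi> \<one> = \<one>\<^bsub>B\<^esub>"
  and mult: "!!g h. g \<in> carrier \<Lambda> ==> h \<in> carrier \<Lambda> ==> \<pi> (g \<otimes> h) = \<pi> g \<otimes>\<^bsub>B\<^esub> \<pi> h"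
  and st: "!!g. g \<in> carrier \<Lambda> ==> \<pi> (inv g) = star B (\<pi> g)"
 shows "\<exists>F\<in>cstar_hom (group_cstar \<Lambda>) B. \<forall>g\<in>carrier \<Lambda>. F (group_elem \<Lambda> g) = \<pi> g"
proof -
 interpret B: cstar_algebra B by fact
 note l = ga.lift_hom[where \<pi> = \<pi>, OF B.star_alg \<pi> one mult st]
 have "\<exists>F\<in>cstar_hom (univ_cstar (group_alg \<Lambda>) {}) B. \<forall>x\<in>carrier (group_alg \<Lambda>).
   F (univ_elem (group_alg \<Lambda>) {} x) = ga.lift B \<pi> x"
  by (rule U.univ_hom[OF B]) (use l(1) in \<open>auto simp: group_alg_eq\<close>)
 then show ?thesis
  unfolding group_cstar_def group_elem_def
  using l(2) ga.single_closed unfolding group_alg_eq by metis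
qed

lemma group_cstar_hom_eq:
 assumes B: "cstar_algebra B" and f: "f \<in> cstar_hom (group_cstar \<Lambda>) B" and g: "g \<in> cstar_hom (group_cstar \<Lambda>) B"
  and eq: "!!a. a \<in> carrier \<Lambda> ==> f (group_elem \<Lambda> a) = g (group_elem \<Lambda> a)"
  and x: "x \<in> carrier (group_cstar \<Lambda>)"
 shows "f x = g x"
proof (rule cstar_hom_eqI[OF cstar_algebra_group B f g _ _ _ x])
 interpret B: cstar_algebra B by fact
 let ?D = "univ_elem (group_alg \<Lambda>) {} ` carrier (group_alg \<Lambda>)"
 show "\<exists>y\<in>?D. nrm (group_cstar \<Lambda>) (x \<ominus>\<^bsub>group_cstar \<Lambda>\<^esub> y) < e" if "x \<in> carrier (group_cstar \<Lambda>)" "e > 0" for x e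
  using U.univ_dense that unfolding group_cstar_def by blast
 show "?D \<subseteq> carrier (group_cstar \<Lambda>)"
  using cstar_homD(1)[OF U.univ_elem_hom] unfolding group_cstar_def by blast
 note h = cstar_hom_comp[OF U.univ_elem_hom f[unfolded group_cstar_def]] cstar_hom_comp[OF U.univ_elem_hom g[unfolded group_cstar_def]]
 show "f y = g y" if "y \<in> ?D" for y
  using that ga.hom_eq_of_single[OF B.star_alg h[unfolded group_alg_eq]] eq
  unfolding group_elem_def group_alg_eq by auto
qed

end

lemma group_cstar_map_hom:
 assumes G: "group_dual G" and H: "group_dual H" and p: "p \<in> hom G H"
 shows "group_cstar_map H p \<in> cstar_hom (group_cstar G) (group_cstar H)"
  and "g \<in> carrier G ==> group_cstar_map H p (group_elem G g) = group_elem H (p g)"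
proof -
 interpret G: group_dual G by fact
 interpret H: group_dual H by fact
 interpret gh: group_hom G H p by (intro group_hom.intro G.group_axioms H.group_axioms group_hom_axioms.intro p)
 \<comment> \<open>The push-forward along \<open>p\<close> from the definition of
   \<open>group_cstar_map\<close>. It is identified with the linear extension of g to p g, from
   which it inherits the homomorphism laws.\<close>
 define m where "m = (%f z. \<Sum>g\<in>{g. f g ~= 0}. if p g = z then f g else (0::complex))"
 have ml: "m f z = G.ga.lsum f (%g. if p g = z then 1 else 0)" for f z
  by (simp add: m_def G.ga.lsum_def if_distrib cong: if_cong)
 note l = G.ga.lift_hom[where \<pi> = "%g. single (p g)", OF H.ga.star_algebra_X]
 have eq: "m f = G.ga.lift H.ga.X (%g. single (p g)) f" if "f \<in> carrier G.ga.X" for f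
  using that
 proof (induction f rule: G.ga.X_induct)
  case zero
  show ?case
   using H.ga.X.finsum_empty by (simp add: m_def G.ga.lift_def G.ga.zero_X H.ga.zero_X)
 next
  case (add f g c)
  have lift: "G.ga.lift H.ga.X (%g. single (p g)) \<in> cstar_hom G.ga.X H.ga.X"
   "G.ga.lift H.ga.X (%g. single (p g)) (single g) = single (p g)"
   by (rule l; use add in \<open>simp add: H.ga.single_closed H.ga.one_X H.ga.single_mult H.ga.single_star\<close>)+
  have "m (f \<oplus>\<^bsub>G.ga.X\<^esub> scale G.ga.X c (single g)) = (%z. m f z + c * single (p g) z)"
  proof (rule ext)
   show "m (f \<oplus>\<^bsub>G.ga.X\<^esub> scale G.ga.X c (single g)) z = m f z + c * single (p g) z" for z
    unfolding ml using add
    by (simp add: G.ga.lsum_add G.ga.single_closed G.ga.lsum_scale G.ga.lsum_single) (simp add: single_def)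
  qed
  also have "... = m f \<oplus>\<^bsub>H.ga.X\<^esub> scale H.ga.X c (single (p g))" by (simp add: monoid_alg_def)
  finally show ?case
   using add lift by (simp add: cstar_homD[OF lift(1)] G.ga.single_closed)
 qed
 have "G.ga.lift H.ga.X (%g. single (p g)) \<in> cstar_hom G.ga.X H.ga.X"
  by (rule l(1); simp add: H.ga.single_closed H.ga.one_X H.ga.single_mult H.ga.single_star)
 then have mh: "m \<in> cstar_hom (group_alg G) (group_alg H)"
  unfolding G.group_alg_eq H.group_alg_eq by (rule cstar_hom_cong[OF G.ga.star_algebra_X]) (rule eq)
 have um: "group_cstar_map H p = univ_map (group_alg H) m"
  by (simp add: group_cstar_map_def m_def)
 show "group_cstar_map H p \<in> cstar_hom (group_cstar G) (group_cstar H)"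
  unfolding um group_cstar_def by (rule univ_map_hom(1)[OF G.univ_alg_group H.univ_alg_group mh])
 show "group_cstar_map H p (group_elem G g) = group_elem H (p g)" if "g \<in> carrier G"
 proof -
  have "m (single g) = single (p g)" by (rule ext, simp only: ml G.ga.lsum_single) (auto simp: single_def)
  then show ?thesis
   using univ_map_hom(2)[OF G.univ_alg_group H.univ_alg_group mh] G.ga.single_closed that
   unfolding um group_elem_def G.group_alg_eq by simp
 qed
qed

section \<open>Tensor products\<close>

locale tensor = A: star_algebra A + B: star_algebra B
 for A :: "('a, 'm) star_alg_scheme" and B :: "('b, 'k) star_alg_scheme"
begin

abbreviation T :: "('a, 'b) tensor star_alg" where "T == alg_tensor A B"
abbreviation bil :: "('a => 'b => complex) => bool" where "bil == bilinear_on A B"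
abbreviation st :: "'a => 'b => ('a, 'b) tensor" where "st == simple_tensor A B"

text \<open>Finite sums of simple tensors given by lists, in order to obtain the induction rule
  \<open>T_induct\<close>.\<close>

definition tens :: "('a \<times> 'b) list => ('a, 'b) tensor" where
 "tens xs \<phi> = (\<Sum>(a, b)\<leftarrow>xs. st a b \<phi>)"

lemma tens_simps: "tens [] = (%\<phi>. 0)" "tens ((a, b) # xs) = (%\<phi>. st a b \<phi> + tens xs \<phi>)"
 by (auto simp: tens_def fun_eq_iff)

lemma carrier_T: "carrier T = tens ` {xs. set xs \<subseteq> carrier A \<times> carrier B}"
proof (intro equalityI subsetI)
 fix t assume "t \<in> carrier T"
 then obtain m :: nat and a b where ab: "\<forall>k<m. a k \<in> carrier A & b k \<in> carrier B"
  "t = (%\<phi>. \<Sum>k<m. st (a k) (b k) \<phi>)" by (auto simp: alg_tensor_def)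
 have "t = tens (map (%k. (a k, b k)) [0..<m])"
  unfolding ab(2) by (rule ext) (simp add: tens_def comp_def interv_sum_list_conv_sum_set_nat atLeast0LessThan)
 then show "t \<in> tens ` {xs. set xs \<subseteq> carrier A \<times> carrier B}" by (rule image_eqI) (use ab(1) in auto)
next
 fix t assume "t \<in> tens ` {xs. set xs \<subseteq> carrier A \<times> carrier B}"
 then obtain xs where xs: "t = tens xs" "set xs \<subseteq> carrier A \<times> carrier B" by auto
 have "t = (%\<phi>. \<Sum>k<length xs. st (fst (xs ! k)) (snd (xs ! k)) \<phi>)"
  unfolding xs(1) by (rule ext) (simp add: tens_def sum_list_sum_nth atLeast0LessThan case_prod_beta)
 moreover have "\<forall>k<length xs. fst (xs ! k) \<in> carrier A & snd (xs ! k) \<in> carrier B"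
  using xs(2) nth_mem by (metis mem_Times_iff subsetD)
 ultimately have "\<exists>(m::nat) a b. (\<forall>k<m. a k \<in> carrier A & b k \<in> carrier B) & t = (%\<phi>. \<Sum>k<m. st (a k) (b k) \<phi>)"
  by (intro exI[of _ "length xs"] exI[of _ "%k. fst (xs ! k)"] exI[of _ "%k. snd (xs ! k)"] conjI)
 then show "t \<in> carrier T" by (simp add: alg_tensor_def)
qed

lemma T_ops:
 "(s \<oplus>\<^bsub>T\<^esub> t) \<phi> = s \<phi> + t \<phi>" "\<zero>\<^bsub>T\<^esub> \<phi> = 0" "scale T c t \<phi> = c * t \<phi>" "\<one>\<^bsub>T\<^esub> = st \<one>\<^bsub>A\<^esub> \<one>\<^bsub>B\<^esub>"
 "(s \<otimes>\<^bsub>T\<^esub> t) \<phi> = (if bil \<phi> then s (%a b. t (%c d. \<phi> (a \<otimes>\<^bsub>A\<^esub> c) (b \<otimes>\<^bsub>B\<^esub> d))) else 0)"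
 "star T t \<phi> = (if bil \<phi> then cnj (t (%a b. cnj (\<phi> (star A a) (star B b)))) else 0)"
 by (simp_all add: alg_tensor_def)

lemma bilD:
 assumes "bil \<phi>"
 shows "a \<in> carrier A ==> a' \<in> carrier A ==> b \<in> carrier B ==> \<phi> (a \<oplus>\<^bsub>A\<^esub> a') b = \<phi> a b + \<phi> a' b"
  "a \<in> carrier A ==> b \<in> carrier B ==> b' \<in> carrier B ==> \<phi> a (b \<oplus>\<^bsub>B\<^esub> b') = \<phi> a b + \<phi> a b'"
  "a \<in> carrier A ==> b \<in> carrier B ==> \<phi> (scale A c a) b = c * \<phi> a b"
  "a \<in> carrier A ==> b \<in> carrier B ==> \<phi> a (scale B c b) = c * \<phi> a b"
 using assms by (auto simp: bilinear_on_def)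

text \<open>Tensors are functions of all forms, bilinear or not. Vanishing on the latter is what
  lets \<open>T_eqI\<close> test equality on bilinear forms only.\<close>

lemma T_nonbil: "t \<in> carrier T ==> \<not> bil \<phi> ==> t \<phi> = 0"
proof -
 assume "t \<in> carrier T" and \<phi>: "\<not> bil \<phi>"
 then obtain xs where "t = tens xs" by (auto simp: carrier_T)
 moreover have "tens xs \<phi> = 0" for xs
  using \<phi> by (induction xs) (auto simp: tens_simps simple_tensor_def)
 ultimately show ?thesis by simp
qed

lemma T_induct [consumes 1, case_names zero add]:
 assumes t: "t \<in> carrier T" and zero: "P \<zero>\<^bsub>T\<^esub>"
  and add: "!!t a b. t \<in> carrier T ==> a \<in> carrier A ==> b \<in> carrier B ==> P t ==> P (st a b \<oplus>\<^bsub>T\<^esub> t)"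
 shows "P t"
proof -
 obtain xs where xs: "set xs \<subseteq> carrier A \<times> carrier B" "t = tens xs" using t by (auto simp: carrier_T)
 have "P (tens xs)" using xs(1)
 proof (induction xs)
  case Nil
  have "tens [] = \<zero>\<^bsub>T\<^esub>" by (rule ext) (simp add: tens_simps T_ops)
  then show ?case using zero by simp
 next
  case (Cons x xs)
  obtain a b where x: "x = (a, b)" by force
  have "tens (x # xs) = st a b \<oplus>\<^bsub>T\<^esub> tens xs" by (rule ext) (simp add: tens_simps T_ops x)
  then show ?case using add[of "tens xs" a b] Cons x by (auto simp: carrier_T)
 qed
 then show ?thesis using xs by simp
qed

lemma st_closed: "a \<in> carrier A ==> b \<in> carrier B ==> st a b \<in> carrier T"
 unfolding carrier_T by (rule image_eqI[of _ _ "[(a, b)]"]) (auto simp: tens_simps)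

lemma zero_closed: "\<zero>\<^bsub>T\<^esub> \<in> carrier T"
 unfolding carrier_T by (rule image_eqI[of _ _ "[]"]) (auto simp: tens_simps T_ops fun_eq_iff)

lemma add_closed: assumes "s \<in> carrier T" "t \<in> carrier T" shows "s \<oplus>\<^bsub>T\<^esub> t \<in> carrier T"
proof -
 obtain xs ys where "set xs \<subseteq> carrier A \<times> carrier B" "s = tens xs" "set ys \<subseteq> carrier A \<times> carrier B" "t = tens ys"
  using assms by (auto simp: carrier_T)
 then show ?thesis unfolding carrier_T
  by (intro image_eqI[of _ _ "xs @ ys"]) (auto simp: tens_def T_ops fun_eq_iff)
qed

text \<open>Forms are total functions, whereas associativity and the like hold only on the carriers;
  this lemma permits rewriting under a tensor.\<close>

lemma T_cong:
 assumes "t \<in> carrier T" "bil \<phi>" "bil \<psi>" "!!a b. a \<in> carrier A ==> b \<in> carrier B ==> \<phi> a b = \<psi> a b"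
 shows "t \<phi> = t \<psi>"
 using assms(1)
 by (induction t rule: T_induct) (auto simp: T_ops simple_tensor_def assms(2-4))

lemma T_linear:
 assumes "t \<in> carrier T" "bil \<phi>" "bil \<psi>"
 shows "t (%a b. \<phi> a b + \<psi> a b) = t \<phi> + t \<psi>" "t (%a b. c * \<phi> a b) = c * t \<phi>"
  "bil (%a b. \<phi> a b + \<psi> a b)" "bil (%a b. c * \<phi> a b)"
proof -
 show b: "bil (%a b. \<phi> a b + \<psi> a b)" "bil (%a b. c * \<phi> a b)"
  using assms(2,3) by (auto simp: bilinear_on_def algebra_simps)
 show "t (%a b. \<phi> a b + \<psi> a b) = t \<phi> + t \<psi>"
  using assms(1) by (induction t rule: T_induct) (auto simp: T_ops simple_tensor_def assms(2,3) b)
 show "t (%a b. c * \<phi> a b) = c * t \<phi>"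
  using assms(1) by (induction t rule: T_induct) (auto simp: T_ops simple_tensor_def assms(2,3) b algebra_simps)
qed

lemma bil_shift: "bil \<phi> ==> a \<in> carrier A ==> b \<in> carrier B ==> bil (%c d. \<phi> (a \<otimes>\<^bsub>A\<^esub> c) (b \<otimes>\<^bsub>B\<^esub> d))"
 by (auto simp: bilinear_on_def A.r_distr B.r_distr A.scale_mult_right B.scale_mult_right)

lemma bil_shift_right: "bil \<phi> ==> a \<in> carrier A ==> b \<in> carrier B ==> bil (%c d. \<phi> (c \<otimes>\<^bsub>A\<^esub> a) (d \<otimes>\<^bsub>B\<^esub> b))"
 by (auto simp: bilinear_on_def A.l_distr B.l_distr A.scale_mult_left B.scale_mult_left)

lemma bil_star: "bil \<phi> ==> bil (%a b. cnj (\<phi> (star A a) (star B b)))"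
 by (auto simp: bilinear_on_def A.star_add B.star_add A.star_scale B.star_scale)

text \<open>A product evaluates its left factor at this form; were the form not bilinear, the
  default value 0 would result.\<close>

lemma bil_inner:
 assumes t: "t \<in> carrier T" and \<phi>: "bil \<phi>"
 shows "bil (%a b. t (%c d. \<phi> (a \<otimes>\<^bsub>A\<^esub> c) (b \<otimes>\<^bsub>B\<^esub> d)))"
 using t
proof (induction t rule: T_induct)
 case (add t x y)
 have eq: "(st x y \<oplus>\<^bsub>T\<^esub> t) (%c d. \<phi> (a \<otimes>\<^bsub>A\<^esub> c) (b \<otimes>\<^bsub>B\<^esub> d)) =
   \<phi> (a \<otimes>\<^bsub>A\<^esub> x) (b \<otimes>\<^bsub>B\<^esub> y) + t (%c d. \<phi> (a \<otimes>\<^bsub>A\<^esub> c) (b \<otimes>\<^bsub>B\<^esub> d))"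
  if "a \<in> carrier A" "b \<in> carrier B" for a b
  using bil_shift[OF \<phi> that] by (simp add: T_ops simple_tensor_def)
 have "bil (%a b. \<phi> (a \<otimes>\<^bsub>A\<^esub> x) (b \<otimes>\<^bsub>B\<^esub> y) + t (%c d. \<phi> (a \<otimes>\<^bsub>A\<^esub> c) (b \<otimes>\<^bsub>B\<^esub> d)))"
  using bil_shift_right[OF \<phi> add(2,3)] add(4) T_linear(3)[OF zero_closed] by blast
 then show ?case unfolding bilinear_on_def using eq by simp
qed (simp add: T_ops bilinear_on_def)

lemma T_eqI: "s \<in> carrier T ==> t \<in> carrier T ==> (!!\<phi>. bil \<phi> ==> s \<phi> = t \<phi>) ==> s = t"
 using T_nonbil by (metis ext)

lemma st_add_left: "a \<in> carrier A ==> a' \<in> carrier A ==> b \<in> carrier B ==> st (a \<oplus>\<^bsub>A\<^esub> a') b = st a b \<oplus>\<^bsub>T\<^esub> st a' b"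
 and st_add_right: "a \<in> carrier A ==> b \<in> carrier B ==> b' \<in> carrier B ==> st a (b \<oplus>\<^bsub>B\<^esub> b') = st a b \<oplus>\<^bsub>T\<^esub> st a b'"
 and st_scale_left: "a \<in> carrier A ==> b \<in> carrier B ==> st (scale A c a) b = scale T c (st a b)"
 and st_scale_right: "a \<in> carrier A ==> b \<in> carrier B ==> st a (scale B c b) = scale T c (st a b)"
 by (rule ext; simp add: simple_tensor_def T_ops bilD)+

lemma st_mult: "a \<in> carrier A ==> b \<in> carrier B ==> c \<in> carrier A ==> d \<in> carrier B ==>
  st a b \<otimes>\<^bsub>T\<^esub> st c d = st (a \<otimes>\<^bsub>A\<^esub> c) (b \<otimes>\<^bsub>B\<^esub> d)"
 using bil_inner[OF st_closed[of c d]]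
 by (intro ext) (simp add: T_ops, simp add: simple_tensor_def bil_shift)

lemma st_star: "a \<in> carrier A ==> b \<in> carrier B ==> star T (st a b) = st (star A a) (star B b)"
 by (rule ext) (simp add: T_ops simple_tensor_def bil_star)

lemma scale_closed: "t \<in> carrier T ==> scale T c t \<in> carrier T"
proof (induction t rule: T_induct)
 case zero
 have "scale T c \<zero>\<^bsub>T\<^esub> = \<zero>\<^bsub>T\<^esub>" by (rule ext) (simp add: T_ops)
 then show ?case using zero_closed by simp
next
 case (add t a b)
 have "scale T c (st a b \<oplus>\<^bsub>T\<^esub> t) = scale T c (st a b) \<oplus>\<^bsub>T\<^esub> scale T c t" by (rule ext) (simp add: T_ops distrib_left)
 moreover have "scale T c (st a b) \<in> carrier T"
  using st_scale_left[of a b c] st_closed[of "scale A c a" b] add by simp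
 ultimately show ?case using add add_closed by simp
qed

lemma star_closed: "t \<in> carrier T ==> star T t \<in> carrier T"
proof (induction t rule: T_induct)
 case zero
 have "star T \<zero>\<^bsub>T\<^esub> = \<zero>\<^bsub>T\<^esub>" by (rule ext) (simp add: T_ops)
 then show ?case using zero_closed by simp
next
 case (add t a b)
 have "star T (st a b \<oplus>\<^bsub>T\<^esub> t) = star T (st a b) \<oplus>\<^bsub>T\<^esub> star T t" by (rule ext) (simp add: T_ops)
 then show ?case using add add_closed st_closed st_star by simp
qed

lemma mult_distrib_left: "s \<in> carrier T ==> t \<in> carrier T ==> t' \<in> carrier T ==> s \<otimes>\<^bsub>T\<^esub> (t \<oplus>\<^bsub>T\<^esub> t') = s \<otimes>\<^bsub>T\<^esub> t \<oplus>\<^bsub>T\<^esub> s \<otimes>\<^bsub>T\<^esub> t'"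
 by (rule ext) (simp add: T_ops T_linear(1)[OF _ bil_inner bil_inner])

lemma mult_distrib_right: "(s \<oplus>\<^bsub>T\<^esub> s') \<otimes>\<^bsub>T\<^esub> t = s \<otimes>\<^bsub>T\<^esub> t \<oplus>\<^bsub>T\<^esub> s' \<otimes>\<^bsub>T\<^esub> t"
 by (rule ext) (simp add: T_ops)

lemma mult_zero: "s \<in> carrier T ==> s \<otimes>\<^bsub>T\<^esub> \<zero>\<^bsub>T\<^esub> = \<zero>\<^bsub>T\<^esub>" "\<zero>\<^bsub>T\<^esub> \<otimes>\<^bsub>T\<^esub> t = \<zero>\<^bsub>T\<^esub>"
proof -
 have "bil (%a b. 0)" by (simp add: bilinear_on_def)
 then show "s \<in> carrier T ==> s \<otimes>\<^bsub>T\<^esub> \<zero>\<^bsub>T\<^esub> = \<zero>\<^bsub>T\<^esub>"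
  using T_linear(2)[of s "%a b. 0" "%a b. 0" 0] by (intro ext) (simp add: T_ops)
qed (rule ext, simp add: T_ops)

lemma mult_closed: assumes "s \<in> carrier T" "t \<in> carrier T" shows "s \<otimes>\<^bsub>T\<^esub> t \<in> carrier T"
proof -
 have 1: "st a b \<otimes>\<^bsub>T\<^esub> t \<in> carrier T" if "a \<in> carrier A" "b \<in> carrier B" for a b
  using assms(2)
  by (induction t rule: T_induct)
   (use that in \<open>auto simp: mult_zero mult_distrib_left st_mult add_closed zero_closed st_closed\<close>)
 show ?thesis
  using assms(1)
  by (induction s rule: T_induct)
   (auto simp: mult_zero mult_distrib_right 1 add_closed zero_closed)
qed

lemma star_algebra_T: "star_algebra T"
proof -
 note cl = add_closed mult_closed scale_closed star_closed zero_closed st_closed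
 have ab: "abelian_group T"
 proof (rule abelian_groupI)
  show "\<exists>y\<in>carrier T. y \<oplus>\<^bsub>T\<^esub> x = \<zero>\<^bsub>T\<^esub>" if "x \<in> carrier T" for x
   by (rule bexI[of _ "scale T (-1) x"]) (use that in \<open>auto simp: cl T_ops fun_eq_iff\<close>)
 qed (auto simp: cl T_ops fun_eq_iff)
 have mo: "monoid T"
 proof (rule monoidI)
  show "(x \<otimes>\<^bsub>T\<^esub> y) \<otimes>\<^bsub>T\<^esub> z = x \<otimes>\<^bsub>T\<^esub> (y \<otimes>\<^bsub>T\<^esub> z)" if c: "x \<in> carrier T" "y \<in> carrier T" "z \<in> carrier T" for x y z
  proof (rule T_eqI)
   fix \<phi> assume \<phi>: "bil \<phi>"
   have "((x \<otimes>\<^bsub>T\<^esub> y) \<otimes>\<^bsub>T\<^esub> z) \<phi> = x (%a b. y (%c d. z (%e f. \<phi> ((a \<otimes>\<^bsub>A\<^esub> c) \<otimes>\<^bsub>A\<^esub> e) ((b \<otimes>\<^bsub>B\<^esub> d) \<otimes>\<^bsub>B\<^esub> f))))"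
    using bil_inner[OF c(3) \<phi>] \<phi> by (simp add: T_ops)
   also have "... = x (%a b. (y \<otimes>\<^bsub>T\<^esub> z) (%c d. \<phi> (a \<otimes>\<^bsub>A\<^esub> c) (b \<otimes>\<^bsub>B\<^esub> d)))"
   proof (rule T_cong[OF c(1)])
    show "bil (%a b. y (%c d. z (%e f. \<phi> ((a \<otimes>\<^bsub>A\<^esub> c) \<otimes>\<^bsub>A\<^esub> e) ((b \<otimes>\<^bsub>B\<^esub> d) \<otimes>\<^bsub>B\<^esub> f))))"
     by (rule bil_inner[OF c(2) bil_inner[OF c(3) \<phi>]])
    show "bil (%a b. (y \<otimes>\<^bsub>T\<^esub> z) (%c d. \<phi> (a \<otimes>\<^bsub>A\<^esub> c) (b \<otimes>\<^bsub>B\<^esub> d)))"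
     by (rule bil_inner[OF mult_closed[OF c(2,3)] \<phi>])
    fix a b assume ab: "a \<in> carrier A" "b \<in> carrier B"
    have "(y \<otimes>\<^bsub>T\<^esub> z) (%c d. \<phi> (a \<otimes>\<^bsub>A\<^esub> c) (b \<otimes>\<^bsub>B\<^esub> d)) =
      y (%c d. z (%e f. \<phi> (a \<otimes>\<^bsub>A\<^esub> (c \<otimes>\<^bsub>A\<^esub> e)) (b \<otimes>\<^bsub>B\<^esub> (d \<otimes>\<^bsub>B\<^esub> f))))"
     using bil_shift[OF \<phi> ab] by (simp add: T_ops)
    also have "... = y (%c d. z (%e f. \<phi> ((a \<otimes>\<^bsub>A\<^esub> c) \<otimes>\<^bsub>A\<^esub> e) ((b \<otimes>\<^bsub>B\<^esub> d) \<otimes>\<^bsub>B\<^esub> f)))"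
    proof (rule T_cong[OF c(2)])
     show "bil (%c d. z (%e f. \<phi> (a \<otimes>\<^bsub>A\<^esub> (c \<otimes>\<^bsub>A\<^esub> e)) (b \<otimes>\<^bsub>B\<^esub> (d \<otimes>\<^bsub>B\<^esub> f))))"
      by (rule bil_inner[OF c(3) bil_shift[OF \<phi> ab]])
     show "bil (%c d. z (%e f. \<phi> ((a \<otimes>\<^bsub>A\<^esub> c) \<otimes>\<^bsub>A\<^esub> e) ((b \<otimes>\<^bsub>B\<^esub> d) \<otimes>\<^bsub>B\<^esub> f)))"
      by (rule bil_shift[OF bil_inner[OF c(3) \<phi>] ab])
     fix u v assume uv: "u \<in> carrier A" "v \<in> carrier B"
     show "z (%e f. \<phi> (a \<otimes>\<^bsub>A\<^esub> (u \<otimes>\<^bsub>A\<^esub> e)) (b \<otimes>\<^bsub>B\<^esub> (v \<otimes>\<^bsub>B\<^esub> f))) =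
       z (%e f. \<phi> ((a \<otimes>\<^bsub>A\<^esub> u) \<otimes>\<^bsub>A\<^esub> e) ((b \<otimes>\<^bsub>B\<^esub> v) \<otimes>\<^bsub>B\<^esub> f))"
      by (rule T_cong[OF c(3) bil_shift[OF bil_shift[OF \<phi> ab] uv] bil_shift[OF \<phi>]])
       (use ab uv in \<open>auto simp: A.m_assoc B.m_assoc\<close>)
    qed
    finally show "y (%c d. z (%e f. \<phi> ((a \<otimes>\<^bsub>A\<^esub> c) \<otimes>\<^bsub>A\<^esub> e) ((b \<otimes>\<^bsub>B\<^esub> d) \<otimes>\<^bsub>B\<^esub> f))) =
      (y \<otimes>\<^bsub>T\<^esub> z) (%c d. \<phi> (a \<otimes>\<^bsub>A\<^esub> c) (b \<otimes>\<^bsub>B\<^esub> d))" by simp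
   qed
   also have "... = (x \<otimes>\<^bsub>T\<^esub> (y \<otimes>\<^bsub>T\<^esub> z)) \<phi>" using \<phi> by (simp add: T_ops(5)[of x])
   finally show "((x \<otimes>\<^bsub>T\<^esub> y) \<otimes>\<^bsub>T\<^esub> z) \<phi> = (x \<otimes>\<^bsub>T\<^esub> (y \<otimes>\<^bsub>T\<^esub> z)) \<phi>" .
  qed (use c in \<open>auto simp: cl\<close>)
  show "\<one>\<^bsub>T\<^esub> \<otimes>\<^bsub>T\<^esub> x = x" if "x \<in> carrier T" for x
   using that by (induction x rule: T_induct)
    (auto simp: T_ops(4) mult_zero mult_distrib_left st_mult cl)
  show "x \<otimes>\<^bsub>T\<^esub> \<one>\<^bsub>T\<^esub> = x" if "x \<in> carrier T" for x
   using that by (induction x rule: T_induct)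
    (auto simp: T_ops(4) mult_zero mult_distrib_right st_mult cl)
 qed (auto simp: cl T_ops(4))
 have ri: "ring T"
  by (rule ringI[OF ab mo]) (auto simp: mult_distrib_left mult_distrib_right)
 interpret T: ring T by fact
 have sa: "star T (x \<oplus>\<^bsub>T\<^esub> y) = star T x \<oplus>\<^bsub>T\<^esub> star T y" for x y
  by (rule ext) (simp add: T_ops)
 have sz: "star T \<zero>\<^bsub>T\<^esub> = \<zero>\<^bsub>T\<^esub>" by (rule ext) (simp add: T_ops)
 have sm1: "star T (st a b \<otimes>\<^bsub>T\<^esub> y) = star T y \<otimes>\<^bsub>T\<^esub> star T (st a b)"
  if "a \<in> carrier A" "b \<in> carrier B" "y \<in> carrier T" for a b y
  using that(3)
  by (induction y rule: T_induct)
   (use that(1,2) in \<open>auto simp: sz sa mult_zero mult_distrib_left mult_distrib_right cl st_mult st_star A.star_mult B.star_mult\<close>)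
 show ?thesis
 proof (intro star_algebra.intro ri star_algebra_axioms.intro)
  show "star T (x \<otimes>\<^bsub>T\<^esub> y) = star T y \<otimes>\<^bsub>T\<^esub> star T x" if "x \<in> carrier T" "y \<in> carrier T" for x y
   using that(1)
   by (induction x rule: T_induct)
    (use that(2) in \<open>auto simp: sz sa sm1 mult_zero mult_distrib_left mult_distrib_right cl\<close>)
  show "star T (star T x) = x" if "x \<in> carrier T" for x
   using that by (induction x rule: T_induct) (auto simp: sz sa st_star)
  show "x \<otimes>\<^bsub>T\<^esub> scale T c y = scale T c (x \<otimes>\<^bsub>T\<^esub> y)" if "x \<in> carrier T" "y \<in> carrier T" for c x y
   by (rule ext) (use that in \<open>auto simp: T_ops T_linear(2)[OF that(1) bil_inner[OF that(2)] bil_inner[OF that(2)]]\<close>)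
  show "scale T c x \<in> carrier T" "star T x \<in> carrier T" "star T (x \<oplus>\<^bsub>T\<^esub> y) = star T x \<oplus>\<^bsub>T\<^esub> star T y"
   if "x \<in> carrier T" for c x y using that by (auto simp: cl sa)
 qed (auto simp: T_ops fun_eq_iff algebra_simps)
qed

sublocale T: star_algebra T by (rule star_algebra_T)

lemma left_hom: "(%a. st a \<one>\<^bsub>B\<^esub>) \<in> cstar_hom A T" and right_hom: "(%b. st \<one>\<^bsub>A\<^esub> b) \<in> cstar_hom B T"
 by (rule cstar_homI; simp add: st_closed st_add_left st_add_right st_mult T_ops(4) st_scale_left st_scale_right st_star)+

end

lemma tensor_map_alg_hom:
 assumes A: "star_algebra A" and B: "star_algebra B" and C: "star_algebra C" and D: "star_algebra D"
  and f: "f \<in> cstar_hom A C" and g: "g \<in> cstar_hom B D"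
 defines "m == %t \<phi>. if bilinear_on C D \<phi> then t (%a b. \<phi> (f a) (g b)) else 0"
 shows "m \<in> cstar_hom (alg_tensor A B) (alg_tensor C D)"
  and "a \<in> carrier A ==> b \<in> carrier B ==> m (simple_tensor A B a b) = simple_tensor C D (f a) (g b)"
proof -
 interpret S: tensor A B by (rule tensor.intro[OF A B])
 interpret R: tensor C D by (rule tensor.intro[OF C D])
 note fD = cstar_homD[OF f] note gD = cstar_homD[OF g]
 have bil: "S.bil (%a b. \<phi> (f a) (g b))" if "R.bil \<phi>" for \<phi>
  using that by (auto simp: bilinear_on_def fD gD)
 have ms: "m (S.st a b) = R.st (f a) (g b)" if "a \<in> carrier A" "b \<in> carrier B" for a b
  using bil by (intro ext) (simp add: m_def simple_tensor_def)
 then show "a \<in> carrier A ==> b \<in> carrier B ==> m (simple_tensor A B a b) = simple_tensor C D (f a) (g b)" .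
 have ma: "m (s \<oplus>\<^bsub>S.T\<^esub> t) = m s \<oplus>\<^bsub>R.T\<^esub> m t" for s t by (rule ext) (simp add: m_def S.T_ops R.T_ops)
 have mz: "m \<zero>\<^bsub>S.T\<^esub> = \<zero>\<^bsub>R.T\<^esub>" by (rule ext) (simp add: m_def S.T_ops R.T_ops)
 have msc: "m (scale S.T c t) = scale R.T c (m t)" for c t by (rule ext) (simp add: m_def S.T_ops R.T_ops)
 have mc: "m t \<in> carrier R.T" if "t \<in> carrier S.T" for t
  using that by (induction t rule: S.T_induct) (auto simp: mz ma ms fD gD R.st_closed)
 have mm1: "m (S.st a b \<otimes>\<^bsub>S.T\<^esub> t) = m (S.st a b) \<otimes>\<^bsub>R.T\<^esub> m t" if "a \<in> carrier A" "b \<in> carrier B" "t \<in> carrier S.T" for a b t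
  using that(3)
  by (induction t rule: S.T_induct)
   (use that(1,2) in \<open>auto simp: mz ma ms mc fD gD S.st_closed R.st_closed S.st_mult R.st_mult S.T.r_distr R.T.r_distr\<close>)
 have mm: "m (s \<otimes>\<^bsub>S.T\<^esub> t) = m s \<otimes>\<^bsub>R.T\<^esub> m t" if "s \<in> carrier S.T" "t \<in> carrier S.T" for s t
  using that(1)
  by (induction s rule: S.T_induct)
   (use that(2) in \<open>auto simp: mz ma mm1 mc S.st_closed S.T.l_distr R.T.l_distr\<close>)
 have mst: "m (star S.T t) = star R.T (m t)" if "t \<in> carrier S.T" for t
  using that
  by (induction t rule: S.T_induct)
   (auto simp: mz ma ms mc S.st_closed R.st_closed S.T.star_add R.T.star_add S.st_star R.st_star fD gD)
 show "m \<in> cstar_hom (alg_tensor A B) (alg_tensor C D)"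
  by (rule cstar_homI) (auto simp: mc ma mm msc mst S.T_ops(4) R.T_ops(4) ms fD(4) gD(4))
qed

section \<open>The maximal tensor product of C*-algebras\<close>

locale cstar_tensor = A: cstar_algebra A + B: cstar_algebra B
 for A :: "('a, 'm) cstar_alg_scheme" and B :: "('b, 'k) cstar_alg_scheme"
begin

sublocale tensor A B by unfold_locales

lemma st_split: "a \<in> carrier A ==> b \<in> carrier B ==> st a b = st a \<one>\<^bsub>B\<^esub> \<otimes>\<^bsub>T\<^esub> st \<one>\<^bsub>A\<^esub> b"
 by (simp add: st_mult)

text \<open>Split the simple tensor into its two legs. Each leg embeds its algebra, and
  \<open>p\<close> pulled back along the embedding is a C*-seminorm on a C*-algebra, hence below the
  norm. This keeps the supremum in the maximal tensor norm finite.\<close>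

lemma cross_le:
 assumes p: "cstar_seminorm T p" and a: "a \<in> carrier A" and b: "b \<in> carrier B"
 shows "p (st a b) <= nrm A a * nrm B b"
proof -
 interpret p: star_seminorm T p using star_algebra_T p by (rule star_seminormI)
 have "p (st a b) <= p (st a \<one>\<^bsub>B\<^esub>) * p (st \<one>\<^bsub>A\<^esub> b)"
  unfolding st_split[OF a b] using a b by (intro p.p_mult st_closed) auto
 also have "... <= nrm A a * nrm B b"
  using A.seminorm_le_nrm[OF seminorm_pullback[OF A.star_alg left_hom p] a]
   B.seminorm_le_nrm[OF seminorm_pullback[OF B.star_alg right_hom p] b] a b
  by (intro mult_mono) (auto simp: st_closed)
 finally show ?thesis .
qed

lemma univ_alg_T: "univ_alg T {}"
proof (intro univ_alg.intro star_algebra_T univ_alg_axioms.intro)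
 have "\<exists>M. \<forall>p. cstar_seminorm T p --> p t <= M" if "t \<in> carrier T" for t
  using that
 proof (induction t rule: T_induct)
  case zero
  have "p \<zero>\<^bsub>T\<^esub> <= 0" if "cstar_seminorm T p" for p
  proof -
   interpret p: star_seminorm T p using star_algebra_T that by (rule star_seminormI)
   show ?thesis by simp
  qed
  then show ?case by blast
 next
  case (add t a b)
  then obtain M where M: "\<forall>p. cstar_seminorm T p --> p t <= M" by blast
  have "p (st a b \<oplus>\<^bsub>T\<^esub> t) <= nrm A a * nrm B b + M" if p: "cstar_seminorm T p" for p
  proof -
   interpret p: star_seminorm T p using star_algebra_T p by (rule star_seminormI)
   show ?thesis using p.p_add[OF st_closed[OF add(2,3)] add(1)] cross_le[OF p add(2,3)] M p by fastforce
  qed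
  then show ?case by blast
 qed
 then show "bounded_rel T {}" by (simp add: bounded_rel_def)
qed

sublocale U: univ_alg T "{}" by (rule univ_alg_T)

abbreviation TC where "TC == tensor_cstar A B"
abbreviation te where "te == tensor_elem A B"

lemma TC_eq: "TC = univ_cstar T {}" by (simp add: tensor_cstar_def)

lemma cstar_algebra_TC: "cstar_algebra TC"
 unfolding TC_eq by (rule U.cstar_algebra_univ)

sublocale TC: cstar_algebra TC by (rule cstar_algebra_TC)

lemma te_closed: "a \<in> carrier A ==> b \<in> carrier B ==> te a b \<in> carrier TC"
 and te_add_left: "a \<in> carrier A ==> a' \<in> carrier A ==> b \<in> carrier B ==> te (a \<oplus>\<^bsub>A\<^esub> a') b = te a b \<oplus>\<^bsub>TC\<^esub> te a' b"
 and te_add_right: "a \<in> carrier A ==> b \<in> carrier B ==> b' \<in> carrier B ==> te a (b \<oplus>\<^bsub>B\<^esub> b') = te a b \<oplus>\<^bsub>TC\<^esub> te a b'"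
 and te_scale_left: "a \<in> carrier A ==> b \<in> carrier B ==> te (scale A c a) b = scale TC c (te a b)"
 and te_scale_right: "a \<in> carrier A ==> b \<in> carrier B ==> te a (scale B c b) = scale TC c (te a b)"
 and te_mult: "a \<in> carrier A ==> b \<in> carrier B ==> a' \<in> carrier A ==> b' \<in> carrier B ==>
  te a b \<otimes>\<^bsub>TC\<^esub> te a' b' = te (a \<otimes>\<^bsub>A\<^esub> a') (b \<otimes>\<^bsub>B\<^esub> b')"
 and te_star: "a \<in> carrier A ==> b \<in> carrier B ==> star TC (te a b) = te (star A a) (star B b)"
 and te_one: "te \<one>\<^bsub>A\<^esub> \<one>\<^bsub>B\<^esub> = \<one>\<^bsub>TC\<^esub>"
 using cstar_homD[OF U.univ_elem_hom]
 unfolding TC_eq tensor_elem_def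
 by (simp_all add: st_closed st_add_left st_add_right st_scale_left st_scale_right st_mult[symmetric] st_star[symmetric]
   flip: T_ops(4))

end

lemma tensor_map_hom:
 assumes A: "cstar_algebra A" and B: "cstar_algebra B" and C: "cstar_algebra C" and D: "cstar_algebra D"
  and f: "f \<in> cstar_hom A C" and g: "g \<in> cstar_hom B D"
 shows "tensor_map C D f g \<in> cstar_hom (tensor_cstar A B) (tensor_cstar C D)"
  and "a \<in> carrier A ==> b \<in> carrier B ==>
   tensor_map C D f g (tensor_elem A B a b) = tensor_elem C D (f a) (g b)"
proof -
 interpret S: cstar_tensor A B by (rule cstar_tensor.intro[OF A B])
 interpret R: cstar_tensor C D by (rule cstar_tensor.intro[OF C D])
 note m = tensor_map_alg_hom[OF S.A.star_alg S.B.star_alg R.A.star_alg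
   R.B.star_alg f g]
 note u = univ_map_hom[OF S.univ_alg_T R.univ_alg_T m(1)]
 show "tensor_map C D f g \<in> cstar_hom (tensor_cstar A B) (tensor_cstar C D)"
  unfolding tensor_map_def tensor_cstar_def by (rule u(1))
 show "tensor_map C D f g (tensor_elem A B a b) = tensor_elem C D (f a) (g b)" if "a \<in> carrier A" "b \<in> carrier B"
  unfolding tensor_map_def tensor_elem_def u(2)[OF S.st_closed[OF that]] m(2)[OF that] ..
qed

section \<open>Positive functionals and states\<close>

definition nn :: "complex => bool" where
 "nn z \<longleftrightarrow> Im z = 0 & 0 <= Re z"

lemma nn_simps: "nn 0" "nn w ==> nn z ==> nn (w + z)" "nn w ==> nn z ==> nn (w * z)" "nn (cnj z * z)" "nn (z * cnj z)"
 by (auto simp: nn_def)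

lemma nn_of_real: "nn z ==> z = of_real (Re z)"
 by (auto simp: nn_def complex_eq_iff)

lemma nn_divide: "nn w ==> nn z ==> nn (w / z)"
 using nn_of_real[of w] nn_of_real[of z] by (metis Im_complex_of_real Re_complex_of_real nn_def of_real_divide zero_le_divide_iff)

definition psd :: "'i set => ('i => 'i => complex) => bool" where
 "psd K M \<longleftrightarrow> (\<forall>c. nn (\<Sum>k\<in>K. \<Sum>l\<in>K. cnj (c k) * c l * M k l))"

lemma psdD: "psd K M ==> nn (\<Sum>k\<in>K. \<Sum>l\<in>K. cnj (c k) * c l * M k l)"
 by (simp add: psd_def)

lemma psd_mono: assumes "psd K M" "J \<subseteq> K" "finite K" shows "psd J M"
 unfolding psd_def
proof
 fix c :: "'a => complex"
 define d where "d k = (if k \<in> J then c k else 0)" for k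
 have "(\<Sum>k\<in>J. \<Sum>l\<in>J. cnj (c k) * c l * M k l) = (\<Sum>k\<in>K. \<Sum>l\<in>K. cnj (d k) * d l * M k l)"
  using assms(2,3) by (intro sum.mono_neutral_cong_left) (auto simp: d_def intro!: sum.mono_neutral_cong_left sum.neutral)
 then show "nn (\<Sum>k\<in>J. \<Sum>l\<in>J. cnj (c k) * c l * M k l)" using assms(1) by (simp add: psd_def)
qed

lemma psd_two:
 assumes "psd K M" "finite K" "j \<in> K" "k \<in> K" "j ~= k"
 shows "nn (cnj a * a * M j j + cnj a * b * M j k + cnj b * a * M k j + cnj b * b * M k k)"
proof -
 have "psd {j, k} M" using psd_mono[OF assms(1)] assms by auto
 from psdD[OF this, of "%x. if x = j then a else b"]
 show ?thesis using assms(5) by (simp add: algebra_simps)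
qed

lemma psd_hermitian:
 assumes "psd K M" "finite K" "j \<in> K" "k \<in> K"
 shows "M k j = cnj (M j k)" "nn (M j j)"
proof -
 have *: "nn (M i i)" if "i \<in> K" for i
 proof -
  have "psd {i} M" using psd_mono[OF assms(1)] that assms by auto
  from psdD[OF this, of "%x. 1"]
  show ?thesis by simp
 qed
 show "nn (M j j)" using * assms by blast
 show "M k j = cnj (M j k)"
 proof (cases "j = k")
  case True
  then show ?thesis using *[OF assms(3)] by (simp add: nn_def complex_eq_iff)
 next
  case False
  show ?thesis
   using psd_two[OF assms False, of 1 1] psd_two[OF assms False, of 1 \<i>] *[OF assms(3)] *[OF assms(4)]
   by (simp add: nn_def complex_eq_iff)
 qed
qed

lemma psd_zero_row:
 assumes "psd K M" "finite K" "j \<in> K" "k \<in> K" "M j j = 0"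
 shows "M j k = 0" "M k j = 0"
proof -
 have h: "M k j = cnj (M j k)" by (rule psd_hermitian[OF assms(1-4)])
 have "M j k = 0"
 proof (rule ccontr)
  assume nz: "M j k ~= 0"
  then have jk: "j ~= k" using assms(5) by auto
  define n where "n = Re (M j k * cnj (M j k))"
  have n: "n > 0" "M j k * cnj (M j k) = of_real n"
   using nz by (auto simp: n_def complex_mult_cnj complex_neq_0)
  have kk: "M k k = of_real (Re (M k k))" by (rule nn_of_real[OF psd_hermitian(2)[OF assms(1,2,4,4)]])
  \<comment> \<open>At the vector with entries - t M j k and 1 the form takes the value M k k - 2 t
    n; this \<open>t\<close> is large enough to make it negative.\<close>
  define t where "t = (\<bar>Re (M k k)\<bar> + 1) / n"
  have "nn (cnj (- of_real t * M j k) * 1 * M j k + cnj 1 * (- of_real t * M j k) * M k j + cnj 1 * 1 * M k k)"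
   using psd_two[OF assms(1-4) jk, of "- of_real t * M j k" 1] assms(5) by simp
  moreover have "cnj (- of_real t * M j k) * 1 * M j k + cnj 1 * (- of_real t * M j k) * M k j + cnj 1 * 1 * M k k
    = of_real (Re (M k k) - 2 * t * n)"
   using n(2) kk by (simp add: h algebra_simps)
  ultimately have "nn (of_real (Re (M k k) - 2 * t * n))" by (simp only:)
  then have "0 <= Re (M k k) - 2 * t * n" by (simp only: nn_def Re_complex_of_real)
  then show False using n(1) by (simp add: t_def)
 qed
 then show "M j k = 0" "M k j = 0" using h by auto
qed

text \<open>By induction on \<open>K\<close>, splitting off a Schur complement.\<close>

lemma schur_product:
 assumes "finite K" "psd K M" "psd K N"
 shows "nn (\<Sum>k\<in>K. \<Sum>l\<in>K. M k l * N k l)"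
 using assms
proof (induction K arbitrary: M rule: finite_induct)
 case (insert j K)
 have fin: "finite (insert j K)" using insert by simp
 have N': "psd K N" using psd_mono[OF insert.prems(2) _ fin] by blast
 have split: "(\<Sum>k\<in>insert j K. \<Sum>l\<in>insert j K. f k l) = f j j + (\<Sum>l\<in>K. f j l) + (\<Sum>k\<in>K. f k j) + (\<Sum>k\<in>K. \<Sum>l\<in>K. f k l)"
  for f :: "'a => 'a => complex"
  using insert.hyps by (simp add: sum.distrib algebra_simps)
 show ?case
 proof (cases "M j j = 0")
  case True
  have "M j k = 0" "M k j = 0" if "k \<in> K" for k
   using psd_zero_row[OF insert.prems(1) fin, of j k] True that by auto
  then have "(\<Sum>k\<in>insert j K. \<Sum>l\<in>insert j K. M k l * N k l) = (\<Sum>k\<in>K. \<Sum>l\<in>K. M k l * N k l)"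
   unfolding split using True by simp
  then show ?thesis using insert.IH[OF psd_mono[OF insert.prems(1) _ fin] N'] by auto
 next
  case False
  define d where "d = M j j"
  have d: "d ~= 0" "nn d" "cnj d = d"
   using False psd_hermitian[OF insert.prems(1) fin, of j j] by (auto simp: d_def)
  have h: "M k j = cnj (M j k)" if "k \<in> insert j K" for k
   by (rule psd_hermitian[OF insert.prems(1) fin]) (use that in auto)
  define M' where "M' k l = M k l - M k j * M j l / d" for k l
  have M': "psd K M'"
   unfolding psd_def
  proof
   fix c :: "'a => complex"
   define s where "s = (\<Sum>l\<in>K. c l * M j l)"
   \<comment> \<open>The entry - s / d at \<open>j\<close> minimises the form of \<open>M\<close> in
     that coordinate; what remains is the form of the Schur complement.\<close>
   define e where "e k = (if k = j then - s / d else c k)" for k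
   have ek: "e k = c k" if "k \<in> K" for k using that insert.hyps by (auto simp: e_def)
   have cs: "(\<Sum>k\<in>K. cnj (c k) * M k j) = cnj s"
    by (simp add: s_def h)
   have "(\<Sum>k\<in>insert j K. \<Sum>l\<in>insert j K. cnj (e k) * e l * M k l) =
     cnj (e j) * e j * d + cnj (e j) * s + e j * cnj s + (\<Sum>k\<in>K. \<Sum>l\<in>K. cnj (c k) * c l * M k l)"
   proof -
    have "(\<Sum>l\<in>K. cnj (e j) * e l * M j l) = cnj (e j) * s"
     by (simp add: s_def sum_distrib_left ek mult.assoc)
    moreover have "(\<Sum>k\<in>K. cnj (e k) * e j * M k j) = e j * cnj s"
     by (simp add: cs[symmetric] sum_distrib_left ek mult_ac)
    ultimately show ?thesis unfolding split by (simp add: ek d_def)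
   qed
   also have "cnj (e j) * e j * d + cnj (e j) * s + e j * cnj s = - (cnj s * s / d)"
    using d by (simp add: e_def field_simps)
   also have "- (cnj s * s / d) + (\<Sum>k\<in>K. \<Sum>l\<in>K. cnj (c k) * c l * M k l) = (\<Sum>k\<in>K. \<Sum>l\<in>K. cnj (c k) * c l * M' k l)"
   proof -
    have "cnj s * s / d = (\<Sum>k\<in>K. \<Sum>l\<in>K. cnj (c k) * c l * (M k j * M j l / d))"
     unfolding cs[symmetric] unfolding s_def sum_product sum_divide_distrib
     by (intro sum.cong refl) simp
    then show ?thesis by (simp add: M'_def right_diff_distrib sum_subtractf)
   qed
   finally have "(\<Sum>k\<in>K. \<Sum>l\<in>K. cnj (c k) * c l * M' k l) = (\<Sum>k\<in>insert j K. \<Sum>l\<in>insert j K. cnj (e k) * e l * M k l)"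
    by simp
   then show "nn (\<Sum>k\<in>K. \<Sum>l\<in>K. cnj (c k) * c l * M' k l)" using insert.prems(1) unfolding psd_def by simp
  qed
  have "(\<Sum>k\<in>insert j K. \<Sum>l\<in>insert j K. M' k l * N k l) = (\<Sum>k\<in>K. \<Sum>l\<in>K. M' k l * N k l)"
  proof -
   have "M' j l = 0" "M' k j = 0" for k l using d by (auto simp: M'_def d_def)
   then show ?thesis unfolding split by simp
  qed
  then have 1: "nn (\<Sum>k\<in>insert j K. \<Sum>l\<in>insert j K. M' k l * N k l)" using insert.IH[OF M' N'] by simp
  \<comment> \<open>The rank one part that was split off pairs with \<open>N\<close> to a value of
    the form of \<open>N\<close>, at the vector with entries M j l.\<close>
  have 2: "nn ((\<Sum>k\<in>insert j K. \<Sum>l\<in>insert j K. M k j * M j l * N k l) / d)"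
  proof (rule nn_divide[OF _ d(2)])
   have "(\<Sum>k\<in>insert j K. \<Sum>l\<in>insert j K. M k j * M j l * N k l) =
     (\<Sum>k\<in>insert j K. \<Sum>l\<in>insert j K. cnj (M j k) * M j l * N k l)"
    by (intro sum.cong refl) (simp add: h)
   then show "nn (\<Sum>k\<in>insert j K. \<Sum>l\<in>insert j K. M k j * M j l * N k l)"
    using insert.prems(2) unfolding psd_def by simp
  qed
  have "(\<Sum>k\<in>insert j K. \<Sum>l\<in>insert j K. M k l * N k l) =
    (\<Sum>k\<in>insert j K. \<Sum>l\<in>insert j K. M' k l * N k l) + (\<Sum>k\<in>insert j K. \<Sum>l\<in>insert j K. M k j * M j l * N k l) / d"
   unfolding sum_divide_distrib sum.distrib[symmetric]
   by (intro sum.cong refl) (use d in \<open>simp add: M'_def field_simps\<close>)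
  then show ?thesis using nn_simps(2)[OF 1 2] by simp
 qed
qed (simp add: nn_simps)

section \<open>Positive functionals and their GNS seminorms\<close>

definition posfun :: "('a, 'm) star_alg_scheme => ('a => complex) => bool" where
 "posfun A \<phi> \<longleftrightarrow>
   (\<forall>x\<in>carrier A. \<forall>y\<in>carrier A. \<phi> (x \<oplus>\<^bsub>A\<^esub> y) = \<phi> x + \<phi> y) &
   (\<forall>c. \<forall>x\<in>carrier A. \<phi> (scale A c x) = c * \<phi> x) &
   (\<forall>x\<in>carrier A. nn (\<phi> (star A x \<otimes>\<^bsub>A\<^esub> x)))"

definition state :: "('a, 'm) star_alg_scheme => ('a => complex) => bool" where
 "state A \<phi> \<longleftrightarrow> posfun A \<phi> & \<phi> \<one>\<^bsub>A\<^esub> = 1"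

locale positive_functional = star_algebra A for A :: "('a, 'm) star_alg_scheme" (structure) +
 fixes \<phi> :: "'a => complex"
 assumes posfun: "posfun A \<phi>"
begin

lemma phi_add: "x \<in> carrier A ==> y \<in> carrier A ==> \<phi> (x \<oplus> y) = \<phi> x + \<phi> y"
 and phi_scale: "x \<in> carrier A ==> \<phi> (scale A c x) = c * \<phi> x"
 and phi_pos: "x \<in> carrier A ==> nn (\<phi> (star A x \<otimes> x))"
 using posfun by (auto simp: posfun_def)

lemma phi_zero: "\<phi> \<zero> = 0"
 using phi_scale[of \<zero> 0] by simp

lemma phi_minus: "x \<in> carrier A ==> y \<in> carrier A ==> \<phi> (x \<ominus> y) = \<phi> x - \<phi> y"
 by (simp add: minus_conv phi_add phi_scale)

lemma psd_gram:
 assumes K: "finite K" and x: "!!k. k \<in> K ==> x k \<in> carrier A"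
 shows "psd K (%k l. \<phi> (star A (x k) \<otimes> x l))"
 unfolding psd_def
proof
 fix c :: "'b => complex"
 \<comment> \<open>\<open>v\<close> is the combination of the \<open>x l\<close> with coefficients
   \<open>c l\<close>, recorded through its pairings, which avoids finite sums in the ring. The
   quadratic form will be the value at v* v.\<close>
 have "\<exists>v. v \<in> carrier A & (\<forall>y\<in>carrier A. \<phi> (star A y \<otimes> v) = (\<Sum>l\<in>K. c l * \<phi> (star A y \<otimes> x l)))"
  using K x
 proof (induction K rule: finite_induct)
  case empty
  show ?case by (rule exI[of _ \<zero>]) (simp add: phi_zero)
 next
  case (insert k K)
  then obtain v where v: "v \<in> carrier A" "\<forall>y\<in>carrier A. \<phi> (star A y \<otimes> v) = (\<Sum>l\<in>K. c l * \<phi> (star A y \<otimes> x l))"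
   by auto
  show ?case
   by (rule exI[of _ "scale A (c k) (x k) \<oplus> v"])
    (use v insert in \<open>auto simp: r_distr scale_mult_right phi_add phi_scale\<close>)
 qed
 then obtain v where v: "v \<in> carrier A" "!!y. y \<in> carrier A ==> \<phi> (star A y \<otimes> v) = (\<Sum>l\<in>K. c l * \<phi> (star A y \<otimes> x l))"
  by blast
 have "\<exists>w. w \<in> carrier A & w = v & \<phi> (star A w \<otimes> v) = (\<Sum>k\<in>K. cnj (c k) * \<phi> (star A (x k) \<otimes> v))"
 proof -
  have h: "\<phi> (star A a \<otimes> b) = cnj (\<phi> (star A b \<otimes> a))" if "a \<in> carrier A" "b \<in> carrier A" for a b
  proof -
   have e: "\<phi> (star A (a \<oplus> scale A c b) \<otimes> (a \<oplus> scale A c b)) =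
     \<phi> (star A a \<otimes> a) + c * \<phi> (star A a \<otimes> b) + cnj c * \<phi> (star A b \<otimes> a) + cnj c * c * \<phi> (star A b \<otimes> b)" for c
    using that by (simp add: star_ops l_distr r_distr phi_add phi_scale algebra_simps)
   have "nn (\<phi> (star A (a \<oplus> scale A c b) \<otimes> (a \<oplus> scale A c b)))" for c using that by (intro phi_pos) auto
   from this[of 1] this[of \<i>] phi_pos[OF that(1)] phi_pos[OF that(2)] show ?thesis
    unfolding e by (simp add: nn_def complex_eq_iff)
  qed
  have "\<phi> (star A v \<otimes> v) = cnj (\<Sum>l\<in>K. c l * \<phi> (star A v \<otimes> x l))"
   using h[OF v(1) v(1)] v(2)[OF v(1)] by simp
  also have "... = (\<Sum>k\<in>K. cnj (c k) * \<phi> (star A (x k) \<otimes> v))"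
   using x v(1) h by (simp add: h[symmetric])
  finally show ?thesis using v by blast
 qed
 then have "\<phi> (star A v \<otimes> v) = (\<Sum>k\<in>K. cnj (c k) * \<phi> (star A (x k) \<otimes> v))" by blast
 also have "... = (\<Sum>k\<in>K. \<Sum>l\<in>K. cnj (c k) * c l * \<phi> (star A (x k) \<otimes> x l))"
  using x by (intro sum.cong refl) (simp add: v(2) sum_distrib_left mult.assoc)
 finally show "nn (\<Sum>k\<in>K. \<Sum>l\<in>K. cnj (c k) * c l * \<phi> (star A (x k) \<otimes> x l))"
  using phi_pos[OF v(1)] by simp
qed

lemma phi_hermitian: "x \<in> carrier A ==> y \<in> carrier A ==> \<phi> (star A x \<otimes> y) = cnj (\<phi> (star A y \<otimes> x))"
 using psd_hermitian(1)[OF psd_gram[of UNIV "%b. if b then x else y"], of False True] by (auto split: if_splits)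

definition n2 :: "'a => real" where "n2 x = sqrt (Re (\<phi> (star A x \<otimes> x)))"

lemma n2_sq: "x \<in> carrier A ==> (n2 x)^2 = Re (\<phi> (star A x \<otimes> x))"
 using phi_pos[of x] by (simp add: n2_def nn_def)

lemma n2_nonneg: "x \<in> carrier A ==> 0 <= n2 x"
 using phi_pos[of x] by (simp add: n2_def nn_def)

lemma phi_n2: "x \<in> carrier A ==> \<phi> (star A x \<otimes> x) = of_real ((n2 x)^2)"
 using phi_pos[of x] n2_sq[of x] nn_of_real by metis

lemma cauchy_schwarz:
 assumes x: "x \<in> carrier A" and y: "y \<in> carrier A"
 shows "cmod (\<phi> (star A x \<otimes> y)) <= n2 x * n2 y"
proof -
 let ?M = "%k l. \<phi> (star A (if k then x else y) \<otimes> (if l then x else y))"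
 have psd: "psd UNIV ?M" by (rule psd_gram) (use x y in auto)
 define b where "b = \<phi> (star A x \<otimes> y)"
 have h: "\<phi> (star A y \<otimes> x) = cnj b" using phi_hermitian[OF y x] by (simp add: b_def)
 have "(cmod b)^2 <= (n2 x * n2 y)^2"
 proof (cases "n2 x = 0")
  case True
  then have "?M True True = 0" using phi_n2[OF x] by simp
  then have "b = 0" using psd_zero_row(1)[OF psd, of True False] by (simp add: b_def)
  then show ?thesis by simp
 next
  case False
  define d where "d = (n2 x)^2"
  have d: "d > 0" "\<phi> (star A x \<otimes> x) = of_real d" using False phi_n2[OF x] by (auto simp: d_def)
  have bb: "b * cnj b = of_real ((cmod b)^2)" by (rule complex_norm_square[symmetric])
  then have bb': "(complex_of_real (cmod b))^2 = b * cnj b" by simp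
  \<comment> \<open>The Gram form at (- b / d, 1), its minimum over all vectors with second entry 1,
    equals the square of \<open>n2 y\<close> minus |b|^2 / d.\<close>
  have "nn (cnj (- b / d) * (- b / d) * ?M True True + cnj (- b / d) * 1 * ?M True False +
    cnj 1 * (- b / d) * ?M False True + cnj 1 * 1 * ?M False False)"
   by (rule psd_two[OF psd]) auto
  moreover have "cnj (- b / d) * (- b / d) * ?M True True + cnj (- b / d) * 1 * ?M True False +
    cnj 1 * (- b / d) * ?M False True + cnj 1 * 1 * ?M False False = of_real ((n2 y)^2 - (cmod b)^2 / d)"
   using d by (simp add: h b_def[symmetric] phi_n2[OF y] bb' field_simps)
  ultimately have "nn (of_real ((n2 y)^2 - (cmod b)^2 / d))" by (simp only:)
  then have "0 <= (n2 y)^2 - (cmod b)^2 / d" by (simp only: nn_def Re_complex_of_real)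
  then show ?thesis using d(1) by (simp add: d_def field_simps power_mult_distrib)
 qed
 then show ?thesis
  unfolding b_def by (rule power2_le_imp_le) (simp add: n2_nonneg x y)
qed

lemma n2_add: assumes x: "x \<in> carrier A" and y: "y \<in> carrier A" shows "n2 (x \<oplus> y) <= n2 x + n2 y"
proof (rule power2_le_imp_le)
 have "(n2 (x \<oplus> y))^2 = (n2 x)^2 + (n2 y)^2 + 2 * Re (\<phi> (star A x \<otimes> y))"
  using x y phi_hermitian[OF y x] by (simp add: n2_sq star_add l_distr r_distr phi_add)
 also have "... <= (n2 x)^2 + (n2 y)^2 + 2 * (n2 x * n2 y)"
  using cauchy_schwarz[OF x y] complex_Re_le_cmod[of "\<phi> (star A x \<otimes> y)"] by linarith
 finally show "(n2 (x \<oplus> y))^2 <= (n2 x + n2 y)^2" by (simp add: power2_eq_square algebra_simps)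
qed (simp add: n2_nonneg x y)

lemma n2_scale: "x \<in> carrier A ==> n2 (scale A c x) = cmod c * n2 x"
proof -
 assume x: "x \<in> carrier A"
 have "\<phi> (star A (scale A c x) \<otimes> scale A c x) = of_real ((cmod c)^2) * \<phi> (star A x \<otimes> x)"
  using x by (simp add: star_scale scale_mult_left scale_mult_right scale_scale phi_scale complex_norm_square del: of_real_power)
 then show ?thesis unfolding n2_def by (simp add: real_sqrt_mult)
qed

text \<open>Left multiplication by \<open>t\<close> is bounded by M on the GNS space. A relation
  rather than a norm, because existence of a bound has to be proved separately for each
  functional.\<close>

definition bdd :: "'a => real => bool" where
 "bdd t M \<longleftrightarrow> 0 <= M & (\<forall>s\<in>carrier A. n2 (t \<otimes> s) <= M * n2 s)"

lemma bdd_zero: "bdd \<zero> 0" by (simp add: bdd_def n2_def phi_zero)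

lemma bdd_add: assumes "t \<in> carrier A" "u \<in> carrier A" "bdd t M" "bdd u N" shows "bdd (t \<oplus> u) (M + N)"
 unfolding bdd_def
proof (intro conjI ballI)
 fix s assume s: "s \<in> carrier A"
 have "n2 ((t \<oplus> u) \<otimes> s) <= n2 (t \<otimes> s) + n2 (u \<otimes> s)" using s assms by (simp add: l_distr n2_add)
 also have "... <= M * n2 s + N * n2 s" using s assms by (intro add_mono) (auto simp: bdd_def)
 finally show "n2 ((t \<oplus> u) \<otimes> s) <= (M + N) * n2 s" by (simp add: algebra_simps)
qed (use assms in \<open>auto simp: bdd_def\<close>)

lemma bdd_scale: assumes "t \<in> carrier A" "bdd t M" shows "bdd (scale A c t) (cmod c * M)"
 using assms by (auto simp: bdd_def scale_mult_left n2_scale mult.assoc intro!: mult_left_mono)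

lemma bdd_mult: assumes "t \<in> carrier A" "u \<in> carrier A" "bdd t M" "bdd u N" shows "bdd (t \<otimes> u) (M * N)"
 unfolding bdd_def
proof (intro conjI ballI)
 fix s assume s: "s \<in> carrier A"
 have "n2 ((t \<otimes> u) \<otimes> s) <= M * n2 (u \<otimes> s)" using s assms by (simp add: m_assoc bdd_def)
 also have "... <= M * (N * n2 s)" using s assms by (intro mult_left_mono) (auto simp: bdd_def)
 finally show "n2 ((t \<otimes> u) \<otimes> s) <= (M * N) * n2 s" by (simp add: mult.assoc)
qed (use assms in \<open>auto simp: bdd_def\<close>)

text \<open>If \<open>r* r + a* a = M^2\<close> then \<open>a\<close> is bounded by \<open>M\<close> in every GNS representation.\<close>

lemma bdd_of_complement:
 assumes a: "a \<in> carrier A" and r: "r \<in> carrier A" and M: "M \<ge> 0"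
  and eq: "star A r \<otimes> r \<oplus> star A a \<otimes> a = scale A (of_real (M^2)) \<one>"
 shows "bdd a M"
 unfolding bdd_def
proof (intro conjI ballI M)
 fix s assume s: "s \<in> carrier A"
 have "star A (r \<otimes> s) \<otimes> (r \<otimes> s) \<oplus> star A (a \<otimes> s) \<otimes> (a \<otimes> s) = star A s \<otimes> ((star A r \<otimes> r \<oplus> star A a \<otimes> a) \<otimes> s)"
  using a r s by (simp add: star_mult l_distr r_distr m_assoc)
 also have "... = scale A (of_real (M^2)) (star A s \<otimes> s)"
  unfolding eq using s by (simp add: scale_mult_left scale_mult_right)
 finally have "\<phi> (star A (r \<otimes> s) \<otimes> (r \<otimes> s) \<oplus> star A (a \<otimes> s) \<otimes> (a \<otimes> s)) = of_real (M^2) * \<phi> (star A s \<otimes> s)"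
  using s by (simp add: phi_scale)
 then have "(n2 (r \<otimes> s))^2 + (n2 (a \<otimes> s))^2 = M^2 * (n2 s)^2"
  using a r s by (simp add: phi_add phi_n2 flip: of_real_add of_real_mult of_real_power)
 then have "(n2 (a \<otimes> s))^2 <= (M * n2 s)^2"
  using zero_le_power2[of "n2 (r \<otimes> s)"] unfolding power_mult_distrib by linarith
 then show "n2 (a \<otimes> s) <= M * n2 s"
  by (rule power2_le_imp_le) (simp add: M n2_nonneg s)
qed

text \<open>\<open>p\<close> is the operator norm of left multiplication on the GNS space, obtained
  without dividing by null vectors or completing. The estimate for \<open>\<phi>\<close> results
  from the vector given by the unit.\<close>

lemma gns_seminorm:
 assumes b: "!!t. t \<in> carrier A ==> \<exists>M. bdd t M"
 shows "\<exists>p. cstar_seminorm A p & (\<forall>t\<in>carrier A. cmod (\<phi> t) <= Re (\<phi> \<one>) * p t)"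
proof -
 define p where "p t = Inf {M. bdd t M}" for t
 have lower: "p t <= M" if "bdd t M" for t M
  unfolding p_def by (rule cInf_lower) (use that in \<open>auto simp: bdd_def bdd_below_def\<close>)
 have nn: "0 <= p t" if "t \<in> carrier A" for t
  unfolding p_def by (rule cInf_greatest) (use b[OF that] in \<open>auto simp: bdd_def\<close>)
 have pb: "bdd t (p t)" if t: "t \<in> carrier A" for t
  unfolding bdd_def
 proof (intro conjI ballI nn[OF t])
  fix s assume s: "s \<in> carrier A"
  show "n2 (t \<otimes> s) <= p t * n2 s"
  proof (cases "n2 s = 0")
   case True
   then show ?thesis using b[OF t] s by (auto simp: bdd_def)
  next
   case False
   then have pos: "n2 s > 0" using n2_nonneg[OF s] by simp
   have "n2 (t \<otimes> s) / n2 s <= p t"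
    unfolding p_def by (rule cInf_greatest) (use b[OF t] s pos in \<open>auto simp: bdd_def pos_divide_le_eq\<close>)
   then show ?thesis using pos by (simp add: pos_divide_le_eq)
  qed
 qed
 have sc: "p (scale A c t) <= cmod c * p t" if "t \<in> carrier A" for c t
  by (rule lower[OF bdd_scale[OF that pb[OF that]]])
 have sc': "cmod c * p t <= p (scale A c t)" if t: "t \<in> carrier A" for c t
 proof (cases "c = 0")
  case False
  have "p t <= cmod (inverse c) * p (scale A c t)"
   using sc[of "scale A c t" "inverse c"] t False by (simp add: scale_scale)
  then show ?thesis using False by (simp add: norm_divide inverse_eq_divide pos_le_divide_eq mult.commute)
 qed (use nn t in simp)
 have ml: "p (t \<otimes> u) <= p t * p u" if "t \<in> carrier A" "u \<in> carrier A" for t u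
  by (rule lower[OF bdd_mult[OF that pb[OF that(1)] pb[OF that(2)]]])
 have sq: "(p t)^2 <= p (star A t \<otimes> t)" if t: "t \<in> carrier A" for t
 proof -
  have q: "p (star A t \<otimes> t) \<ge> 0" using nn t by simp
  \<comment> \<open>The lower half of the C*-identity: the square of
    \<open>n2 (t \<otimes> s)\<close> is the inner product of \<open>s\<close> with
    \<open>(star A t \<otimes> t) \<otimes> s\<close>, so Cauchy-Schwarz applies.\<close>
  have "bdd t (sqrt (p (star A t \<otimes> t)))"
   unfolding bdd_def
  proof (intro conjI ballI)
   fix s assume s: "s \<in> carrier A"
   have "(n2 (t \<otimes> s))^2 = Re (\<phi> (star A s \<otimes> ((star A t \<otimes> t) \<otimes> s)))"
    using s t by (simp add: n2_sq star_mult m_assoc)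
   also have "... <= n2 s * n2 ((star A t \<otimes> t) \<otimes> s)"
    using cauchy_schwarz[of s "(star A t \<otimes> t) \<otimes> s"] s t complex_Re_le_cmod order.trans by fastforce
   also have "... <= n2 s * (p (star A t \<otimes> t) * n2 s)"
    using pb[of "star A t \<otimes> t"] s t n2_nonneg[OF s] by (intro mult_left_mono) (auto simp: bdd_def)
   also have "... = (sqrt (p (star A t \<otimes> t)) * n2 s)^2"
    using q by (simp add: power_mult_distrib) (simp add: power2_eq_square)
   finally show "n2 (t \<otimes> s) <= sqrt (p (star A t \<otimes> t)) * n2 s"
    by (rule power2_le_imp_le) (simp add: n2_nonneg s q)
  qed (use q in simp)
  then have "p t <= sqrt (p (star A t \<otimes> t))" by (rule lower)
  then have "(p t)^2 <= (sqrt (p (star A t \<otimes> t)))^2" using nn[OF t] by (rule power_mono)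
  then show ?thesis using q by simp
 qed
 have st1: "p t <= p (star A t)" if t: "t \<in> carrier A" for t
 proof (cases "p t = 0")
  case False
  have "p t * p t <= p (star A t) * p t"
   using sq[OF t] ml[of "star A t" t] t by (simp add: power2_eq_square)
  moreover have "p t > 0" using False nn[OF t] by linarith
  ultimately show ?thesis by simp
 qed (use nn t in simp)
 have up: "p (star A t \<otimes> t) <= (p t)^2" if t: "t \<in> carrier A" for t
 proof -
  have "p (star A t \<otimes> t) <= p (star A t) * p t" using ml t by simp
  also have "... <= p t * p t" using st1[of "star A t"] t nn by (intro mult_right_mono) auto
  finally show ?thesis by (simp add: power2_eq_square)
 qed
 have "p (t \<oplus> u) <= p t + p u" if "t \<in> carrier A" "u \<in> carrier A" for t u
  by (rule lower[OF bdd_add[OF that pb[OF that(1)] pb[OF that(2)]]])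
 moreover have "p (star A t \<otimes> t) = (p t)^2" if "t \<in> carrier A" for t
  using up[OF that] sq[OF that] by (rule antisym)
 moreover have "p (scale A c t) = cmod c * p t" if "t \<in> carrier A" for c t
  using sc[OF that] sc'[OF that] by (rule antisym)
 ultimately have "cstar_seminorm A p" unfolding cstar_seminorm_def using nn ml by simp
 moreover have "cmod (\<phi> t) <= Re (\<phi> \<one>) * p t" if t: "t \<in> carrier A" for t
 proof -
  have "cmod (\<phi> t) <= n2 \<one> * n2 t" using cauchy_schwarz[of \<one> t] t by simp
  also have "n2 t <= p t * n2 \<one>"
  proof -
   have "n2 (t \<otimes> \<one>) <= p t * n2 \<one>" using pb[OF t] unfolding bdd_def by blast
   then show ?thesis using t by simp
  qed
  finally have "cmod (\<phi> t) <= n2 \<one> * (p t * n2 \<one>)" using n2_nonneg[of \<one>] by (simp add: mult_left_mono)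
  also have "... = (n2 \<one>)^2 * p t" by (simp add: power2_eq_square)
  finally show ?thesis by (simp add: n2_sq)
 qed
 ultimately show ?thesis by blast
qed

end

text \<open>The GNS seminorm of \<open>\<phi>\<close> is one of those over which the universal norm
  is the supremum. Hence \<open>\<phi>\<close> is bounded by the universal norm and extends by
  continuity, with positivity preserved in the limit.\<close>

lemma state_extension:
 assumes X: "univ_alg X {}" and s: "state X \<phi>"
  and b: "!!t. t \<in> carrier X ==> \<exists>M. positive_functional.bdd X \<phi> t M"
 shows "\<exists>\<Phi>. state (univ_cstar X {}) \<Phi> & (\<forall>x\<in>carrier X. \<Phi> (univ_elem X {} x) = \<phi> x)"
proof -
 interpret X: univ_alg X "{}" by fact
 interpret P: positive_functional X \<phi>
  by unfold_locales (use s in \<open>simp add: state_def\<close>)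
 let ?U = "univ_cstar X {}" and ?j = "univ_elem X {}"
 interpret U: cstar_algebra ?U by (rule X.cstar_algebra_univ)
 have p1: "\<phi> \<one>\<^bsub>X\<^esub> = 1" using s by (simp add: state_def)
 obtain p where p: "cstar_seminorm X p" "\<forall>t\<in>carrier X. cmod (\<phi> t) <= Re (\<phi> \<one>\<^bsub>X\<^esub>) * p t"
  using P.gns_seminorm[OF b] by blast
 have le0: "cmod (\<phi> t) <= X.un t" if "t \<in> carrier X" for t
  using p X.un_upper[of p t] that p1 by fastforce
 note jD = cstar_homD[OF X.univ_elem_hom]
 have jm: "?j x \<ominus>\<^bsub>?U\<^esub> ?j y = ?j (x \<ominus>\<^bsub>X\<^esub> y)" if "x \<in> carrier X" "y \<in> carrier X" for x y
  using cstar_hom_minus[OF X.star_alg U.star_alg X.univ_elem_hom that] by simp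
 have le: "nrm complex_alg (\<phi> x \<ominus>\<^bsub>complex_alg\<^esub> \<phi> y) <= nrm ?U (?j x \<ominus>\<^bsub>?U\<^esub> ?j y)" if "x \<in> carrier X" "y \<in> carrier X" for x y
  using le0[of "x \<ominus>\<^bsub>X\<^esub> y"] that by (simp add: jm X.nrm_univ_elem P.phi_minus)
 have cl: "\<phi> x \<in> carrier complex_alg" for x by simp
 obtain F where F: "(\<forall>a\<in>carrier ?U. F a \<in> carrier complex_alg) &
  (\<forall>x a. (\<forall>k. x k \<in> carrier X) --> U.nm.lims (%k. ?j (x k)) a -->
    star_seminorm.lims complex_alg (nrm complex_alg) (%k. \<phi> (x k)) (F a)) &
  (\<forall>x\<in>carrier X. F (?j x) = \<phi> x) &
  (\<forall>a\<in>carrier ?U. \<exists>x. (\<forall>k. x k \<in> carrier X) & U.nm.lims (%k. ?j (x k)) a)"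
  using dense_extension[OF X.cstar_algebra_univ cstar_algebra_complex jD(1) cl le X.univ_dense] ..
 have F2: "(%k. \<phi> (x k)) \<longlonglongrightarrow> F a" if "!!k. x k \<in> carrier X" "U.nm.lims (%k. ?j (x k)) a" for x a
  using F that by (simp add: lims_complex_iff[simplified])
 have F3: "F (?j x) = \<phi> x" if "x \<in> carrier X" for x using F that by simp
 have F4: "\<exists>x. (\<forall>k. x k \<in> carrier X) & U.nm.lims (%k. ?j (x k)) a" if "a \<in> carrier ?U" for a
  using F that by simp
 have "posfun ?U F"
  unfolding posfun_def
 proof (intro conjI ballI allI)
  fix a b assume a: "a \<in> carrier ?U" and b: "b \<in> carrier ?U"
  obtain x where x: "!!k. x k \<in> carrier X" "U.nm.lims (%k. ?j (x k)) a" using F4[OF a] by blast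
  obtain y where y: "!!k. y k \<in> carrier X" "U.nm.lims (%k. ?j (y k)) b" using F4[OF b] by blast
  have "U.nm.lims (%k. ?j (x k \<oplus>\<^bsub>X\<^esub> y k)) (a \<oplus>\<^bsub>?U\<^esub> b)"
   using U.nm.lims_add[OF x(2) y(2)] x(1) y(1) by (simp add: jD)
  from F2[OF _ this] have "(%k. \<phi> (x k) + \<phi> (y k)) \<longlonglongrightarrow> F (a \<oplus>\<^bsub>?U\<^esub> b)"
   using x(1) y(1) by (simp add: P.phi_add)
  then show "F (a \<oplus>\<^bsub>?U\<^esub> b) = F a + F b"
   by (rule LIMSEQ_unique) (rule tendsto_add[OF F2[OF x] F2[OF y]])
 next
  fix c a assume a: "a \<in> carrier ?U"
  obtain x where x: "!!k. x k \<in> carrier X" "U.nm.lims (%k. ?j (x k)) a" using F4[OF a] by blast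
  have "U.nm.lims (%k. ?j (scale X c (x k))) (scale ?U c a)"
   using U.nm.lims_scale[OF x(2)] x(1) by (simp add: jD)
  from F2[OF _ this] have "(%k. c * \<phi> (x k)) \<longlonglongrightarrow> F (scale ?U c a)"
   using x(1) by (simp add: P.phi_scale)
  then show "F (scale ?U c a) = c * F a"
   by (rule LIMSEQ_unique) (rule tendsto_mult_left[OF F2[OF x]])
 next
  fix a assume a: "a \<in> carrier ?U"
  obtain x where x: "!!k. x k \<in> carrier X" "U.nm.lims (%k. ?j (x k)) a" using F4[OF a] by blast
  have "U.nm.lims (%k. ?j (star X (x k) \<otimes>\<^bsub>X\<^esub> x k)) (star ?U a \<otimes>\<^bsub>?U\<^esub> a)"
   using U.nm.lims_mult[OF U.nm.lims_star[OF x(2)] x(2)] x(1) by (simp add: jD)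
  from F2[OF _ this] have l: "(%k. \<phi> (star X (x k) \<otimes>\<^bsub>X\<^esub> x k)) \<longlonglongrightarrow> F (star ?U a \<otimes>\<^bsub>?U\<^esub> a)"
   using x(1) by simp
  have "nn (\<phi> (star X (x k) \<otimes>\<^bsub>X\<^esub> x k))" for k using P.phi_pos x by simp
  then show "nn (F (star ?U a \<otimes>\<^bsub>?U\<^esub> a))"
   using LIMSEQ_le_const[OF tendsto_Re[OF l], of 0] LIMSEQ_unique[OF tendsto_Im[OF l], of 0] by (auto simp: nn_def)
 qed
 moreover have "F \<one>\<^bsub>?U\<^esub> = 1" using F3[of "\<one>\<^bsub>X\<^esub>"] jD(4) p1 by simp
 ultimately show ?thesis using F3 by (auto simp: state_def)
qed

context cstar_algebra
begin

text \<open>\<open>r\<close> is the square root of nrm(a)^2 - a* a, as wanted by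
  \<open>bdd_of_complement\<close>.\<close>

lemma complement_ex:
 assumes a: "a \<in> carrier A"
 shows "\<exists>r\<in>carrier A. star A r \<otimes> r \<oplus> star A a \<otimes> a = scale A (of_real ((nrm A a)^2)) \<one>"
proof (cases "nrm A a = 0")
 case True
 then have "a = \<zero>" using a nrm_definite by blast
 then show ?thesis by (intro bexI[of _ \<zero>]) auto
next
 case False
 define n where "n = nrm A a"
 have n: "n > 0" using False nm.p_nonneg[OF a] by (simp add: n_def less_le)
 define z where "z = scale A (of_real (inverse (n^2))) (star A a \<otimes> a)"
 have z: "z \<in> carrier A" "star A z = z" using a by (auto simp: z_def star_scale star_mult)
 have "nrm A z = cmod (of_real (inverse (n^2))) * n^2"
  unfolding z_def using a by (subst nm.p_scale) (simp_all add: nm.p_cstar n_def)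
 also have "... = 1" using n by (simp only: norm_of_real) (simp add: field_simps)
 finally have nz: "nrm A z <= 1" by simp
 obtain s where s: "s \<in> carrier A" "star A s = s" "s \<otimes> s = \<one> \<ominus> z" using sqrt_ex[OF z nz] by blast
 have zz: "scale A (of_real (n^2)) z = star A a \<otimes> a"
  unfolding z_def using a n
  by (subst scale_scale) (simp_all flip: of_real_mult of_real_power of_real_inverse)
 have "star A (scale A (of_real n) s) \<otimes> scale A (of_real n) s = scale A (of_real (n^2)) (\<one> \<ominus> z)"
  using s z by (simp add: star_scale scale_mult_left scale_mult_right scale_scale power2_eq_square)
 also have "... = scale A (of_real (n^2)) \<one> \<ominus> star A a \<otimes> a"
  using z zz by (simp add: scale_minus)
 finally have "star A (scale A (of_real n) s) \<otimes> scale A (of_real n) s \<oplus> star A a \<otimes> a = scale A (of_real (n^2)) \<one>"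
  using a by (simp add: minus_eq a_assoc l_neg)
 then show ?thesis using s by (intro bexI[of _ "scale A (of_real n) s"]) (auto simp: n_def)
qed

text \<open>The value at \<open>x\<close> is an inner product with the unit vector given by 1, on
  which \<open>x\<close> acts with bound \<open>nrm A x\<close>.\<close>

lemma state_bound:
 assumes s: "state A \<phi>" and x: "x \<in> carrier A"
 shows "cmod (\<phi> x) <= nrm A x"
proof -
 interpret P: positive_functional A \<phi> by unfold_locales (use s in \<open>simp add: state_def\<close>)
 obtain r where r: "r \<in> carrier A" "star A r \<otimes> r \<oplus> star A x \<otimes> x = scale A (of_real ((nrm A x)^2)) \<one>"
  using complement_ex[OF x] by blast
 have "P.bdd x (nrm A x)" by (rule P.bdd_of_complement[OF x r(1) _ r(2)]) (use x in simp)
 then have "P.n2 (x \<otimes> \<one>) <= nrm A x * P.n2 \<one>" unfolding P.bdd_def by blast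
 moreover have n1: "P.n2 \<one> = 1" using s by (simp add: P.n2_def state_def)
 moreover have "cmod (\<phi> x) <= P.n2 \<one> * P.n2 x" using P.cauchy_schwarz[of \<one> x] x by simp
 ultimately show ?thesis using x by simp
qed

end

section \<open>Product states on maximal tensor products\<close>

context cstar_tensor
begin

text \<open>A tensor is a functional on bilinear forms, so evaluation at the form
  \<open>\<phi> a * \<psi> b\<close> is linear at once. Positivity is \<open>schur_product\<close>
  for the two Gram matrices. For the extension to the completed tensor product, left multiplications
  must be bounded; by \<open>st_split\<close> it suffices to bound those by the two legs, which
  \<open>complement_ex\<close> does.\<close>

lemma product_state:
 assumes \<phi>: "state A \<phi>" and \<psi>: "state B \<psi>"
 shows "\<exists>\<Phi>. state TC \<Phi> & (\<forall>a\<in>carrier A. \<forall>b\<in>carrier B. \<Phi> (te a b) = \<phi> a * \<psi> b)"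
proof -
 interpret P: positive_functional A \<phi> by unfold_locales (use \<phi> in \<open>simp add: state_def\<close>)
 interpret Q: positive_functional B \<psi> by unfold_locales (use \<psi> in \<open>simp add: state_def\<close>)
 define \<xi> where "\<xi> = (%a b. \<phi> a * \<psi> b)"
 define F where "F t = t \<xi>" for t :: "('a, 'b) tensor"
 have b: "bil \<xi>" by (simp add: bilinear_on_def \<xi>_def P.phi_add Q.phi_add P.phi_scale Q.phi_scale algebra_simps)
 have Fst: "F (st a c) = \<phi> a * \<psi> c" for a c using b by (simp add: F_def simple_tensor_def \<xi>_def)
 have pos: "nn (F (star T t \<otimes>\<^bsub>T\<^esub> t))" if t: "t \<in> carrier T" for t
 proof -
  obtain xs where xs: "set xs \<subseteq> carrier A \<times> carrier B" "t = tens xs" using t by (auto simp: carrier_T)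
  define K where "K = {..<length xs}"
  define x where "x k = fst (xs ! k)" for k
  define y where "y k = snd (xs ! k)" for k
  have xy: "x k \<in> carrier A" "y k \<in> carrier B" if "k \<in> K" for k
  proof -
   have "xs ! k \<in> carrier A \<times> carrier B" using xs(1) nth_mem[of k xs] that unfolding K_def by blast
   then show "x k \<in> carrier A" "y k \<in> carrier B" by (auto simp: x_def y_def mem_Times_iff)
  qed
  have tv: "t f = (\<Sum>k\<in>K. f (x k) (y k))" if "bil f" for f
   unfolding xs(2) tens_def using that
   by (simp add: sum_list_sum_nth simple_tensor_def K_def x_def y_def case_prod_beta atLeast0LessThan)
  have "F (star T t \<otimes>\<^bsub>T\<^esub> t) = star T t (%a b. t (%c d. \<xi> (a \<otimes>\<^bsub>A\<^esub> c) (b \<otimes>\<^bsub>B\<^esub> d)))"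
   using b by (simp add: F_def T_ops(5)[of "star T t"])
  also have "... = cnj (t (%a b. cnj (t (%c d. \<xi> (star A a \<otimes>\<^bsub>A\<^esub> c) (star B b \<otimes>\<^bsub>B\<^esub> d)))))"
   using bil_inner[OF t b] by (simp add: T_ops)
  also have "... = (\<Sum>k\<in>K. t (%c d. \<xi> (star A (x k) \<otimes>\<^bsub>A\<^esub> c) (star B (y k) \<otimes>\<^bsub>B\<^esub> d)))"
   using tv[OF bil_star[OF bil_inner[OF t b]]] by simp
  also have "... = (\<Sum>k\<in>K. \<Sum>l\<in>K. \<xi> (star A (x k) \<otimes>\<^bsub>A\<^esub> x l) (star B (y k) \<otimes>\<^bsub>B\<^esub> y l))"
   by (intro sum.cong refl tv bil_shift[OF b]) (simp_all add: xy)
  finally have "F (star T t \<otimes>\<^bsub>T\<^esub> t) = (\<Sum>k\<in>K. \<Sum>l\<in>K. \<phi> (star A (x k) \<otimes>\<^bsub>A\<^esub> x l) * \<psi> (star B (y k) \<otimes>\<^bsub>B\<^esub> y l))"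
   by (simp add: \<xi>_def)
  moreover have "nn (\<Sum>k\<in>K. \<Sum>l\<in>K. \<phi> (star A (x k) \<otimes>\<^bsub>A\<^esub> x l) * \<psi> (star B (y k) \<otimes>\<^bsub>B\<^esub> y l))"
   by (rule schur_product[OF _ P.psd_gram Q.psd_gram]) (use xy in \<open>auto simp: K_def\<close>)
  ultimately show ?thesis by simp
 qed
 have F: "state T F"
 proof -
  have "F (s \<oplus>\<^bsub>T\<^esub> t) = F s + F t" "F (scale T c t) = c * F t" for s t c by (simp_all add: F_def T_ops)
  moreover have "F \<one>\<^bsub>T\<^esub> = 1" unfolding T_ops(4) Fst using \<phi> \<psi> by (simp add: state_def)
  ultimately show ?thesis unfolding state_def posfun_def using pos by blast
 qed
 interpret R: positive_functional T F by unfold_locales (use F in \<open>simp add: state_def\<close>)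
 have ba: "\<exists>M. R.bdd (st a \<one>\<^bsub>B\<^esub>) M" if a: "a \<in> carrier A" for a
 proof -
  obtain r where r: "r \<in> carrier A" "star A r \<otimes>\<^bsub>A\<^esub> r \<oplus>\<^bsub>A\<^esub> star A a \<otimes>\<^bsub>A\<^esub> a = scale A (of_real ((nrm A a)^2)) \<one>\<^bsub>A\<^esub>"
   using A.complement_ex[OF a] by blast
  have "star T (st r \<one>\<^bsub>B\<^esub>) \<otimes>\<^bsub>T\<^esub> st r \<one>\<^bsub>B\<^esub> \<oplus>\<^bsub>T\<^esub> star T (st a \<one>\<^bsub>B\<^esub>) \<otimes>\<^bsub>T\<^esub> st a \<one>\<^bsub>B\<^esub> = scale T (of_real ((nrm A a)^2)) \<one>\<^bsub>T\<^esub>"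
   using arg_cong[OF r(2), of "%v. st v \<one>\<^bsub>B\<^esub>"] a r(1) by (simp add: st_star st_mult st_add_left st_scale_left T_ops(4))
  then show ?thesis
   using R.bdd_of_complement[of "st a \<one>\<^bsub>B\<^esub>" "st r \<one>\<^bsub>B\<^esub>" "nrm A a"] a r(1) st_closed A.nm.p_nonneg by blast
 qed
 have bb: "\<exists>M. R.bdd (st \<one>\<^bsub>A\<^esub> a) M" if a: "a \<in> carrier B" for a
 proof -
  obtain r where r: "r \<in> carrier B" "star B r \<otimes>\<^bsub>B\<^esub> r \<oplus>\<^bsub>B\<^esub> star B a \<otimes>\<^bsub>B\<^esub> a = scale B (of_real ((nrm B a)^2)) \<one>\<^bsub>B\<^esub>"
   using B.complement_ex[OF a] by blast
  have "star T (st \<one>\<^bsub>A\<^esub> r) \<otimes>\<^bsub>T\<^esub> st \<one>\<^bsub>A\<^esub> r \<oplus>\<^bsub>T\<^esub> star T (st \<one>\<^bsub>A\<^esub> a) \<otimes>\<^bsub>T\<^esub> st \<one>\<^bsub>A\<^esub> a = scale T (of_real ((nrm B a)^2)) \<one>\<^bsub>T\<^esub>"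
   using arg_cong[OF r(2), of "%v. st \<one>\<^bsub>A\<^esub> v"] a r(1) by (simp add: st_star st_mult st_add_right st_scale_right T_ops(4))
  then show ?thesis
   using R.bdd_of_complement[of "st \<one>\<^bsub>A\<^esub> a" "st \<one>\<^bsub>A\<^esub> r" "nrm B a"] a r(1) st_closed B.nm.p_nonneg by blast
 qed
 have bd: "\<exists>M. R.bdd t M" if "t \<in> carrier T" for t
  using that
 proof (induction t rule: T_induct)
  case zero
  then show ?case using R.bdd_zero by blast
 next
  case (add t a c)
  obtain M where M: "R.bdd (st a \<one>\<^bsub>B\<^esub>) M" using ba add by blast
  obtain N where N: "R.bdd (st \<one>\<^bsub>A\<^esub> c) N" using bb add by blast
  obtain L where L: "R.bdd t L" using add by blast
  have "R.bdd (st a c) (M * N)"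
   unfolding st_split[OF add(2,3)] by (rule R.bdd_mult[OF _ _ M N]) (use add in \<open>auto simp: st_closed\<close>)
  then show ?case using R.bdd_add[OF st_closed[OF add(2,3)] add(1) _ L] by blast
 qed
 obtain \<Phi> where "state (univ_cstar T {}) \<Phi>" "\<forall>x\<in>carrier T. \<Phi> (univ_elem T {} x) = F x"
  using state_extension[OF univ_alg_T F bd] by blast
 then show ?thesis using Fst st_closed by (auto simp: TC_eq tensor_elem_def)
qed

end

section \<open>The canonical trace of a group C*-algebra\<close>

context group_dual
begin

text \<open>Evaluation at the identity is positive since its value at f* f is the sum of the |f
  a|^2.\<close>

lemma trace_ex: "\<exists>\<tau>. state (group_cstar \<Lambda>) \<tau> & (\<forall>g\<in>carrier \<Lambda>. \<tau> (group_elem \<Lambda> g) = (if g = \<one> then 1 else 0))"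
proof -
 define F where "F f = f \<one>" for f :: "'g => complex"
 have Fl: "F f = ga.lsum f (%a. if a = \<one> then 1 else 0)" if "f \<in> carrier ga.X" for f
  using ga.lsum_ind[OF that, of \<one> 1] by (simp add: F_def)
 have pos: "nn (F (star ga.X f \<otimes>\<^bsub>ga.X\<^esub> f))" if f: "f \<in> carrier ga.X" for f
 proof -
  have ab: "(inv a \<otimes> b = \<one>) = (b = a)" if "a \<in> carrier \<Lambda>" "b \<in> carrier \<Lambda>" for a b
   using that by (metis inv_equality inv_inv inv_closed r_inv l_inv)
  have "F (star ga.X f \<otimes>\<^bsub>ga.X\<^esub> f) = cnj (ga.lsum f (%a. cnj (ga.lsum f (%b. if inv a \<otimes> b = \<one> then 1 else 0))))"
   using f by (simp add: Fl ga.mult_closed ga.star_closed ga.lsum_mult ga.lsum_star)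
  also have "ga.lsum f (%a. cnj (ga.lsum f (%b. if inv a \<otimes> b = \<one> then 1 else 0))) = ga.lsum f (%a. cnj (f a))"
  proof (rule ga.lsum_cong[OF f])
   fix a assume a: "a \<in> carrier \<Lambda>"
   have "ga.lsum f (%b. if inv a \<otimes> b = \<one> then 1 else 0) = ga.lsum f (%b. if b = a then 1 else 0)"
    by (rule ga.lsum_cong[OF f]) (simp add: ab a)
   then show "cnj (ga.lsum f (%b. if inv a \<otimes> b = \<one> then 1 else 0)) = cnj (f a)"
    using ga.lsum_ind[OF f, of a 1] by simp
  qed
  finally have "F (star ga.X f \<otimes>\<^bsub>ga.X\<^esub> f) = (\<Sum>a\<in>{a. f a ~= 0}. cnj (f a) * f a)"
   by (simp add: ga.lsum_def mult.commute)
  moreover have "nn (\<Sum>a\<in>S. cnj (f a) * f a)" for S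
   by (induction S rule: infinite_finite_induct) (auto simp: nn_simps)
  ultimately show ?thesis by simp
 qed
 have F: "state ga.X F"
  using pos by (auto simp: state_def posfun_def F_def ga.one_X single_def) (simp_all add: monoid_alg_def)
 interpret R: positive_functional ga.X F by unfold_locales (use F in \<open>simp add: state_def\<close>)
 \<comment> \<open>A group element is unitary, so the complement in \<open>bdd_of_complement\<close>
   can be taken to be 0.\<close>
 have b1: "R.bdd (single g) 1" if g: "g \<in> carrier \<Lambda>" for g
  by (rule R.bdd_of_complement[of _ "\<zero>\<^bsub>ga.X\<^esub>"]) (use g in \<open>simp_all add: ga.single_closed single_unitary\<close>)
 have bd: "\<exists>M. R.bdd t M" if "t \<in> carrier ga.X" for t
  using that
 proof (induction t rule: ga.X_induct)
  case zero
  then show ?case using R.bdd_zero by blast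
 next
  case (add f g c)
  then obtain M where "R.bdd f M" by blast
  then show ?case
   using R.bdd_add[OF add(1) ga.scale_closed[OF ga.single_closed[OF add(2)]]]
    R.bdd_scale[OF ga.single_closed[OF add(2)] b1[OF add(2)]] by blast
 qed
 obtain \<tau> where "state (univ_cstar ga.X {}) \<tau>" "\<forall>x\<in>carrier ga.X. \<tau> (univ_elem ga.X {} x) = F x"
  using state_extension[OF univ_alg_group[unfolded group_alg_eq] F bd] by blast
 then show ?thesis
  using ga.single_closed by (auto simp: group_cstar_def group_elem_def group_alg_eq F_def single_def)
qed

end

section \<open>The Hahn--Banach theorem and existence of states\<close>

context star_algebra
begin

abbreviation rs :: "real => 'a => 'a" where "rs r x == scale A (of_real r) x"

definition sublinear :: "('a => real) => bool" where
 "sublinear q \<longleftrightarrow> (\<forall>x\<in>carrier A. \<forall>y\<in>carrier A. q (x \<oplus> y) <= q x + q y) &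
   (\<forall>x\<in>carrier A. \<forall>r\<ge>0. q (rs r x) = r * q x)"

lemma sublinearD:
 assumes "sublinear q"
 shows "x \<in> carrier A ==> y \<in> carrier A ==> q (x \<oplus> y) <= q x + q y"
  "x \<in> carrier A ==> r \<ge> 0 ==> q (rs r x) = r * q x" "q \<zero> = 0"
  "x \<in> carrier A ==> - q (\<ominus> x) <= q x"
proof -
 show 1: "x \<in> carrier A ==> y \<in> carrier A ==> q (x \<oplus> y) <= q x + q y" for x y
  using assms by (auto simp: sublinear_def)
 show 2: "x \<in> carrier A ==> r \<ge> 0 ==> q (rs r x) = r * q x" for x r
  using assms by (auto simp: sublinear_def)
 show 3: "q \<zero> = 0" using 2[of \<zero> 0] by simp
 show "x \<in> carrier A ==> - q (\<ominus> x) <= q x" using 1[of x "\<ominus> x"] 3 by (simp add: r_neg)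
qed

lemma sublinearI:
 assumes add: "!!x y. x \<in> carrier A ==> y \<in> carrier A ==> q (x \<oplus> y) <= q x + q y"
  and zero: "q \<zero> = 0" and scale: "!!x r. x \<in> carrier A ==> r > 0 ==> q (rs r x) <= r * q x"
 shows "sublinear q"
 unfolding sublinear_def
proof (intro conjI ballI allI impI add)
 fix x r assume x: "x \<in> carrier A" and r: "(r::real) \<ge> 0"
 show "q (rs r x) = r * q x"
 proof (cases "r = 0")
  case False
  then have r: "r > 0" using r by simp
  have "q x <= inverse r * q (rs r x)"
   using scale[of "rs r x" "inverse r"] x r by (simp add: scale_scale flip: of_real_mult of_real_inverse)
  then have "r * q x <= q (rs r x)" using r by (simp add: field_simps)
  then show ?thesis using scale[OF x r] by simp
 qed (use x zero in simp)
qed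

text \<open>Lowers \<open>q\<close> in the direction of \<open>y\<close>. The result is still
  sublinear and below \<open>q\<close>, and its value at the negative of \<open>y\<close> is at most
  - q y, so a linear functional below it has at \<open>y\<close> at least the value
  \<open>q y\<close>.\<close>

definition shift :: "('a => real) => 'a => 'a => real" where
 "shift q y x = (if x \<in> carrier A then Inf {q (x \<oplus> rs t y) - t * q y | t. t \<ge> 0} else 0)"

lemma shift_facts:
 assumes q: "sublinear q" and y: "y \<in> carrier A"
 shows "sublinear (shift q y)" "x \<in> carrier A ==> t \<ge> 0 ==> shift q y x <= q (x \<oplus> rs t y) - t * q y"
proof -
 note qD = sublinearD[OF q]
 have low: "- q (\<ominus> x) <= q (x \<oplus> rs t y) - t * q y" if x: "x \<in> carrier A" and t: "t \<ge> 0" for x t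
 proof -
  have "t * q y = q (rs t y)" using qD(2) y t by simp
  also have "rs t y = (x \<oplus> rs t y) \<oplus> \<ominus> x"
   using x y minus_swap4[of x "rs t y" x \<zero>] by (simp add: minus_eq r_neg)
  also have "q ... <= q (x \<oplus> rs t y) + q (\<ominus> x)" using x y by (intro qD(1)) auto
  finally show ?thesis by simp
 qed
 have up: "shift q y x <= q (x \<oplus> rs t y) - t * q y" if x: "x \<in> carrier A" and t: "t \<ge> 0" for x t
 proof -
  have "bdd_below {q (x \<oplus> rs t y) - t * q y | t. t \<ge> 0}"
   unfolding bdd_below_def using low[OF x] by (intro exI[of _ "- q (\<ominus> x)"]) auto
  then show ?thesis unfolding shift_def using x t by (auto intro!: cInf_lower)
 qed
 then show "x \<in> carrier A ==> t \<ge> 0 ==> shift q y x <= q (x \<oplus> rs t y) - t * q y" .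
 have great: "c <= shift q y x" if "x \<in> carrier A" "!!t. t \<ge> 0 ==> c <= q (x \<oplus> rs t y) - t * q y" for c x
  unfolding shift_def using that by (auto intro!: cInf_greatest)
 show "sublinear (shift q y)"
 proof (rule sublinearI)
  show "shift q y \<zero> = 0"
  proof (rule antisym)
   show "shift q y \<zero> <= 0" using up[of \<zero> 0] y qD(3) by simp
   show "0 <= shift q y \<zero>" by (rule great) (use y qD(2) in auto)
  qed
 next
  fix x r assume x: "x \<in> carrier A" and r: "(r::real) > 0"
  have "shift q y (rs r x) / r <= shift q y x"
  proof (rule great[OF x])
   fix t :: real assume t: "t \<ge> 0"
   have "shift q y (rs r x) <= q (rs r x \<oplus> rs (r * t) y) - (r * t) * q y"
    using x r t by (intro up) auto
   also have "rs r x \<oplus> rs (r * t) y = rs r (x \<oplus> rs t y)" using x y by (simp add: scale_add scale_scale)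
   also have "q ... = r * q (x \<oplus> rs t y)" using qD(2) x y r by simp
   finally show "shift q y (rs r x) / r <= q (x \<oplus> rs t y) - t * q y"
    using r by (simp add: field_simps)
  qed
  then show "shift q y (rs r x) <= r * shift q y x" using r by (simp add: field_simps)
 next
  fix x z assume x: "x \<in> carrier A" and z: "z \<in> carrier A"
  have *: "shift q y (x \<oplus> z) <= (q (x \<oplus> rs t y) - t * q y) + (q (z \<oplus> rs s y) - s * q y)"
   if "t \<ge> 0" "s \<ge> 0" for t s
  proof -
   have "shift q y (x \<oplus> z) <= q ((x \<oplus> z) \<oplus> rs (t + s) y) - (t + s) * q y"
    using x z that by (intro up) auto
   also have "(x \<oplus> z) \<oplus> rs (t + s) y = (x \<oplus> rs t y) \<oplus> (z \<oplus> rs s y)"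
    using x y z by (simp add: add_scale a_ac)
   also have "q ... <= q (x \<oplus> rs t y) + q (z \<oplus> rs s y)" using x y z by (intro qD(1)) auto
   finally show ?thesis by (simp add: algebra_simps)
  qed
  have "shift q y (x \<oplus> z) - (q (z \<oplus> rs s y) - s * q y) <= shift q y x" if "s \<ge> 0" for s
   by (rule great[OF x]) (use *[OF _ that] in fastforce)
  then have "shift q y (x \<oplus> z) - shift q y x <= shift q y z"
   by (intro great[OF z]) fastforce
  then show "shift q y (x \<oplus> z) <= shift q y x + shift q y z" by simp
 qed
qed

text \<open>Minimal sublinear functionals are linear, because \<open>shift\<close> cannot make them smaller.\<close>

lemma minimal_sublinear:
 assumes p: "sublinear p"
 shows "\<exists>m. sublinear m & (\<forall>x\<in>carrier A. m x <= p x) &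
  (\<forall>q. sublinear q --> (\<forall>x\<in>carrier A. q x <= m x) --> (\<forall>x\<in>carrier A. q x = m x))"
proof -
 \<comment> \<open>Fixing the value 0 off the carrier lets inequalities on the carrier decide the
   order \<open>P\<close>, which compares functions everywhere.\<close>
 define S where "S = {q. sublinear q & (\<forall>x\<in>carrier A. q x <= p x) & (\<forall>x. x \<notin> carrier A --> q x = 0)}"
 define P where "P = (%a b. \<forall>x. (b x :: real) <= a (x::'a))"
 have SD: "sublinear q" "x \<in> carrier A ==> q x <= p x" "x \<notin> carrier A ==> q x = 0" if "q \<in> S" for q x
  using that by (auto simp: S_def)
 have "\<exists>m\<in>S. \<forall>a\<in>S. P m a --> a = m"
 proof (rule predicate_Zorn)
  show "partial_order_on S (relation_of P S)"
   by (rule partial_order_on_relation_ofI) (auto simp: P_def fun_eq_iff intro: order.trans antisym)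
  fix C assume C: "C \<in> Chains (relation_of P S)"
  have CS: "C \<subseteq> S" using C by (auto simp: Chains_def relation_of_def)
  have chain: "P a b \<or> P b a" if "a \<in> C" "b \<in> C" for a b
   using C that by (auto simp: Chains_def relation_of_def)
  show "\<exists>u\<in>S. \<forall>a\<in>C. P a u"
  proof (cases "C = {}")
   case True
   have "(%x. if x \<in> carrier A then p x else 0) \<in> S"
    using p unfolding S_def by (auto simp: sublinear_def)
   then show ?thesis using True by blast
  next
   case False
   define u where "u x = (if x \<in> carrier A then Inf ((%q. q x) ` C) else 0)" for x
   have low: "- p (\<ominus> x) <= q x" if "q \<in> C" "x \<in> carrier A" for q x
   proof -
    have "q \<in> S" using CS that by blast
    then show ?thesis using sublinearD(4)[OF SD(1), of q x] SD(2)[of q "\<ominus> x"] that by simp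
   qed
   have up: "u x <= q x" if "q \<in> C" "x \<in> carrier A" for q x
   proof -
    have "bdd_below ((%q. q x) ` C)"
     unfolding bdd_below_def using low that(2) by (intro exI[of _ "- p (\<ominus> x)"]) auto
    then show ?thesis unfolding u_def using that by (auto intro!: cInf_lower)
   qed
   have great: "c <= u x" if "x \<in> carrier A" "!!q. q \<in> C ==> c <= q x" for c x
    unfolding u_def using that False by (auto intro!: cInf_greatest)
   have "sublinear u"
   proof (rule sublinearI)
    obtain q where q: "q \<in> C" using False by blast
    show "u \<zero> = 0"
    proof (rule antisym)
     show "u \<zero> <= 0" using up[OF q zero_closed] sublinearD(3)[OF SD(1)] CS q by fastforce
     show "0 <= u \<zero>" by (rule great) (use sublinearD(3)[OF SD(1)] CS in fastforce)+
    qed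
   next
    fix x r assume x: "x \<in> carrier A" and r: "(r::real) > 0"
    have "u (rs r x) / r <= u x"
    proof (rule great[OF x])
     fix q assume q: "q \<in> C"
     have "u (rs r x) <= r * q x" using up[OF q, of "rs r x"] sublinearD(2)[OF SD(1), of q x r] CS q x r by fastforce
     then show "u (rs r x) / r <= q x" using r by (simp add: field_simps)
    qed
    then show "u (rs r x) <= r * u x" using r by (simp add: field_simps)
   next
    fix x y assume x: "x \<in> carrier A" and y: "y \<in> carrier A"
    \<comment> \<open>Of two members of the chain the smaller serves for both points; for a family
      that is not a chain the infimum need not be subadditive.\<close>
    have *: "u (x \<oplus> y) <= a x + b y" if ab: "a \<in> C" "b \<in> C" for a b
    proof -
     obtain c where c: "c \<in> C" "c x <= a x" "c y <= b y"
      using chain[OF ab] ab unfolding P_def by (metis order.refl)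
     have "u (x \<oplus> y) <= c x + c y"
      using up[OF c(1), of "x \<oplus> y"] sublinearD(1)[OF SD(1), of c x y] CS c x y by fastforce
     then show ?thesis using c by linarith
    qed
    have "u (x \<oplus> y) - b y <= u x" if "b \<in> C" for b
     by (rule great[OF x]) (use *[OF _ that] in fastforce)
    then have "u (x \<oplus> y) - u x <= u y" by (intro great[OF y]) fastforce
    then show "u (x \<oplus> y) <= u x + u y" by simp
   qed
   moreover have "u x <= p x" if "x \<in> carrier A" for x
    using False up that SD(2) CS by (meson all_not_in_conv order.trans subsetD)
   ultimately have "u \<in> S" by (simp add: S_def u_def)
   moreover have "P a u" if "a \<in> C" for a
    unfolding P_def
   proof
    fix x
    show "u x <= a x" using up[OF that, of x] SD(3)[of a x] CS that by (cases "x \<in> carrier A") (auto simp: u_def)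
   qed
   ultimately show ?thesis by blast
  qed
 qed
 then obtain m where m: "m \<in> S" "!!a. a \<in> S ==> P m a ==> a = m" by blast
 have "\<forall>x\<in>carrier A. q x = m x" if q: "sublinear q" "\<forall>x\<in>carrier A. q x <= m x" for q
 proof -
  define q' where "q' x = (if x \<in> carrier A then q x else 0)" for x
  have "q' \<in> S" using q SD(2)[OF m(1)] unfolding S_def q'_def by (auto simp: sublinear_def intro: order.trans)
  moreover have "P m q'" using q SD(3)[OF m(1)] by (auto simp: P_def q'_def)
  ultimately have "q' = m" using m(2) by blast
  then have "q' x = m x" for x by simp
  then show ?thesis unfolding q'_def by (metis (full_types))
 qed
 then show ?thesis using SD[OF m(1)] by blast
qed

text \<open>A minimal sublinear functional \<open>f\<close> below \<open>shift p z\<close> is taken.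
  For each y, \<open>shift f y\<close> lies below \<open>f\<close>, hence equals it, which gives
  additivity. The bound at the negative of \<open>z\<close> forces the value at
  \<open>z\<close>.\<close>

lemma hahn_banach:
 assumes p: "sublinear p" and z: "z \<in> carrier A"
 shows "\<exists>f. (\<forall>x\<in>carrier A. \<forall>y\<in>carrier A. f (x \<oplus> y) = f x + f y) &
  (\<forall>x\<in>carrier A. \<forall>r. f (rs r x) = r * f x) & (\<forall>x\<in>carrier A. f x <= p x) & f z = p z"
proof -
 obtain f where f: "sublinear f" "\<forall>x\<in>carrier A. f x <= shift p z x"
  and min: "\<forall>q. sublinear q --> (\<forall>x\<in>carrier A. q x <= f x) --> (\<forall>x\<in>carrier A. q x = f x)"
  using minimal_sublinear[OF shift_facts(1)[OF p z]] by blast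
 note fD = sublinearD[OF f(1)]
 have add: "f (x \<oplus> y) = f x + f y" if xy: "x \<in> carrier A" "y \<in> carrier A" for x y
 proof -
  have "\<forall>v\<in>carrier A. shift f y v <= f v"
   using shift_facts(2)[OF f(1) xy(2), of _ 0] xy by auto
  then have "shift f y x = f x" using min shift_facts(1)[OF f(1) xy(2)] xy by blast
  then have "f x <= f (x \<oplus> y) - f y" using shift_facts(2)[OF f(1) xy(2,1), of 1] xy by simp
  then show ?thesis using fD(1)[OF xy] by simp
 qed
 have neg: "f (\<ominus> x) = - f x" if "x \<in> carrier A" for x
  using add[of x "\<ominus> x"] that fD(3) by (simp add: r_neg)
 have scale: "f (rs r x) = r * f x" if x: "x \<in> carrier A" for r x
 proof (cases "r \<ge> 0")
  case False
  have "rs r x = \<ominus> rs (- r) x" using x by (simp add: scale_minus_one scale_scale)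
  then show ?thesis using neg[of "rs (- r) x"] fD(2)[of x "- r"] x False by simp
 qed (use fD(2) x in simp)
 have le: "f x <= p x" if "x \<in> carrier A" for x
  using f(2) shift_facts(2)[OF p z that, of 0] that z by fastforce
 have "f (\<ominus> z) <= shift p z (\<ominus> z)" using f(2) z by simp
 also have "... <= p (\<ominus> z \<oplus> rs 1 z) - 1 * p z"
  by (rule shift_facts(2)[OF p z]) (use z in auto)
 finally have "f (\<ominus> z) <= p (\<ominus> z \<oplus> rs 1 z) - 1 * p z" .
 then have "p z <= f z" using z neg[OF z] sublinearD(3)[OF p] by (simp add: l_neg)
 then have "f z = p z" using le[OF z] by simp
 then show ?thesis using add scale le by blast
qed

end

section \<open>States that attain the norm\<close>

context cstar_algebra
begin

text \<open>Hahn-Banach is applied at 1 + x* x, whose norm is 1 + |x|^2 by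
  \<open>nrm_add_square\<close>; attaining it forces f 1 = 1 and f (x* x) = |x|^2 at once. The
  complexification of \<open>f\<close> is real on self-adjoint elements by \<open>im\<close>, and
  positivity follows from f (1 - v* v) <= 1 for contractions v.\<close>

lemma state_ex:
 assumes x: "x \<in> carrier A" and nt: "nrm A \<one> = 1"
 shows "\<exists>\<phi>. state A \<phi> & \<phi> (star A x \<otimes> x) = of_real ((nrm A x)^2)"
proof -
 have sub: "sublinear (nrm A)"
  by (rule sublinearI) (auto simp: nm.p_add nm.p_scale)
 obtain r where r: "r \<in> carrier A" "star A r = r" "star A x \<otimes> x = r \<otimes> r"
  using star_mult_square[OF x] by blast
 define h where "h = star A x \<otimes> x"
 have h: "h \<in> carrier A" "nrm A h = (nrm A x)^2" using x by (auto simp: h_def nm.p_cstar)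
 have rx: "(nrm A r)^2 = (nrm A x)^2"
  using nm.p_selfadjoint_square[OF r(1,2)] h(2) r(3) by (simp add: h_def)
 have z: "nrm A (\<one> \<oplus> h) = 1 + (nrm A x)^2"
 proof (rule antisym)
  show "nrm A (\<one> \<oplus> h) <= 1 + (nrm A x)^2" using nm.p_add[of \<one> h] h nt by simp
  show "1 + (nrm A x)^2 <= nrm A (\<one> \<oplus> h)"
   using nrm_add_square[OF r(1,2), of 1] nt rx by (simp add: h_def r(3))
 qed
 obtain f where f: "(\<forall>x\<in>carrier A. \<forall>y\<in>carrier A. f (x \<oplus> y) = f x + f y) &
  (\<forall>x\<in>carrier A. \<forall>r. f (rs r x) = r * f x) & (\<forall>x\<in>carrier A. f x <= nrm A x) & f (\<one> \<oplus> h) = nrm A (\<one> \<oplus> h)"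
  using hahn_banach[OF sub, of "\<one> \<oplus> h"] h by auto
 have fa: "f (x \<oplus> y) = f x + f y" if "x \<in> carrier A" "y \<in> carrier A" for x y using f that by blast
 have fs: "f (rs r x) = r * f x" if "x \<in> carrier A" for r x using f that by blast
 have fl: "f x <= nrm A x" if "x \<in> carrier A" for x using f that by blast
 have f1: "f \<one> = 1" and fh: "f h = (nrm A x)^2"
  using f z fa[of \<one> h] fl[of \<one>] fl[of h] h nt by auto
 define \<phi> where "\<phi> v = of_real (f v) - \<i> * of_real (f (scale A \<i> v))" for v
 have fc: "f (scale A c v) = Re c * f v + Im c * f (scale A \<i> v)" if v: "v \<in> carrier A" for c v
 proof -
  have "scale A c v = rs (Re c) v \<oplus> rs (Im c) (scale A \<i> v)"
   using v by (simp add: scale_scale add_scale[symmetric] mult.commute[of _ \<i>] complex_eq[symmetric])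
  then show ?thesis using v by (simp add: fa fs)
 qed
 have im0: "f (scale A \<i> k) <= 0" if k: "k \<in> carrier A" "star A k = k" for k
 proof (rule ccontr)
  assume "\<not> f (scale A \<i> k) <= 0"
  define a where "a = f (scale A \<i> k)"
  have a: "a > 0" using \<open>\<not> f (scale A \<i> k) <= 0\<close> by (simp add: a_def)
  \<comment> \<open>The value of \<open>f\<close> at t + i k is t + a, while the C*-identity bounds
    the squared norm of t + i k by t^2 + |k|^2. With this \<open>t\<close> one has t a = |k|^2,
    which contradicts 2 t a + a^2 <= |k|^2.\<close>
  define t where "t = (nrm A k)^2 / a"
  have t: "t \<ge> 0" using a by (simp add: t_def)
  let ?v = "rs t \<one> \<oplus> scale A \<i> k"
  have vc: "?v \<in> carrier A" using k by simp
  have "star A ?v \<otimes> ?v = rs (t * t) \<one> \<oplus> k \<otimes> k"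
  proof -
   have kk: "k \<otimes> k \<in> carrier A" using k by simp
   have "star A ?v \<otimes> ?v = (rs (t * t) \<one> \<oplus> scale A (- (of_real t * \<i>)) k) \<oplus> (scale A (\<i> * of_real t) k \<oplus> k \<otimes> k)"
    using k by (simp add: star_ops l_distr r_distr)
   also have "... = rs (t * t) \<one> \<oplus> ((scale A (- (of_real t * \<i>)) k \<oplus> scale A (\<i> * of_real t) k) \<oplus> k \<otimes> k)"
    using k(1) kk by (simp only: a_assoc scale_closed one_closed a_closed)
   also have "scale A (- (of_real t * \<i>)) k \<oplus> scale A (\<i> * of_real t) k = scale A (- (of_real t * \<i>) + \<i> * of_real t) k"
    using k(1) by (simp only: add_scale)
   also have "- (of_real t * \<i>) + \<i> * of_real t = 0" by simp
   finally show ?thesis using k by simp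
  qed
  then have "(nrm A ?v)^2 <= t * t + (nrm A k)^2"
   using nm.p_add[of "rs (t * t) \<one>" "k \<otimes> k"] k nt nm.p_selfadjoint_square[OF k] t nm.p_cstar[OF vc]
    nm.p_scale[OF one_closed, of "of_real (t * t)"] norm_of_real[of "t * t", where 'a = complex]
   by (simp del: of_real_mult norm_of_real)
  moreover have "t + a <= nrm A ?v" using fl[OF vc] k by (simp add: fa fs f1 a_def)
  then have "(t + a)^2 <= (nrm A ?v)^2" using t a by (intro power_mono) auto
  ultimately have "2 * (t * a) + a^2 <= (nrm A k)^2" by (simp add: power2_eq_square algebra_simps)
  moreover have "t * a = (nrm A k)^2" using a by (simp add: t_def)
  ultimately show False using a zero_le_power2[of "nrm A k"] zero_less_power[OF a, of 2] by linarith
 qed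
 have im: "f (scale A \<i> k) = 0" if k: "k \<in> carrier A" "star A k = k" for k
 proof -
  have "f (scale A \<i> (rs (- 1) k)) <= 0" by (rule im0) (use k in \<open>auto simp: star_scale\<close>)
  moreover have "scale A \<i> (rs (- 1) k) = rs (- 1) (scale A \<i> k)" using k by (simp add: scale_scale)
  ultimately show ?thesis using im0[OF k] fs[of "scale A \<i> k" "- 1"] k by simp
 qed
 have pos1: "0 <= f (star A v \<otimes> v)" if v: "v \<in> carrier A" "nrm A v <= 1" for v
 proof -
  obtain s where s: "s \<in> carrier A" "star A s = s" "star A v \<otimes> v = s \<otimes> s" using star_mult_square[OF v(1)] by blast
  have "(nrm A s)^2 = (nrm A v)^2"
   using nm.p_selfadjoint_square[OF s(1,2)] nm.p_cstar[OF v(1)] s(3) by simp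
  then have "nrm A s <= 1" using v s nm.p_nonneg by (metis power2_eq_imp_eq)
  then have "nrm A (\<one> \<ominus> star A v \<otimes> v) <= 1" unfolding s(3) using nrm_one_minus(2)[OF s(1,2)] by simp
  moreover have "f (\<one> \<ominus> star A v \<otimes> v) = 1 - f (star A v \<otimes> v)"
   using v fs[of "star A v \<otimes> v" "- 1"] by (simp add: minus_conv fa f1)
  ultimately show ?thesis using fl[of "\<one> \<ominus> star A v \<otimes> v"] v by simp
 qed
 have pos: "0 <= f (star A v \<otimes> v)" if v: "v \<in> carrier A" for v
 proof -
  define m where "m = 1 + nrm A v"
  have m: "m > 0" "nrm A v <= m" using nm.p_nonneg[OF v] by (auto simp: m_def simp del: nm.p_nonneg)
  have "0 <= f (star A (rs (inverse m) v) \<otimes> rs (inverse m) v)"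
   by (rule pos1) (use v m in \<open>auto simp: nm.p_scale norm_divide inverse_eq_divide pos_divide_le_eq\<close>)
  also have "star A (rs (inverse m) v) \<otimes> rs (inverse m) v = rs (inverse m * inverse m) (star A v \<otimes> v)"
   using v by (simp add: star_scale scale_mult_left scale_mult_right scale_scale)
  finally have "0 <= f (rs (inverse m * inverse m) (star A v \<otimes> v))" .
  moreover have "star A v \<otimes> v \<in> carrier A" using v by simp
  ultimately have "0 <= inverse m * inverse m * f (star A v \<otimes> v)" by (simp only: fs)
  moreover have "inverse m * inverse m > 0" using m by simp
  ultimately show ?thesis
   using mult_le_cancel_left_pos[of "inverse m * inverse m" 0 "f (star A v \<otimes> v)"] by simp
 qed
 have ph: "\<phi> v = of_real (f v)" if "v \<in> carrier A" "star A v = v" for v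
  using im[OF that] by (simp add: \<phi>_def)
 have "posfun A \<phi>"
  unfolding posfun_def
 proof (intro conjI ballI allI)
  fix v w assume "v \<in> carrier A" "w \<in> carrier A"
  then show "\<phi> (v \<oplus> w) = \<phi> v + \<phi> w" by (simp add: \<phi>_def fa scale_add algebra_simps)
 next
  fix c v assume v: "v \<in> carrier A"
  have "f (scale A \<i> (scale A c v)) = Re (\<i> * c) * f v + Im (\<i> * c) * f (scale A \<i> v)"
   using v fc[OF v, of "\<i> * c"] by (simp add: scale_scale)
  then show "\<phi> (scale A c v) = c * \<phi> v"
   using v by (simp add: \<phi>_def fc[OF v, of c] complex_eq_iff algebra_simps)
 next
  fix v assume v: "v \<in> carrier A"
  then show "nn (\<phi> (star A v \<otimes> v))" using pos[OF v] by (simp add: ph star_mult nn_def)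
 qed
 moreover have "\<phi> \<one> = 1" by (simp add: ph f1)
 moreover have "\<phi> h = of_real ((nrm A x)^2)" using ph[of h] fh h x by (simp add: h_def star_mult)
 ultimately show ?thesis by (auto simp: state_def h_def)
qed

end

section \<open>Diagonalised matrices over a star algebra\<close>

text \<open>Weaker than \<open>cstar_hom\<close> on purpose: functionals, multiplication by a fixed
  element and one leg of a simple tensor also have to be moved through finite sums.\<close>

definition lin :: "('a, 'm) star_alg_scheme => ('b, 'k) star_alg_scheme => ('a => 'b) => bool" where
 "lin A B h \<longleftrightarrow> (\<forall>x\<in>carrier A. h x \<in> carrier B) &
   (\<forall>x\<in>carrier A. \<forall>y\<in>carrier A. h (x \<oplus>\<^bsub>A\<^esub> y) = h x \<oplus>\<^bsub>B\<^esub> h y) &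
   (\<forall>c. \<forall>x\<in>carrier A. h (scale A c x) = scale B c (h x))"

lemma lin_hom: "f \<in> cstar_hom A B ==> lin A B f"
 by (simp add: lin_def cstar_homD)

lemma lin_finsum:
 assumes A: "star_algebra A" and B: "star_algebra B" and h: "lin A B h"
  and f: "!!k. k \<in> K ==> f k \<in> carrier A"
 shows "h (\<Oplus>\<^bsub>A\<^esub>k\<in>K. f k) = (\<Oplus>\<^bsub>B\<^esub>k\<in>K. h (f k))"
proof -
 interpret A: star_algebra A by fact
 interpret B: star_algebra B by fact
 have hD: "h x \<in> carrier B" "h (x \<oplus>\<^bsub>A\<^esub> y) = h x \<oplus>\<^bsub>B\<^esub> h y" "h (scale A c x) = scale B c (h x)"
  if "x \<in> carrier A" "y \<in> carrier A" for x y c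
  using h that by (auto simp: lin_def)
 have h0: "h \<zero>\<^bsub>A\<^esub> = \<zero>\<^bsub>B\<^esub>" using hD(3)[of "\<zero>\<^bsub>A\<^esub>" "\<zero>\<^bsub>A\<^esub>" 0] hD(1)[of "\<zero>\<^bsub>A\<^esub>" "\<zero>\<^bsub>A\<^esub>"] by simp
 show ?thesis
  using f
 proof (induction K rule: infinite_finite_induct)
  case (insert k K)
  have "h (\<Oplus>\<^bsub>A\<^esub>j\<in>insert k K. f j) = h (f k \<oplus>\<^bsub>A\<^esub> (\<Oplus>\<^bsub>A\<^esub>j\<in>K. f j))"
   using insert by (subst A.finsum_insert) auto
  also have "... = h (f k) \<oplus>\<^bsub>B\<^esub> (\<Oplus>\<^bsub>B\<^esub>j\<in>K. h (f j))"
   using insert by (subst hD(2)) (auto intro!: A.finsum_closed)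
  also have "... = (\<Oplus>\<^bsub>B\<^esub>j\<in>insert k K. h (f j))"
   using insert hD(1) by (subst B.finsum_insert) auto
  finally show ?case .
 qed (auto simp: h0)
qed

context star_algebra
begin

lemma finsum_scale: "(!!k. k \<in> K ==> f k \<in> carrier A) ==> scale A c (\<Oplus>k\<in>K. f k) = (\<Oplus>k\<in>K. scale A c (f k))"
 by (rule lin_finsum[OF star_alg star_alg])
  (simp_all add: lin_def scale_add scale_scale mult.commute)

lemma finsum_sum_scale: "finite K ==> x \<in> carrier A ==> (\<Oplus>k\<in>K. scale A (c k) x) = scale A (\<Sum>k\<in>K. c k) x"
proof (induction K rule: finite_induct)
 case (insert k K)
 then show ?case by (subst finsum_insert) (auto simp: add_scale)
qed simp

lemma finsum_swap:
 assumes "finite I" "finite J" "!!i j. i \<in> I ==> j \<in> J ==> f i j \<in> carrier A"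
 shows "(\<Oplus>i\<in>I. \<Oplus>j\<in>J. f i j) = (\<Oplus>j\<in>J. \<Oplus>i\<in>I. f i j)"
 using assms(1,3)
proof (induction I rule: finite_induct)
 case (insert k I)
 have "(\<Oplus>i\<in>insert k I. \<Oplus>j\<in>J. f i j) = (\<Oplus>j\<in>J. f k j) \<oplus> (\<Oplus>j\<in>J. \<Oplus>i\<in>I. f i j)"
  using insert by (subst finsum_insert) (auto intro!: finsum_closed)
 also have "... = (\<Oplus>j\<in>J. f k j \<oplus> (\<Oplus>i\<in>I. f i j))"
  using insert by (intro finsum_addf[symmetric]) (auto intro!: finsum_closed)
 also have "... = (\<Oplus>j\<in>J. \<Oplus>i\<in>insert k I. f i j)"
 proof (rule finsum_cong'[OF refl])
  show "f k j \<oplus> (\<Oplus>i\<in>I. f i j) = (\<Oplus>i\<in>insert k I. f i j)" if "j \<in> J" for j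
   using insert that by (subst finsum_insert) auto
 qed (use insert in \<open>auto intro!: finsum_closed\<close>)
 finally show ?case .
qed simp

lemma finsum_delta:
 assumes "finite K" "j \<in> K" "!!k. k \<in> K ==> d k \<in> carrier A"
 shows "(\<Oplus>k\<in>K. scale A (if k = j then c else 0) (d k)) = scale A c (d j)"
proof -
 have "(\<Oplus>k\<in>K. scale A (if k = j then c else 0) (d k)) = (\<Oplus>k\<in>insert j (K - {j}). scale A (if k = j then c else 0) (d k))"
  using assms by (simp add: insert_absorb)
 also have "... = scale A c (d j) \<oplus> (\<Oplus>k\<in>K - {j}. scale A (if k = j then c else 0) (d k))"
  using assms by (subst finsum_insert) auto
 also have "(\<Oplus>k\<in>K - {j}. scale A (if k = j then c else 0) (d k)) = (\<Oplus>k\<in>K - {j}. \<zero>)"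
  using assms by (intro finsum_cong') auto
 finally show ?thesis using assms by simp
qed

end

lemma unitary_sums:
 assumes U: "U \<in> unitary_group"
 shows "(\<Sum>k\<in>UNIV. U $ i $ k * cnj (U $ j $ k)) = (if i = j then 1 else 0)"
  "(\<Sum>i\<in>UNIV. cnj (U $ i $ k) * U $ i $ l) = (if k = l then 1 else 0)"
proof -
 have 1: "U ** (\<chi> i j. cnj (U $ j $ i)) = mat 1" and 2: "(\<chi> i j. cnj (U $ j $ i)) ** U = mat 1"
  using U by (auto simp: unitary_group_def)
 show "(\<Sum>k\<in>UNIV. U $ i $ k * cnj (U $ j $ k)) = (if i = j then 1 else 0)"
  using arg_cong[OF 1, of "%M. M $ i $ j"] by (simp add: matrix_matrix_mult_def mat_def)
 show "(\<Sum>i\<in>UNIV. cnj (U $ i $ k) * U $ i $ l) = (if k = l then 1 else 0)"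
  using arg_cong[OF 2, of "%M. M $ k $ l"] by (simp add: matrix_matrix_mult_def mat_def)
qed

text \<open>The matrix \<open>U* diag(d) U\<close>.\<close>

definition dform :: "('b, 'm) star_alg_scheme => complex ^ 'n ^ 'n::finite => ('n => 'b) => 'n => 'n => 'b" where
 "dform B U d k l = (\<Oplus>\<^bsub>B\<^esub>i\<in>UNIV. scale B (cnj (U $ i $ k) * U $ i $ l) (d i))"

context star_algebra
begin

lemma dform_closed: "(!!i. d i \<in> carrier A) ==> dform A U d k l \<in> carrier A"
 unfolding dform_def by (intro finsum_closed) auto

lemma rotated_closed: "(!!i j. x i j \<in> carrier A) ==> rotated A x U i j \<in> carrier A"
 unfolding rotated_def by (intro finsum_closed) (auto intro!: finsum_closed)

lemma rotated_dform:
 assumes U: "U \<in> unitary_group" and d: "!!i. d i \<in> carrier A"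
 shows "rotated A (dform A U d) U i j = (if i = j then d i else \<zero>)"
proof -
 let ?c = "%k l m. U $ i $ k * cnj (U $ j $ l) * (cnj (U $ m $ k) * U $ m $ l)"
 have "rotated A (dform A U d) U i j = (\<Oplus>k\<in>UNIV. \<Oplus>l\<in>UNIV. \<Oplus>m\<in>UNIV. scale A (?c k l m) (d m))"
  unfolding rotated_def dform_def
  by (intro finsum_cong' refl) (auto simp: finsum_scale scale_scale d intro!: finsum_closed)
 also have "... = (\<Oplus>k\<in>UNIV. \<Oplus>m\<in>UNIV. scale A (\<Sum>l\<in>UNIV. ?c k l m) (d m))"
 proof (rule finsum_cong'[OF refl])
  fix k
  have "(\<Oplus>l\<in>UNIV. \<Oplus>m\<in>UNIV. scale A (?c k l m) (d m)) = (\<Oplus>m\<in>UNIV. \<Oplus>l\<in>UNIV. scale A (?c k l m) (d m))"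
   by (rule finsum_swap) (auto simp: d)
  also have "... = (\<Oplus>m\<in>UNIV. scale A (\<Sum>l\<in>UNIV. ?c k l m) (d m))"
   by (intro finsum_cong' refl finsum_sum_scale) (auto simp: d)
  finally show "(\<Oplus>l\<in>UNIV. \<Oplus>m\<in>UNIV. scale A (?c k l m) (d m)) = (\<Oplus>m\<in>UNIV. scale A (\<Sum>l\<in>UNIV. ?c k l m) (d m))" .
 qed (auto intro!: finsum_closed simp: d)
 also have "... = (\<Oplus>m\<in>UNIV. \<Oplus>k\<in>UNIV. scale A (\<Sum>l\<in>UNIV. ?c k l m) (d m))"
  by (rule finsum_swap) (auto simp: d)
 also have "... = (\<Oplus>m\<in>UNIV. scale A (\<Sum>k\<in>UNIV. \<Sum>l\<in>UNIV. ?c k l m) (d m))"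
  by (intro finsum_cong' refl finsum_sum_scale) (auto simp: d)
 also have "... = (\<Oplus>m\<in>UNIV. scale A (if m = i then (if i = j then 1 else 0) else 0) (d m))"
 proof (intro finsum_cong' refl)
  fix m
  have "(\<Sum>k\<in>UNIV. \<Sum>l\<in>UNIV. ?c k l m) = (\<Sum>k\<in>UNIV. U $ i $ k * cnj (U $ m $ k)) * (\<Sum>l\<in>UNIV. U $ m $ l * cnj (U $ j $ l))"
   unfolding sum_product by (intro sum.cong refl) simp
  then show "scale A (\<Sum>k\<in>UNIV. \<Sum>l\<in>UNIV. ?c k l m) (d m) = scale A (if m = i then (if i = j then 1 else 0) else 0) (d m)"
   by (simp add: unitary_sums[OF U])
 qed (auto simp: d)
 also have "... = scale A (if i = j then 1 else 0) (d i)" by (rule finsum_delta) (auto simp: d)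
 finally show ?thesis by (simp add: d)
qed

text \<open>With y = U x U* this reads x = U* y U; orthonormality of the columns of \<open>U\<close>
  contracts the sums over \<open>i\<close> and \<open>j\<close>.\<close>

lemma dform_rotated:
 assumes U: "U \<in> unitary_group" and x: "!!k l. x k l \<in> carrier A"
  and r: "!!i j. rotated A x U i j = (if i = j then d i else \<zero>)"
 shows "x k l = dform A U d k l"
proof -
 have d: "d i \<in> carrier A" for i using rotated_closed[of x U i i] x r[of i i] by simp
 let ?c = "%i j a b. cnj (U $ i $ k) * U $ j $ l * (U $ i $ a * cnj (U $ j $ b))"
 have in1: "scale A (cnj (U $ i $ k) * U $ i $ l) (d i) = (\<Oplus>j\<in>UNIV. scale A (cnj (U $ i $ k) * U $ j $ l) (rotated A x U i j))" for i
 proof -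
  have "(\<Oplus>j\<in>UNIV. scale A (cnj (U $ i $ k) * U $ j $ l) (rotated A x U i j)) =
    (\<Oplus>j\<in>UNIV. scale A (if j = i then cnj (U $ i $ k) * U $ i $ l else 0) (d i))"
   by (intro finsum_cong' refl) (auto simp: r d)
  also have "... = scale A (cnj (U $ i $ k) * U $ i $ l) (d i)"
   by (rule finsum_delta[where d = "%_. d i"]) (auto simp: d)
  finally show ?thesis by simp
 qed
 have "dform A U d k l = (\<Oplus>i\<in>UNIV. \<Oplus>j\<in>UNIV. scale A (cnj (U $ i $ k) * U $ j $ l) (rotated A x U i j))"
  unfolding dform_def in1 ..
 also have "... = (\<Oplus>i\<in>UNIV. \<Oplus>j\<in>UNIV. \<Oplus>a\<in>UNIV. \<Oplus>b\<in>UNIV. scale A (?c i j a b) (x a b))"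
  unfolding rotated_def
  by (intro finsum_cong' refl) (auto simp: finsum_scale scale_scale x intro!: finsum_closed)
 also have "... = (\<Oplus>i\<in>UNIV. \<Oplus>a\<in>UNIV. \<Oplus>b\<in>UNIV. scale A (\<Sum>j\<in>UNIV. ?c i j a b) (x a b))"
 proof (rule finsum_cong'[OF refl])
  fix i
  have "(\<Oplus>j\<in>UNIV. \<Oplus>a\<in>UNIV. \<Oplus>b\<in>UNIV. scale A (?c i j a b) (x a b)) = (\<Oplus>a\<in>UNIV. \<Oplus>j\<in>UNIV. \<Oplus>b\<in>UNIV. scale A (?c i j a b) (x a b))"
   by (rule finsum_swap) (auto simp: x intro!: finsum_closed)
  also have "... = (\<Oplus>a\<in>UNIV. \<Oplus>b\<in>UNIV. \<Oplus>j\<in>UNIV. scale A (?c i j a b) (x a b))"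
   by (intro finsum_cong' refl finsum_swap) (auto simp: x intro!: finsum_closed)
  also have "... = (\<Oplus>a\<in>UNIV. \<Oplus>b\<in>UNIV. scale A (\<Sum>j\<in>UNIV. ?c i j a b) (x a b))"
   by (intro finsum_cong' refl finsum_sum_scale) (auto simp: x intro!: finsum_closed)
  finally show "(\<Oplus>j\<in>UNIV. \<Oplus>a\<in>UNIV. \<Oplus>b\<in>UNIV. scale A (?c i j a b) (x a b)) = ..." .
 qed (auto simp: x intro!: finsum_closed)
 also have "... = (\<Oplus>a\<in>UNIV. \<Oplus>i\<in>UNIV. \<Oplus>b\<in>UNIV. scale A (\<Sum>j\<in>UNIV. ?c i j a b) (x a b))"
  by (rule finsum_swap) (auto simp: x intro!: finsum_closed)
 also have "... = (\<Oplus>a\<in>UNIV. \<Oplus>b\<in>UNIV. \<Oplus>i\<in>UNIV. scale A (\<Sum>j\<in>UNIV. ?c i j a b) (x a b))"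
  by (intro finsum_cong' refl finsum_swap) (auto simp: x intro!: finsum_closed)
 also have "... = (\<Oplus>a\<in>UNIV. \<Oplus>b\<in>UNIV. scale A (\<Sum>i\<in>UNIV. \<Sum>j\<in>UNIV. ?c i j a b) (x a b))"
  by (intro finsum_cong' refl finsum_sum_scale) (auto simp: x intro!: finsum_closed)
 also have "... = (\<Oplus>a\<in>UNIV. \<Oplus>b\<in>UNIV. scale A (if b = l then (if a = k then 1 else 0) else 0) (x a b))"
 proof (intro finsum_cong' refl)
  fix a b
  have "(\<Sum>i\<in>UNIV. \<Sum>j\<in>UNIV. ?c i j a b) = (\<Sum>i\<in>UNIV. cnj (U $ i $ k) * U $ i $ a) * (\<Sum>j\<in>UNIV. cnj (U $ j $ b) * U $ j $ l)"
   unfolding sum_product by (intro sum.cong refl) simp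
  then have "(\<Sum>i\<in>UNIV. \<Sum>j\<in>UNIV. ?c i j a b) = (if b = l then (if a = k then 1 else 0) else 0)"
   using unitary_sums(2)[OF U, of k a] unitary_sums(2)[OF U, of b l] by auto
  then show "scale A (\<Sum>i\<in>UNIV. \<Sum>j\<in>UNIV. ?c i j a b) (x a b) = scale A (if b = l then (if a = k then 1 else 0) else 0) (x a b)"
   by (simp only:)
 qed (auto simp: x intro!: finsum_closed)
 also have "... = (\<Oplus>a\<in>UNIV. scale A (if a = k then 1 else 0) (x a l))"
  by (intro finsum_cong' refl finsum_delta) (auto simp: x intro!: finsum_closed)
 also have "... = scale A 1 (x k l)" by (rule finsum_delta) (auto simp: x)
 finally show ?thesis by (simp add: x)
qed

end

text \<open>The sum over the middle index is orthonormality of the rows of \<open>U\<close>. A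
  general bilinear \<open>\<beta>\<close> covers products in an algebra as well as simple tensors,
  hence both unitarity and comultiplication.\<close>

lemma dform_product:
 assumes A: "star_algebra A" and B: "star_algebra B" and C: "star_algebra C"
  and U: "U \<in> unitary_group" and d: "!!i. d i \<in> carrier A" and e: "!!i. e i \<in> carrier B"
  and \<beta>1: "!!b. b \<in> carrier B ==> lin A C (%a. \<beta> a b)" and \<beta>2: "!!a. a \<in> carrier A ==> lin B C (%b. \<beta> a b)"
 shows "(\<Oplus>\<^bsub>C\<^esub>m\<in>UNIV. \<beta> (dform A U d k m) (dform B U e m l)) = dform C U (%i. \<beta> (d i) (e i)) k l"
proof -
 interpret A: star_algebra A by fact
 interpret B: star_algebra B by fact
 interpret C: star_algebra C by fact
 have c: "\<beta> a b \<in> carrier C" if "a \<in> carrier A" "b \<in> carrier B" for a b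
  using \<beta>1[OF that(2)] that by (simp add: lin_def)
 have s1: "\<beta> (scale A t a) b = scale C t (\<beta> a b)" "\<beta> a (scale B t b) = scale C t (\<beta> a b)" if "a \<in> carrier A" "b \<in> carrier B" for a b t
  using \<beta>1[OF that(2)] \<beta>2[OF that(1)] that by (simp_all add: lin_def)
 let ?c = "%m i j. cnj (U $ i $ k) * U $ i $ m * (cnj (U $ j $ m) * U $ j $ l)"
 have "\<beta> (dform A U d k m) (dform B U e m l) = (\<Oplus>\<^bsub>C\<^esub>i\<in>UNIV. \<Oplus>\<^bsub>C\<^esub>j\<in>UNIV. scale C (?c m i j) (\<beta> (d i) (e j)))" for m
 proof -
  have "\<beta> (dform A U d k m) (dform B U e m l) =
    (\<Oplus>\<^bsub>C\<^esub>i\<in>UNIV. \<beta> (scale A (cnj (U $ i $ k) * U $ i $ m) (d i)) (dform B U e m l))"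
   by (subst dform_def[of A], rule lin_finsum[OF A C \<beta>1]) (auto simp: d e B.dform_closed)
  also have "... = (\<Oplus>\<^bsub>C\<^esub>i\<in>UNIV. scale C (cnj (U $ i $ k) * U $ i $ m) (\<beta> (d i) (dform B U e m l)))"
   by (simp add: s1 d e B.dform_closed)
  also have "... = (\<Oplus>\<^bsub>C\<^esub>i\<in>UNIV. scale C (cnj (U $ i $ k) * U $ i $ m)
    (\<Oplus>\<^bsub>C\<^esub>j\<in>UNIV. scale C (cnj (U $ j $ m) * U $ j $ l) (\<beta> (d i) (e j))))"
  proof -
   have "\<beta> (d i) (dform B U e m l) = (\<Oplus>\<^bsub>C\<^esub>j\<in>UNIV. scale C (cnj (U $ j $ m) * U $ j $ l) (\<beta> (d i) (e j)))" for i
   proof -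
    have "\<beta> (d i) (dform B U e m l) = (\<Oplus>\<^bsub>C\<^esub>j\<in>UNIV. \<beta> (d i) (scale B (cnj (U $ j $ m) * U $ j $ l) (e j)))"
     unfolding dform_def by (rule lin_finsum[OF B C \<beta>2]) (auto simp: d e)
    then show ?thesis by (simp add: s1 d e)
   qed
   then show ?thesis by simp
  qed
  also have "... = (\<Oplus>\<^bsub>C\<^esub>i\<in>UNIV. \<Oplus>\<^bsub>C\<^esub>j\<in>UNIV. scale C (?c m i j) (\<beta> (d i) (e j)))"
   by (intro C.finsum_cong' refl) (auto simp: C.finsum_scale C.scale_scale c d e intro!: C.finsum_closed)
  finally show ?thesis .
 qed
 then have "(\<Oplus>\<^bsub>C\<^esub>m\<in>UNIV. \<beta> (dform A U d k m) (dform B U e m l)) =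
   (\<Oplus>\<^bsub>C\<^esub>m\<in>UNIV. \<Oplus>\<^bsub>C\<^esub>i\<in>UNIV. \<Oplus>\<^bsub>C\<^esub>j\<in>UNIV. scale C (?c m i j) (\<beta> (d i) (e j)))" by simp
 also have "... = (\<Oplus>\<^bsub>C\<^esub>i\<in>UNIV. \<Oplus>\<^bsub>C\<^esub>m\<in>UNIV. \<Oplus>\<^bsub>C\<^esub>j\<in>UNIV. scale C (?c m i j) (\<beta> (d i) (e j)))"
  by (rule C.finsum_swap) (auto simp: c d e intro!: C.finsum_closed)
 also have "... = (\<Oplus>\<^bsub>C\<^esub>i\<in>UNIV. \<Oplus>\<^bsub>C\<^esub>j\<in>UNIV. \<Oplus>\<^bsub>C\<^esub>m\<in>UNIV. scale C (?c m i j) (\<beta> (d i) (e j)))"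
  by (intro C.finsum_cong' refl C.finsum_swap) (auto simp: c d e intro!: C.finsum_closed)
 also have "... = (\<Oplus>\<^bsub>C\<^esub>i\<in>UNIV. \<Oplus>\<^bsub>C\<^esub>j\<in>UNIV. scale C (\<Sum>m\<in>UNIV. ?c m i j) (\<beta> (d i) (e j)))"
  by (intro C.finsum_cong' refl C.finsum_sum_scale) (auto simp: c d e intro!: C.finsum_closed)
 also have "... = (\<Oplus>\<^bsub>C\<^esub>i\<in>UNIV. \<Oplus>\<^bsub>C\<^esub>j\<in>UNIV. scale C (if j = i then cnj (U $ i $ k) * U $ i $ l else 0) (\<beta> (d i) (e j)))"
 proof (intro C.finsum_cong' refl)
  fix i j
  have "(\<Sum>m\<in>UNIV. ?c m i j) = cnj (U $ i $ k) * U $ j $ l * (\<Sum>m\<in>UNIV. U $ i $ m * cnj (U $ j $ m))"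
   unfolding sum_distrib_left by (intro sum.cong refl) simp
  then have "(\<Sum>m\<in>UNIV. ?c m i j) = (if j = i then cnj (U $ i $ k) * U $ i $ l else 0)"
   using unitary_sums(1)[OF U, of i j] by auto
  then show "scale C (\<Sum>m\<in>UNIV. ?c m i j) (\<beta> (d i) (e j)) = scale C (if j = i then cnj (U $ i $ k) * U $ i $ l else 0) (\<beta> (d i) (e j))"
   by (simp only:)
 qed (auto simp: c d e intro!: C.finsum_closed)
 also have "... = (\<Oplus>\<^bsub>C\<^esub>i\<in>UNIV. scale C (cnj (U $ i $ k) * U $ i $ l) (\<beta> (d i) (e i)))"
  by (intro C.finsum_cong' refl C.finsum_delta) (auto simp: c d e)
 finally show ?thesis by (simp add: dform_def)
qed

lemma dform_hom:
 assumes A: "star_algebra A" and B: "star_algebra B" and h: "lin A B h" and d: "!!i. d i \<in> carrier A"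
 shows "h (dform A U d k l) = dform B U (%i. h (d i)) k l"
proof -
 interpret A: star_algebra A by fact
 show ?thesis
  unfolding dform_def
  by (subst lin_finsum[OF A B h]) (use d h in \<open>auto simp: lin_def\<close>)
qed

lemma rotated_hom:
 assumes A: "star_algebra A" and B: "star_algebra B" and h: "lin A B h" and x: "!!i j. x i j \<in> carrier A"
 shows "h (rotated A x U i j) = rotated B (%i j. h (x i j)) U i j"
proof -
 interpret A: star_algebra A by fact
 interpret B: star_algebra B by fact
 show ?thesis
  unfolding rotated_def
 proof (subst lin_finsum[OF A B h])
  have "h (\<Oplus>\<^bsub>A\<^esub>l\<in>UNIV. scale A (U $ i $ k * cnj (U $ j $ l)) (x k l)) =
    (\<Oplus>\<^bsub>B\<^esub>l\<in>UNIV. scale B (U $ i $ k * cnj (U $ j $ l)) (h (x k l)))" for k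
   by (subst lin_finsum[OF A B h]) (use x h in \<open>auto simp: lin_def\<close>)
  then show "(\<Oplus>\<^bsub>B\<^esub>k\<in>UNIV. h (\<Oplus>\<^bsub>A\<^esub>l\<in>UNIV. scale A (U $ i $ k * cnj (U $ j $ l)) (x k l))) =
    (\<Oplus>\<^bsub>B\<^esub>k\<in>UNIV. \<Oplus>\<^bsub>B\<^esub>l\<in>UNIV. scale B (U $ i $ k * cnj (U $ j $ l)) (h (x k l)))" by simp
 qed (use x in \<open>auto intro!: A.finsum_closed\<close>)
qed

section \<open>Star subalgebras\<close>

definition star_subalg :: "('a, 'm) star_alg_scheme => 'a set => bool" where
 "star_subalg A S \<longleftrightarrow> S \<subseteq> carrier A & \<one>\<^bsub>A\<^esub> \<in> S &
   (\<forall>x\<in>S. \<forall>y\<in>S. x \<oplus>\<^bsub>A\<^esub> y \<in> S & x \<otimes>\<^bsub>A\<^esub> y \<in> S) &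
   (\<forall>x\<in>S. star A x \<in> S & (\<forall>c. scale A c x \<in> S))"

lemma gen_star_subalg_alt: "gen_star_subalg A X = \<Inter>{S. X \<subseteq> S & star_subalg A S}"
 unfolding gen_star_subalg_def star_subalg_def by (rule arg_cong[of _ _ Inter]) auto

context star_algebra
begin

lemma star_subalg_gen: assumes X: "X \<subseteq> carrier A"
 shows "star_subalg A (gen_star_subalg A X)" "X \<subseteq> gen_star_subalg A X"
  "!!S. star_subalg A S ==> X \<subseteq> S ==> gen_star_subalg A X \<subseteq> S"
proof -
 have c: "star_subalg A (carrier A)" by (simp add: star_subalg_def)
 show "X \<subseteq> gen_star_subalg A X" "!!S. star_subalg A S ==> X \<subseteq> S ==> gen_star_subalg A X \<subseteq> S"
  unfolding gen_star_subalg_alt by auto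
 show "star_subalg A (gen_star_subalg A X)"
  unfolding gen_star_subalg_alt star_subalg_def[of A "\<Inter>_"]
 proof (intro conjI ballI allI)
  show "\<Inter>{S. X \<subseteq> S & star_subalg A S} \<subseteq> carrier A" using c X by blast
 qed (auto simp: star_subalg_def)
qed

lemma star_algebra_sub: assumes S: "star_subalg A S" shows "star_algebra (A\<lparr>carrier := S\<rparr>)"
proof -
 have SD: "x \<in> S ==> x \<in> carrier A" "\<one> \<in> S" "x \<in> S ==> y \<in> S ==> x \<oplus> y \<in> S" "x \<in> S ==> y \<in> S ==> x \<otimes> y \<in> S"
  "x \<in> S ==> star A x \<in> S" "x \<in> S ==> scale A c x \<in> S" for x y c
  using S by (auto simp: star_subalg_def)
 have S0: "\<zero> \<in> S" using SD(6)[OF SD(2), of 0] by simp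
 have ab: "abelian_group (A\<lparr>carrier := S\<rparr>)"
 proof (rule abelian_groupI)
  show "\<exists>y\<in>carrier (A\<lparr>carrier := S\<rparr>). y \<oplus>\<^bsub>A\<lparr>carrier := S\<rparr>\<^esub> x = \<zero>\<^bsub>A\<lparr>carrier := S\<rparr>\<^esub>" if "x \<in> carrier (A\<lparr>carrier := S\<rparr>)" for x
   by (rule bexI[of _ "scale A (-1) x"])
    (use that SD(6) scale_minus_one[OF SD(1)[of x]] l_neg[OF SD(1)[of x]] in auto)
 qed (auto simp: SD S0 a_ac)
 have mo: "monoid (A\<lparr>carrier := S\<rparr>)" by (rule monoidI) (auto simp: SD m_assoc)
 have ri: "ring (A\<lparr>carrier := S\<rparr>)" by (rule ringI[OF ab mo]) (auto simp: SD l_distr r_distr)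
 show ?thesis
  by (intro star_algebra.intro ri star_algebra_axioms.intro) (auto simp: SD star_ops add_scale)
qed

end

lemma equalizer_subalg:
 assumes A: "star_algebra A" and B: "star_algebra B" and f: "f \<in> cstar_hom A B" and g: "g \<in> cstar_hom A B"
 shows "star_subalg A {x \<in> carrier A. f x = g x}"
proof -
 interpret A: star_algebra A by fact
 show ?thesis unfolding star_subalg_def by (auto simp: cstar_homD[OF f] cstar_homD[OF g])
qed

lemma vimage_subalg:
 assumes A: "star_algebra A" and f: "f \<in> cstar_hom A B" and S: "star_subalg B S"
 shows "star_subalg A {x \<in> carrier A. f x \<in> S}"
proof -
 interpret A: star_algebra A by fact
 show ?thesis using S unfolding star_subalg_def by (auto simp: cstar_homD[OF f])
qed

lemma image_subalg:
 assumes A: "star_algebra A" and f: "f \<in> cstar_hom A B"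
 shows "star_subalg B (f ` carrier A)"
proof -
 interpret A: star_algebra A by fact
 show ?thesis unfolding star_subalg_def
  by (auto simp: cstar_homD(1)[OF f] cstar_homD(2-6)[OF f, symmetric] intro!: imageI)
qed

section \<open>The free unitary quantum group\<close>

definition word_star :: "('n \<times> 'n \<times> bool) list => ('n \<times> 'n \<times> bool) list" where
 "word_star w = rev (map (%(i, j, s). (i, j, \<not> s)) w)"

abbreviation words :: "('n \<times> 'n \<times> bool) list monoid" where
 "words == \<lparr>carrier = UNIV, monoid.mult = (@), one = []\<rparr>"

interpretation W: inv_monoid "words" "word_star :: ('n \<times> 'n \<times> bool) list => _"
 by unfold_locales (auto simp: word_star_def rev_map comp_def case_prod_beta)

lemma free_star_alg_eq: "free_star_alg = W.X"
 by (simp add: free_star_alg_def word_star_def[abs_def])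

lemma free_subalg:
 fixes S :: "(('n \<times> 'n \<times> bool) list => complex) set"
 assumes S: "star_subalg free_star_alg S" and g: "!!i j. free_gen i j \<in> S"
 shows "carrier free_star_alg \<subseteq> S"
proof
 have SD: "\<one>\<^bsub>W.X\<^esub> \<in> S" "x \<in> S ==> y \<in> S ==> x \<oplus>\<^bsub>W.X\<^esub> y \<in> S" "x \<in> S ==> y \<in> S ==> x \<otimes>\<^bsub>W.X\<^esub> y \<in> S"
  "x \<in> S ==> star W.X x \<in> S" "x \<in> S ==> scale W.X c x \<in> S" for x y c
  using S unfolding free_star_alg_eq by (auto simp: star_subalg_def)
 have l: "single [(i, j, s)] \<in> S" for i j s
 proof (cases s)
  case True
  have "single [(i, j, s)] = star W.X (free_gen i j)"
   unfolding free_gen_def by (subst W.single_star) (auto simp: word_star_def True)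
  then show ?thesis using SD(4) g by simp
 qed (use g in \<open>simp add: free_gen_def\<close>)
 have w: "single w \<in> S" for w :: "('n \<times> 'n \<times> bool) list"
 proof (induction w)
  case Nil
  then show ?case using SD(1) by (simp add: W.one_X)
 next
  case (Cons a w)
  have "single (a # w) = single [a] \<otimes>\<^bsub>W.X\<^esub> single w" by (subst W.single_mult) auto
  then show ?case using Cons l SD(3) by (metis prod_cases3)
 qed
 fix x :: "('n \<times> 'n \<times> bool) list => complex" assume "x \<in> carrier free_star_alg"
 then show "x \<in> S"
  unfolding free_star_alg_eq
 proof (induction x rule: W.X_induct)
  case zero
  show ?case using SD(5)[OF SD(1), of 0] by simp
 qed (auto simp: SD w)
qed

text \<open>The generators have norm at most one in every C*-seminorm that kills the relations: in the
 completion, \<open>\<Sum>\<^sub>k u\<^sub>i\<^sub>k u\<^sub>i\<^sub>k* = 1\<close>.\<close>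

lemma univ_alg_Un_plus: "univ_alg free_star_alg (Un_plus_relations :: (('n::finite \<times> 'n \<times> bool) list => complex) set)"
proof -
 let ?R = "Un_plus_relations :: (('n \<times> 'n \<times> bool) list => complex) set"
 let ?X = "W.X :: (('n \<times> 'n \<times> bool) list => complex) star_alg"
 have gc: "free_gen i j \<in> carrier ?X" for i j unfolding free_gen_def by (rule W.single_closed) simp
 have gen: "p (free_gen i j) <= 1" if p: "cstar_seminorm ?X p" "\<forall>r\<in>?R. p r = 0" for p i j
 proof -
  interpret p: star_seminorm ?X p using W.star_algebra_X p(1) by (rule star_seminormI)
  interpret C: cstar_algebra p.C by (rule p.cstar_algebra_C)
  let ?j = "%x. cls ?X p (%k. x)"
  note jh = p.completion_hom note jD = cstar_homD[OF jh]
  have "mat_mult ?X free_gen (mat_adj ?X free_gen) i i \<ominus>\<^bsub>?X\<^esub> mat_one ?X i i \<in> ?R"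
   unfolding Un_plus_relations_def unitary_relations_def free_star_alg_eq by blast
  then have p0: "p ((\<Oplus>\<^bsub>?X\<^esub>k\<in>UNIV. free_gen i k \<otimes>\<^bsub>?X\<^esub> star ?X (free_gen i k)) \<ominus>\<^bsub>?X\<^esub> \<one>\<^bsub>?X\<^esub>) = 0"
   using p(2) by (simp add: mat_mult_def mat_adj_def mat_one_def)
  have fc: "(\<Oplus>\<^bsub>?X\<^esub>k\<in>UNIV. free_gen i k \<otimes>\<^bsub>?X\<^esub> star ?X (free_gen i k)) \<in> carrier ?X"
   by (rule W.X.finsum_closed) (auto simp: gc)
  have "?j (\<Oplus>\<^bsub>?X\<^esub>k\<in>UNIV. free_gen i k \<otimes>\<^bsub>?X\<^esub> star ?X (free_gen i k)) = ?j \<one>\<^bsub>?X\<^esub>"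
   by (rule p.cls_eqI) (use p0 fc in \<open>auto simp: p.cauchy_const\<close>)
  then have "(\<Oplus>\<^bsub>p.C\<^esub>k\<in>UNIV. ?j (free_gen i k \<otimes>\<^bsub>?X\<^esub> star ?X (free_gen i k))) = \<one>\<^bsub>p.C\<^esub>"
   using lin_finsum[OF W.star_algebra_X p.star_algebra_C lin_hom[OF jh], of UNIV "%k. free_gen i k \<otimes>\<^bsub>?X\<^esub> star ?X (free_gen i k)"]
   by (simp add: gc jD(4))
  \<comment> \<open>The relation has the adjoint on the right, so \<open>nrm_le_one_of_sum\<close>
    is applied to the adjoints of the generators.\<close>
  then have "(\<Oplus>\<^bsub>p.C\<^esub>k\<in>UNIV. star p.C (star p.C (?j (free_gen i k))) \<otimes>\<^bsub>p.C\<^esub> star p.C (?j (free_gen i k))) = \<one>\<^bsub>p.C\<^esub>"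
   using gc by (simp add: jD(1,3,6))
  then have "nrm p.C (star p.C (?j (free_gen i j))) <= 1"
   by (intro C.nrm_le_one_of_sum[of UNIV j "%k. star p.C (?j (free_gen i k))"]) (auto simp: jD(1) gc)
  then show ?thesis using gc by (simp add: jD(1) p.nrm_C_const)
 qed
 have "bounded_rel ?X ?R"
 proof (rule W.bounded_relI)
  fix w :: "('n \<times> 'n \<times> bool) list"
  have "p (single w) <= 1" if p: "cstar_seminorm ?X p" "\<forall>r\<in>?R. p r = 0" for p
  proof -
   interpret p: star_seminorm ?X p using W.star_algebra_X p(1) by (rule star_seminormI)
   have l: "p (single [(i, j, s)]) <= 1" for i j s
   proof (cases s)
    case True
    have "single [(i, j, s)] = star ?X (free_gen i j)"
     unfolding free_gen_def by (subst W.single_star) (auto simp: word_star_def True)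
    then show ?thesis using gen[OF p] gc by simp
   qed (use gen[OF p] in \<open>simp add: free_gen_def\<close>)
   show ?thesis
   proof (induction w)
    case Nil
    then show ?case using p.p_one_le by (simp add: W.one_X)
   next
    case (Cons a w)
    have "single (a # w) = single [a] \<otimes>\<^bsub>?X\<^esub> single w" by (subst W.single_mult) auto
    then have "p (single (a # w)) <= p (single [a]) * p (single w)"
     using p.p_mult[of "single [a]" "single w"] W.single_closed[of "[a]"] W.single_closed[of w] by simp
    also have "... <= 1 * 1"
     using l Cons W.single_closed[of w] by (intro mult_mono) (auto, metis prod_cases3)
    finally show ?case by simp
   qed
  qed
  then show "\<exists>K. \<forall>p. cstar_seminorm ?X p --> (\<forall>r\<in>?R. p r = 0) --> p (single w) <= K" by blast
 qed
 then show ?thesis unfolding free_star_alg_eq by (intro univ_alg.intro W.star_algebra_X univ_alg_axioms.intro)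
qed

lemma star_finsum:
 assumes A: "star_algebra A" and f: "!!k. k \<in> K ==> f k \<in> carrier A"
 shows "star A (\<Oplus>\<^bsub>A\<^esub>k\<in>K. f k) = (\<Oplus>\<^bsub>A\<^esub>k\<in>K. star A (f k))"
proof -
 interpret A: star_algebra A by fact
 show ?thesis
  using f
 proof (induction K rule: infinite_finite_induct)
  case (insert k K)
  then have "star A (\<Oplus>\<^bsub>A\<^esub>i\<in>insert k K. f i) = star A (f k \<oplus>\<^bsub>A\<^esub> (\<Oplus>\<^bsub>A\<^esub>i\<in>K. f i))"
   by (subst A.finsum_insert) auto
  also have "... = star A (f k) \<oplus>\<^bsub>A\<^esub> (\<Oplus>\<^bsub>A\<^esub>i\<in>K. star A (f i))"
   using insert by (subst A.star_add) (auto intro!: A.finsum_closed)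
  also have "... = (\<Oplus>\<^bsub>A\<^esub>i\<in>insert k K. star A (f i))"
   using insert by (subst A.finsum_insert) auto
  finally show ?case .
 qed auto
qed

lemma state_comp:
 assumes A: "star_algebra A" and f: "f \<in> cstar_hom A B" and s: "state B \<Phi>"
 shows "state A (%x. \<Phi> (f x))"
proof -
 interpret A: star_algebra A by fact
 show ?thesis using s unfolding state_def posfun_def by (auto simp: cstar_homD[OF f])
qed

lemma state_complex_id: "state complex_alg (%z. z)"
 by (auto simp: state_def posfun_def nn_simps)

lemma state_convex:
 assumes "state A \<phi>" "state A \<psi>" shows "state A (%x. (\<phi> x + \<psi> x) / 2)"
 using assms unfolding state_def posfun_def
 by (auto simp: nn_def add_divide_distrib algebra_simps)

text \<open>Serves to lift the projection of the coordinate algebra through the injection of the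
  group algebra into the diagonal quotient.\<close>

lemma inv_into_hom:
 assumes X: "star_algebra X" and Y: "star_algebra Y" and \<iota>: "\<iota> \<in> cstar_hom X B" and inj: "inj_on \<iota> (carrier X)"
  and f: "f \<in> cstar_hom Y B" and sub: "f ` carrier Y \<subseteq> \<iota> ` carrier X"
 shows "inv_into (carrier X) \<iota> \<circ> f \<in> cstar_hom Y X"
proof -
 interpret X: star_algebra X by fact
 interpret Y: star_algebra Y by fact
 let ?g = "inv_into (carrier X) \<iota>"
 note iD = cstar_homD[OF \<iota>] note fD = cstar_homD[OF f]
 have c: "?g (f y) \<in> carrier X" "\<iota> (?g (f y)) = f y" if "y \<in> carrier Y" for y
 proof -
  have "f y \<in> \<iota> ` carrier X" using sub that by blast
  then show "?g (f y) \<in> carrier X" "\<iota> (?g (f y)) = f y" by (rule inv_into_into, rule f_inv_into_f)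
 qed
 have u: "?g z = x" if "x \<in> carrier X" "\<iota> x = z" for x z
  using inv_into_f_f[OF inj that(1)] that(2) by simp
 show ?thesis
  by (rule cstar_homI) (auto simp: c intro!: u simp: iD fD)
qed

section \<open>The coordinate algebra of a closed subgroup\<close>

locale Un_plus_subgroup = closed_subgroup_Un_plus A \<Delta> \<theta>
 for A :: "'a cstar_alg" (structure) and \<Delta> :: "'a => (nat => ('a, 'a) tensor) set"
  and \<theta> :: "'n::finite Un_plus_elem => 'a"
begin

definition u :: "'n => 'n => 'a" where "u i j = \<theta> (Un_plus_gen i j)"

interpretation FU: univ_alg "free_star_alg :: (('n \<times> 'n \<times> bool) list => complex) star_alg" Un_plus_relations
 by (rule univ_alg_Un_plus)

abbreviation CU :: "'n Un_plus_elem cstar_alg" where "CU == C_Un_plus"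

lemma cstar_algebra_CU: "cstar_algebra CU"
 unfolding C_Un_plus_def by (rule FU.cstar_algebra_univ)

lemma A_cstar: "cstar_algebra A" by (rule cstar_algebra_axioms)

lemma theta_hom: "\<theta> \<in> cstar_hom CU A" and theta_surj: "\<theta> ` carrier CU = carrier A"
 using subgroup by (auto simp: closed_subgroup_def)

definition fr :: "(('n \<times> 'n \<times> bool) list => complex) => 'a" where
 "fr = \<theta> \<circ> univ_elem free_star_alg Un_plus_relations"

lemma fr_hom: "fr \<in> cstar_hom free_star_alg A"
 unfolding fr_def using cstar_hom_comp[OF FU.univ_elem_hom] theta_hom unfolding C_Un_plus_def by blast

lemma fr_gen: "fr (free_gen i j) = u i j"
 by (simp add: fr_def u_def Un_plus_gen_def)

lemma free_gen_closed: "free_gen i j \<in> carrier free_star_alg"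
 unfolding free_star_alg_eq free_gen_def by (rule W.single_closed) simp

lemma u_closed [simp]: "u i j \<in> carrier A"
 using cstar_homD(1)[OF fr_hom free_gen_closed] by (simp add: fr_gen)

lemma gen_closed: "Un_plus_gen i j \<in> carrier CU"
 using cstar_homD(1)[OF FU.univ_elem_hom free_gen_closed] by (simp add: C_Un_plus_def Un_plus_gen_def)

lemma fr_rel: assumes "r \<in> Un_plus_relations" "r \<in> carrier free_star_alg" shows "fr r = \<zero>"
proof -
 have "univ_elem free_star_alg Un_plus_relations r = univ_elem free_star_alg Un_plus_relations \<zero>\<^bsub>free_star_alg\<^esub>"
  by (rule FU.univ_elem_eq) (use assms FU.un_rel in \<open>auto simp: FU.minus_eq\<close>)
 then have "fr r = fr \<zero>\<^bsub>free_star_alg\<^esub>" by (simp add: fr_def)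
 then show ?thesis using cstar_hom_zero[OF FU.star_alg star_alg fr_hom] by simp
qed

lemma u_unitary:
 "(\<Oplus>m\<in>UNIV. u k m \<otimes> star A (u l m)) = (if k = l then \<one> else \<zero>)"
 "(\<Oplus>m\<in>UNIV. star A (u m k) \<otimes> u m l) = (if k = l then \<one> else \<zero>)"
proof -
 note hD = cstar_homD[OF fr_hom]
 have hm: "fr (x \<ominus>\<^bsub>free_star_alg\<^esub> y) = fr x \<ominus> fr y" if "x \<in> carrier free_star_alg" "y \<in> carrier free_star_alg" for x y
  by (rule cstar_hom_minus[OF FU.star_alg star_alg fr_hom that])
 have key: "(\<Oplus>m\<in>UNIV. fr (f m)) = (if k = l then \<one> else \<zero>)"
  if f: "!!m. f m \<in> carrier free_star_alg"
   and r: "(\<Oplus>\<^bsub>free_star_alg\<^esub>m\<in>UNIV. f m) \<ominus>\<^bsub>free_star_alg\<^esub> mat_one free_star_alg k l \<in> Un_plus_relations"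
  for f :: "'n => ('n \<times> 'n \<times> bool) list => complex"
 proof -
  have s: "(\<Oplus>\<^bsub>free_star_alg\<^esub>m\<in>UNIV. f m) \<in> carrier free_star_alg" by (rule FU.finsum_closed) (use f in auto)
  have o: "mat_one free_star_alg k l \<in> carrier (free_star_alg :: (('n \<times> 'n \<times> bool) list => complex) star_alg)"
   by (simp add: mat_one_def)
  have "fr (\<Oplus>\<^bsub>free_star_alg\<^esub>m\<in>UNIV. f m) \<ominus> fr (mat_one free_star_alg k l) = \<zero>"
   using fr_rel[OF r] s o by (simp add: hm)
  then have "fr (\<Oplus>\<^bsub>free_star_alg\<^esub>m\<in>UNIV. f m) = fr (mat_one free_star_alg k l)"
   using minus_eq_zero_iff hD(1)[OF s] hD(1)[OF o] by blast
  moreover have "fr (mat_one free_star_alg k l) = (if k = l then \<one> else \<zero>)"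
   using cstar_hom_zero[OF FU.star_alg star_alg fr_hom] by (simp add: mat_one_def hD(4))
  ultimately show ?thesis
   using lin_finsum[OF FU.star_alg star_alg lin_hom[OF fr_hom], of UNIV f] f by simp
 qed
 have "mat_mult free_star_alg free_gen (mat_adj free_star_alg free_gen) k l \<ominus>\<^bsub>free_star_alg\<^esub> mat_one free_star_alg k l \<in> Un_plus_relations"
  "mat_mult free_star_alg (mat_adj free_star_alg free_gen) free_gen k l \<ominus>\<^bsub>free_star_alg\<^esub> mat_one free_star_alg k l \<in> Un_plus_relations"
  unfolding Un_plus_relations_def unitary_relations_def by blast+
 from key[OF _ this(1)[unfolded mat_mult_def mat_adj_def]] key[OF _ this(2)[unfolded mat_mult_def mat_adj_def]]
 show "(\<Oplus>m\<in>UNIV. u k m \<otimes> star A (u l m)) = (if k = l then \<one> else \<zero>)"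
  "(\<Oplus>m\<in>UNIV. star A (u m k) \<otimes> u m l) = (if k = l then \<one> else \<zero>)"
  by (simp_all add: free_gen_closed hD(3,6) fr_gen)
qed

text \<open>The dense *-algebra of coordinates, written as in the fullness assumption so that the
  latter folds into it.\<close>

definition pol :: "'a set" where "pol = gen_star_subalg A {\<theta> (Un_plus_gen i j) | i j. True}"

lemma pol_facts: "star_subalg A pol" "u i j \<in> pol" "!!S. star_subalg A S ==> (!!i j. u i j \<in> S) ==> pol \<subseteq> S"
proof -
 have c: "{\<theta> (Un_plus_gen i j) | i j. True} \<subseteq> carrier A" using u_closed by (auto simp: u_def)
 show "star_subalg A pol" unfolding pol_def by (rule star_subalg_gen(1)[OF c])
 show "u i j \<in> pol" unfolding pol_def using star_subalg_gen(2)[OF c] by (auto simp: u_def)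
 show "pol \<subseteq> S" if "star_subalg A S" "!!i j. u i j \<in> S" for S
  unfolding pol_def by (rule star_subalg_gen(3)[OF c that(1)]) (use that(2) in \<open>auto simp: u_def\<close>)
qed

lemma pol_closed: "pol \<subseteq> carrier A" using pol_facts(1) by (simp add: star_subalg_def)

text \<open>\<open>\<theta>\<close> is onto and contractive, the free *-algebra is dense in
  \<open>C_Un_plus\<close>, and its image in \<open>A\<close> lies in \<open>pol\<close>.\<close>

lemma pol_dense: assumes x: "x \<in> carrier A" and e: "e > 0" shows "\<exists>y\<in>pol. nrm A (x \<ominus> y) < e"
proof -
 interpret CU: cstar_algebra CU by (rule cstar_algebra_CU)
 obtain c where c: "c \<in> carrier CU" "x = \<theta> c" using theta_surj x by auto
 obtain w where w: "w \<in> carrier free_star_alg"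
  "nrm CU (c \<ominus>\<^bsub>CU\<^esub> univ_elem free_star_alg Un_plus_relations w) < e"
  using FU.univ_dense c(1) e unfolding C_Un_plus_def by blast
 have uc: "univ_elem free_star_alg Un_plus_relations w \<in> carrier CU"
  using cstar_homD(1)[OF FU.univ_elem_hom w(1)] by (simp add: C_Un_plus_def)
 have "x \<ominus> fr w = \<theta> (c \<ominus>\<^bsub>CU\<^esub> univ_elem free_star_alg Un_plus_relations w)"
  using cstar_hom_minus[OF CU.star_alg star_alg theta_hom c(1) uc] c by (simp add: fr_def)
 then have "nrm A (x \<ominus> fr w) < e"
  using cstar_hom_contractive[OF cstar_algebra_CU A_cstar theta_hom CU.minus_closed[OF c(1) uc]] w(2) by simp
 moreover have "fr w \<in> pol"
 proof -
  have "carrier free_star_alg \<subseteq> {x \<in> carrier free_star_alg. fr x \<in> pol}"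
   by (rule free_subalg[OF vimage_subalg[OF FU.star_alg fr_hom pol_facts(1)]])
    (simp add: free_gen_closed fr_gen pol_facts(2))
  then show ?thesis using w(1) by blast
 qed
 ultimately show ?thesis by blast
qed

lemma eq_on_gens:
 assumes B: "cstar_algebra B" and f: "f \<in> cstar_hom A B" and g: "g \<in> cstar_hom A B"
  and eq: "!!i j. f (u i j) = g (u i j)" and x: "x \<in> carrier A"
 shows "f x = g x"
proof (rule cstar_hom_eqI[OF A_cstar B f g pol_dense pol_closed _ x])
 interpret B: cstar_algebra B by fact
 have "pol \<subseteq> {x \<in> carrier A. f x = g x}"
  by (rule pol_facts(3)[OF equalizer_subalg[OF star_alg B.star_alg f g]]) (simp add: eq)
 then show "f y = g y" if "y \<in> pol" for y using that by blast
qed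

lemma Delta_u: "\<Delta> (u i j) = (\<Oplus>\<^bsub>tensor_cstar A A\<^esub>k\<in>UNIV. tensor_elem A A (u i k) (u k j))"
proof -
 obtain DU where DU: "Un_plus_comult DU" "closed_subgroup CU DU A \<Delta> \<theta>" using subgroup by blast
 interpret TU: cstar_tensor CU CU by (rule cstar_tensor.intro[OF cstar_algebra_CU cstar_algebra_CU])
 interpret TA: cstar_tensor A A by (rule cstar_tensor.intro[OF A_cstar A_cstar])
 note th = tensor_map_hom[OF cstar_algebra_CU cstar_algebra_CU A_cstar A_cstar theta_hom theta_hom]
 have "\<Delta> (u i j) = tensor_map A A \<theta> \<theta> (DU (Un_plus_gen i j))"
  using DU(2) gen_closed by (simp add: closed_subgroup_def u_def)
 also have "DU (Un_plus_gen i j) = (\<Oplus>\<^bsub>TU.TC\<^esub>k\<in>UNIV. TU.te (Un_plus_gen i k) (Un_plus_gen k j))"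
  using DU(1) by (simp add: Un_plus_comult_def)
 also have "tensor_map A A \<theta> \<theta> ... = (\<Oplus>\<^bsub>TA.TC\<^esub>k\<in>UNIV. tensor_map A A \<theta> \<theta> (TU.te (Un_plus_gen i k) (Un_plus_gen k j)))"
  by (rule lin_finsum[OF TU.TC.star_alg TA.TC.star_alg lin_hom[OF th(1)]])
   (simp add: TU.te_closed gen_closed)
 also have "... = (\<Oplus>\<^bsub>TA.TC\<^esub>k\<in>UNIV. TA.te (u i k) (u k j))"
  by (simp add: th(2) gen_closed u_def)
 finally show ?thesis .
qed

end

section \<open>The diagonal quotient and the group of its diagonal entries\<close>

locale diagonal = Un_plus_subgroup A \<Delta> \<theta>
 for A :: "'a cstar_alg" (structure) and \<Delta> :: "'a => (nat => ('a, 'a) tensor) set" and \<theta> :: "'n::finite Un_plus_elem => 'a" +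
 fixes U :: "complex ^ 'n ^ 'n"
 assumes U: "U \<in> unitary_group"
begin

abbreviation v :: "'n => 'n => 'a" where "v == v_gen A \<theta> U"
abbreviation J :: "'a set" where "J == diag_ideal A \<theta> U"
abbreviation D :: "'a set cstar_alg" where "D == diag_quotient A \<theta> U"
abbreviation q :: "'a => 'a set" where "q == diag_proj A \<theta> U"
abbreviation \<Gamma> :: "'a set monoid" where "\<Gamma> == Gamma A \<theta> U"

lemma v_eq: "v = rotated A u U"
 by (simp add: v_gen_def u_def[abs_def])

lemma v_closed [simp]: "v i j \<in> carrier A"
 unfolding v_eq by (rule rotated_closed) simp

lemma J_facts: "cstar_algebra.closed_ideal A J" "i ~= j ==> v i j \<in> J"
  "!!K. cstar_algebra.closed_ideal A K ==> (!!i j. i ~= j ==> v i j \<in> K) ==> J \<subseteq> K"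
proof -
 have c: "{v i j | i j. i ~= j} \<subseteq> carrier A" by auto
 note f = closed_star_ideal_facts[OF c, folded diag_ideal_def]
 show "closed_ideal J" by (rule f(1))
 show "i ~= j ==> v i j \<in> J" using f(2) by blast
 show "J \<subseteq> K" if "closed_ideal K" "!!i j. i ~= j ==> v i j \<in> K" for K
  by (rule f(3)[OF that(1)]) (use that(2) in auto)
qed

sublocale QJ: cstar_quotient A J
 by (intro cstar_quotient.intro A_cstar cstar_quotient_axioms.intro J_facts(1))

lemma D_eq: "D = QJ.Q" by (simp add: diag_quotient_def)

lemma q_eq: "q = (%x. J +> x)" by (rule ext) (simp add: diag_proj_def)

lemma D_cstar: "cstar_algebra D" unfolding D_eq by (rule QJ.cstar_algebra_Q)

sublocale D: cstar_algebra D by (rule D_cstar)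

lemma q_hom: "q \<in> cstar_hom A D"
 using QJ.proj_hom unfolding q_eq D_eq .

lemma q_surj: "q ` carrier A = carrier D"
 using QJ.carrier_Q by (simp add: q_eq D_eq)

lemma q_closed [simp]: "x \<in> carrier A ==> q x \<in> carrier D"
 by (rule cstar_homD(1)[OF q_hom])

lemma factor:
 assumes B: "cstar_algebra B" and f: "f \<in> cstar_hom A B" and z: "!!i j. i ~= j ==> f (v i j) = \<zero>\<^bsub>B\<^esub>"
 shows "\<exists>F\<in>cstar_hom D B. \<forall>x\<in>carrier A. F (q x) = f x"
proof -
 interpret B: cstar_algebra B by fact
 have "J \<subseteq> {x \<in> carrier A. f x = \<zero>\<^bsub>B\<^esub>}"
  by (rule J_facts(3)[OF kernel_closed_ideal[OF A_cstar B f]]) (simp add: z)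
 then show ?thesis
  using QJ.factor_hom[OF f _ B.star_alg] unfolding D_eq q_eq by blast
qed

text \<open>If \<open>f\<close> carries u to U* diag(d) U, rotation by \<open>U\<close> leaves
  diag(d). The off-diagonal entries die, which is the condition for factoring through
  \<open>D\<close>.\<close>

lemma hom_v:
 assumes B: "cstar_algebra B" and f: "f \<in> cstar_hom A B" and fu: "!!k l. f (u k l) = dform B U d k l"
  and d: "!!i. d i \<in> carrier B"
 shows "f (v i j) = (if i = j then d i else \<zero>\<^bsub>B\<^esub>)"
proof -
 interpret B: cstar_algebra B by fact
 have "f (v i j) = rotated B (%k l. f (u k l)) U i j"
  unfolding v_eq by (rule rotated_hom[OF star_alg B.star_alg lin_hom[OF f]]) simp
 then show ?thesis
  using B.rotated_dform[OF U d] by (simp add: fu)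
qed

definition g :: "'n => 'a set" where "g i = q (v i i)"

lemma g_closed [simp]: "g i \<in> carrier D" by (simp add: g_def)

lemma q_zero: "x \<in> J ==> q x = \<zero>\<^bsub>D\<^esub>"
 unfolding q_eq D_eq QJ.zero_Q using QJ.ID(2)[of x] by (simp add: QJ.coset_eq_iff minus_eq)

lemma q_u: "q (u k l) = dform D U g k l"
proof (rule D.dform_rotated[OF U])
 show "rotated D (%k l. q (u k l)) U i j = (if i = j then g i else \<zero>\<^bsub>D\<^esub>)" for i j
 proof -
  have "rotated D (%k l. q (u k l)) U i j = q (v i j)"
   unfolding v_eq by (rule rotated_hom[OF star_alg D.star_alg lin_hom[OF q_hom], symmetric]) simp
  then show ?thesis using q_zero J_facts(2) by (auto simp: g_def)
 qed
qed simp

lemma dform_star: "star D (dform D U d l m) = dform D U (%i. star D (d i)) m l" if "!!i. d i \<in> carrier D"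
 unfolding dform_def using that by (simp add: star_finsum[OF D.star_alg] D.star_scale mult.commute)

text \<open>The image of u in \<open>D\<close> is U* diag(g) U, so unitarity of u says that
  conjugating diag(g g* ) by \<open>U\<close> gives the identity matrix, and likewise in the other
  order; \<open>un\<close> compares diagonals after rotating back.\<close>

lemma g_unitary: "star D (g i) \<otimes>\<^bsub>D\<^esub> g i = \<one>\<^bsub>D\<^esub>" "g i \<otimes>\<^bsub>D\<^esub> star D (g i) = \<one>\<^bsub>D\<^esub>"
proof -
 have one: "dform D U (%i. \<one>\<^bsub>D\<^esub>) k l = (if k = l then \<one>\<^bsub>D\<^esub> else \<zero>\<^bsub>D\<^esub>)" for k l
  unfolding dform_def by (subst D.finsum_sum_scale) (auto simp: unitary_sums[OF U])
 have un: "d i = \<one>\<^bsub>D\<^esub>" if d: "!!i. d i \<in> carrier D" and e: "!!k l. dform D U d k l = (if k = l then \<one>\<^bsub>D\<^esub> else \<zero>\<^bsub>D\<^esub>)" for d i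
 proof -
  have "dform D U d = dform D U (%i. \<one>\<^bsub>D\<^esub>)" by (intro ext) (simp add: e one)
  then show ?thesis
   using D.rotated_dform[OF U, of d i i] D.rotated_dform[OF U, of "%_. \<one>\<^bsub>D\<^esub>" i i] d by simp
 qed
 have \<beta>: "lin D D (%a. a \<otimes>\<^bsub>D\<^esub> b)" "lin D D (%a. b \<otimes>\<^bsub>D\<^esub> a)" if "b \<in> carrier D" for b
  using that by (simp_all add: lin_def D.l_distr D.r_distr D.scale_mult_left D.scale_mult_right)
 note prod = dform_product[OF D.star_alg D.star_alg D.star_alg U _ _ \<beta>]
 have ql: "lin A D q" by (rule lin_hom[OF q_hom])
 note qD = cstar_homD[OF q_hom]
 have q0: "q \<zero> = \<zero>\<^bsub>D\<^esub>" by (rule cstar_hom_zero[OF star_alg D.star_alg q_hom])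
 have "dform D U (%i. g i \<otimes>\<^bsub>D\<^esub> star D (g i)) k l = (if k = l then \<one>\<^bsub>D\<^esub> else \<zero>\<^bsub>D\<^esub>)" for k l
 proof -
  have "dform D U (%i. g i \<otimes>\<^bsub>D\<^esub> star D (g i)) k l =
    (\<Oplus>\<^bsub>D\<^esub>m\<in>UNIV. dform D U g k m \<otimes>\<^bsub>D\<^esub> dform D U (%i. star D (g i)) m l)"
   by (rule prod[symmetric]) auto
  also have "... = (\<Oplus>\<^bsub>D\<^esub>m\<in>UNIV. q (u k m \<otimes> star A (u l m)))"
   by (simp add: q_u[symmetric] dform_star[symmetric] qD(3,6))
  also have "... = q (\<Oplus>m\<in>UNIV. u k m \<otimes> star A (u l m))"
   by (rule lin_finsum[OF star_alg D.star_alg ql, symmetric]) simp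
  finally show ?thesis by (simp add: u_unitary qD(4) q0)
 qed
 then show "g i \<otimes>\<^bsub>D\<^esub> star D (g i) = \<one>\<^bsub>D\<^esub>" by (rule un[rotated]) simp
 have "dform D U (%i. star D (g i) \<otimes>\<^bsub>D\<^esub> g i) k l = (if k = l then \<one>\<^bsub>D\<^esub> else \<zero>\<^bsub>D\<^esub>)" for k l
 proof -
  have "dform D U (%i. star D (g i) \<otimes>\<^bsub>D\<^esub> g i) k l =
    (\<Oplus>\<^bsub>D\<^esub>m\<in>UNIV. dform D U (%i. star D (g i)) k m \<otimes>\<^bsub>D\<^esub> dform D U g m l)"
   by (rule prod[symmetric]) auto
  also have "... = (\<Oplus>\<^bsub>D\<^esub>m\<in>UNIV. q (star A (u m k) \<otimes> u m l))"
   by (simp add: q_u[symmetric] dform_star[symmetric] qD(3,6))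
  also have "... = q (\<Oplus>m\<in>UNIV. star A (u m k) \<otimes> u m l)"
   by (rule lin_finsum[OF star_alg D.star_alg ql, symmetric]) simp
  finally show ?thesis by (simp add: u_unitary qD(4) q0)
 qed
 then show "star D (g i) \<otimes>\<^bsub>D\<^esub> g i = \<one>\<^bsub>D\<^esub>" by (rule un[rotated]) simp
qed

lemma g_unit: "g i \<in> Units D"
 unfolding Units_def using g_unitary g_closed by (auto intro!: bexI[of _ "star D (g i)"])

lemma units_group: "group (units_of D)" by (rule D.units_group)

lemma carrier_Gamma: "carrier \<Gamma> = generate (units_of D) (range g)"
 by (simp add: Gamma_def g_def[abs_def])

lemma Gamma_ops: "x \<otimes>\<^bsub>\<Gamma>\<^esub> y = x \<otimes>\<^bsub>D\<^esub> y" "\<one>\<^bsub>\<Gamma>\<^esub> = \<one>\<^bsub>D\<^esub>"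
 by (simp_all add: Gamma_def units_of_def)

lemma Gamma_group: "group \<Gamma>"
proof -
 have "subgroup (generate (units_of D) (range g)) (units_of D)"
  by (rule group.generate_is_subgroup[OF units_group]) (use g_unit in \<open>auto simp: units_of_def\<close>)
 from subgroup.subgroup_is_group[OF this units_group] show ?thesis
  unfolding Gamma_def g_def[abs_def] .
qed

sublocale G: group_dual \<Gamma> by (intro group_dual.intro Gamma_group)

lemma inv_g: "inv\<^bsub>units_of D\<^esub> g i = star D (g i)"
proof -
 interpret UG: group "units_of D" by (rule units_group)
 have "star D (g i) \<in> Units D"
  unfolding Units_def using g_unitary g_closed by (auto intro!: bexI[of _ "g i"])
 then show ?thesis
  by (intro UG.inv_equality) (use g_unitary g_unit in \<open>auto simp: units_of_def\<close>)
qed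

lemma Gamma_induct [consumes 1, case_names one gen inv mult]:
 assumes "\<gamma> \<in> carrier \<Gamma>" "P \<one>\<^bsub>D\<^esub>" "!!i. P (g i)" "!!i. P (star D (g i))"
  "!!x y. x \<in> carrier \<Gamma> ==> y \<in> carrier \<Gamma> ==> P x ==> P y ==> P (x \<otimes>\<^bsub>D\<^esub> y)"
 shows "P \<gamma>"
 using assms(1) unfolding carrier_Gamma
proof (induction rule: generate.induct)
 case (eng h1 h2)
 then show ?case using assms(5) by (simp add: carrier_Gamma units_of_def)
qed (use assms(2-4) in \<open>auto simp: inv_g units_of_one\<close>)

lemma g_Gamma [simp]: "g i \<in> carrier \<Gamma>"
 unfolding carrier_Gamma by (rule generate.incl) simp

lemma Gamma_closed: "\<gamma> \<in> carrier \<Gamma> ==> \<gamma> \<in> carrier D"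
 by (induction \<gamma> rule: Gamma_induct) auto

lemma Gamma_unitary: "\<gamma> \<in> carrier \<Gamma> ==> star D \<gamma> \<otimes>\<^bsub>D\<^esub> \<gamma> = \<one>\<^bsub>D\<^esub> & \<gamma> \<otimes>\<^bsub>D\<^esub> star D \<gamma> = \<one>\<^bsub>D\<^esub>"
proof (induction \<gamma> rule: Gamma_induct)
 case (mult x y)
 note c = Gamma_closed[OF mult(1)] Gamma_closed[OF mult(2)]
 have "star D y \<otimes>\<^bsub>D\<^esub> (star D x \<otimes>\<^bsub>D\<^esub> x) \<otimes>\<^bsub>D\<^esub> y = \<one>\<^bsub>D\<^esub>" "x \<otimes>\<^bsub>D\<^esub> (y \<otimes>\<^bsub>D\<^esub> star D y) \<otimes>\<^bsub>D\<^esub> star D x = \<one>\<^bsub>D\<^esub>"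
  using mult c by simp_all
 then show ?case using c by (simp add: D.star_mult D.m_assoc)
qed (simp_all add: g_unitary)

lemma Gamma_inv: assumes "\<gamma> \<in> carrier \<Gamma>" shows "inv\<^bsub>\<Gamma>\<^esub> \<gamma> = star D \<gamma>"
proof -
 have "inv\<^bsub>\<Gamma>\<^esub> \<gamma> \<otimes>\<^bsub>D\<^esub> \<gamma> = \<one>\<^bsub>D\<^esub>" using G.l_inv[OF assms] by (simp add: Gamma_ops)
 then have "inv\<^bsub>\<Gamma>\<^esub> \<gamma> \<otimes>\<^bsub>D\<^esub> (\<gamma> \<otimes>\<^bsub>D\<^esub> star D \<gamma>) = star D \<gamma>"
  using Gamma_closed[OF assms] Gamma_closed[OF G.inv_closed[OF assms]] by (simp flip: D.m_assoc)
 then show ?thesis using Gamma_unitary[OF assms] Gamma_closed[OF G.inv_closed[OF assms]] by simp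
qed

lemma hom_eq_on_D:
 assumes B: "cstar_algebra B" and f: "f \<in> cstar_hom D B" and h: "h \<in> cstar_hom D B"
  and eq: "!!i. f (g i) = h (g i)" and x: "x \<in> carrier D"
 shows "f x = h x"
proof -
 interpret B: cstar_algebra B by fact
 obtain a where a: "a \<in> carrier A" "x = q a" using x q_surj by blast
 have "(f \<circ> q) a = (h \<circ> q) a"
 proof (rule eq_on_gens[OF B cstar_hom_comp[OF q_hom f] cstar_hom_comp[OF q_hom h] _ a(1)])
  show "(f \<circ> q) (u i j) = (h \<circ> q) (u i j)" for i j
   using dform_hom[OF D.star_alg B.star_alg lin_hom[OF f], of g]
    dform_hom[OF D.star_alg B.star_alg lin_hom[OF h], of g] by (simp add: q_u eq)
 qed
 then show ?thesis using a by simp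
qed

text \<open>\<open>T\<close> need not be linear, only multiplicative on \<open>\<Gamma>\<close>;
  thus it may be the squaring map from \<open>\<gamma>\<close> to the tensor of
  \<open>\<gamma>\<close> with itself.\<close>

lemma hom_on_Gamma:
 assumes F: "F \<in> cstar_hom D B" and gen: "!!i. F (g i) = T (g i)" and one: "T \<one>\<^bsub>D\<^esub> = \<one>\<^bsub>B\<^esub>"
  and mult: "!!x y. x \<in> carrier \<Gamma> ==> y \<in> carrier \<Gamma> ==> T (x \<otimes>\<^bsub>D\<^esub> y) = T x \<otimes>\<^bsub>B\<^esub> T y"
  and st: "!!x. x \<in> carrier \<Gamma> ==> T (star D x) = star B (T x)"
  and \<gamma>: "\<gamma> \<in> carrier \<Gamma>"
 shows "F \<gamma> = T \<gamma>"
 using \<gamma> by (induction \<gamma> rule: Gamma_induct)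
  (simp_all add: cstar_homD(3,4,6)[OF F] Gamma_closed one gen mult st)

text \<open>The counit sends u to the identity matrix, which conjugation by \<open>U\<close> does
  not change, so it descends to \<open>D\<close> and sends every g i to 1. It shows that
  \<open>D\<close> is nonzero and is the partner for averaging in
  \<open>state_contracts\<close>.\<close>

lemma counit_state: "\<exists>\<phi>. state D \<phi> & (\<forall>\<gamma>\<in>carrier \<Gamma>. \<phi> \<gamma> = 1)"
proof -
 obtain \<epsilon> where e: "\<epsilon> \<in> cstar_hom A complex_alg" "!!i j. \<epsilon> (u i j) = (if i = j then 1 else 0)"
  using counit by (auto simp: u_def)
 interpret CX: cstar_algebra complex_alg by (rule cstar_algebra_complex)
 have sumc: "(\<Oplus>\<^bsub>complex_alg\<^esub>k\<in>K. f k) = (\<Sum>k\<in>K. f k)" for f :: "'n => complex" and K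
  by (induction K rule: infinite_finite_induct) (simp_all add: CX.finsum_insert)
 have "\<epsilon> (u k l) = dform complex_alg U (%_. 1) k l" for k l
  unfolding dform_def sumc e(2) by (simp add: unitary_sums[OF U])
 then have ev: "\<epsilon> (v i j) = (if i = j then 1 else 0)" for i j
  using hom_v[OF cstar_algebra_complex e(1), of "%_. 1"] by simp
 obtain F where F: "F \<in> cstar_hom D complex_alg" "\<forall>x\<in>carrier A. F (q x) = \<epsilon> x"
  using factor[OF cstar_algebra_complex e(1)] ev by auto
 have "F \<gamma> = 1" if "\<gamma> \<in> carrier \<Gamma>" for \<gamma>
  by (rule hom_on_Gamma[OF F(1), of "%_. 1"]) (use F(2) ev that in \<open>auto simp: g_def\<close>)
 then show ?thesis
  using state_comp[OF D.star_alg F(1) state_complex_id] by blast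
qed

lemma D_nrm_one: "nrm D \<one>\<^bsub>D\<^esub> = 1"
proof -
 obtain \<phi> where "state D \<phi>" using counit_state by blast
 then have "1 <= nrm D \<one>\<^bsub>D\<^esub>" using D.state_bound[of \<phi> "\<one>\<^bsub>D\<^esub>"] by (simp add: state_def)
 then show ?thesis using D.nm.p_one_cases by auto
qed

section \<open>Multiplication of states on the diagonal quotient\<close>

sublocale TD: cstar_tensor D D by (intro cstar_tensor.intro D_cstar)

text \<open>By \<open>dform_product\<close> the comultiplication of u becomes diagonal with entries
  \<open>TD.te (g i) (g i)\<close> after passing to \<open>D\<close> on both legs; it therefore
  factors through \<open>D\<close> with group-like generators.\<close>

lemma comult_D: "\<exists>F\<in>cstar_hom D TD.TC. \<forall>\<gamma>\<in>carrier \<Gamma>. F \<gamma> = TD.te \<gamma> \<gamma>"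
proof -
 note th = tensor_map_hom[OF A_cstar A_cstar D_cstar D_cstar q_hom q_hom]
 interpret TA: cstar_tensor A A by (intro cstar_tensor.intro A_cstar)
 define f where "f = tensor_map D D q q \<circ> \<Delta>"
 have f: "f \<in> cstar_hom A TD.TC" unfolding f_def by (rule cstar_hom_comp[OF comult th(1)])
 have \<beta>: "lin D TD.TC (%a. TD.te a b)" "lin D TD.TC (%a. TD.te b a)" if "b \<in> carrier D" for b
  using that by (simp_all add: lin_def TD.te_closed TD.te_add_left TD.te_add_right TD.te_scale_left TD.te_scale_right)
 have fu: "f (u k l) = dform TD.TC U (%i. TD.te (g i) (g i)) k l" for k l
 proof -
  have "f (u k l) = (\<Oplus>\<^bsub>TD.TC\<^esub>m\<in>UNIV. tensor_map D D q q (TA.te (u k m) (u m l)))"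
   unfolding f_def comp_def Delta_u
   by (rule lin_finsum[OF TA.TC.star_alg TD.TC.star_alg lin_hom[OF th(1)]]) (simp add: TA.te_closed)
  also have "... = (\<Oplus>\<^bsub>TD.TC\<^esub>m\<in>UNIV. TD.te (dform D U g k m) (dform D U g m l))"
   by (simp add: th(2) q_u)
  also have "... = dform TD.TC U (%i. TD.te (g i) (g i)) k l"
   by (rule dform_product[OF D.star_alg D.star_alg TD.TC.star_alg U]) (auto simp: \<beta>)
  finally show ?thesis .
 qed
 have fv: "f (v i j) = (if i = j then TD.te (g i) (g i) else \<zero>\<^bsub>TD.TC\<^esub>)" for i j
  by (rule hom_v[OF TD.cstar_algebra_TC f fu]) (simp add: TD.te_closed)
 obtain F where F: "F \<in> cstar_hom D TD.TC" "\<forall>x\<in>carrier A. F (q x) = f x"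
  using factor[OF TD.cstar_algebra_TC f] fv by auto
 have "F \<gamma> = TD.te \<gamma> \<gamma>" if "\<gamma> \<in> carrier \<Gamma>" for \<gamma>
  by (rule hom_on_Gamma[OF F(1), of "%\<gamma>. TD.te \<gamma> \<gamma>"])
   (use F(2) fv that in \<open>auto simp: g_def TD.te_one TD.te_mult TD.te_star Gamma_closed\<close>)
 then show ?thesis using F(1) by blast
qed

lemma state_mult:
 assumes \<phi>: "state D \<phi>" and \<psi>: "state D \<psi>"
 shows "\<exists>\<omega>. state D \<omega> & (\<forall>\<gamma>\<in>carrier \<Gamma>. \<omega> \<gamma> = \<phi> \<gamma> * \<psi> \<gamma>)"
proof -
 obtain F where F: "F \<in> cstar_hom D TD.TC" "\<forall>\<gamma>\<in>carrier \<Gamma>. F \<gamma> = TD.te \<gamma> \<gamma>" using comult_D by blast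
 obtain \<Phi> where P: "state TD.TC \<Phi>" "\<forall>a\<in>carrier D. \<forall>b\<in>carrier D. \<Phi> (TD.te a b) = \<phi> a * \<psi> b"
  using TD.product_state[OF \<phi> \<psi>] by blast
 show ?thesis
 proof (intro exI conjI ballI)
  show "state D (%x. \<Phi> (F x))" by (rule state_comp[OF D.star_alg F(1) P(1)])
  show "\<Phi> (F \<gamma>) = \<phi> \<gamma> * \<psi> \<gamma>" if "\<gamma> \<in> carrier \<Gamma>" for \<gamma>
   using bspec[OF F(2) that] bspec[OF bspec[OF P(2) Gamma_closed[OF that]] Gamma_closed[OF that]] by simp
 qed
qed

lemma state_le_one: assumes "state D \<phi>" "\<gamma> \<in> carrier \<Gamma>" shows "cmod (\<phi> \<gamma>) <= 1"
proof -
 have "nrm D \<gamma> <= 1"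
  by (rule D.nm.p_isometry_le[OF Gamma_closed[OF assms(2)]]) (use Gamma_unitary[OF assms(2)] in blast)
 then show ?thesis using D.state_bound[OF assms(1) Gamma_closed[OF assms(2)]] by linarith
qed

text \<open>Take a state attaining the norm of x = 1 - \<open>\<gamma>\<close> on x* x. That value
  is 2 - 2 Re (\<open>\<phi>\<close> \<open>\<gamma>\<close>), so it could not be nonzero if
  \<open>\<phi> \<gamma>\<close> were 1.\<close>

lemma state_separates:
 assumes \<gamma>: "\<gamma> \<in> carrier \<Gamma>" "\<gamma> ~= \<one>\<^bsub>D\<^esub>"
 shows "\<exists>\<phi>. state D \<phi> & \<phi> \<gamma> ~= 1"
proof -
 note c = Gamma_closed[OF \<gamma>(1)]
 define x where "x = \<one>\<^bsub>D\<^esub> \<ominus>\<^bsub>D\<^esub> \<gamma>"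
 have x: "x \<in> carrier D" "nrm D x ~= 0"
  using c \<gamma>(2) D.nrm_definite[of x] by (auto simp: x_def D.minus_eq_zero_iff)
 obtain \<phi> where s: "state D \<phi>" "\<phi> (star D x \<otimes>\<^bsub>D\<^esub> x) = of_real ((nrm D x)^2)"
  using D.state_ex[OF x(1) D_nrm_one] by blast
 interpret P: positive_functional D \<phi> by unfold_locales (use s in \<open>simp add: state_def\<close>)
 have p1: "\<phi> \<one>\<^bsub>D\<^esub> = 1" using s by (simp add: state_def)
 have "star D x \<otimes>\<^bsub>D\<^esub> x = (\<one>\<^bsub>D\<^esub> \<ominus>\<^bsub>D\<^esub> star D \<gamma>) \<ominus>\<^bsub>D\<^esub> (\<gamma> \<ominus>\<^bsub>D\<^esub> \<one>\<^bsub>D\<^esub>)"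
  using c Gamma_unitary[OF \<gamma>(1)] by (simp add: x_def D.star_minus D.l_distr_minus D.r_distr_minus)
 moreover have "\<phi> (star D \<gamma>) = cnj (\<phi> \<gamma>)" using P.phi_hermitian[of \<gamma> "\<one>\<^bsub>D\<^esub>"] c by simp
 ultimately have e: "\<phi> (star D x \<otimes>\<^bsub>D\<^esub> x) = (1 - cnj (\<phi> \<gamma>)) - (\<phi> \<gamma> - 1)"
  using c by (simp add: P.phi_minus p1)
 have "\<phi> \<gamma> ~= 1"
 proof
  assume "\<phi> \<gamma> = 1"
  then have "complex_of_real ((nrm D x)^2) = 0" using e s(2) by simp
  then show False using x(2) by simp
 qed
 then show ?thesis using s by blast
qed

text \<open>A state different from 1 at \<open>\<gamma>\<close> may still have modulus one there.
  Averaging with the counit state cures this, because the midpoint of 1 and another point of the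
  closed unit disc lies in the open disc. Multiplying by the earlier state keeps the elements
  already treated.\<close>

lemma state_contracts:
 assumes "finite S" "S \<subseteq> carrier \<Gamma> - {\<one>\<^bsub>D\<^esub>}"
 shows "\<exists>\<phi>. state D \<phi> & (\<forall>\<gamma>\<in>S. cmod (\<phi> \<gamma>) < 1)"
 using assms
proof (induction S rule: finite_induct)
 case empty
 then show ?case using counit_state by auto
next
 case (insert \<gamma> S)
 then obtain \<phi> where p: "state D \<phi>" "\<forall>\<gamma>\<in>S. cmod (\<phi> \<gamma>) < 1" by auto
 obtain \<psi> where s: "state D \<psi>" "\<psi> \<gamma> ~= 1" using state_separates[of \<gamma>] insert by auto
 obtain \<epsilon> where e: "state D \<epsilon>" "\<forall>\<gamma>\<in>carrier \<Gamma>. \<epsilon> \<gamma> = 1" using counit_state by blast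
 define \<omega> where "\<omega> = (%x. (\<epsilon> x + \<psi> x) / 2)"
 have w: "state D \<omega>" unfolding \<omega>_def by (rule state_convex[OF e(1) s(1)])
 have gc: "\<gamma> \<in> carrier \<Gamma>" using insert by auto
 have "cmod (\<omega> \<gamma>) < 1"
 proof -
  have p1: "cmod (\<psi> \<gamma>) <= 1" by (rule state_le_one[OF s(1) gc])
  then have r1: "Re (\<psi> \<gamma>) <= 1" using complex_Re_le_cmod order.trans by blast
  have sq: "(cmod (\<psi> \<gamma>))^2 <= 1" using p1 by (simp add: power_le_one)
  have "Re (\<psi> \<gamma>) < 1"
  proof (rule ccontr)
   assume "\<not> Re (\<psi> \<gamma>) < 1"
   then have "Re (\<psi> \<gamma>) = 1" using r1 by simp
   then have "\<psi> \<gamma> = 1" using sq by (simp add: cmod_power2 complex_eq_iff)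
   then show False using s by simp
  qed
  then have "(cmod (1 + \<psi> \<gamma>))^2 < 2^2"
  proof -
   have "(cmod (1 + \<psi> \<gamma>))^2 = 1 + 2 * Re (\<psi> \<gamma>) + (cmod (\<psi> \<gamma>))^2"
    unfolding cmod_power2 by (simp add: power2_eq_square algebra_simps)
   then show ?thesis using sq \<open>Re (\<psi> \<gamma>) < 1\<close> by simp
  qed
  then have "cmod (1 + \<psi> \<gamma>) < 2" by (rule power2_less_imp_less) simp
  then show ?thesis using e gc by (simp add: \<omega>_def norm_divide)
 qed
 moreover obtain \<rho> where r: "state D \<rho>" "\<forall>\<gamma>\<in>carrier \<Gamma>. \<rho> \<gamma> = \<phi> \<gamma> * \<omega> \<gamma>" using state_mult[OF p(1) w] by blast
 have "cmod (\<rho> \<eta>) < 1" if eta: "\<eta> \<in> insert \<gamma> S" for \<eta>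
 proof -
  have ec: "\<eta> \<in> carrier \<Gamma>" using insert eta by auto
  have "cmod (\<phi> \<eta>) <= 1" "cmod (\<omega> \<eta>) <= 1" using state_le_one[OF p(1) ec] state_le_one[OF w ec] by auto
  moreover have "cmod (\<phi> \<eta>) < 1 \<or> cmod (\<omega> \<eta>) < 1" using eta p(2) \<open>cmod (\<omega> \<gamma>) < 1\<close> by auto
  ultimately have "cmod (\<phi> \<eta>) * cmod (\<omega> \<eta>) < 1"
   using mult_left_le[of "cmod (\<omega> \<eta>)" "cmod (\<phi> \<eta>)"] mult_left_le_one_le[of "cmod (\<omega> \<eta>)" "cmod (\<phi> \<eta>)"] by fastforce
  then show ?thesis using r(2) ec by (simp add: norm_mult)
 qed
 then show ?case using r(1) by blast
qed

lemma state_power: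
 assumes \<phi>: "state D \<phi>"
 shows "\<exists>\<omega>. state D \<omega> & (\<forall>\<gamma>\<in>carrier \<Gamma>. \<omega> \<gamma> = \<phi> \<gamma> ^ Suc m)"
proof (induction m)
 case (Suc m)
 then obtain \<omega> where w: "state D \<omega>" "\<forall>\<gamma>\<in>carrier \<Gamma>. \<omega> \<gamma> = \<phi> \<gamma> ^ Suc m" by blast
 obtain \<rho> where "state D \<rho>" "\<forall>\<gamma>\<in>carrier \<Gamma>. \<rho> \<gamma> = \<phi> \<gamma> * \<omega> \<gamma>" using state_mult[OF \<phi> w(1)] by blast
 then show ?case using w(2) by auto
qed (use \<phi> in auto)

section \<open>Linear independence and the identification with the group C*-algebra\<close>

abbreviation CG where "CG == group_alg \<Gamma>"

definition \<iota> :: "('a set => complex) => 'a set" where "\<iota> = G.ga.lift D (%\<gamma>. \<gamma>)"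

lemma iota_hom: "\<iota> \<in> cstar_hom CG D" and iota_single: "\<gamma> \<in> carrier \<Gamma> ==> \<iota> (single \<gamma>) = \<gamma>"
proof -
 note l = G.ga.lift_hom[where \<pi> = "%\<gamma>. \<gamma>", OF D.star_alg]
 show "\<iota> \<in> cstar_hom CG D" unfolding \<iota>_def G.group_alg_eq
  by (rule l(1)) (auto simp: Gamma_closed Gamma_ops Gamma_inv)
 show "\<gamma> \<in> carrier \<Gamma> ==> \<iota> (single \<gamma>) = \<gamma>" unfolding \<iota>_def
  by (rule l(2)) (auto simp: Gamma_closed Gamma_ops Gamma_inv)
qed

text \<open>Linear independence of \<open>\<Gamma>\<close>: the powers of a state that is strictly contractive on the finitely
 many \<open>\<gamma>\<^sub>0* \<gamma> \<noteq> 1\<close> isolate the coefficient of \<open>\<gamma>\<^sub>0\<close>.\<close>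

lemma iota_zero:
 assumes f: "f \<in> carrier CG" and z: "\<iota> f = \<zero>\<^bsub>D\<^esub>"
 shows "f = \<zero>\<^bsub>CG\<^esub>"
proof -
 have fX: "f \<in> carrier G.ga.X" using f by (simp add: G.group_alg_eq)
 then have fin: "finite {\<gamma>. f \<gamma> ~= 0}" "{\<gamma>. f \<gamma> ~= 0} \<subseteq> carrier \<Gamma>" by (auto simp: G.ga.carrier_X)
 have lin: "\<phi> (x \<otimes>\<^bsub>D\<^esub> \<iota> f) = G.ga.lsum f (%\<gamma>. \<phi> (x \<otimes>\<^bsub>D\<^esub> \<gamma>))" if s: "state D \<phi>" and x: "x \<in> carrier D" for \<phi> x
  using fX
 proof (induction f rule: G.ga.X_induct)
  case zero
  interpret P: positive_functional D \<phi> by unfold_locales (use s in \<open>simp add: state_def\<close>)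
  have "\<iota> \<zero>\<^bsub>G.ga.X\<^esub> = \<zero>\<^bsub>D\<^esub>"
   using cstar_hom_zero[OF G.ga.star_algebra_X D.star_alg] iota_hom by (simp add: G.group_alg_eq)
  then show ?case using x by (simp add: P.phi_zero G.ga.lsum_zero)
 next
  case (add f \<gamma> c)
  interpret P: positive_functional D \<phi> by unfold_locales (use s in \<open>simp add: state_def\<close>)
  note iD = cstar_homD[OF iota_hom[unfolded G.group_alg_eq]]
  have "\<iota> (f \<oplus>\<^bsub>G.ga.X\<^esub> scale G.ga.X c (single \<gamma>)) = \<iota> f \<oplus>\<^bsub>D\<^esub> scale D c \<gamma>"
   using add by (simp add: iD G.ga.single_closed iota_single)
  then show ?case
   using add x Gamma_closed[OF add(2)] iD(1)[OF add(1)]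
   by (simp add: D.r_distr D.scale_mult_right P.phi_add P.phi_scale G.ga.lsum_add G.ga.lsum_scale G.ga.single_closed G.ga.lsum_single)
 qed
 have "f \<gamma>0 = 0" for \<gamma>0
 proof (rule ccontr)
  assume nz: "f \<gamma>0 ~= 0"
  then have g0: "\<gamma>0 \<in> carrier \<Gamma>" using fin by auto
  \<comment> \<open>Translation by the adjoint of \<open>\<gamma>0\<close> moves
    \<open>\<gamma>0\<close> to the unit, where every power of every state is 1.\<close>
  define \<eta> where "\<eta> \<gamma> = star D \<gamma>0 \<otimes>\<^bsub>D\<^esub> \<gamma>" for \<gamma>
  have ec: "\<eta> \<gamma> \<in> carrier \<Gamma>" if "\<gamma> \<in> carrier \<Gamma>" for \<gamma>
   using G.m_closed[OF G.inv_closed[OF g0] that] by (simp add: \<eta>_def Gamma_inv[OF g0] Gamma_ops)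
  have e1: "\<eta> \<gamma> ~= \<one>\<^bsub>D\<^esub>" if "\<gamma> \<in> carrier \<Gamma>" "\<gamma> ~= \<gamma>0" for \<gamma>
  proof
   assume "\<eta> \<gamma> = \<one>\<^bsub>D\<^esub>"
   then have "inv\<^bsub>\<Gamma>\<^esub> \<gamma>0 \<otimes>\<^bsub>\<Gamma>\<^esub> \<gamma> = \<one>\<^bsub>\<Gamma>\<^esub>" by (simp add: \<eta>_def Gamma_inv[OF g0] Gamma_ops)
   then show False using that g0 by (metis G.inv_closed G.inv_equality G.inv_inv G.inv_solve_left G.r_one G.one_closed)
  qed
  have e0: "\<eta> \<gamma>0 = \<one>\<^bsub>D\<^esub>" using Gamma_unitary[OF g0] by (simp add: \<eta>_def)
  obtain \<phi> where p: "state D \<phi>" "\<forall>\<gamma>\<in>\<eta> ` ({\<gamma>. f \<gamma> ~= 0} - {\<gamma>0}). cmod (\<phi> \<gamma>) < 1"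
  proof -
   have "\<eta> ` ({\<gamma>. f \<gamma> ~= 0} - {\<gamma>0}) \<subseteq> carrier \<Gamma> - {\<one>\<^bsub>D\<^esub>}" using fin(2) ec e1 by blast
   from state_contracts[OF _ this] fin(1) that show ?thesis by blast
  qed
  \<comment> \<open>The sum is the value of a power state at the adjoint of \<open>\<gamma>0\<close>
    times \<open>\<iota> f\<close>, and \<open>\<iota> f\<close> is 0.\<close>
  have zero: "(\<Sum>\<gamma>\<in>{\<gamma>. f \<gamma> ~= 0}. f \<gamma> * \<phi> (\<eta> \<gamma>) ^ Suc m) = 0" for m
  proof -
   obtain \<omega> where w: "state D \<omega>" "\<forall>\<gamma>\<in>carrier \<Gamma>. \<omega> \<gamma> = \<phi> \<gamma> ^ Suc m" using state_power[OF p(1)] by blast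
   interpret P: positive_functional D \<omega> by unfold_locales (use w in \<open>simp add: state_def\<close>)
   have "(\<Sum>\<gamma>\<in>{\<gamma>. f \<gamma> ~= 0}. f \<gamma> * \<phi> (\<eta> \<gamma>) ^ Suc m) = G.ga.lsum f (%\<gamma>. \<omega> (star D \<gamma>0 \<otimes>\<^bsub>D\<^esub> \<gamma>))"
    unfolding G.ga.lsum_def by (intro sum.cong refl) (use w(2) ec fin in \<open>auto simp: \<eta>_def\<close>)
   also have "... = \<omega> (star D \<gamma>0 \<otimes>\<^bsub>D\<^esub> \<iota> f)" using lin[OF w(1)] Gamma_closed[OF g0] by simp
   also have "... = 0" using z Gamma_closed[OF g0] by (simp add: P.phi_zero)
   finally show ?thesis .
  qed
  have "(%m. \<Sum>\<gamma>\<in>{\<gamma>. f \<gamma> ~= 0}. f \<gamma> * \<phi> (\<eta> \<gamma>) ^ Suc m) \<longlonglongrightarrow> (\<Sum>\<gamma>\<in>{\<gamma>. f \<gamma> ~= 0}. if \<gamma> = \<gamma>0 then f \<gamma> else 0)"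
  proof (rule tendsto_sum)
   fix \<gamma> assume g: "\<gamma> \<in> {\<gamma>. f \<gamma> ~= 0}"
   show "(%m. f \<gamma> * \<phi> (\<eta> \<gamma>) ^ Suc m) \<longlonglongrightarrow> (if \<gamma> = \<gamma>0 then f \<gamma> else 0)"
   proof (cases "\<gamma> = \<gamma>0")
    case True
    then show ?thesis using e0 p(1) by (simp add: state_def)
   next
    case False
    then have "cmod (\<phi> (\<eta> \<gamma>)) < 1" using p(2) g by auto
    then have "(%m. \<phi> (\<eta> \<gamma>) ^ Suc m) \<longlonglongrightarrow> 0" by (intro LIMSEQ_Suc LIMSEQ_power_zero)
    then have "(%m. f \<gamma> * \<phi> (\<eta> \<gamma>) ^ Suc m) \<longlonglongrightarrow> f \<gamma> * 0" by (rule tendsto_mult_left)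
    then show ?thesis using False by simp
   qed
  qed
  then have "(\<Sum>\<gamma>\<in>{\<gamma>. f \<gamma> ~= 0}. if \<gamma> = \<gamma>0 then f \<gamma> else 0) = 0"
   unfolding zero by (simp add: LIMSEQ_const_iff)
  then show False using fin nz by (simp add: sum.delta)
 qed
 then show ?thesis by (auto simp: G.group_alg_eq G.ga.zero_X)
qed

lemma iota_inj: "inj_on \<iota> (carrier CG)"
proof (rule inj_onI)
 fix x y assume xy: "x \<in> carrier CG" "y \<in> carrier CG" "\<iota> x = \<iota> y"
 have "\<iota> (x \<ominus>\<^bsub>CG\<^esub> y) = \<zero>\<^bsub>D\<^esub>"
  using cstar_hom_minus[OF G.U.star_alg D.star_alg iota_hom xy(1,2)] xy cstar_homD(1)[OF iota_hom] by simp
 then have "x \<ominus>\<^bsub>CG\<^esub> y = \<zero>\<^bsub>CG\<^esub>" using iota_zero xy by simp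
 then show "x = y" using G.U.minus_eq_zero_iff xy by blast
qed

text \<open>The projection of the coordinate algebra has image in that of \<open>\<iota>\<close>; as
  \<open>\<iota>\<close> is injective, it lifts to the group algebra and on to the group C*-algebra.
  Fullness makes the lift contractive, so it extends to \<open>A\<close>, and it kills the
  off-diagonal entries, so it factors through \<open>D\<close>.\<close>

lemma Gamma_identification_ex: "\<exists>\<kappa>. Gamma_identification A \<theta> U \<kappa>"
proof -
 let ?C = "group_cstar \<Gamma>" and ?P = "A\<lparr>carrier := pol\<rparr>"
 interpret C: cstar_algebra ?C by (rule G.cstar_algebra_group)
 have P: "star_algebra ?P" by (rule star_algebra_sub[OF pol_facts(1)])
 have incl: "(%x. x) \<in> cstar_hom ?P A" by (rule cstar_homI) (use pol_closed in auto)
 have qP: "q \<in> cstar_hom ?P D" using cstar_hom_comp[OF incl q_hom] by (simp add: comp_def)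
 have du: "q (u k l) = \<iota> (dform CG U (%i. single (g i)) k l)" for k l
  unfolding q_u using dform_hom[OF G.U.star_alg D.star_alg lin_hom[OF iota_hom], of "%i. single (g i)"]
   G.ga.single_closed by (simp add: iota_single G.group_alg_eq)
 have dc: "dform CG U (%i. single (g i)) k l \<in> carrier CG" for k l
  by (rule G.U.dform_closed) (simp add: G.group_alg_eq G.ga.single_closed)
 have "pol \<subseteq> {x \<in> carrier A. q x \<in> \<iota> ` carrier CG}"
  by (rule pol_facts(3)[OF vimage_subalg[OF star_alg q_hom image_subalg[OF G.U.star_alg iota_hom]]])
   (use du dc in auto)
 then have sub: "q ` carrier ?P \<subseteq> \<iota> ` carrier CG" by auto
 define f0 where "f0 = inv_into (carrier CG) \<iota> \<circ> q"
 have f0: "f0 \<in> cstar_hom ?P CG"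
  unfolding f0_def by (rule inv_into_hom[OF G.U.star_alg P iota_hom iota_inj qP sub])
 define f where "f = univ_elem CG {} \<circ> f0"
 have f: "f \<in> cstar_hom ?P ?C" unfolding f_def group_cstar_def by (rule cstar_hom_comp[OF f0 G.U.univ_elem_hom])
 \<comment> \<open>Fullness enters here: the norm of the group C*-algebra pulled back along
   \<open>f\<close> is a C*-seminorm on the coordinate algebra, hence below the norm of
   \<open>A\<close>.\<close>
 have le: "nrm ?C (f x) <= nrm A x" if "x \<in> carrier ?P" for x
  by (rule full[folded pol_def, OF seminorm_pullback[OF P f C.nrm_cstar]]) (use that in simp)
 have dense: "\<exists>x\<in>carrier ?P. nrm A (a \<ominus> x) < e" if "a \<in> carrier A" "e > 0" for a e
  using pol_dense[OF that] by simp
 obtain \<pi> where pi: "\<pi> \<in> cstar_hom A ?C" "\<forall>x\<in>carrier ?P. \<pi> x = f x"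
  using hom_extension[OF P A_cstar G.cstar_algebra_group incl f le dense] by blast
 have pu: "\<pi> (u k l) = dform ?C U (%i. group_elem \<Gamma> (g i)) k l" for k l
 proof -
  have "\<pi> (u k l) = univ_elem CG {} (f0 (u k l))" using pi(2) pol_facts(2) by (simp add: f_def)
  also have "f0 (u k l) = dform CG U (%i. single (g i)) k l"
   unfolding f0_def comp_def du by (rule inv_into_f_f[OF iota_inj dc])
  also have "univ_elem CG {} ... = dform ?C U (%i. group_elem \<Gamma> (g i)) k l"
   unfolding group_cstar_def group_elem_def
   using dform_hom[OF G.U.star_alg C.star_alg[unfolded group_cstar_def] lin_hom[OF G.U.univ_elem_hom], of "%i. single (g i)"]
    G.ga.single_closed by (simp add: G.group_alg_eq)
  finally show ?thesis .
 qed
 have pv: "\<pi> (v i j) = (if i = j then group_elem \<Gamma> (g i) else \<zero>\<^bsub>?C\<^esub>)" for i j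
  by (rule hom_v[OF G.cstar_algebra_group pi(1) pu]) (simp add: G.group_elem_closed)
 obtain \<kappa> where k: "\<kappa> \<in> cstar_hom D ?C" "\<forall>x\<in>carrier A. \<kappa> (q x) = \<pi> x"
  using factor[OF G.cstar_algebra_group pi(1)] pv by auto
 have kg: "\<kappa> \<gamma> = group_elem \<Gamma> \<gamma>" if "\<gamma> \<in> carrier \<Gamma>" for \<gamma>
 proof (rule hom_on_Gamma[OF k(1) _ _ _ _ that])
  show "\<kappa> (g i) = group_elem \<Gamma> (g i)" for i using k(2) pv by (simp add: g_def)
  show "group_elem \<Gamma> \<one>\<^bsub>D\<^esub> = \<one>\<^bsub>?C\<^esub>" using G.group_elem_one by (simp add: Gamma_ops)
  show "group_elem \<Gamma> (x \<otimes>\<^bsub>D\<^esub> y) = group_elem \<Gamma> x \<otimes>\<^bsub>?C\<^esub> group_elem \<Gamma> y" if "x \<in> carrier \<Gamma>" "y \<in> carrier \<Gamma>" for x y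
   using G.group_elem_mult[OF that] by (simp add: Gamma_ops)
  show "group_elem \<Gamma> (star D x) = star ?C (group_elem \<Gamma> x)" if "x \<in> carrier \<Gamma>" for x
   using G.group_elem_inv[OF that] by (simp add: Gamma_inv[OF that])
 qed
 \<comment> \<open>The inverse comes from the universal property of the group C*-algebra; both
   composites fix the generators.\<close>
 obtain \<sigma> where s: "\<sigma> \<in> cstar_hom ?C D" "\<forall>\<gamma>\<in>carrier \<Gamma>. \<sigma> (group_elem \<Gamma> \<gamma>) = \<gamma>"
  using G.group_cstar_hom[OF D_cstar, of "%\<gamma>. \<gamma>"] by (auto simp: Gamma_closed Gamma_ops Gamma_inv)
 have idC: "(%x. x) \<in> cstar_hom ?C ?C" "(%x. x) \<in> cstar_hom D D" by (rule cstar_homI; simp)+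
 have ks: "\<kappa> (\<sigma> x) = x" if "x \<in> carrier ?C" for x
  using G.group_cstar_hom_eq[OF G.cstar_algebra_group cstar_hom_comp[OF s(1) k(1)] idC(1) _ that] s(2) kg by simp
 have sk: "\<sigma> (\<kappa> x) = x" if "x \<in> carrier D" for x
  using hom_eq_on_D[OF D_cstar cstar_hom_comp[OF k(1) s(1)] idC(2) _ that] s(2) kg by simp
 have "bij_betw \<kappa> (carrier D) (carrier ?C)"
  by (rule bij_betw_byWitness[of _ \<sigma>]) (use ks sk cstar_homD(1)[OF s(1)] cstar_homD(1)[OF k(1)] in auto)
 then show ?thesis using k(1) kg by (auto simp: Gamma_identification_def cstar_iso_def)
qed

end

section \<open>Group C*-algebras and quotient groups\<close>

context group_dual
begin

lemma group_lims_ex: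
 assumes x: "x \<in> carrier (group_cstar \<Lambda>)"
 shows "\<exists>X. (\<forall>k. X k \<in> carrier ga.X) &
  star_seminorm.lims (group_cstar \<Lambda>) (nrm (group_cstar \<Lambda>)) (%k. univ_elem (group_alg \<Lambda>) {} (X k)) x"
proof -
 let ?C = "group_cstar \<Lambda>" and ?e = "univ_elem (group_alg \<Lambda>) {}"
 interpret C: cstar_algebra ?C by (rule cstar_algebra_group)
 have cl: "?e f \<in> carrier ?C" if "f \<in> carrier ga.X" for f
  using cstar_homD(1)[OF U.univ_elem_hom, of f] that by (simp add: group_alg_eq group_cstar_def)
 have "\<exists>f\<in>carrier ga.X. nrm ?C (x \<ominus>\<^bsub>?C\<^esub> ?e f) < inverse (Suc k)" for k
  using U.univ_dense[OF x[unfolded group_cstar_def], of "inverse (Suc k)"]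
  by (simp add: group_alg_eq group_cstar_def)
 then obtain X where X: "!!k. X k \<in> carrier ga.X" "!!k. nrm ?C (x \<ominus>\<^bsub>?C\<^esub> ?e (X k)) < inverse (Suc k)" by metis
 have "(%k. nrm ?C (?e (X k) \<ominus>\<^bsub>?C\<^esub> x)) \<longlonglongrightarrow> 0"
 proof (rule tendsto_sandwich[OF _ _ tendsto_const LIMSEQ_inverse_real_of_nat])
  show "\<forall>\<^sub>F k in sequentially. 0 <= nrm ?C (?e (X k) \<ominus>\<^bsub>?C\<^esub> x)"
   using C.nm.p_nonneg C.minus_closed[OF cl[OF X(1)] x] by simp
  have "nrm ?C (?e (X k) \<ominus>\<^bsub>?C\<^esub> x) <= inverse (real (Suc k))" for k
   using C.nm.p_minus_commute[OF cl[OF X(1)] x] X(2)[of k] by simp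
  then show "\<forall>\<^sub>F k in sequentially. nrm ?C (?e (X k) \<ominus>\<^bsub>?C\<^esub> x) <= inverse (real (Suc k))" by simp
 qed
 then have "C.nm.lims (%k. ?e (X k)) x" using X(1) x cl by (simp add: C.nm.lims_def)
 then show ?thesis using X(1) by blast
qed

lemma group_alg_elem_simps:
 "univ_elem (group_alg \<Lambda>) {} \<zero>\<^bsub>ga.X\<^esub> = \<zero>\<^bsub>group_cstar \<Lambda>\<^esub>"
 "f \<in> carrier ga.X ==> g \<in> carrier \<Lambda> ==> univ_elem (group_alg \<Lambda>) {} (f \<oplus>\<^bsub>ga.X\<^esub> scale ga.X c (single g)) =
   univ_elem (group_alg \<Lambda>) {} f \<oplus>\<^bsub>group_cstar \<Lambda>\<^esub> scale (group_cstar \<Lambda>) c (group_elem \<Lambda> g)"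
 "f \<in> carrier ga.X ==> univ_elem (group_alg \<Lambda>) {} f \<in> carrier (group_cstar \<Lambda>)"
proof -
 interpret C: cstar_algebra "group_cstar \<Lambda>" by (rule cstar_algebra_group)
 have h: "univ_elem (group_alg \<Lambda>) {} \<in> cstar_hom ga.X (group_cstar \<Lambda>)"
  using U.univ_elem_hom by (simp add: group_alg_eq group_cstar_def)
 note hD = cstar_homD[OF h]
 show "univ_elem (group_alg \<Lambda>) {} \<zero>\<^bsub>ga.X\<^esub> = \<zero>\<^bsub>group_cstar \<Lambda>\<^esub>"
  by (rule cstar_hom_zero[OF ga.star_algebra_X C.star_alg h])
 show "f \<in> carrier ga.X ==> univ_elem (group_alg \<Lambda>) {} f \<in> carrier (group_cstar \<Lambda>)" by (rule hD(1))
 show "univ_elem (group_alg \<Lambda>) {} (f \<oplus>\<^bsub>ga.X\<^esub> scale ga.X c (single g)) =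
   univ_elem (group_alg \<Lambda>) {} f \<oplus>\<^bsub>group_cstar \<Lambda>\<^esub> scale (group_cstar \<Lambda>) c (group_elem \<Lambda> g)"
  if "f \<in> carrier ga.X" "g \<in> carrier \<Lambda>"
  using that hD(2)[of f "scale ga.X c (single g)"] hD(5)[of "single g" c] ga.single_closed
  by (simp add: ga.X.scale_closed group_elem_def)
qed

lemma group_elem_inj: "inj_on (group_elem \<Lambda>) (carrier \<Lambda>)"
proof (rule inj_onI)
 fix g h assume gh: "g \<in> carrier \<Lambda>" "h \<in> carrier \<Lambda>" "group_elem \<Lambda> g = group_elem \<Lambda> h"
 obtain \<tau> where t: "\<forall>g\<in>carrier \<Lambda>. \<tau> (group_elem \<Lambda> g) = (if g = \<one> then 1 else (0::complex))" using trace_ex by blast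
 have "group_elem \<Lambda> (inv g \<otimes> h) = group_elem \<Lambda> (inv g) \<otimes>\<^bsub>group_cstar \<Lambda>\<^esub> group_elem \<Lambda> h"
  by (rule group_elem_mult) (use gh in auto)
 also have "... = group_elem \<Lambda> (inv g \<otimes> g)"
  unfolding gh(3)[symmetric] by (rule group_elem_mult[symmetric]) (use gh in auto)
 finally have "group_elem \<Lambda> (inv g \<otimes> h) = group_elem \<Lambda> \<one>" using gh by simp
 then have "\<tau> (group_elem \<Lambda> (inv g \<otimes> h)) = \<tau> (group_elem \<Lambda> \<one>)" by (rule arg_cong)
 then have "inv g \<otimes> h = \<one>" using t gh by (auto split: if_splits)
 then have "inv h = inv g" using gh by (intro inv_equality) auto
 then have "inv (inv h) = inv (inv g)" by (rule arg_cong)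
 then show "g = h" using gh by simp
qed

text \<open>Commuting with \<open>x\<close> is a linear and closed condition. It is used twice, with
  \<open>x\<close> a group element and then with \<open>x\<close> arbitrary.\<close>

lemma commute_all:
 assumes x: "x \<in> carrier (group_cstar \<Lambda>)"
  and c: "!!g. g \<in> carrier \<Lambda> ==> x \<otimes>\<^bsub>group_cstar \<Lambda>\<^esub> group_elem \<Lambda> g = group_elem \<Lambda> g \<otimes>\<^bsub>group_cstar \<Lambda>\<^esub> x"
  and y: "y \<in> carrier (group_cstar \<Lambda>)"
 shows "x \<otimes>\<^bsub>group_cstar \<Lambda>\<^esub> y = y \<otimes>\<^bsub>group_cstar \<Lambda>\<^esub> x"
proof -
 let ?C = "group_cstar \<Lambda>" and ?e = "univ_elem (group_alg \<Lambda>) {}"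
 interpret C: cstar_algebra ?C by (rule cstar_algebra_group)
 have e: "x \<otimes>\<^bsub>?C\<^esub> ?e f = ?e f \<otimes>\<^bsub>?C\<^esub> x" if "f \<in> carrier ga.X" for f
  using that
 proof (induction f rule: ga.X_induct)
  case zero
  then show ?case using x by (simp add: group_alg_elem_simps)
 next
  case (add f g a)
  then show ?case
   using x c[OF add(2)] group_elem_closed[OF add(2)] group_alg_elem_simps(3)[OF add(1)]
   by (simp add: group_alg_elem_simps(2) C.l_distr C.r_distr C.scale_mult_left C.scale_mult_right)
 qed
 obtain Y where Y: "!!k. Y k \<in> carrier ga.X" "C.nm.lims (%k. ?e (Y k)) y" using group_lims_ex[OF y] by blast
 have 1: "C.nm.lims (%k. x \<otimes>\<^bsub>?C\<^esub> ?e (Y k)) (x \<otimes>\<^bsub>?C\<^esub> y)" by (rule C.nm.lims_mult[OF C.nm.lims_const[OF x] Y(2)])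
 have 2: "C.nm.lims (%k. ?e (Y k) \<otimes>\<^bsub>?C\<^esub> x) (y \<otimes>\<^bsub>?C\<^esub> x)" by (rule C.nm.lims_mult[OF Y(2) C.nm.lims_const[OF x]])
 show ?thesis by (rule C.lims_unique[OF 1]) (use 2 in \<open>simp only: e[OF Y(1)]\<close>)
qed

lemma commutative_group_cstar_iff: "commutative_alg (group_cstar \<Lambda>) \<longleftrightarrow> comm_group \<Lambda>"
proof
 assume c: "commutative_alg (group_cstar \<Lambda>)"
 show "comm_group \<Lambda>"
 proof (rule group_comm_groupI)
  fix x y assume xy: "x \<in> carrier \<Lambda>" "y \<in> carrier \<Lambda>"
  then have "group_elem \<Lambda> (x \<otimes> y) = group_elem \<Lambda> (y \<otimes> x)"
   using c group_elem_closed by (simp add: group_elem_mult commutative_alg_def)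
  then show "x \<otimes> y = y \<otimes> x" using inj_onD[OF group_elem_inj] xy by simp
 qed
next
 assume "comm_group \<Lambda>"
 then interpret L: comm_group \<Lambda> .
 have 1: "group_elem \<Lambda> g \<otimes>\<^bsub>group_cstar \<Lambda>\<^esub> x = x \<otimes>\<^bsub>group_cstar \<Lambda>\<^esub> group_elem \<Lambda> g"
  if "g \<in> carrier \<Lambda>" "x \<in> carrier (group_cstar \<Lambda>)" for g x
  by (rule commute_all[OF group_elem_closed[OF that(1)] _ that(2)])
   (use that in \<open>simp add: group_elem_mult[symmetric] L.m_comm\<close>)
 show "commutative_alg (group_cstar \<Lambda>)"
  unfolding commutative_alg_def using commute_all 1 by simp
qed

lemma group_comult_ex: "\<exists>\<Delta>. group_comult \<Lambda> \<Delta>"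
proof -
 interpret T: cstar_tensor "group_cstar \<Lambda>" "group_cstar \<Lambda>" by (intro cstar_tensor.intro cstar_algebra_group)
 have "\<exists>F\<in>cstar_hom (group_cstar \<Lambda>) T.TC. \<forall>g\<in>carrier \<Lambda>. F (group_elem \<Lambda> g) = T.te (group_elem \<Lambda> g) (group_elem \<Lambda> g)"
  by (rule group_cstar_hom[OF T.cstar_algebra_TC])
   (simp_all add: T.te_closed group_elem_closed T.te_mult group_elem_mult T.te_star group_elem_inv T.te_one group_elem_one)
 then show ?thesis unfolding group_comult_def by blast
qed

end

text \<open>Instead of closedness of the range: the target maps to the quotient of the source by the
  kernel, sending h to the class of any preimage, and following this by the map that
  \<open>f\<close> induces on the quotient gives the identity.\<close>

lemma group_cstar_map_surj:
 assumes G: "group_dual G" and H: "group_dual H" and p: "p \<in> epi G H"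
 shows "group_cstar_map H p ` carrier (group_cstar G) = carrier (group_cstar H)"
proof -
 interpret G: group_dual G by fact
 interpret H: group_dual H by fact
 have ph: "p \<in> hom G H" and ps: "p ` carrier G = carrier H" using p by (auto simp: epi_def)
 interpret gh: group_hom G H p by (intro group_hom.intro G.group_axioms H.group_axioms group_hom_axioms.intro ph)
 interpret A: cstar_algebra "group_cstar G" by (rule G.cstar_algebra_group)
 interpret B: cstar_algebra "group_cstar H" by (rule H.cstar_algebra_group)
 define f where "f = group_cstar_map H p"
 have f: "f \<in> cstar_hom (group_cstar G) (group_cstar H)" "f (group_elem G a) = group_elem H (p a)" if "a \<in> carrier G" for a
  using group_cstar_map_hom[OF G H ph] that by (auto simp: f_def)
 note fh = f(1)[OF G.one_closed]
 define I where "I = {x \<in> carrier (group_cstar G). f x = \<zero>\<^bsub>group_cstar H\<^esub>}"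
 interpret Q: cstar_quotient "group_cstar G" I
  by (intro cstar_quotient.intro G.cstar_algebra_group cstar_quotient_axioms.intro)
   (simp add: I_def kernel_closed_ideal[OF G.cstar_algebra_group H.cstar_algebra_group fh])
 define \<pi> where "\<pi> h = I +>\<^bsub>group_cstar G\<^esub> group_elem G (inv_into (carrier G) p h)" for h
 have \<pi>: "\<pi> (p a) = I +>\<^bsub>group_cstar G\<^esub> group_elem G a" if a: "a \<in> carrier G" for a
 proof -
  let ?b = "inv_into (carrier G) p (p a)"
  have b: "?b \<in> carrier G" "p ?b = p a" using a by (auto intro: inv_into_into f_inv_into_f)
  have "f (group_elem G ?b \<ominus>\<^bsub>group_cstar G\<^esub> group_elem G a) = \<zero>\<^bsub>group_cstar H\<^esub>"
   using cstar_hom_minus[OF A.star_alg B.star_alg fh G.group_elem_closed[OF b(1)] G.group_elem_closed[OF a]]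
    f(2)[OF b(1)] f(2)[OF a] b(2) H.group_elem_closed[of "p a"] a by (simp add: B.minus_eq B.r_neg)
  then have "group_elem G ?b \<ominus>\<^bsub>group_cstar G\<^esub> group_elem G a \<in> I"
   unfolding I_def using A.minus_closed[OF G.group_elem_closed[OF b(1)] G.group_elem_closed[OF a]] by simp
  then show ?thesis
   unfolding \<pi>_def using Q.coset_eq_iff[OF G.group_elem_closed[OF b(1)] G.group_elem_closed[OF a]] by (rule iffD2[rotated])
 qed
 note cD = cstar_homD[OF Q.proj_hom]
 have "\<exists>F\<in>cstar_hom (group_cstar H) Q.Q. \<forall>h\<in>carrier H. F (group_elem H h) = \<pi> h"
 proof (rule H.group_cstar_hom[OF Q.cstar_algebra_Q])
  show "\<pi> h \<in> carrier Q.Q" if h: "h \<in> carrier H" for h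
  proof -
   obtain a where a: "a \<in> carrier G" "h = p a" using h ps by (metis imageE)
   show ?thesis unfolding a(2) \<pi>[OF a(1)] by (rule cD(1)[OF G.group_elem_closed[OF a(1)]])
  qed
  show "\<pi> \<one>\<^bsub>H\<^esub> = \<one>\<^bsub>Q.Q\<^esub>"
   using \<pi>[OF G.one_closed] unfolding gh.hom_one G.group_elem_one cD(4) .
  show "\<pi> (h \<otimes>\<^bsub>H\<^esub> k) = \<pi> h \<otimes>\<^bsub>Q.Q\<^esub> \<pi> k" if hk: "h \<in> carrier H" "k \<in> carrier H" for h k
  proof -
   obtain a b where ab: "a \<in> carrier G" "h = p a" "b \<in> carrier G" "k = p b" using hk ps by (metis imageE)
   have "\<pi> (h \<otimes>\<^bsub>H\<^esub> k) = \<pi> (p (a \<otimes>\<^bsub>G\<^esub> b))" using ab by simp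
   also have "... = \<pi> h \<otimes>\<^bsub>Q.Q\<^esub> \<pi> k"
    using ab by (simp only: \<pi> G.m_closed G.group_elem_mult cD(3)[OF G.group_elem_closed G.group_elem_closed])
   finally show ?thesis .
  qed
  show "\<pi> (inv\<^bsub>H\<^esub> h) = star Q.Q (\<pi> h)" if h: "h \<in> carrier H" for h
  proof -
   obtain a where a: "a \<in> carrier G" "h = p a" using h ps by (metis imageE)
   have "\<pi> (inv\<^bsub>H\<^esub> h) = \<pi> (p (inv\<^bsub>G\<^esub> a))" using a by simp
   also have "... = star Q.Q (\<pi> h)"
    using a by (simp only: \<pi> G.inv_closed G.group_elem_inv cD(6)[OF G.group_elem_closed])
   finally show ?thesis .
  qed
 qed
 then obtain F where F: "F \<in> cstar_hom (group_cstar H) Q.Q" and F': "\<forall>h\<in>carrier H. F (group_elem H h) = \<pi> h" ..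
 have ker: "f x = \<zero>\<^bsub>group_cstar H\<^esub>" if "x \<in> I" for x
  using that unfolding I_def mem_Collect_eq by (rule conjunct2)
 have "\<exists>k\<in>cstar_hom Q.Q (group_cstar H). \<forall>x\<in>carrier (group_cstar G). k (I +>\<^bsub>group_cstar G\<^esub> x) = f x"
  by (rule Q.factor_hom[OF fh ker B.star_alg])
 then obtain k where k: "k \<in> cstar_hom Q.Q (group_cstar H)"
  and k': "\<forall>x\<in>carrier (group_cstar G). k (I +>\<^bsub>group_cstar G\<^esub> x) = f x" ..
 have idH: "(%x. x) \<in> cstar_hom (group_cstar H) (group_cstar H)" by (rule cstar_homI) auto
 have kF: "(k \<circ> F) x = x" if "x \<in> carrier (group_cstar H)" for x
 proof (rule H.group_cstar_hom_eq[OF H.cstar_algebra_group cstar_hom_comp[OF F k] idH _ that])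
  show "(k \<circ> F) (group_elem H h) = group_elem H h" if h: "h \<in> carrier H" for h
  proof -
   obtain a where "a \<in> carrier G" "h = p a" using h ps by (metis imageE)
   then have a: "a \<in> carrier G" "p a = h" by simp_all
   have "F (group_elem H h) = I +>\<^bsub>group_cstar G\<^esub> group_elem G a"
    using bspec[OF F' h] \<pi>[OF a(1)] unfolding a(2) by (rule trans)
   then show ?thesis
    using bspec[OF k' G.group_elem_closed[OF a(1)]] f(2)[OF a(1)] unfolding a(2) comp_def by simp
  qed
 qed
 have "carrier (group_cstar H) \<subseteq> f ` carrier (group_cstar G)"
 proof
  fix x assume x: "x \<in> carrier (group_cstar H)"
  then have "F x \<in> carrier Q.Q" by (rule cstar_homD(1)[OF F])
  then obtain y where y: "y \<in> carrier (group_cstar G)" "F x = I +>\<^bsub>group_cstar G\<^esub> y"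
   unfolding Q.carrier_Q by (rule imageE) (rule that)
  have "x = f y" using kF[OF x] bspec[OF k' y(1)] y(2) by simp
  then show "x \<in> f ` carrier (group_cstar G)" using y by blast
 qed
 then show ?thesis using cstar_homD(1)[OF fh] by (auto simp: f_def)
qed

section \<open>Duals of quotients of the diagonal groups\<close>

context Un_plus_subgroup
begin

text \<open>Both sides are homomorphisms, so the coordinates u suffice; there
  \<open>dform_product\<close> on the right meets the group-like formula on the left.\<close>

lemma diagonal_comult:
 assumes L: "group \<Lambda>" and U: "U \<in> unitary_group" and hc: "!!i. h i \<in> carrier \<Lambda>"
  and \<rho>: "\<rho> \<in> cstar_hom A (group_cstar \<Lambda>)" and \<rho>u: "!!k l. \<rho> (u k l) = dform (group_cstar \<Lambda>) U (%i. group_elem \<Lambda> (h i)) k l"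
  and D: "group_comult \<Lambda> \<Delta>\<Lambda>" and x: "x \<in> carrier A"
 shows "\<Delta>\<Lambda> (\<rho> x) = tensor_map (group_cstar \<Lambda>) (group_cstar \<Lambda>) \<rho> \<rho> (\<Delta> x)"
proof -
 let ?C = "group_cstar \<Lambda>"
 interpret L: group_dual \<Lambda> by (intro group_dual.intro L)
 interpret C: cstar_algebra ?C by (rule L.cstar_algebra_group)
 interpret TA: cstar_tensor A A by (intro cstar_tensor.intro A_cstar)
 interpret T: cstar_tensor ?C ?C by (intro cstar_tensor.intro L.cstar_algebra_group)
 have Dh: "\<Delta>\<Lambda> \<in> cstar_hom ?C T.TC" "!!g. g \<in> carrier \<Lambda> ==> \<Delta>\<Lambda> (group_elem \<Lambda> g) = T.te (group_elem \<Lambda> g) (group_elem \<Lambda> g)"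
  using D by (auto simp: group_comult_def)
 note th = tensor_map_hom[OF A_cstar A_cstar L.cstar_algebra_group L.cstar_algebra_group \<rho> \<rho>]
 have gc: "group_elem \<Lambda> (h i) \<in> carrier ?C" for i by (rule L.group_elem_closed[OF hc])
 have \<beta>: "lin ?C T.TC (%a. T.te a b)" "lin ?C T.TC (%a. T.te b a)" if "b \<in> carrier ?C" for b
  using that by (simp_all add: lin_def T.te_closed T.te_add_left T.te_add_right T.te_scale_left T.te_scale_right)
 have "(\<Delta>\<Lambda> \<circ> \<rho>) x = (tensor_map ?C ?C \<rho> \<rho> \<circ> \<Delta>) x"
 proof (rule eq_on_gens[OF T.cstar_algebra_TC cstar_hom_comp[OF \<rho> Dh(1)] cstar_hom_comp[OF comult th(1)] _ x])
  fix k l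
  have "(tensor_map ?C ?C \<rho> \<rho> \<circ> \<Delta>) (u k l) = (\<Oplus>\<^bsub>T.TC\<^esub>m\<in>UNIV. tensor_map ?C ?C \<rho> \<rho> (TA.te (u k m) (u m l)))"
   unfolding comp_def Delta_u
   by (rule lin_finsum[OF TA.TC.star_alg T.TC.star_alg lin_hom[OF th(1)]]) (simp add: TA.te_closed)
  also have "... = (\<Oplus>\<^bsub>T.TC\<^esub>m\<in>UNIV. T.te (dform ?C U (%i. group_elem \<Lambda> (h i)) k m) (dform ?C U (%i. group_elem \<Lambda> (h i)) m l))"
   by (simp add: th(2) \<rho>u)
  also have "... = dform T.TC U (%i. T.te (group_elem \<Lambda> (h i)) (group_elem \<Lambda> (h i))) k l"
   by (rule dform_product[OF C.star_alg C.star_alg T.TC.star_alg U gc gc]) (auto simp: \<beta>)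
  also have "... = dform T.TC U (%i. \<Delta>\<Lambda> (group_elem \<Lambda> (h i))) k l" by (simp add: Dh(2) hc)
  also have "... = \<Delta>\<Lambda> (\<rho> (u k l))"
   unfolding \<rho>u by (rule dform_hom[OF C.star_alg T.TC.star_alg lin_hom[OF Dh(1)] gc, symmetric])
  finally show "(\<Delta>\<Lambda> \<circ> \<rho>) (u k l) = (tensor_map ?C ?C \<rho> \<rho> \<circ> \<Delta>) (u k l)" by simp
 qed
 then show ?thesis by simp
qed

end

context diagonal
begin

lemma dual_map:
 assumes \<kappa>: "Gamma_identification A \<theta> U \<kappa>" and L: "group \<Lambda>" and p: "p \<in> hom \<Gamma> \<Lambda>"
 shows "group_cstar_map \<Lambda> p \<circ> \<kappa> \<circ> q \<in> cstar_hom A (group_cstar \<Lambda>)"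
  "(group_cstar_map \<Lambda> p \<circ> \<kappa> \<circ> q) (u k l) = dform (group_cstar \<Lambda>) U (%i. group_elem \<Lambda> (p (g i))) k l"
proof -
 interpret L: group_dual \<Lambda> by (intro group_dual.intro L)
 interpret C: cstar_algebra "group_cstar \<Lambda>" by (rule L.cstar_algebra_group)
 have k: "\<kappa> \<in> cstar_hom D (group_cstar \<Gamma>)" "!!\<gamma>. \<gamma> \<in> carrier \<Gamma> ==> \<kappa> \<gamma> = group_elem \<Gamma> \<gamma>"
  using \<kappa> by (auto simp: Gamma_identification_def cstar_iso_def)
 note m = group_cstar_map_hom[OF G.group_dual_axioms L.group_dual_axioms p]
 have h: "group_cstar_map \<Lambda> p \<circ> \<kappa> \<in> cstar_hom D (group_cstar \<Lambda>)" by (rule cstar_hom_comp[OF k(1) m(1)])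
 show "group_cstar_map \<Lambda> p \<circ> \<kappa> \<circ> q \<in> cstar_hom A (group_cstar \<Lambda>)" by (rule cstar_hom_comp[OF q_hom h])
 have "(group_cstar_map \<Lambda> p \<circ> \<kappa>) (q (u k l)) = dform (group_cstar \<Lambda>) U (%i. (group_cstar_map \<Lambda> p \<circ> \<kappa>) (g i)) k l"
  unfolding q_u by (rule dform_hom[OF D.star_alg C.star_alg lin_hom[OF h]]) simp
 then show "(group_cstar_map \<Lambda> p \<circ> \<kappa> \<circ> q) (u k l) = dform (group_cstar \<Lambda>) U (%i. group_elem \<Lambda> (p (g i))) k l"
  by (simp add: k(2) m(2))
qed

lemma dual_of_quotient:
 assumes \<kappa>: "Gamma_identification A \<theta> U \<kappa>" and L: "group \<Lambda>" and p: "p \<in> epi \<Gamma> \<Lambda>"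
 shows "group_dual_subgroup A \<Delta> \<Lambda> (group_cstar_map \<Lambda> p \<circ> \<kappa> \<circ> q)"
proof -
 interpret L: group_dual \<Lambda> by (intro group_dual.intro L)
 have ph: "p \<in> hom \<Gamma> \<Lambda>" using p by (simp add: epi_def)
 note d = dual_map[OF \<kappa> L ph]
 obtain \<Delta>\<Lambda> where D: "group_comult \<Lambda> \<Delta>\<Lambda>" using L.group_comult_ex by blast
 have pc: "p (g i) \<in> carrier \<Lambda>" for i using ph by (auto simp: hom_def)
 have "\<kappa> ` carrier D = carrier (group_cstar \<Gamma>)"
  using \<kappa> by (auto simp: Gamma_identification_def cstar_iso_def bij_betw_def)
 then have s: "(group_cstar_map \<Lambda> p \<circ> \<kappa> \<circ> q) ` carrier A = carrier (group_cstar \<Lambda>)"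
  using group_cstar_map_surj[OF G.group_dual_axioms L.group_dual_axioms p] by (simp only: image_comp[symmetric] q_surj)
 show ?thesis
  unfolding group_dual_subgroup_def closed_subgroup_def
  using D d(1) s diagonal_comult[OF L U pc d D] by blast
qed

text \<open>The elements are values of words in the finitely many \<open>g i\<close> and their
  adjoints.\<close>

lemma countable_Gamma: "countable (carrier \<Gamma>)"
proof -
 define ev where "ev w = foldr (%(i, s) x. (if s then star D (g i) else g i) \<otimes>\<^bsub>D\<^esub> x) w \<one>\<^bsub>D\<^esub>" for w :: "('n \<times> bool) list"
 have c: "ev w \<in> carrier D" for w by (induction w) (auto simp: ev_def)
 have m: "ev (w @ w') = ev w \<otimes>\<^bsub>D\<^esub> ev w'" for w w'
 proof (induction w)
  case Nil
  then show ?case using c[of w'] by (simp add: ev_def)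
 next
  case (Cons z w)
  obtain i s where z: "z = (i, s)" by force
  have "ev (z # w) = (if s then star D (g i) else g i) \<otimes>\<^bsub>D\<^esub> ev w" for w by (simp add: ev_def z)
  then show ?case using Cons c[of w] c[of w'] by (simp add: D.m_assoc)
 qed
 have "\<gamma> \<in> range ev" if "\<gamma> \<in> carrier \<Gamma>" for \<gamma>
  using that
 proof (induction \<gamma> rule: Gamma_induct)
  case one
  have "\<one>\<^bsub>D\<^esub> = ev []" by (simp add: ev_def)
  then show ?case by (rule range_eqI)
 next
  case (gen i)
  have "g i = ev [(i, False)]" by (simp add: ev_def)
  then show ?case by (rule range_eqI)
 next
  case (inv i)
  have "star D (g i) = ev [(i, True)]" by (simp add: ev_def)
  then show ?case by (rule range_eqI)
 next
  case (mult x y)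
  then obtain w w' where "x = ev w" "y = ev w'" by blast
  then have "x \<otimes>\<^bsub>D\<^esub> y = ev (w @ w')" by (simp add: m)
  then show ?case by (rule range_eqI)
 qed
 then have "carrier \<Gamma> \<subseteq> range ev" by blast
 moreover have "countable (range ev)" by (rule countable_image) simp
 ultimately show ?thesis by (rule countable_subset)
qed

end

lemma group_transport:
 fixes e :: "'a => 'h"
 assumes G: "group G" and e: "inj_on e (carrier G)"
 shows "\<exists>H :: 'h monoid. group H & e \<in> epi G H"
proof -
 interpret group G by fact
 define H where "H = \<lparr>carrier = e ` carrier G,
  monoid.mult = %x y. e (inv_into (carrier G) e x \<otimes>\<^bsub>G\<^esub> inv_into (carrier G) e y), one = e \<one>\<^bsub>G\<^esub>\<rparr>"
 have m: "e x \<otimes>\<^bsub>H\<^esub> e y = e (x \<otimes>\<^bsub>G\<^esub> y)" if "x \<in> carrier G" "y \<in> carrier G" for x y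
  using that by (simp add: H_def inv_into_f_f[OF e])
 have H: "carrier H = e ` carrier G" "\<one>\<^bsub>H\<^esub> = e \<one>\<^bsub>G\<^esub>" by (simp_all add: H_def)
 have "group H"
 proof (rule groupI)
  show "\<exists>y\<in>carrier H. y \<otimes>\<^bsub>H\<^esub> x = \<one>\<^bsub>H\<^esub>" if x: "x \<in> carrier H" for x
  proof -
   obtain a where "a \<in> carrier G" "x = e a" using x H by blast
   then show ?thesis by (intro bexI[of _ "e (inv\<^bsub>G\<^esub> a)"]) (simp_all add: H m)
  qed
 qed (auto simp: H m m_assoc)
 moreover have "e \<in> epi G H" by (auto simp: epi_def hom_def H m)
 ultimately show ?thesis by blast
qed

section \<open>Bounded functionals\<close>

lemma lin_functional_finsum:
 assumes A: "star_algebra A" and f: "lin A complex_alg \<phi>" and x: "!!k. k \<in> K ==> x k \<in> carrier A"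
 shows "\<phi> (\<Oplus>\<^bsub>A\<^esub>k\<in>K. x k) = (\<Sum>k\<in>K. \<phi> (x k))"
proof -
 interpret CX: star_algebra complex_alg by (rule star_algebra_complex)
 have "(\<Oplus>\<^bsub>complex_alg\<^esub>k\<in>K. f k) = (\<Sum>k\<in>K. f k)" for f :: "'c => complex" and K
  by (induction K rule: infinite_finite_induct) (simp_all add: CX.finsum_insert)
 then show ?thesis using lin_finsum[OF A star_algebra_complex f, of K x] x by simp
qed

text \<open>Asks for no positivity, since differences and translates of states have to be compared
  on group elements.\<close>

definition bounded_functional :: "('a, 'm) cstar_alg_scheme => real => ('a => complex) => bool" where
 "bounded_functional A K \<phi> \<longleftrightarrow> lin A complex_alg \<phi> & 0 <= K & (\<forall>x\<in>carrier A. cmod (\<phi> x) <= K * nrm A x)"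

lemma bounded_functionalD:
 assumes "bounded_functional A K \<phi>"
 shows "x \<in> carrier A ==> y \<in> carrier A ==> \<phi> (x \<oplus>\<^bsub>A\<^esub> y) = \<phi> x + \<phi> y"
  "x \<in> carrier A ==> \<phi> (scale A c x) = c * \<phi> x"
  "x \<in> carrier A ==> cmod (\<phi> x) <= K * nrm A x"
 using assms by (simp_all add: bounded_functional_def lin_def)

lemma bounded_functional_comp:
 assumes A: "cstar_algebra A" and B: "cstar_algebra B" and f: "f \<in> cstar_hom A B" and \<phi>: "bounded_functional B K \<phi>"
 shows "bounded_functional A K (%x. \<phi> (f x))"
proof -
 note fD = cstar_homD[OF f] and pD = bounded_functionalD[OF \<phi>]
 have K: "0 <= K" using \<phi> by (simp add: bounded_functional_def)
 have "cmod (\<phi> (f x)) <= K * nrm A x" if x: "x \<in> carrier A" for x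
  using pD(3)[OF fD(1)[OF x]] mult_left_mono[OF cstar_hom_contractive[OF A B f x] K] by linarith
 then show ?thesis using K unfolding bounded_functional_def lin_def by (simp add: fD pD)
qed

lemma bounded_functional_diff:
 assumes \<phi>: "bounded_functional A K \<phi>" and \<psi>: "bounded_functional A L \<psi>"
 shows "bounded_functional A (K + cmod c * L) (%x. \<phi> x - c * \<psi> x)"
proof -
 note pD = bounded_functionalD[OF \<phi>] and sD = bounded_functionalD[OF \<psi>]
 have K: "0 <= K" "0 <= L" using \<phi> \<psi> by (simp_all add: bounded_functional_def)
 have "cmod (\<phi> x - c * \<psi> x) <= (K + cmod c * L) * nrm A x" if x: "x \<in> carrier A" for x
 proof -
  have "cmod (\<phi> x - c * \<psi> x) <= cmod (\<phi> x) + cmod c * cmod (\<psi> x)"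
   by (metis norm_mult norm_triangle_ineq4)
  also have "... <= K * nrm A x + cmod c * (L * nrm A x)"
   by (intro add_mono mult_left_mono pD(3) sD(3) x) simp
  finally show ?thesis by (simp add: algebra_simps)
 qed
 moreover have "\<phi> (x \<oplus>\<^bsub>A\<^esub> y) - c * \<psi> (x \<oplus>\<^bsub>A\<^esub> y) = (\<phi> x - c * \<psi> x) + (\<phi> y - c * \<psi> y)"
  if "x \<in> carrier A" "y \<in> carrier A" for x y using pD(1)[OF that] sD(1)[OF that] by (simp add: algebra_simps)
 moreover have "\<phi> (scale A d x) - c * \<psi> (scale A d x) = d * (\<phi> x - c * \<psi> x)" if "x \<in> carrier A" for d x
  using pD(2)[OF that, of d] sD(2)[OF that, of d] by (simp add: algebra_simps)
 ultimately show ?thesis using K unfolding bounded_functional_def lin_def by simp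
qed

context cstar_algebra
begin

lemma state_functional:
 assumes \<phi>: "state A \<phi>" and a: "a \<in> carrier A"
 shows "bounded_functional A (nrm A a) (%x. \<phi> (a \<otimes> x))"
proof -
 interpret P: positive_functional A \<phi> by unfold_locales (use \<phi> in \<open>simp add: state_def\<close>)
 have "cmod (\<phi> (a \<otimes> x)) <= nrm A a * nrm A x" if x: "x \<in> carrier A" for x
  using state_bound[OF \<phi> m_closed[OF a x]] nm.p_mult[OF a x] by linarith
 then show ?thesis
  using a unfolding bounded_functional_def lin_def
  by (simp add: nm.p_nonneg r_distr scale_mult_right P.phi_add P.phi_scale)
qed

lemma state_sesquilinear:
 assumes \<phi>: "state A \<phi>" and x: "!!k. x k \<in> carrier A" and y: "!!k. y k \<in> carrier A"
 shows "\<phi> (star A (\<Oplus>k\<in>K. scale A (r k) (x k)) \<otimes> (\<Oplus>l\<in>M. scale A (s l) (y l))) =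
  (\<Sum>k\<in>K. \<Sum>l\<in>M. cnj (r k) * s l * \<phi> (star A (x k) \<otimes> y l))"
proof -
 interpret P: positive_functional A \<phi> by unfold_locales (use \<phi> in \<open>simp add: state_def\<close>)
 have right: "\<phi> (a \<otimes> (\<Oplus>l\<in>M. scale A (s l) (y l))) = (\<Sum>l\<in>M. s l * \<phi> (a \<otimes> y l))"
  if a: "a \<in> carrier A" and y: "!!k. y k \<in> carrier A" for a M s and y :: "'z => 'a"
 proof -
  have l: "lin A complex_alg (%x. \<phi> (a \<otimes> x))" using state_functional[OF \<phi> a] by (simp add: bounded_functional_def)
  show ?thesis
   using lin_functional_finsum[OF star_alg l, of M "%l. scale A (s l) (y l)"] a y
   by (simp add: scale_mult_right P.phi_scale)
 qed
 have xc: "(\<Oplus>k\<in>K. scale A (r k) (x k)) \<in> carrier A" by (rule finsum_closed) (use x in auto)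
 have "\<phi> (star A (\<Oplus>k\<in>K. scale A (r k) (x k)) \<otimes> (\<Oplus>l\<in>M. scale A (s l) (y l))) =
   (\<Sum>l\<in>M. s l * \<phi> (star A (\<Oplus>k\<in>K. scale A (r k) (x k)) \<otimes> y l))"
  by (rule right[OF star_closed[OF xc] y])
 also have "... = (\<Sum>l\<in>M. s l * cnj (\<Sum>k\<in>K. r k * \<phi> (star A (y l) \<otimes> x k)))"
  by (simp only: P.phi_hermitian[OF xc y] right[OF star_closed[OF y] x])
 also have "... = (\<Sum>l\<in>M. \<Sum>k\<in>K. cnj (r k) * s l * \<phi> (star A (x k) \<otimes> y l))"
  by (simp add: sum_distrib_left P.phi_hermitian[OF x y] mult_ac)
 finally show ?thesis by (subst sum.swap) simp
qed

end

context group_dual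
begin

text \<open>Linear combinations of group elements are dense, and the bound carries the vanishing to
  limits.\<close>

lemma bounded_functional_zero:
 assumes \<phi>: "bounded_functional (group_cstar \<Lambda>) K \<phi>" and z: "!!g. g \<in> carrier \<Lambda> ==> \<phi> (group_elem \<Lambda> g) = 0"
  and x: "x \<in> carrier (group_cstar \<Lambda>)"
 shows "\<phi> x = 0"
proof -
 let ?C = "group_cstar \<Lambda>" and ?e = "univ_elem (group_alg \<Lambda>) {}"
 interpret C: cstar_algebra ?C by (rule cstar_algebra_group)
 note pD = bounded_functionalD[OF \<phi>]
 have K: "0 <= K" using \<phi> by (simp add: bounded_functional_def)
 have e: "\<phi> (?e f) = 0" if "f \<in> carrier ga.X" for f
  using that
 proof (induction f rule: ga.X_induct)
  case zero
  have "\<phi> (scale ?C 0 \<one>\<^bsub>?C\<^esub>) = 0" by (simp only: pD(2)[OF C.one_closed] mult_zero_left)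
  then show ?case by (simp add: group_alg_elem_simps(1) C.scale_zero_left)
 next
  case (add f g c)
  then show ?case
   using group_alg_elem_simps(3)[OF add(1)] group_elem_closed[OF add(2)]
   by (simp add: group_alg_elem_simps(2) pD(1,2) z C.scale_closed)
 qed
 obtain X where X: "!!k. X k \<in> carrier ga.X" "C.nm.lims (%k. ?e (X k)) x" using group_lims_ex[OF x] by blast
 have "cmod (\<phi> x) <= K * nrm ?C (?e (X k) \<ominus>\<^bsub>?C\<^esub> x)" for k
 proof -
  have c: "?e (X k) \<in> carrier ?C" by (rule group_alg_elem_simps(3)[OF X(1)])
  have "\<phi> (?e (X k) \<ominus>\<^bsub>?C\<^esub> x) = - \<phi> x"
   using c x by (simp add: C.minus_conv pD(1,2) e[OF X(1)] C.scale_closed)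
  then show ?thesis using pD(3)[OF C.minus_closed[OF c x]] by simp
 qed
 moreover have "(%k. K * nrm ?C (?e (X k) \<ominus>\<^bsub>?C\<^esub> x)) \<longlonglongrightarrow> K * 0"
  by (rule tendsto_mult_left[OF C.nm.limsD(3)[OF X(2)]])
 ultimately have "cmod (\<phi> x) <= K * 0" by (intro LIMSEQ_le_const) auto
 then show ?thesis by simp
qed

end

section \<open>Linear algebra over the complex numbers\<close>

text \<open>Filling up with zero rows gives a square matrix with a zero row. It has no right
  inverse, hence no left inverse, hence a kernel.\<close>

lemma kernel_of_few_rows:
 fixes f :: "'n::finite => 'n => complex"
 assumes K: "K ~= UNIV"
 shows "\<exists>x. (\<exists>j. x j ~= 0) & (\<forall>k\<in>K. (\<Sum>j\<in>UNIV. f k j * x j) = 0)"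
proof -
 obtain m where m: "m \<notin> K" using K by blast
 define M where "M = (\<chi> k j. if k \<in> K then f k j else 0)"
 have "\<nexists>B. B ** M = mat 1"
 proof
  assume "\<exists>B. B ** M = mat 1"
  then obtain B where "M ** B = mat 1" using matrix_left_right_inverse by blast
  then have "(M ** B) $ m $ m = 1" by (simp add: mat_def)
  moreover have "(M ** B) $ m $ m = 0" using m by (simp add: matrix_matrix_mult_def M_def)
  ultimately show False by simp
 qed
 then obtain x where x: "M *v x = 0" "x ~= 0" using matrix_left_invertible_ker[of M] by blast
 have "(\<Sum>j\<in>UNIV. f k j * x $ j) = 0" if "k \<in> K" for k
 proof -
  have "(M *v x) $ k = 0" using x by simp
  then show ?thesis using that by (simp add: matrix_vector_mult_def M_def)
 qed
 moreover have "\<exists>j. x $ j ~= 0" using x(2) by (simp add: vec_eq_iff)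
 ultimately show ?thesis by blast
qed

section \<open>Group dual subgroups diagonalise\<close>

locale dual_subgroup = Un_plus_subgroup A \<Delta> \<theta> + L: group_dual \<Lambda>
 for A :: "'a cstar_alg" (structure) and \<Delta> :: "'a => (nat => ('a, 'a) tensor) set"
  and \<theta> :: "'n::finite Un_plus_elem => 'a" and \<Lambda> :: "'g monoid" +
 fixes \<rho> :: "'a => (nat => 'g => complex) set"
 assumes dual: "group_dual_subgroup A \<Delta> \<Lambda> \<rho>"
begin

abbreviation C where "C == group_cstar \<Lambda>"
abbreviation ge where "ge == group_elem \<Lambda>"

sublocale C: cstar_algebra C by (rule L.cstar_algebra_group)
sublocale T: cstar_tensor C C by (intro cstar_tensor.intro L.cstar_algebra_group)

definition comult_dual where "comult_dual = (SOME D. group_comult \<Lambda> D & closed_subgroup A \<Delta> C D \<rho>)"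

lemma dual_facts: "group_comult \<Lambda> comult_dual" "closed_subgroup A \<Delta> C comult_dual \<rho>"
 using someI_ex[OF dual[unfolded group_dual_subgroup_def]] by (simp_all add: comult_dual_def)

lemma comult_dual_hom: "comult_dual \<in> cstar_hom C T.TC"
 and comult_dual_elem: "g \<in> carrier \<Lambda> ==> comult_dual (ge g) = T.te (ge g) (ge g)"
 using dual_facts(1) by (simp_all add: group_comult_def)

lemma rho_hom: "\<rho> \<in> cstar_hom A C" and rho_surj: "\<rho> ` carrier A = carrier C"
 using dual_facts(2) by (simp_all add: closed_subgroup_def)

definition w :: "'n => 'n => (nat => 'g => complex) set" where "w i j = \<rho> (u i j)"

lemma w_closed [simp]: "w i j \<in> carrier C"
 unfolding w_def by (rule cstar_homD(1)[OF rho_hom u_closed])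

lemma w_unitary:
 "(\<Oplus>\<^bsub>C\<^esub>m\<in>UNIV. w k m \<otimes>\<^bsub>C\<^esub> star C (w l m)) = (if k = l then \<one>\<^bsub>C\<^esub> else \<zero>\<^bsub>C\<^esub>)"
 "(\<Oplus>\<^bsub>C\<^esub>m\<in>UNIV. star C (w m k) \<otimes>\<^bsub>C\<^esub> w m l) = (if k = l then \<one>\<^bsub>C\<^esub> else \<zero>\<^bsub>C\<^esub>)"
proof -
 note rD = cstar_homD[OF rho_hom]
 note lf = lin_finsum[OF star_alg C.star_alg lin_hom[OF rho_hom], of UNIV]
 have z: "\<rho> (if k = l then \<one> else \<zero>) = (if k = l then \<one>\<^bsub>C\<^esub> else \<zero>\<^bsub>C\<^esub>)"
  using cstar_hom_zero[OF star_alg C.star_alg rho_hom] rD(4) by simp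
 show "(\<Oplus>\<^bsub>C\<^esub>m\<in>UNIV. w k m \<otimes>\<^bsub>C\<^esub> star C (w l m)) = (if k = l then \<one>\<^bsub>C\<^esub> else \<zero>\<^bsub>C\<^esub>)"
  unfolding z[symmetric] u_unitary(1)[symmetric] by (subst lf) (simp_all add: w_def rD(3,6))
 show "(\<Oplus>\<^bsub>C\<^esub>m\<in>UNIV. star C (w m k) \<otimes>\<^bsub>C\<^esub> w m l) = (if k = l then \<one>\<^bsub>C\<^esub> else \<zero>\<^bsub>C\<^esub>)"
  unfolding z[symmetric] u_unitary(2)[symmetric] by (subst lf) (simp_all add: w_def rD(3,6))
qed

lemma comult_w: "comult_dual (w i j) = (\<Oplus>\<^bsub>T.TC\<^esub>k\<in>UNIV. T.te (w i k) (w k j))"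
proof -
 interpret TA: cstar_tensor A A by (intro cstar_tensor.intro A_cstar)
 note th = tensor_map_hom[OF A_cstar A_cstar L.cstar_algebra_group L.cstar_algebra_group rho_hom rho_hom]
 have "comult_dual (w i j) = tensor_map C C \<rho> \<rho> (\<Delta> (u i j))"
  using dual_facts(2) by (simp add: closed_subgroup_def w_def)
 also have "... = (\<Oplus>\<^bsub>T.TC\<^esub>k\<in>UNIV. tensor_map C C \<rho> \<rho> (TA.te (u i k) (u k j)))"
  unfolding Delta_u
  by (rule lin_finsum[OF TA.TC.star_alg T.TC.star_alg lin_hom[OF th(1)]]) (simp add: TA.te_closed)
 finally show ?thesis by (simp add: th(2) w_def)
qed

definition \<tau> where "\<tau> = (SOME t. state C t & (\<forall>g\<in>carrier \<Lambda>. t (ge g) = (if g = \<one>\<^bsub>\<Lambda>\<^esub> then 1 else 0)))"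

lemma tau_state: "state C \<tau>" and tau_elem: "g \<in> carrier \<Lambda> ==> \<tau> (ge g) = (if g = \<one>\<^bsub>\<Lambda>\<^esub> then 1 else 0)"
 using someI_ex[OF L.trace_ex] unfolding \<tau>_def by blast+

sublocale tau: positive_functional C \<tau>
 by unfold_locales (use tau_state in \<open>simp add: state_def\<close>)

lemma C_nrm_one: "nrm C \<one>\<^bsub>C\<^esub> = 1"
proof -
 have "1 <= nrm C \<one>\<^bsub>C\<^esub>" using C.state_bound[OF tau_state C.one_closed] tau_state by (simp add: state_def)
 then show ?thesis using C.nm.p_one_cases by auto
qed

definition E :: "'g => (nat => 'g => complex) set => complex" where
 "E h x = \<tau> (star C (ge h) \<otimes>\<^bsub>C\<^esub> x)"

lemma E_functional: "h \<in> carrier \<Lambda> ==> bounded_functional C (nrm C (star C (ge h))) (E h)"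
 unfolding E_def[abs_def] by (rule C.state_functional[OF tau_state]) (simp add: L.group_elem_closed)

lemma E_elem: assumes "h \<in> carrier \<Lambda>" "g \<in> carrier \<Lambda>" shows "E h (ge g) = (if g = h then 1 else 0)"
proof -
 have "star C (ge h) \<otimes>\<^bsub>C\<^esub> ge g = ge (inv\<^bsub>\<Lambda>\<^esub> h \<otimes>\<^bsub>\<Lambda>\<^esub> g)"
  using assms by (simp add: L.group_elem_mult L.group_elem_inv)
 moreover have "inv\<^bsub>\<Lambda>\<^esub> h \<otimes>\<^bsub>\<Lambda>\<^esub> g = \<one>\<^bsub>\<Lambda>\<^esub> \<longleftrightarrow> g = h"
 proof
  assume "inv\<^bsub>\<Lambda>\<^esub> h \<otimes>\<^bsub>\<Lambda>\<^esub> g = \<one>\<^bsub>\<Lambda>\<^esub>"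
  then have "inv\<^bsub>\<Lambda>\<^esub> g = inv\<^bsub>\<Lambda>\<^esub> h" using assms by (intro L.inv_equality) auto
  then have "inv\<^bsub>\<Lambda>\<^esub> (inv\<^bsub>\<Lambda>\<^esub> g) = inv\<^bsub>\<Lambda>\<^esub> (inv\<^bsub>\<Lambda>\<^esub> h)" by (rule arg_cong)
  then show "g = h" using assms by simp
 qed (use assms in simp)
 ultimately show ?thesis using assms by (simp add: E_def tau_elem)
qed

section \<open>Eigenrows of the fundamental matrix\<close>

definition eig :: "'g => ('n => complex) => bool" where
 "eig h r \<longleftrightarrow> h \<in> carrier \<Lambda> & (\<forall>j. (\<Oplus>\<^bsub>C\<^esub>k\<in>UNIV. scale C (r k) (w k j)) = scale C (r j) (ge h))"

text \<open>Comparing coefficients of \<open>h \<otimes> \<Lambda>\<close> in \<open>\<Delta>(w\<^sub>i\<^sub>j) = \<Sum>\<^sub>k w\<^sub>i\<^sub>k \<otimes> w\<^sub>k\<^sub>j\<close>; the second factor is tested against all states.\<close>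

lemma eig_coefficients:
 assumes h: "h \<in> carrier \<Lambda>"
 shows "eig h (%k. E h (w i k))"
proof -
 note gh = L.group_elem_closed[OF h]
 have "(\<Oplus>\<^bsub>C\<^esub>k\<in>UNIV. scale C (E h (w i k)) (w k j)) = scale C (E h (w i j)) (ge h)" for j
 proof -
  define s where "s = (\<Oplus>\<^bsub>C\<^esub>k\<in>UNIV. scale C (E h (w i k)) (w k j))"
  define r where "r = scale C (E h (w i j)) (ge h)"
  have sr: "s \<in> carrier C" "r \<in> carrier C" unfolding s_def r_def using gh by (auto intro!: C.finsum_closed)
  define y where "y = s \<ominus>\<^bsub>C\<^esub> r"
  have y: "y \<in> carrier C" using sr by (simp add: y_def)
  \<comment> \<open>\<open>\<psi>\<close> attains the norm of the difference \<open>y\<close>; so y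
    = 0 follows once \<open>\<psi>\<close> agrees at \<open>s\<close> and \<open>r\<close> after
    left multiplication by the adjoint \<open>b\<close> of \<open>y\<close>.\<close>
  obtain \<psi> where \<psi>: "state C \<psi>" "\<psi> (star C y \<otimes>\<^bsub>C\<^esub> y) = of_real ((nrm C y)^2)"
   using C.state_ex[OF y C_nrm_one] by blast
  define b where "b = star C y"
  have b: "b \<in> carrier C" using y by (simp add: b_def)
  obtain \<Phi> where P: "state T.TC \<Phi>" "\<forall>a\<in>carrier C. \<forall>b\<in>carrier C. \<Phi> (T.te a b) = \<tau> a * \<psi> b"
   using T.product_state[OF tau_state \<psi>(1)] by blast
  \<comment> \<open>Left multiplication by \<open>t\<close> turns the product state into the
    coefficient at \<open>h\<close> on the first leg and into \<open>\<psi>\<close> of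
    \<open>b\<close> times the second leg.\<close>
  define t where "t = T.te (star C (ge h)) b"
  have t: "t \<in> carrier T.TC" unfolding t_def using gh b by (simp add: T.te_closed)
  have Ft: "\<Phi> (t \<otimes>\<^bsub>T.TC\<^esub> T.te a c) = E h a * \<psi> (b \<otimes>\<^bsub>C\<^esub> c)" if "a \<in> carrier C" "c \<in> carrier C" for a c
   using that gh b P(2) by (simp add: t_def T.te_mult E_def)
  note F = T.TC.state_functional[OF P(1) t]
  note S = C.state_functional[OF \<psi>(1) b]
  \<comment> \<open>Both terms are bounded functionals of \<open>w i j\<close>. On a group element g
    each is the value of \<open>\<psi>\<close> at \<open>b\<close> times g if g = h, and 0
    otherwise.\<close>
  have "\<Phi> (t \<otimes>\<^bsub>T.TC\<^esub> comult_dual (w i j)) - \<psi> (b \<otimes>\<^bsub>C\<^esub> ge h) * E h (w i j) = 0"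
  proof (rule L.bounded_functional_zero[OF bounded_functional_diff[OF
     bounded_functional_comp[OF L.cstar_algebra_group T.cstar_algebra_TC comult_dual_hom F] E_functional[OF h]] _ w_closed])
   show "\<Phi> (t \<otimes>\<^bsub>T.TC\<^esub> comult_dual (ge g)) - \<psi> (b \<otimes>\<^bsub>C\<^esub> ge h) * E h (ge g) = 0" if "g \<in> carrier \<Lambda>" for g
    using that by (simp add: comult_dual_elem Ft L.group_elem_closed E_elem h)
  qed
  moreover have "\<Phi> (t \<otimes>\<^bsub>T.TC\<^esub> comult_dual (w i j)) = (\<Sum>k\<in>UNIV. E h (w i k) * \<psi> (b \<otimes>\<^bsub>C\<^esub> w k j))"
   using lin_functional_finsum[OF T.TC.star_alg, of "%x. \<Phi> (t \<otimes>\<^bsub>T.TC\<^esub> x)" UNIV "%k. T.te (w i k) (w k j)"] F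
   by (simp add: comult_w bounded_functional_def T.te_closed Ft)
  moreover have "\<psi> (b \<otimes>\<^bsub>C\<^esub> s) = (\<Sum>k\<in>UNIV. E h (w i k) * \<psi> (b \<otimes>\<^bsub>C\<^esub> w k j))"
   using lin_functional_finsum[OF C.star_alg, of "%x. \<psi> (b \<otimes>\<^bsub>C\<^esub> x)" UNIV "%k. scale C (E h (w i k)) (w k j)"] S
    bounded_functionalD(2)[OF S]
   by (simp add: s_def bounded_functional_def)
  moreover have "\<psi> (b \<otimes>\<^bsub>C\<^esub> r) = E h (w i j) * \<psi> (b \<otimes>\<^bsub>C\<^esub> ge h)"
   unfolding r_def by (rule bounded_functionalD(2)[OF S gh])
  ultimately have "\<psi> (b \<otimes>\<^bsub>C\<^esub> s) = \<psi> (b \<otimes>\<^bsub>C\<^esub> r)" by (simp add: mult.commute)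
  moreover have "\<psi> (b \<otimes>\<^bsub>C\<^esub> y) = \<psi> (b \<otimes>\<^bsub>C\<^esub> s) - \<psi> (b \<otimes>\<^bsub>C\<^esub> r)"
   unfolding y_def C.minus_conv[OF sr] using bounded_functionalD(1)[OF S sr(1) C.scale_closed[OF sr(2)]]
    bounded_functionalD(2)[OF S sr(2)] by simp
  ultimately have "of_real ((nrm C y)^2) = (0::complex)" using \<psi>(2) by (simp add: b_def)
  then have "y = \<zero>\<^bsub>C\<^esub>" by (intro C.nrm_definite[OF y]) simp
  then show ?thesis using sr C.minus_eq_zero_iff unfolding y_def s_def r_def by blast
 qed
 then show ?thesis using h by (simp add: eig_def)
qed

lemma eig_scale: assumes "eig h r" shows "eig h (%k. c * r k)"
proof -
 have "(\<Oplus>\<^bsub>C\<^esub>k\<in>UNIV. scale C (c * r k) (w k j)) = scale C (c * r j) (ge h)" for j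
 proof -
  have "(\<Oplus>\<^bsub>C\<^esub>k\<in>UNIV. scale C (c * r k) (w k j)) = scale C c (\<Oplus>\<^bsub>C\<^esub>k\<in>UNIV. scale C (r k) (w k j))"
   by (subst C.finsum_scale) (simp_all add: C.scale_scale)
  then show ?thesis using assms L.group_elem_closed by (simp add: eig_def C.scale_scale)
 qed
 then show ?thesis using assms by (simp add: eig_def)
qed

lemma eig_diff: assumes r: "eig h r" and s: "eig h s" shows "eig h (%k. r k - s k)"
proof -
 have gh: "ge h \<in> carrier C" using r by (simp add: eig_def L.group_elem_closed)
 have sp: "scale C (a - b) x = scale C a x \<oplus>\<^bsub>C\<^esub> scale C (-1 * b) x" if "x \<in> carrier C" for a b x
  using C.add_scale[OF that, of a "-b"] by simp
 have "(\<Oplus>\<^bsub>C\<^esub>k\<in>UNIV. scale C (r k - s k) (w k j)) = scale C (r j - s j) (ge h)" for j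
 proof -
  have "(\<Oplus>\<^bsub>C\<^esub>k\<in>UNIV. scale C (r k - s k) (w k j)) =
    (\<Oplus>\<^bsub>C\<^esub>k\<in>UNIV. scale C (r k) (w k j)) \<oplus>\<^bsub>C\<^esub> (\<Oplus>\<^bsub>C\<^esub>k\<in>UNIV. scale C (-1 * s k) (w k j))"
   by (simp only: sp[OF w_closed]) (subst C.finsum_addf, auto)
  then show ?thesis using r eig_scale[OF s, of "-1"] sp[OF gh] by (simp add: eig_def)
 qed
 then show ?thesis using r by (simp add: eig_def)
qed

lemma eig_combination:
 assumes r: "eig h r" and M: "finite M" and s: "!!m. m \<in> M ==> eig h (s m)"
 shows "eig h (%k. r k - (\<Sum>m\<in>M. c m * s m k))"
 using M s
proof (induction M rule: finite_induct)
 case (insert m M)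
 have "eig h (%k. (r k - (\<Sum>m\<in>M. c m * s m k)) - c m * s m k)"
  by (rule eig_diff[OF _ eig_scale]) (use insert in auto)
 then show ?case using insert(1,2) by (simp add: algebra_simps)
qed (use r in simp)

text \<open>Pair the rows r w and s w under the trace in two ways. Entrywise one gets multiples of
  the trace of h times the inverse of g, which is 0; unitarity of w, on the other hand, reduces the
  total to the inner product of r and s.\<close>

lemma eig_orthogonal:
 assumes r: "eig h r" and s: "eig g s" and hg: "h ~= g"
 shows "(\<Sum>k\<in>UNIV. r k * cnj (s k)) = 0"
proof -
 have c: "h \<in> carrier \<Lambda>" "g \<in> carrier \<Lambda>" using r s by (auto simp: eig_def)
 note gc = L.group_elem_closed[OF c(1)] L.group_elem_closed[OF c(2)]
 have sw: "star C (w k j) \<in> carrier C" for k j by simp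
 have st: "star C (scale C a (star C x)) = scale C (cnj a) x" if "x \<in> carrier C" for a x
  using that by (simp add: C.star_scale C.star_star)
 have E0: "E (inv\<^bsub>\<Lambda>\<^esub> h) (ge (inv\<^bsub>\<Lambda>\<^esub> g)) = 0"
 proof -
  have "inv\<^bsub>\<Lambda>\<^esub> g ~= inv\<^bsub>\<Lambda>\<^esub> h"
  proof
   assume "inv\<^bsub>\<Lambda>\<^esub> g = inv\<^bsub>\<Lambda>\<^esub> h"
   then have "inv\<^bsub>\<Lambda>\<^esub> (inv\<^bsub>\<Lambda>\<^esub> g) = inv\<^bsub>\<Lambda>\<^esub> (inv\<^bsub>\<Lambda>\<^esub> h)" by (rule arg_cong)
   then show False using c hg by simp
  qed
  then show ?thesis using c by (simp add: E_elem)
 qed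
 have "(\<Sum>j\<in>UNIV. \<Sum>k\<in>UNIV. \<Sum>l\<in>UNIV. r k * cnj (s l) * \<tau> (w k j \<otimes>\<^bsub>C\<^esub> star C (w l j))) = 0"
 proof (rule sum.neutral, rule ballI)
  fix j
  have fin: "star C (\<Oplus>\<^bsub>C\<^esub>k\<in>UNIV. scale C (a k) (w k j)) = (\<Oplus>\<^bsub>C\<^esub>k\<in>UNIV. scale C (cnj (a k)) (star C (w k j)))" for a
   by (subst star_finsum) (auto simp: C.star_alg C.star_scale)
  have "\<tau> (star C (\<Oplus>\<^bsub>C\<^esub>k\<in>UNIV. scale C (cnj (r k)) (star C (w k j))) \<otimes>\<^bsub>C\<^esub> (\<Oplus>\<^bsub>C\<^esub>l\<in>UNIV. scale C (cnj (s l)) (star C (w l j)))) =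
    (\<Sum>k\<in>UNIV. \<Sum>l\<in>UNIV. r k * cnj (s l) * \<tau> (w k j \<otimes>\<^bsub>C\<^esub> star C (w l j)))"
   using C.state_sesquilinear[OF tau_state, of "%k. star C (w k j)" "%k. star C (w k j)" "%k. cnj (r k)" UNIV "%k. cnj (s k)" UNIV]
   by (simp add: C.star_star)
  moreover have "(\<Oplus>\<^bsub>C\<^esub>k\<in>UNIV. scale C (cnj (r k)) (star C (w k j))) = scale C (cnj (r j)) (star C (ge h))"
   unfolding fin[symmetric] using r gc by (simp add: eig_def C.star_scale)
  moreover have "(\<Oplus>\<^bsub>C\<^esub>k\<in>UNIV. scale C (cnj (s k)) (star C (w k j))) = scale C (cnj (s j)) (star C (ge g))"
   unfolding fin[symmetric] using s gc by (simp add: eig_def C.star_scale)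
  moreover have "\<tau> (star C (scale C (cnj (r j)) (star C (ge h))) \<otimes>\<^bsub>C\<^esub> scale C (cnj (s j)) (star C (ge g))) = 0"
   using E0 gc c by (simp add: C.star_scale C.star_star E_def L.group_elem_inv C.scale_mult_left C.scale_mult_right tau.phi_scale)
  ultimately show "(\<Sum>k\<in>UNIV. \<Sum>l\<in>UNIV. r k * cnj (s l) * \<tau> (w k j \<otimes>\<^bsub>C\<^esub> star C (w l j))) = 0" by simp
 qed
 moreover have "(\<Sum>j\<in>UNIV. \<Sum>k\<in>UNIV. \<Sum>l\<in>UNIV. r k * cnj (s l) * \<tau> (w k j \<otimes>\<^bsub>C\<^esub> star C (w l j))) =
   (\<Sum>k\<in>UNIV. \<Sum>l\<in>UNIV. r k * cnj (s l) * (\<Sum>j\<in>UNIV. \<tau> (w k j \<otimes>\<^bsub>C\<^esub> star C (w l j))))"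
  by (subst sum.swap, rule sum.cong[OF refl], subst sum.swap) (simp add: sum_distrib_left)
 moreover have "(\<Sum>j\<in>UNIV. \<tau> (w k j \<otimes>\<^bsub>C\<^esub> star C (w l j))) = (if k = l then 1 else 0)" for k l
  using lin_functional_finsum[OF C.star_alg, of \<tau> UNIV "%j. w k j \<otimes>\<^bsub>C\<^esub> star C (w l j)"] w_unitary(1)[of k l] tau_state
  by (simp add: lin_def tau.phi_add tau.phi_scale state_def tau.phi_zero split: if_splits)
 ultimately show ?thesis by (simp add: sum.delta if_distrib cong: if_cong)
qed

text \<open>If x annihilates all coefficient rows, the entries y i of w x have no nonzero
  coefficient, so the trace of y i* y i is 0. Summed over i, unitarity of w turns this into the sum
  of the |x k|^2.\<close>

lemma coefficients_total:
 assumes x: "x m ~= (0::complex)"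
 shows "\<exists>h\<in>carrier \<Lambda>. \<exists>i. (\<Sum>k\<in>UNIV. E h (w i k) * x k) ~= 0"
proof (rule ccontr)
 assume "\<not> ?thesis"
 then have z: "(\<Sum>k\<in>UNIV. E h (w i k) * x k) = 0" if "h \<in> carrier \<Lambda>" for h i using that by blast
 define y where "y i = (\<Oplus>\<^bsub>C\<^esub>k\<in>UNIV. scale C (x k) (w i k))" for i
 have y: "y i \<in> carrier C" for i unfolding y_def by (rule C.finsum_closed) auto
 have Ey: "E h (y i) = 0" if h: "h \<in> carrier \<Lambda>" for h i
  using lin_functional_finsum[OF C.star_alg, of "E h" UNIV "%k. scale C (x k) (w i k)"] E_functional[OF h]
   bounded_functionalD(2)[OF E_functional[OF h]] z[OF h, of i]
  by (simp add: y_def bounded_functional_def mult.commute)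
 have t0: "\<tau> (star C (y i) \<otimes>\<^bsub>C\<^esub> y i) = 0" for i
 proof (rule L.bounded_functional_zero[OF C.state_functional[OF tau_state C.star_closed[OF y]] _ y])
  show "\<tau> (star C (y i) \<otimes>\<^bsub>C\<^esub> ge h) = 0" if h: "h \<in> carrier \<Lambda>" for h
   using tau.phi_hermitian[OF y L.group_elem_closed[OF h]] Ey[OF h] by (simp add: E_def)
 qed
 have "(\<Sum>i\<in>UNIV. \<Sum>k\<in>UNIV. \<Sum>l\<in>UNIV. cnj (x k) * x l * \<tau> (star C (w i k) \<otimes>\<^bsub>C\<^esub> w i l)) = 0"
 proof (rule sum.neutral, rule ballI)
  show "(\<Sum>k\<in>UNIV. \<Sum>l\<in>UNIV. cnj (x k) * x l * \<tau> (star C (w i k) \<otimes>\<^bsub>C\<^esub> w i l)) = 0" for i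
   using C.state_sesquilinear[OF tau_state, of "%k. w i k" "%k. w i k" x UNIV x UNIV] t0[of i] by (simp add: y_def)
 qed
 moreover have "(\<Sum>i\<in>UNIV. \<Sum>k\<in>UNIV. \<Sum>l\<in>UNIV. cnj (x k) * x l * \<tau> (star C (w i k) \<otimes>\<^bsub>C\<^esub> w i l)) =
   (\<Sum>k\<in>UNIV. \<Sum>l\<in>UNIV. cnj (x k) * x l * (\<Sum>i\<in>UNIV. \<tau> (star C (w i k) \<otimes>\<^bsub>C\<^esub> w i l)))"
  by (subst sum.swap, rule sum.cong[OF refl], subst sum.swap) (simp add: sum_distrib_left)
 moreover have "(\<Sum>i\<in>UNIV. \<tau> (star C (w i k) \<otimes>\<^bsub>C\<^esub> w i l)) = (if k = l then 1 else 0)" for k l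
  using lin_functional_finsum[OF C.star_alg, of \<tau> UNIV "%i. star C (w i k) \<otimes>\<^bsub>C\<^esub> w i l"] w_unitary(2)[of k l] tau_state
  by (simp add: lin_def tau.phi_add tau.phi_scale state_def tau.phi_zero split: if_splits)
 ultimately have "(\<Sum>k\<in>UNIV. cnj (x k) * x k) = 0" by (simp add: sum.delta if_distrib cong: if_cong)
 then have "complex_of_real (\<Sum>k\<in>UNIV. (cmod (x k))^2) = 0"
  unfolding of_real_sum complex_norm_square by (simp add: mult.commute)
 then have "(\<Sum>k\<in>UNIV. (cmod (x k))^2) = 0" by (simp only: of_real_eq_0_iff)
 then have "(cmod (x m))^2 = 0" by (subst (asm) sum_nonneg_eq_0_iff) auto
 then show False using x by simp
qed

text \<open>Rows are indexed by a subset of the index type of the matrices, so a frame over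
  \<open>UNIV\<close> is directly a square matrix.\<close>

definition eigenframe :: "'n set => ('n => 'n => complex) => ('n => 'g) => bool" where
 "eigenframe K f a \<longleftrightarrow> (\<forall>i\<in>K. eig (a i) (f i)) &
   (\<forall>i\<in>K. \<forall>j\<in>K. (\<Sum>k\<in>UNIV. f i k * cnj (f j k)) = (if i = j then 1 else 0))"

text \<open>A vector x annihilated by the rows so far is not annihilated by some coefficient row r,
  belonging to a group element h. Gram-Schmidt is carried out only against rows belonging to the
  same h, so that the remainder t is still an eigenrow; orthogonality to the others is automatic.
  Pairing with x shows that t is nonzero.\<close>

lemma eigenframe_extend:
 assumes f: "eigenframe K f a" and m: "m \<notin> K"
 shows "\<exists>f a. eigenframe (insert m K) f a"
proof -
 have fe: "eig (a i) (f i)" if "i \<in> K" for i using f that by (simp add: eigenframe_def)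
 have fo: "(\<Sum>k\<in>UNIV. f i k * cnj (f j k)) = (if i = j then 1 else 0)" if "i \<in> K" "j \<in> K" for i j
  using f that by (simp add: eigenframe_def)
 obtain x j where x: "x j ~= 0" "!!k. k \<in> K ==> (\<Sum>j\<in>UNIV. f k j * x j) = 0"
  using kernel_of_few_rows[of K f] m by blast
 obtain h i where hi: "h \<in> carrier \<Lambda>" "(\<Sum>k\<in>UNIV. E h (w i k) * x k) ~= 0" using coefficients_total[of x j] x(1) by blast
 define r where "r k = E h (w i k)" for k
 have r: "eig h r" unfolding r_def[abs_def] by (rule eig_coefficients[OF hi(1)])
 define K' where "K' = {m \<in> K. a m = h}"
 define c where "c m = (\<Sum>k\<in>UNIV. r k * cnj (f m k))" for m
 define t where "t k = r k - (\<Sum>m\<in>K'. c m * f m k)" for k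
 have t: "eig h t" unfolding t_def[abs_def] by (rule eig_combination[OF r]) (use fe in \<open>auto simp: K'_def\<close>)
 have tf: "(\<Sum>k\<in>UNIV. t k * cnj (f p k)) = 0" if p: "p \<in> K" for p
 proof (cases "a p = h")
  case True
  have "(\<Sum>k\<in>UNIV. t k * cnj (f p k)) = c p - (\<Sum>k\<in>UNIV. \<Sum>m\<in>K'. c m * (f m k * cnj (f p k)))"
   by (simp add: t_def c_def algebra_simps sum_subtractf sum_distrib_left)
  also have "(\<Sum>k\<in>UNIV. \<Sum>m\<in>K'. c m * (f m k * cnj (f p k))) = (\<Sum>m\<in>K'. c m * (\<Sum>k\<in>UNIV. f m k * cnj (f p k)))"
   by (subst sum.swap) (simp add: sum_distrib_left)
  also have "... = (\<Sum>m\<in>K'. if m = p then c p else 0)"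
   by (rule sum.cong[OF refl]) (use fo p in \<open>auto simp: K'_def\<close>)
  also have "... = c p" using p True by (simp add: K'_def)
  finally show ?thesis by simp
 next
  case False
  then show ?thesis using eig_orthogonal[OF t fe[OF p]] by blast
 qed
 have "(\<Sum>k\<in>UNIV. t k * x k) = (\<Sum>k\<in>UNIV. r k * x k) - (\<Sum>k\<in>UNIV. \<Sum>m\<in>K'. c m * (f m k * x k))"
  by (simp add: t_def algebra_simps sum_subtractf sum_distrib_left)
 also have "(\<Sum>k\<in>UNIV. \<Sum>m\<in>K'. c m * (f m k * x k)) = (\<Sum>m\<in>K'. c m * (\<Sum>k\<in>UNIV. f m k * x k))"
  by (subst sum.swap) (simp add: sum_distrib_left)
 also have "... = 0" by (rule sum.neutral) (use x(2) in \<open>auto simp: K'_def\<close>)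
 finally have "(\<Sum>k\<in>UNIV. t k * x k) ~= 0" using hi(2) by (simp add: r_def)
 then obtain k0 where k0: "t k0 ~= 0" by (metis (no_types, lifting) mult_zero_left sum.neutral)
 define N where "N = (\<Sum>k\<in>UNIV. (cmod (t k))^2)"
 have N: "N > 0" unfolding N_def by (rule sum_pos2[of _ k0]) (use k0 in auto)
 have NN: "(\<Sum>k\<in>UNIV. t k * cnj (t k)) = of_real N" unfolding N_def of_real_sum complex_norm_square ..
 define d where "d = complex_of_real (inverse (sqrt N))"
 have dd: "d * cnj d * of_real N = 1"
 proof -
  have "inverse (sqrt N) * inverse (sqrt N) * N = 1"
   using N by (simp add: field_simps flip: power2_eq_square)
  then have "complex_of_real (inverse (sqrt N) * inverse (sqrt N) * N) = 1" by simp
  then show ?thesis by (simp add: d_def)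
 qed
 define f' where "f' = f(m := %k. d * t k)"
 have "eig ((a(m := h)) i) (f' i)" if "i \<in> insert m K" for i
  using that m fe eig_scale[OF t, of d] by (auto simp: f'_def)
 moreover have "(\<Sum>k\<in>UNIV. f' i k * cnj (f' j k)) = (if i = j then 1 else 0)" if ij: "i \<in> insert m K" "j \<in> insert m K" for i j
 proof -
  have mm: "(\<Sum>k\<in>UNIV. (d * t k) * cnj (d * t k)) = 1"
  proof -
   have "(\<Sum>k\<in>UNIV. (d * t k) * cnj (d * t k)) = d * cnj d * (\<Sum>k\<in>UNIV. t k * cnj (t k))"
    by (simp add: sum_distrib_left mult_ac)
   then show ?thesis using dd NN by simp
  qed
  have mK: "(\<Sum>k\<in>UNIV. (d * t k) * cnj (f p k)) = 0" if "p \<in> K" for p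
  proof -
   have "(\<Sum>k\<in>UNIV. (d * t k) * cnj (f p k)) = d * (\<Sum>k\<in>UNIV. t k * cnj (f p k))"
    by (simp add: sum_distrib_left mult_ac)
   then show ?thesis using tf[OF that] by simp
  qed
  have Km: "(\<Sum>k\<in>UNIV. f p k * cnj (d * t k)) = 0" if "p \<in> K" for p
  proof -
   have "cnj (\<Sum>k\<in>UNIV. (d * t k) * cnj (f p k)) = (\<Sum>k\<in>UNIV. f p k * cnj (d * t k))"
    by (simp add: mult_ac)
   then show ?thesis using mK[OF that] by simp
  qed
  consider "i = m" "j = m" | "i = m" "j \<in> K" | "i \<in> K" "j = m" | "i \<in> K" "j \<in> K" using ij by blast
  then show ?thesis
   by cases (use mm mK Km fo m in \<open>auto simp: f'_def simp del: complex_cnj_mult\<close>)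
 qed
 ultimately show ?thesis unfolding eigenframe_def by blast
qed

lemma eigenframe_UNIV: "\<exists>f a. eigenframe UNIV f a"
proof -
 have "\<exists>f a. eigenframe K f a" if "finite K" for K :: "'n set"
  using that
 proof (induction K rule: finite_induct)
  case empty
  then show ?case by (simp add: eigenframe_def)
 next
  case (insert m K)
  then show ?case using eigenframe_extend by blast
 qed
 then show ?thesis by simp
qed

lemma diagonalised: "\<exists>U\<in>unitary_group. \<exists>a. (\<forall>i. a i \<in> carrier \<Lambda>) & (\<forall>k l. w k l = dform C U (%i. ge (a i)) k l)"
proof -
 obtain f a where fa: "eigenframe UNIV f a" using eigenframe_UNIV by blast
 have e: "eig (a i) (f i)" and o: "(\<Sum>k\<in>UNIV. f i k * cnj (f j k)) = (if i = j then 1 else 0)" for i j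
  using fa by (simp_all add: eigenframe_def)
 have a: "a i \<in> carrier \<Lambda>" for i using e[of i] by (simp add: eig_def)
 note ga = L.group_elem_closed[OF a]
 define U :: "complex ^ 'n ^ 'n" where "U = (\<chi> i k. f i k)"
 have "U ** (\<chi> i j. cnj (U $ j $ i)) = mat 1"
  by (simp add: vec_eq_iff matrix_matrix_mult_def mat_def U_def o)
 then have U: "U \<in> unitary_group"
  using matrix_left_right_inverse by (auto simp: unitary_group_def)
 have "w k l = dform C U (%i. ge (a i)) k l" for k l
 proof (rule C.dform_rotated[OF U])
  show "rotated C w U i j = (if i = j then ge (a i) else \<zero>\<^bsub>C\<^esub>)" for i j
  proof -
   have "rotated C w U i j = (\<Oplus>\<^bsub>C\<^esub>l\<in>UNIV. \<Oplus>\<^bsub>C\<^esub>k\<in>UNIV. scale C (f i k * cnj (f j l)) (w k l))"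
    unfolding rotated_def by (subst C.finsum_swap) (simp_all add: U_def)
   also have "... = (\<Oplus>\<^bsub>C\<^esub>l\<in>UNIV. scale C (f i l * cnj (f j l)) (ge (a i)))"
   proof (rule C.finsum_cong'[OF refl])
    fix l
    have "(\<Oplus>\<^bsub>C\<^esub>k\<in>UNIV. scale C (f i k * cnj (f j l)) (w k l)) = scale C (cnj (f j l)) (\<Oplus>\<^bsub>C\<^esub>k\<in>UNIV. scale C (f i k) (w k l))"
     by (subst C.finsum_scale) (simp_all add: C.scale_scale mult.commute)
    then show "(\<Oplus>\<^bsub>C\<^esub>k\<in>UNIV. scale C (f i k * cnj (f j l)) (w k l)) = scale C (f i l * cnj (f j l)) (ge (a i))"
     using e[of i] ga by (simp add: eig_def C.scale_scale mult.commute)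
   qed (use ga in auto)
   also have "... = (if i = j then ge (a i) else \<zero>\<^bsub>C\<^esub>)"
    using ga by (subst C.finsum_sum_scale) (simp_all add: o C.scale_1)
   finally show ?thesis .
  qed
 qed simp
 then show ?thesis using U a by blast
qed

end

lemma epi_comm_group:
 assumes G: "comm_group G" and H: "group H" and p: "p \<in> epi G H"
 shows "comm_group H"
proof -
 interpret G: comm_group G by fact
 interpret H: group H by fact
 have ph: "p \<in> hom G H" and ps: "p ` carrier G = carrier H" using p by (simp_all add: epi_def)
 show ?thesis
 proof (rule H.group_comm_groupI)
  fix x y assume "x \<in> carrier H" "y \<in> carrier H"
  then obtain a b where ab: "a \<in> carrier G" "b \<in> carrier G" "x = p a" "y = p b" using ps by (metis imageE)
  then show "x \<otimes>\<^bsub>H\<^esub> y = y \<otimes>\<^bsub>H\<^esub> x"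
   using hom_mult[OF ph ab(1,2)] hom_mult[OF ph ab(2,1)] G.m_comm[OF ab(1,2)] by simp
 qed
qed

section \<open>Recovering the quotient map, and strangeness\<close>

context dual_subgroup
begin

text \<open>By the diagonalisation \<open>\<rho>\<close> factors through the diagonal quotient and
  sends the g i, hence all of \<open>\<Gamma>\<close>, to group elements; \<open>p\<close> is read
  off from injectivity of \<open>group_elem\<close>. The factorisation through the group C*-algebra
  is then checked on the coordinates u.\<close>

lemma from_quotient:
 "\<exists>U\<in>unitary_group. \<exists>\<kappa> p. Gamma_identification A \<theta> U \<kappa> & p \<in> epi (Gamma A \<theta> U) \<Lambda> &
   (\<forall>x\<in>carrier A. \<rho> x = group_cstar_map \<Lambda> p (\<kappa> (diag_proj A \<theta> U x)))"
proof -
 obtain U a where U: "U \<in> unitary_group" and a: "!!i. a i \<in> carrier \<Lambda>" and wa: "!!k l. w k l = dform C U (%i. ge (a i)) k l"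
  using diagonalised by blast
 interpret d: diagonal A \<Delta> \<theta> U by (intro diagonal.intro Un_plus_subgroup_axioms diagonal_axioms.intro U)
 note ga = L.group_elem_closed[OF a]
 have \<rho>v: "\<rho> (d.v i j) = (if i = j then ge (a i) else \<zero>\<^bsub>C\<^esub>)" for i j
  by (rule d.hom_v[OF L.cstar_algebra_group rho_hom _ ga]) (simp add: wa[symmetric] w_def)
 obtain F where F: "F \<in> cstar_hom d.D C" "\<forall>x\<in>carrier A. F (d.q x) = \<rho> x"
  using d.factor[OF L.cstar_algebra_group rho_hom] \<rho>v by auto
 note FD = cstar_homD[OF F(1)]
 have Fg: "F (d.g i) = ge (a i)" for i using F(2) \<rho>v by (simp add: d.g_def)
 have img: "F \<gamma> \<in> ge ` carrier \<Lambda>" if "\<gamma> \<in> carrier d.\<Gamma>" for \<gamma>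
  using that
 proof (induction \<gamma> rule: d.Gamma_induct)
  case one
  show ?case by (rule image_eqI[of _ _ "\<one>\<^bsub>\<Lambda>\<^esub>"]) (simp_all add: FD(4) L.group_elem_one)
 next
  case (gen i)
  show ?case by (rule image_eqI[of _ _ "a i"]) (simp_all add: Fg a)
 next
  case (inv i)
  show ?case by (rule image_eqI[of _ _ "inv\<^bsub>\<Lambda>\<^esub> a i"]) (simp_all add: FD(6) Fg a L.group_elem_inv)
 next
  case (mult x y)
  obtain g h where "g \<in> carrier \<Lambda>" "F x = ge g" "h \<in> carrier \<Lambda>" "F y = ge h" using mult(3,4) by blast
  then show ?case
   by (intro image_eqI[of _ _ "g \<otimes>\<^bsub>\<Lambda>\<^esub> h"]) (simp_all add: FD(3) d.Gamma_closed mult(1,2) L.group_elem_mult)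
 qed
 define p where "p = inv_into (carrier \<Lambda>) ge \<circ> F"
 have pc: "p \<gamma> \<in> carrier \<Lambda>" and pF: "ge (p \<gamma>) = F \<gamma>" if "\<gamma> \<in> carrier d.\<Gamma>" for \<gamma>
  using inv_into_into[OF img[OF that]] f_inv_into_f[OF img[OF that]] by (simp_all add: p_def)
 have p: "p \<in> hom d.\<Gamma> \<Lambda>"
 proof (rule homI)
  show "p (x \<otimes>\<^bsub>d.\<Gamma>\<^esub> y) = p x \<otimes>\<^bsub>\<Lambda>\<^esub> p y" if xy: "x \<in> carrier d.\<Gamma>" "y \<in> carrier d.\<Gamma>" for x y
  proof (rule inj_onD[OF L.group_elem_inj])
   show "ge (p (x \<otimes>\<^bsub>d.\<Gamma>\<^esub> y)) = ge (p x \<otimes>\<^bsub>\<Lambda>\<^esub> p y)"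
    using pF[OF d.G.m_closed[OF xy]] FD(3)[OF d.Gamma_closed[OF xy(1)] d.Gamma_closed[OF xy(2)]]
    by (simp add: L.group_elem_mult pc xy pF d.Gamma_ops)
  qed (use xy pc in auto)
 qed (rule pc)
 have pg: "p (d.g i) = a i" for i
  by (rule inj_onD[OF L.group_elem_inj]) (simp_all add: pF pc a Fg)
 obtain \<kappa> where \<kappa>: "Gamma_identification A \<theta> U \<kappa>" using d.Gamma_identification_ex by blast
 note dm = d.dual_map[OF \<kappa> L.group_axioms p]
 have eq: "\<rho> x = group_cstar_map \<Lambda> p (\<kappa> (d.q x))" if x: "x \<in> carrier A" for x
 proof -
  have "\<rho> x = (group_cstar_map \<Lambda> p \<circ> \<kappa> \<circ> d.q) x"
  proof (rule eq_on_gens[OF L.cstar_algebra_group rho_hom dm(1) _ x])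
   show "\<rho> (u k l) = (group_cstar_map \<Lambda> p \<circ> \<kappa> \<circ> d.q) (u k l)" for k l
    unfolding dm(2) pg wa[symmetric] w_def ..
  qed
  then show ?thesis by simp
 qed
 note m = group_cstar_map_hom[OF d.G.group_dual_axioms L.group_dual_axioms p]
 \<comment> \<open>Surjectivity of \<open>\<rho>\<close> is transferred to \<open>p\<close> by
   coefficients: if \<open>h\<close> were not in the image, its coefficient functional would vanish
   on all group elements p \<open>\<gamma>\<close>, hence on the whole range of
   \<open>\<rho>\<close>, although it is 1 at \<open>h\<close>.\<close>
 have "h \<in> p ` carrier d.\<Gamma>" if h: "h \<in> carrier \<Lambda>" for h
 proof (rule ccontr)
  assume n: "h \<notin> p ` carrier d.\<Gamma>"
  obtain x where x: "x \<in> carrier A" "ge h = \<rho> x" using L.group_elem_closed[OF h] rho_surj by blast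
  have "\<kappa> (d.q x) \<in> carrier (group_cstar d.\<Gamma>)"
   by (rule cstar_homD(1)[of _ d.D]) (use \<kappa> x in \<open>auto simp: Gamma_identification_def cstar_iso_def\<close>)
  then have "E h (group_cstar_map \<Lambda> p (\<kappa> (d.q x))) = 0"
  proof (rule d.G.bounded_functional_zero[OF bounded_functional_comp[OF d.G.cstar_algebra_group L.cstar_algebra_group m(1) E_functional[OF h]], rotated])
   show "E h (group_cstar_map \<Lambda> p (group_elem d.\<Gamma> \<gamma>)) = 0" if "\<gamma> \<in> carrier d.\<Gamma>" for \<gamma>
    using that n by (auto simp: m(2) E_elem h pc)
  qed
  then show False using eq[OF x(1)] x(2) E_elem[OF h h] by simp
 qed
 then have "p \<in> epi d.\<Gamma> \<Lambda>" using p pc by (auto simp: epi_def)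
 then show ?thesis using U \<kappa> eq by blast
qed

end

lemma (in Un_plus_subgroup) strange_iff:
 "strange TYPE('h::infinite) A \<Delta> \<longleftrightarrow>
   \<not> commutative_alg A & (\<forall>U\<in>unitary_group. comm_group (Gamma A \<theta> U))"
proof (intro iffI conjI ballI)
 assume s: "strange TYPE('h) A \<Delta>"
 then show "\<not> commutative_alg A" by (simp add: strange_def)
 fix U :: "complex ^ 'n ^ 'n" assume U: "U \<in> unitary_group"
 interpret d: diagonal A \<Delta> \<theta> U by (intro diagonal.intro Un_plus_subgroup_axioms diagonal_axioms.intro U)
 obtain e :: "nat => 'h" where e: "inj e"
  using infinite_countable_subset[OF infinite_UNIV] by blast
 \<comment> \<open>Enumerate \<open>\<Gamma>\<close> and embed the naturals. The copy of
   \<open>\<Gamma>\<close> so obtained is in particular a quotient of it, to which strangeness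
   applies.\<close>
 define f where "f = e \<circ> to_nat_on (carrier d.\<Gamma>)"
 have f: "inj_on f (carrier d.\<Gamma>)"
  unfolding f_def using inj_on_to_nat_on[OF d.countable_Gamma] e by (auto intro!: comp_inj_on inj_on_subset[OF e])
 obtain H :: "'h monoid" where H: "group H" "f \<in> epi d.\<Gamma> H" using group_transport[OF d.Gamma_group f] by blast
 interpret H: group_dual H by (intro group_dual.intro H(1))
 obtain \<kappa> where \<kappa>: "Gamma_identification A \<theta> U \<kappa>" using d.Gamma_identification_ex by blast
 have "commutative_alg (group_cstar H)"
  using s d.dual_of_quotient[OF \<kappa> H] H(1) unfolding strange_def by blast
 then interpret CH: comm_group H by (simp add: H.commutative_group_cstar_iff)
 have fh: "f \<in> hom d.\<Gamma> H" using H(2) by (simp add: epi_def)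
 show "comm_group d.\<Gamma>"
 proof (rule d.G.group_comm_groupI)
  fix x y assume xy: "x \<in> carrier d.\<Gamma>" "y \<in> carrier d.\<Gamma>"
  have "f (x \<otimes>\<^bsub>d.\<Gamma>\<^esub> y) = f (y \<otimes>\<^bsub>d.\<Gamma>\<^esub> x)"
   using hom_mult[OF fh xy] hom_mult[OF fh xy(2,1)] CH.m_comm hom_in_carrier[OF fh] xy by simp
  then show "x \<otimes>\<^bsub>d.\<Gamma>\<^esub> y = y \<otimes>\<^bsub>d.\<Gamma>\<^esub> x" using inj_onD[OF f] xy by simp
 qed
next
 assume c: "\<not> commutative_alg A & (\<forall>U\<in>unitary_group. comm_group (Gamma A \<theta> U))"
 have "commutative_alg (group_cstar \<Lambda>)" if L: "group \<Lambda>" "group_dual_subgroup A \<Delta> \<Lambda> \<rho>" for \<Lambda> :: "'h monoid" and \<rho>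
 proof -
  interpret s: dual_subgroup A \<Delta> \<theta> \<Lambda> \<rho>
   by (intro dual_subgroup.intro Un_plus_subgroup_axioms group_dual.intro dual_subgroup_axioms.intro L)
  obtain U p where "U \<in> unitary_group" "p \<in> epi (Gamma A \<theta> U) \<Lambda>" using s.from_quotient by blast
  then have "comm_group \<Lambda>" using c by (intro epi_comm_group[OF _ L(1)]) auto
  then show ?thesis by (simp add: s.L.commutative_group_cstar_iff)
 qed
 then show "strange TYPE('h) A \<Delta>" using c by (simp add: strange_def)
qed

theorem proposition4p5:
 fixes A :: "'a cstar_alg"
  and \<Delta> :: "'a \<Rightarrow> (nat \<Rightarrow> ('a, 'a) tensor) set"
  and \<theta> :: "'n::finite Un_plus_elem \<Rightarrow> 'a"
 assumes "closed_subgroup_Un_plus A \<Delta> \<theta>"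
 shows
  "(\<forall>U\<in>unitary_group. \<exists>\<kappa>. Gamma_identification A \<theta> U \<kappa> \<and>
    (\<forall>(\<Lambda> :: 'g monoid) p. group \<Lambda> \<longrightarrow> p \<in> epi (Gamma A \<theta> U) \<Lambda> \<longrightarrow>
      group_dual_subgroup A \<Delta> \<Lambda> (group_cstar_map \<Lambda> p \<circ> \<kappa> \<circ> diag_proj A \<theta> U)))
   \<and> (\<forall>(\<Lambda> :: 'g monoid) \<rho>. group \<Lambda> \<longrightarrow> group_dual_subgroup A \<Delta> \<Lambda> \<rho> \<longrightarrow>
    (\<exists>U\<in>unitary_group. \<exists>\<kappa> p. Gamma_identification A \<theta> U \<kappa> \<and>
      p \<in> epi (Gamma A \<theta> U) \<Lambda> \<and>
      (\<forall>x\<in>carrier A. \<rho> x = group_cstar_map \<Lambda> p (\<kappa> (diag_proj A \<theta> U x)))))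
   \<and> (strange TYPE('h::infinite) A \<Delta> \<longleftrightarrow>
    \<not> commutative_alg A \<and> (\<forall>U\<in>unitary_group. comm_group (Gamma A \<theta> U)))"
proof -
 interpret Un_plus_subgroup A \<Delta> \<theta> using assms by (rule Un_plus_subgroup.intro)
 have 1: "\<exists>\<kappa>. Gamma_identification A \<theta> U \<kappa> \<and>
   (\<forall>(\<Lambda> :: 'g monoid) p. group \<Lambda> \<longrightarrow> p \<in> epi (Gamma A \<theta> U) \<Lambda> \<longrightarrow>
     group_dual_subgroup A \<Delta> \<Lambda> (group_cstar_map \<Lambda> p \<circ> \<kappa> \<circ> diag_proj A \<theta> U))"
  if U: "U \<in> unitary_group" for U
 proof -
  interpret d: diagonal A \<Delta> \<theta> U by (intro diagonal.intro Un_plus_subgroup_axioms diagonal_axioms.intro U)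
  show ?thesis using d.Gamma_identification_ex d.dual_of_quotient by blast
 qed
 have 2: "\<exists>U\<in>unitary_group. \<exists>\<kappa> p. Gamma_identification A \<theta> U \<kappa> \<and> p \<in> epi (Gamma A \<theta> U) \<Lambda> \<and>
   (\<forall>x\<in>carrier A. \<rho> x = group_cstar_map \<Lambda> p (\<kappa> (diag_proj A \<theta> U x)))"
  if L: "group \<Lambda>" "group_dual_subgroup A \<Delta> \<Lambda> \<rho>" for \<Lambda> :: "'g monoid" and \<rho>
 proof -
  interpret s: dual_subgroup A \<Delta> \<theta> \<Lambda> \<rho>
   by (intro dual_subgroup.intro Un_plus_subgroup_axioms group_dual.intro dual_subgroup_axioms.intro L)
  show ?thesis by (rule s.from_quotient)
 qed
 show ?thesis by (intro conjI ballI allI impI 1 2 strange_iff)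
qed

end
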